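(* Let $k$ be an algebraically closed field of arbitrary characteristic $p>0$, let $V=k^d$ be the natural $GL_d(k)$-module, and let $\lambda\vdash d$. Then for all $i\ge0$: (a) $\dim \mathrm{H}^i(\Sigma_d,M^\lambda)=\dim \mathrm{H}_i(\Sigma_d,V^{\otimes d})_\lambda$. (b) $\dim \mathrm{H}^i(\Sigma_d,Y^\lambda)=[\mathrm{H}_i(\Sigma_d,V^{\otimes d}):L(\lambda)]$.
   Context: $\Sigma_d$ acts on $V^{\otimes d}$ by place permutation, commuting with the diagonal action of $GL_d(k)$, so $\mathrm{H}_i(\Sigma_d,V^{\otimes d})$ is a (polynomial) $GL_d(k)$-module; $U_\lambda$ denotes the $\lambda$-weight space of a $GL_d(k)$-module $U$ (for the diagonal torus), $L(\lambda)$ is the simple $GL_d(k)$-module of highest weight $\lambda$, and $[U:L(\lambda)]$ is composition multiplicity. $M^\lambda$ is the permutation $k\Sigma_d$-module on the cosets of the Young subgroup $\Sigma_\lambda$, and the Young module $Y^\lambda$ is the indecomposable direct summand of $M^\lambda$ containing the Specht module $S^\lambda\subseteq M^\lambda$. *)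

theory Defs
  imports
    "HOL-Algebra.Sym_Groups"
    "HOL-Algebra.AbelCoset"
    "HOL-Algebra.Left_Coset"
    "HOL-Computational_Algebra.Polynomial"
    "Jordan_Normal_Form.VS_Connect"
begin

section \<open>Linear representations of a group\<close>

text \<open>A representation of \<open>G\<close> over the field \<open>'k\<close> is a vector space, given as a module record over
  \<open>class_ring\<close>, together with a map \<open>\<rho>\<close> sending group elements to operators. The multiplicative
  fields of module records carry no information.\<close>

locale linear_rep = group G + vectorspace class_ring V
  for G :: "('g, 'c) monoid_scheme" and V :: "('k::field, 'v) module" and \<rho> :: "'g \<Rightarrow> 'v \<Rightarrow> 'v" +
  assumes act_hom: "g \<in> carrier G \<Longrightarrow> \<rho> g \<in> LinearCombinations.module_hom class_ring V V"
    and act_one: "v \<in> carrier V \<Longrightarrow> \<rho> \<one>\<^bsub>G\<^esub> v = v"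
    and act_mult: "g \<in> carrier G \<Longrightarrow> h \<in> carrier G \<Longrightarrow> v \<in> carrier V \<Longrightarrow>
      \<rho> (g \<otimes>\<^bsub>G\<^esub> h) v = \<rho> g (\<rho> h v)"

definition subrep ::
  "('g, 'c) monoid_scheme \<Rightarrow> ('k::field, 'v) module \<Rightarrow> ('g \<Rightarrow> 'v \<Rightarrow> 'v) \<Rightarrow> 'v set \<Rightarrow> bool" where
  "subrep G V \<rho> W \<longleftrightarrow>
     VectorSpace.subspace class_ring W V \<and> (\<forall>g\<in>carrier G. \<forall>w\<in>W. \<rho> g w \<in> W)"

definition simple_rep ::
  "('g, 'c) monoid_scheme \<Rightarrow> ('k::field, 'v) module \<Rightarrow> ('g \<Rightarrow> 'v \<Rightarrow> 'v) \<Rightarrow> bool" where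
  "simple_rep G V \<rho> \<longleftrightarrow> linear_rep G V \<rho> \<and> carrier V \<noteq> {\<zero>\<^bsub>V\<^esub>} \<and>
     (\<forall>W. subrep G V \<rho> W \<longrightarrow> W = {\<zero>\<^bsub>V\<^esub>} \<or> W = carrier V)"

definition complementary_subreps ::
  "('g, 'c) monoid_scheme \<Rightarrow> ('k::field, 'v) module \<Rightarrow> ('g \<Rightarrow> 'v \<Rightarrow> 'v) \<Rightarrow> 'v set \<Rightarrow> 'v set \<Rightarrow> bool"
  where
  "complementary_subreps G V \<rho> A B \<longleftrightarrow> subrep G V \<rho> A \<and> subrep G V \<rho> B \<and>
     A \<inter> B = {\<zero>\<^bsub>V\<^esub>} \<and> A <+>\<^bsub>V\<^esub> B = carrier V"

definition indecomposable_rep ::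
  "('g, 'c) monoid_scheme \<Rightarrow> ('k::field, 'v) module \<Rightarrow> ('g \<Rightarrow> 'v \<Rightarrow> 'v) \<Rightarrow> bool" where
  "indecomposable_rep G V \<rho> \<longleftrightarrow> linear_rep G V \<rho> \<and> carrier V \<noteq> {\<zero>\<^bsub>V\<^esub>} \<and>
     (\<forall>A B. complementary_subreps G V \<rho> A B \<longrightarrow> A = {\<zero>\<^bsub>V\<^esub>} \<or> B = {\<zero>\<^bsub>V\<^esub>})"

definition isomorphic_reps ::
  "('g, 'c) monoid_scheme \<Rightarrow> ('k::field, 'v) module \<Rightarrow> ('g \<Rightarrow> 'v \<Rightarrow> 'v) \<Rightarrow>
   ('k, 'w) module \<Rightarrow> ('g \<Rightarrow> 'w \<Rightarrow> 'w) \<Rightarrow> bool" where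
  "isomorphic_reps G V \<rho> W \<sigma> \<longleftrightarrow> (\<exists>f \<in> LinearCombinations.module_hom class_ring V W. bij_betw f (carrier V) (carrier W) \<and>
     (\<forall>g\<in>carrier G. \<forall>v\<in>carrier V. f (\<rho> g v) = \<sigma> g (f v)))"


section \<open>Quotients and composition multiplicities\<close>

text \<open>\<open>quot_map V B f\<close> sends a coset \<open>x + A\<close> (of any subspace \<open>A\<close> that \<open>f\<close> maps into \<open>B\<close>)
  to \<open>f x + B\<close>.\<close>

definition quot_map :: "('k::field, 'v) module \<Rightarrow> 'v set \<Rightarrow> ('u \<Rightarrow> 'v) \<Rightarrow> 'u set \<Rightarrow> 'v set" where
  "quot_map V B f X = (\<Union>x\<in>X. B +>\<^bsub>V\<^esub> f x)"

definition quot_module :: "('k::field, 'v) module \<Rightarrow> 'v set \<Rightarrow> ('k, 'v set) module" where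
  "quot_module V B =
     \<lparr> carrier = a_rcosets\<^bsub>V\<^esub> B, mult = undefined, one = undefined,
       zero = B, add = (\<lambda>X Y. X <+>\<^bsub>V\<^esub> Y), smult = (\<lambda>c. quot_map V B (\<lambda>x. c \<odot>\<^bsub>V\<^esub> x)) \<rparr>"

abbreviation subquotient :: "('k::field, 'v) module \<Rightarrow> 'v set \<Rightarrow> 'v set \<Rightarrow> ('k, 'v set) module" where
  "subquotient V Z B \<equiv> quot_module (V\<lparr>carrier := Z\<rparr>) B"

definition composition_series ::
  "('g, 'c) monoid_scheme \<Rightarrow> ('k::field, 'v) module \<Rightarrow> ('g \<Rightarrow> 'v \<Rightarrow> 'v) \<Rightarrow> 'v set list \<Rightarrow> bool" where
  "composition_series G U \<rho> Ws \<longleftrightarrow>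
     Ws \<noteq> [] \<and> hd Ws = {\<zero>\<^bsub>U\<^esub>} \<and> last Ws = carrier U \<and> (\<forall>W\<in>set Ws. subrep G U \<rho> W) \<and>
     (\<forall>j. Suc j < length Ws \<longrightarrow> Ws ! j \<subseteq> Ws ! Suc j \<and>
        simple_rep G (subquotient U (Ws ! Suc j) (Ws ! j)) (\<lambda>g. quot_map U (Ws ! j) (\<rho> g)))"

text \<open>\<open>[U : L]\<close>; by the Jordan--Hoelder theorem the value does not depend on the series.\<close>

definition composition_mult ::
  "('g, 'c) monoid_scheme \<Rightarrow> ('k::field, 'v) module \<Rightarrow> ('g \<Rightarrow> 'v \<Rightarrow> 'v) \<Rightarrow>
   ('k, 'w) module \<Rightarrow> ('g \<Rightarrow> 'w \<Rightarrow> 'w) \<Rightarrow> nat" where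
  "composition_mult G U \<rho> L \<tau> =
     (THE n. \<exists>Ws. composition_series G U \<rho> Ws \<and>
        n = card {j. Suc j < length Ws \<and>
              isomorphic_reps G (subquotient U (Ws ! Suc j) (Ws ! j)) (\<lambda>g. quot_map U (Ws ! j) (\<rho> g)) L \<tau>})"


section \<open>Homology and cohomology of a finite group\<close>

text \<open>Both are computed from the bar resolution. For finite \<open>G\<close> the chains
  \<open>k[G\<^sup>n] \<otimes> V\<close> and the cochains \<open>Map(G\<^sup>n, V)\<close> are the same space of functions; functions are
  normalised to be zero off \<open>G\<^sup>n\<close>.\<close>

definition tuples :: "('g, 'c) monoid_scheme \<Rightarrow> nat \<Rightarrow> 'g list set" where
  "tuples G n = {gs. set gs \<subseteq> carrier G \<and> length gs = n}"

definition bar_space ::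
  "('g, 'c) monoid_scheme \<Rightarrow> ('k::field, 'v) module \<Rightarrow> nat \<Rightarrow> ('k, 'g list \<Rightarrow> 'v) module" where
  "bar_space G V n =
     \<lparr> carrier = {f. (\<forall>gs\<in>tuples G n. f gs \<in> carrier V) \<and> (\<forall>gs. gs \<notin> tuples G n \<longrightarrow> f gs = \<zero>\<^bsub>V\<^esub>)},
       mult = undefined, one = undefined,
       zero = (\<lambda>_. \<zero>\<^bsub>V\<^esub>), add = (\<lambda>f h gs. f gs \<oplus>\<^bsub>V\<^esub> h gs), smult = (\<lambda>c f gs. c \<odot>\<^bsub>V\<^esub> f gs) \<rparr>"

definition bar_face :: "('g, 'c) monoid_scheme \<Rightarrow> nat \<Rightarrow> 'g list \<Rightarrow> 'g list" where
  "bar_face G j gs =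
     (if j = 0 then tl gs
      else if j = length gs then butlast gs
      else take (j - 1) gs @ [gs ! (j - 1) \<otimes>\<^bsub>G\<^esub> gs ! j] @ drop (Suc j) gs)"

text \<open>\<open>(\<delta>f)(g\<^sub>1,\<dots>,g\<^sub>n\<^sub>+\<^sub>1) = g\<^sub>1 f(g\<^sub>2,\<dots>,g\<^sub>n\<^sub>+\<^sub>1)
  + \<Sum>\<^sub>j (-1)\<^sup>j f(\<dots>,g\<^sub>jg\<^sub>j\<^sub>+\<^sub>1,\<dots>) + (-1)\<^sup>n\<^sup>+\<^sup>1 f(g\<^sub>1,\<dots>,g\<^sub>n)\<close>.\<close>

definition coboundary ::
  "('g, 'c) monoid_scheme \<Rightarrow> ('k::field, 'v) module \<Rightarrow> ('g \<Rightarrow> 'v \<Rightarrow> 'v) \<Rightarrow> nat \<Rightarrow>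
   ('g list \<Rightarrow> 'v) \<Rightarrow> 'g list \<Rightarrow> 'v" where
  "coboundary G V \<rho> n f gs =
     (if gs \<in> tuples G (Suc n)
      then \<rho> (hd gs) (f (bar_face G 0 gs)) \<oplus>\<^bsub>V\<^esub>
           (\<Oplus>\<^bsub>V\<^esub>j\<in>{1..Suc n}. (- 1) ^ j \<odot>\<^bsub>V\<^esub> f (bar_face G j gs))
      else \<zero>\<^bsub>V\<^esub>)"

text \<open>Coefficients are left modules, so the complex computing \<open>Tor(k, V)\<close> is
  \<open>\<partial>([g\<^sub>1|\<dots>|g\<^sub>n] \<otimes> v) = [g\<^sub>2|\<dots>|g\<^sub>n] \<otimes> v + \<Sum>\<^sub>j (-1)\<^sup>j [\<dots>|g\<^sub>jg\<^sub>j\<^sub>+\<^sub>1|\<dots>] \<otimes> v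
  + (-1)\<^sup>n [g\<^sub>1|\<dots>|g\<^sub>n\<^sub>-\<^sub>1] \<otimes> g\<^sub>n v\<close>. Here \<open>boundary G V \<rho> n\<close> is the map from degree \<open>n + 1\<close> to degree \<open>n\<close>,
  and \<open>c gs\<close> is the coefficient of \<open>gs\<close> in the chain \<open>c\<close>.\<close>

definition boundary ::
  "('g, 'c) monoid_scheme \<Rightarrow> ('k::field, 'v) module \<Rightarrow> ('g \<Rightarrow> 'v \<Rightarrow> 'v) \<Rightarrow> nat \<Rightarrow>
   ('g list \<Rightarrow> 'v) \<Rightarrow> 'g list \<Rightarrow> 'v" where
  "boundary G V \<rho> n c hs =
     (if hs \<in> tuples G n
      then (\<Oplus>\<^bsub>V\<^esub>gs\<in>tuples G (Suc n). \<Oplus>\<^bsub>V\<^esub>j\<in>{j. j \<le> Suc n \<and> bar_face G j gs = hs}.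
             (- 1) ^ j \<odot>\<^bsub>V\<^esub> (if j = Suc n then \<rho> (last gs) (c gs) else c gs))
      else \<zero>\<^bsub>V\<^esub>)"

definition cocycles ::
  "('g, 'c) monoid_scheme \<Rightarrow> ('k::field, 'v) module \<Rightarrow> ('g \<Rightarrow> 'v \<Rightarrow> 'v) \<Rightarrow> nat \<Rightarrow> ('g list \<Rightarrow> 'v) set" where
  "cocycles G V \<rho> n = {f \<in> carrier (bar_space G V n). coboundary G V \<rho> n f = (\<lambda>_. \<zero>\<^bsub>V\<^esub>)}"

definition coboundaries ::
  "('g, 'c) monoid_scheme \<Rightarrow> ('k::field, 'v) module \<Rightarrow> ('g \<Rightarrow> 'v \<Rightarrow> 'v) \<Rightarrow> nat \<Rightarrow> ('g list \<Rightarrow> 'v) set" where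
  "coboundaries G V \<rho> n =
     (case n of 0 \<Rightarrow> {\<lambda>_. \<zero>\<^bsub>V\<^esub>} | Suc m \<Rightarrow> coboundary G V \<rho> m ` carrier (bar_space G V m))"

definition cycles ::
  "('g, 'c) monoid_scheme \<Rightarrow> ('k::field, 'v) module \<Rightarrow> ('g \<Rightarrow> 'v \<Rightarrow> 'v) \<Rightarrow> nat \<Rightarrow> ('g list \<Rightarrow> 'v) set" where
  "cycles G V \<rho> n =
     (case n of 0 \<Rightarrow> carrier (bar_space G V 0)
      | Suc m \<Rightarrow> {c \<in> carrier (bar_space G V (Suc m)). boundary G V \<rho> m c = (\<lambda>_. \<zero>\<^bsub>V\<^esub>)})"

definition boundaries ::
  "('g, 'c) monoid_scheme \<Rightarrow> ('k::field, 'v) module \<Rightarrow> ('g \<Rightarrow> 'v \<Rightarrow> 'v) \<Rightarrow> nat \<Rightarrow> ('g list \<Rightarrow> 'v) set" where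
  "boundaries G V \<rho> n = boundary G V \<rho> n ` carrier (bar_space G V (Suc n))"

definition group_cohomology ::
  "('g, 'c) monoid_scheme \<Rightarrow> ('k::field, 'v) module \<Rightarrow> ('g \<Rightarrow> 'v \<Rightarrow> 'v) \<Rightarrow> nat \<Rightarrow>
   ('k, ('g list \<Rightarrow> 'v) set) module" where
  "group_cohomology G V \<rho> n = subquotient (bar_space G V n) (cocycles G V \<rho> n) (coboundaries G V \<rho> n)"

definition group_homology ::
  "('g, 'c) monoid_scheme \<Rightarrow> ('k::field, 'v) module \<Rightarrow> ('g \<Rightarrow> 'v \<Rightarrow> 'v) \<Rightarrow> nat \<Rightarrow>
   ('k, ('g list \<Rightarrow> 'v) set) module" where
  "group_homology G V \<rho> n = subquotient (bar_space G V n) (cycles G V \<rho> n) (boundaries G V \<rho> n)"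

text \<open>The map on homology induced by a \<open>G\<close>-endomorphism \<open>\<phi>\<close> of the coefficients.\<close>

definition group_homology_map ::
  "('g, 'c) monoid_scheme \<Rightarrow> ('k::field, 'v) module \<Rightarrow> ('g \<Rightarrow> 'v \<Rightarrow> 'v) \<Rightarrow> nat \<Rightarrow> ('v \<Rightarrow> 'v) \<Rightarrow>
   ('g list \<Rightarrow> 'v) set \<Rightarrow> ('g list \<Rightarrow> 'v) set" where
  "group_homology_map G V \<rho> n \<phi> = quot_map (bar_space G V n) (boundaries G V \<rho> n) (\<lambda>c. \<phi> \<circ> c)"


section \<open>Partitions, Young permutation modules and Young modules\<close>

text \<open>The space \<open>k\<^sup>I\<close> with basis indexed by \<open>I\<close>, as functions vanishing off \<open>I\<close>.\<close>

definition coeff_space :: "'b set \<Rightarrow> ('k::field, 'b \<Rightarrow> 'k) module" where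
  "coeff_space I =
     \<lparr> carrier = {f. \<forall>x. x \<notin> I \<longrightarrow> f x = 0}, mult = undefined, one = undefined,
       zero = (\<lambda>_. 0), add = (\<lambda>f h x. f x + h x), smult = (\<lambda>c f x. c * f x) \<rparr>"

definition partition_of :: "nat \<Rightarrow> nat list \<Rightarrow> bool" where
  "partition_of d \<alpha> \<longleftrightarrow> sorted_wrt (\<ge>) \<alpha> \<and> (\<forall>x\<in>set \<alpha>. 0 < x) \<and> sum_list \<alpha> = d"

text \<open>Row and column of the entry \<open>x \<in> {1..d}\<close> in the \<open>\<alpha>\<close>-tableau in which the numbers
  \<open>1, \<dots>, d\<close> are written in order along the rows (rows counted from 0).\<close>

definition tableau_row :: "nat list \<Rightarrow> nat \<Rightarrow> nat" where
  "tableau_row \<alpha> x = (LEAST r. x \<le> sum_list (take (Suc r) \<alpha>))"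

definition tableau_col :: "nat list \<Rightarrow> nat \<Rightarrow> nat" where
  "tableau_col \<alpha> x = x - sum_list (take (tableau_row \<alpha> x) \<alpha>)"

definition young_subgroup :: "nat \<Rightarrow> nat list \<Rightarrow> (nat \<Rightarrow> nat) set" where
  "young_subgroup d \<alpha> =
     {\<pi> \<in> carrier (sym_group d). \<forall>x\<in>{1..d}. tableau_row \<alpha> (\<pi> x) = tableau_row \<alpha> x}"

definition column_stabilizer :: "nat \<Rightarrow> nat list \<Rightarrow> (nat \<Rightarrow> nat) set" where
  "column_stabilizer d \<alpha> =
     {\<pi> \<in> carrier (sym_group d). \<forall>x\<in>{1..d}. tableau_col \<alpha> (\<pi> x) = tableau_col \<alpha> x}"

definition perm_module :: "nat \<Rightarrow> nat list \<Rightarrow> ('k::field, (nat \<Rightarrow> nat) set \<Rightarrow> 'k) module" where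
  "perm_module d \<alpha> = coeff_space (lcosets\<^bsub>sym_group d\<^esub> (young_subgroup d \<alpha>))"

text \<open>\<open>\<sigma>\<close> sends the basis vector of a coset \<open>X\<close> to that of \<open>\<sigma>X\<close>, so the coefficient at \<open>X\<close>
  of the image is the old coefficient at \<open>\<sigma>\<^sup>-\<^sup>1X\<close>.\<close>

definition perm_act ::
  "nat \<Rightarrow> (nat \<Rightarrow> nat) \<Rightarrow> ((nat \<Rightarrow> nat) set \<Rightarrow> 'k) \<Rightarrow> (nat \<Rightarrow> nat) set \<Rightarrow> 'k::field" where
  "perm_act d \<sigma> f X = f (inv\<^bsub>sym_group d\<^esub> \<sigma> <#\<^bsub>sym_group d\<^esub> X)"

text \<open>Identify the coset \<open>\<pi>\<Sigma>\<^sub>\<alpha>\<close> with the tabloid \<open>{\<pi>t}\<close>, where \<open>t\<close> is the tableau above. Then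
  \<open>polytabloid d \<alpha> = \<Sum>\<^sub>\<pi> sgn(\<pi>) {\<pi>t}\<close> over the column stabilizer is \<open>e\<^sub>t\<close>, every tableau is \<open>\<sigma>t\<close>
  for some \<open>\<sigma>\<close>, and \<open>e\<^sub>\<sigma>\<^sub>t = \<sigma>e\<^sub>t\<close>.\<close>

definition polytabloid :: "nat \<Rightarrow> nat list \<Rightarrow> (nat \<Rightarrow> nat) set \<Rightarrow> 'k::field" where
  "polytabloid d \<alpha> X =
     (\<Sum>\<pi>\<in>column_stabilizer d \<alpha>.
        if X = \<pi> <#\<^bsub>sym_group d\<^esub> young_subgroup d \<alpha> then of_int (sign \<pi>) else 0)"

definition specht_module :: "nat \<Rightarrow> nat list \<Rightarrow> ((nat \<Rightarrow> nat) set \<Rightarrow> 'k::field) set" where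
  "specht_module d \<alpha> =
     LinearCombinations.module.span class_ring (perm_module d \<alpha>)
       {perm_act d \<sigma> (polytabloid d \<alpha>) | \<sigma>. \<sigma> \<in> carrier (sym_group d)}"

text \<open>The Young module is unique only up to isomorphism, hence a predicate on submodules of \<open>M\<^sup>\<alpha>\<close>.\<close>

definition young_module :: "nat \<Rightarrow> nat list \<Rightarrow> ((nat \<Rightarrow> nat) set \<Rightarrow> 'k::field) set \<Rightarrow> bool" where
  "young_module d \<alpha> Y \<longleftrightarrow>
     (\<exists>Z. complementary_subreps (sym_group d) (perm_module d \<alpha>) (perm_act d) Y Z) \<and>
     indecomposable_rep (sym_group d) ((perm_module d \<alpha>)\<lparr>carrier := Y\<rparr>) (perm_act d) \<and>
     specht_module d \<alpha> \<subseteq> Y"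


section \<open>The general linear group and its modules\<close>

definition GL :: "nat \<Rightarrow> 'k::field mat monoid" where
  "GL d = units_of (ring_mat TYPE('k) d ())"

text \<open>The coordinate ring \<open>k[GL\<^sub>d] = k[x\<^sub>i\<^sub>j, det\<^sup>-\<^sup>1]\<close>, as functions of matrices.\<close>

inductive_set regular_fun :: "nat \<Rightarrow> ('k::field mat \<Rightarrow> 'k) set" for d :: nat where
  const: "(\<lambda>_. c) \<in> regular_fun d"
| coord: "i < d \<Longrightarrow> j < d \<Longrightarrow> (\<lambda>g. g $$ (i, j)) \<in> regular_fun d"
| inverse_det: "(\<lambda>g. inverse (det g)) \<in> regular_fun d"
| add: "f \<in> regular_fun d \<Longrightarrow> h \<in> regular_fun d \<Longrightarrow> (\<lambda>g. f g + h g) \<in> regular_fun d"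
| mult: "f \<in> regular_fun d \<Longrightarrow> h \<in> regular_fun d \<Longrightarrow> (\<lambda>g. f g * h g) \<in> regular_fun d"

definition rational_rep ::
  "nat \<Rightarrow> ('k::field, 'v) module \<Rightarrow> ('k mat \<Rightarrow> 'v \<Rightarrow> 'v) \<Rightarrow> bool" where
  "rational_rep d V \<rho> \<longleftrightarrow> linear_rep (GL d) V \<rho> \<and>
     (\<forall>v\<in>carrier V. \<exists>S f. finite S \<and> S \<subseteq> carrier V \<and> (\<forall>w\<in>S. f w \<in> regular_fun d) \<and>
        (\<forall>g\<in>carrier (GL d). \<rho> g v = (\<Oplus>\<^bsub>V\<^esub>w\<in>S. f w g \<odot>\<^bsub>V\<^esub> w)))"

text \<open>A weight \<open>\<mu> \<in> \<int>\<^sup>d\<close> is a function of which only the values on \<open>{..<d}\<close> matter.\<close>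

definition weight_space ::
  "nat \<Rightarrow> ('k::field, 'v) module \<Rightarrow> ('k mat \<Rightarrow> 'v \<Rightarrow> 'v) \<Rightarrow> (nat \<Rightarrow> int) \<Rightarrow> 'v set" where
  "weight_space d V \<rho> \<mu> =
     {v \<in> carrier V. \<forall>t\<in>carrier (GL d). diagonal_mat t \<longrightarrow>
        \<rho> t v = (\<Prod>i<d. t $$ (i, i) powi \<mu> i) \<odot>\<^bsub>V\<^esub> v}"

text \<open>\<open>\<alpha> - \<mu>\<close> is a sum of positive roots \<open>\<epsilon>\<^sub>i - \<epsilon>\<^sub>j\<close> (\<open>i < j\<close>), in terms of partial sums.\<close>

definition weight_le :: "nat \<Rightarrow> (nat \<Rightarrow> int) \<Rightarrow> (nat \<Rightarrow> int) \<Rightarrow> bool" where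
  "weight_le d \<mu> \<alpha> \<longleftrightarrow> (\<forall>m\<le>d. (\<Sum>i<m. \<mu> i) \<le> (\<Sum>i<m. \<alpha> i)) \<and> (\<Sum>i<d. \<mu> i) = (\<Sum>i<d. \<alpha> i)"

definition highest_weight ::
  "nat \<Rightarrow> ('k::field, 'v) module \<Rightarrow> ('k mat \<Rightarrow> 'v \<Rightarrow> 'v) \<Rightarrow> (nat \<Rightarrow> int) \<Rightarrow> bool" where
  "highest_weight d V \<rho> \<alpha> \<longleftrightarrow> weight_space d V \<rho> \<alpha> \<noteq> {\<zero>\<^bsub>V\<^esub>} \<and>
     (\<forall>\<mu>. weight_space d V \<rho> \<mu> \<noteq> {\<zero>\<^bsub>V\<^esub>} \<longrightarrow> weight_le d \<mu> \<alpha>)"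

text \<open>\<open>L \<cong> L(\<alpha>)\<close>.\<close>

definition simple_highest_weight_module ::
  "nat \<Rightarrow> ('k::field, 'v) module \<Rightarrow> ('k mat \<Rightarrow> 'v \<Rightarrow> 'v) \<Rightarrow> (nat \<Rightarrow> int) \<Rightarrow> bool" where
  "simple_highest_weight_module d L \<tau> \<alpha> \<longleftrightarrow>
     rational_rep d L \<tau> \<and> simple_rep (GL d) L \<tau> \<and> highest_weight d L \<tau> \<alpha>"

definition partition_weight :: "nat list \<Rightarrow> nat \<Rightarrow> int" where
  "partition_weight \<alpha> i = (if i < length \<alpha> then int (\<alpha> ! i) else 0)"


section \<open>Tensor space\<close>

text \<open>With \<open>e\<^sub>0, \<dots>, e\<^sub>d\<^sub>-\<^sub>1\<close> the standard basis of \<open>V = k\<^sup>d\<close>, a function \<open>T\<close> stands for the tensor with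
  coefficient \<open>T I\<close> at \<open>e\<^sub>I\<^sub>(\<^sub>1\<^sub>) \<otimes> \<dots> \<otimes> e\<^sub>I\<^sub>(\<^sub>d\<^sub>)\<close>.\<close>

definition multi_indices :: "nat \<Rightarrow> (nat \<Rightarrow> nat) set" where
  "multi_indices d = {1..d} \<rightarrow>\<^sub>E {..<d}"

definition tensor_space :: "nat \<Rightarrow> ('k::field, (nat \<Rightarrow> nat) \<Rightarrow> 'k) module" where
  "tensor_space d = coeff_space (multi_indices d)"

text \<open>\<open>\<sigma>(v\<^sub>1 \<otimes> \<dots> \<otimes> v\<^sub>d) = v\<^sub>\<sigma>\<^sup>-\<^sup>1\<^sub>(\<^sub>1\<^sub>) \<otimes> \<dots> \<otimes> v\<^sub>\<sigma>\<^sup>-\<^sup>1\<^sub>(\<^sub>d\<^sub>)\<close>, that is, \<open>\<sigma>e\<^sub>J = e\<^sub>J \<^sub>\<circ> \<^sub>\<sigma>\<^sup>-\<^sup>1\<close>.\<close>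

definition place_act ::
  "(nat \<Rightarrow> nat) \<Rightarrow> ((nat \<Rightarrow> nat) \<Rightarrow> 'k) \<Rightarrow> (nat \<Rightarrow> nat) \<Rightarrow> 'k::field" where
  "place_act \<sigma> T I = T (I \<circ> \<sigma>)"

definition tensor_act ::
  "nat \<Rightarrow> 'k mat \<Rightarrow> ((nat \<Rightarrow> nat) \<Rightarrow> 'k) \<Rightarrow> (nat \<Rightarrow> nat) \<Rightarrow> 'k::field" where
  "tensor_act d g T I =
     (if I \<in> multi_indices d
      then \<Sum>J\<in>multi_indices d. (\<Prod>s\<in>{1..d}. g $$ (I s, J s)) * T J else 0)"

definition tensor_homology ::
  "nat \<Rightarrow> nat \<Rightarrow> ('k::field, ((nat \<Rightarrow> nat) list \<Rightarrow> (nat \<Rightarrow> nat) \<Rightarrow> 'k) set) module" where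
  "tensor_homology d n = group_homology (sym_group d) (tensor_space d) place_act n"

definition tensor_homology_act ::
  "nat \<Rightarrow> nat \<Rightarrow> 'k::field mat \<Rightarrow> ((nat \<Rightarrow> nat) list \<Rightarrow> (nat \<Rightarrow> nat) \<Rightarrow> 'k) set \<Rightarrow>
   ((nat \<Rightarrow> nat) list \<Rightarrow> (nat \<Rightarrow> nat) \<Rightarrow> 'k) set" where
  "tensor_homology_act d n g =
     group_homology_map (sym_group d) (tensor_space d) place_act n (tensor_act d g)"

end

theory Submission
  imports Defs "Jordan_Normal_Form.DL_Rank" "Jordan_Normal_Form.Char_Poly"
    "Jordan_Normal_Form.Gauss_Jordan_Elimination" "HOL-Combinatorics.Permutations"
begin

text \<open>Write \<open>E = V\<^sup>\<otimes>\<^sup>d\<close>. The module \<open>M\<^sup>\<lambda>\<close> is the \<open>\<lambda>\<close>-weight space of \<open>E\<close>, so \<open>H\<^sub>i(\<Sigma>\<^sub>d, M\<^sup>\<lambda>) = H\<^sub>i(\<Sigma>\<^sub>d, E)\<^sub>\<lambda>\<close>;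
  cohomology and homology have the same dimension for a module with a nondegenerate invariant form, because the
  coboundary of the bar complex is the adjoint of the boundary. For (b), a projection onto \<open>Y\<^sup>\<lambda>\<close> extends to an
  equivariant idempotent of \<open>E\<close>, and every equivariant endomorphism of \<open>E\<close> is the action of some \<open>e \<in> k GL\<^sub>d\<close>. The polytabloid
  \<open>w \<in> Y\<^sup>\<lambda>\<close> satisfies \<open>e a w = F(a) w\<close> for all \<open>a \<in> k GL\<^sub>d\<close>, where \<open>F(g) = \<langle>g e\<^sub>0, w\<rangle>\<close> for the basis tensor \<open>e\<^sub>0\<close> of the standard tableau. This
  \<open>F\<close> is the highest weight matrix coefficient of \<open>L(\<lambda>)\<close>, since both are invariant under the unipotent radicals, have the
  same torus weight, and the big cell is dense. Fitting's lemma for \<open>Y\<^sup>\<lambda>\<close> makes the kernel of \<open>F\<close> on \<open>e (k GL\<^sub>d) e\<close> nilpotent, hence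
  \<open>[U : L(\<lambda>)] = dim e U\<close> for every \<open>U\<close> that satisfies the relations of \<open>E\<close>. For \<open>U = H\<^sub>i(\<Sigma>\<^sub>d, E)\<close> one has \<open>e U \<cong> H\<^sub>i(\<Sigma>\<^sub>d, Y\<^sup>\<lambda>)\<close>.\<close>

text \<open>In characteristic p neither complete reducibility nor orthogonal projection is at hand,
  and this shapes the argument. A summand \<open>Y\<close> of \<open>M^\<lambda>\<close> is the
  image of an idempotent that need not be self-adjoint, so nondegeneracy of the form on
  \<open>Y\<close> has to be proved before homology and cohomology of \<open>Y\<close> can be
  compared. The Schur algebra is not formed: its elements are represented by lists over the group
  algebra, and being a module over it becomes the condition \<open>satisfies_relations\<close>,
  which homology inherits from its coefficients and subquotients inherit from homology. The module
  L(\<lambda>) is not constructed either. It is any simple module with the given highest weight,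
  recognised among composition factors by one matrix coefficient with value 1 at the identity,
  because such a coefficient determines the annihilator of a generating vector. Infinitude of the
  field is what allows coefficients of polynomials to be recovered from values, on GL_d as well as
  on the torus.\<close>

section \<open>Vector spaces over the field of a type\<close>

locale vsp = fixes V :: "('k::field, 'v) module" (structure)
  assumes is_vs: "vectorspace class_ring V"
begin

sublocale vectorspace class_ring V by (rule is_vs)

lemma smult_cl [simp, intro]: "x \<in> carrier V \<Longrightarrow> c \<odot> x \<in> carrier V"
  using smult_closed[of c x] by simp

lemma smult_ass: "x \<in> carrier V \<Longrightarrow> c \<odot> (e \<odot> x) = (c * e) \<odot> x"
  using smult_assoc1[of c e x] by simp

lemma smult_left_distr: "x \<in> carrier V \<Longrightarrow> (c + e) \<odot> x = c \<odot> x \<oplus> e \<odot> x"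
  using smult_l_distr[of c e x] by simp

lemma smult_right_distr: "x \<in> carrier V \<Longrightarrow> y \<in> carrier V \<Longrightarrow> c \<odot> (x \<oplus> y) = c \<odot> x \<oplus> c \<odot> y"
  using smult_r_distr[of c x y] by simp

lemma smult_one' [simp]: "x \<in> carrier V \<Longrightarrow> 1 \<odot> x = x"
  using smult_one[of x] by simp

lemma smult_zero_left [simp]: "x \<in> carrier V \<Longrightarrow> 0 \<odot> x = \<zero>"
  using lmult_0[of x] by simp

lemma smult_zero_right [simp]: "c \<odot> \<zero> = \<zero>"
  using rmult_0[of c] by simp

lemma smult_neg1: "x \<in> carrier V \<Longrightarrow> (-1) \<odot> x = \<ominus> x"
  using smult_minus_1[of x] by (simp add: class_ring_simps)

lemma smult_minus_left: "x \<in> carrier V \<Longrightarrow> (- c) \<odot> x = \<ominus> (c \<odot> x)"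
  using smult_ass[of x "-1" c] smult_neg1[of "c \<odot> x"] by simp

lemma smult_eq_zeroD: "x \<in> carrier V \<Longrightarrow> c \<odot> x = \<zero> \<Longrightarrow> c = 0 \<or> x = \<zero>"
  using smult_ass[of x "inverse c" c] by (cases "c = 0") auto

lemma subsp_iff: "VectorSpace.subspace class_ring W V \<longleftrightarrow>
   W \<subseteq> carrier V \<and> \<zero> \<in> W \<and> (\<forall>x\<in>W. \<forall>y\<in>W. x \<oplus> y \<in> W) \<and> (\<forall>c. \<forall>x\<in>W. c \<odot> x \<in> W)"
  unfolding VectorSpace.subspace_def submodule_def
  using is_vs module_axioms by (intro iffI conjI; elim conjE; simp)

lemma subspD:
  assumes "VectorSpace.subspace class_ring W V"
  shows "W \<subseteq> carrier V" "\<zero> \<in> W" "x \<in> W \<Longrightarrow> y \<in> W \<Longrightarrow> x \<oplus> y \<in> W" "x \<in> W \<Longrightarrow> c \<odot> x \<in> W"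
    "x \<in> W \<Longrightarrow> x \<in> carrier V" "x \<in> W \<Longrightarrow> \<ominus> x \<in> W" "x \<in> W \<Longrightarrow> y \<in> W \<Longrightarrow> x \<ominus> y \<in> W"
proof -
  note * = assms[unfolded subsp_iff]
  show "W \<subseteq> carrier V" "\<zero> \<in> W" "x \<in> W \<Longrightarrow> y \<in> W \<Longrightarrow> x \<oplus> y \<in> W" "x \<in> W \<Longrightarrow> c \<odot> x \<in> W"
    "x \<in> W \<Longrightarrow> x \<in> carrier V" using * by auto
  have neg: "\<ominus> x \<in> W" if "x \<in> W" for x proof -
    have "(-1) \<odot> x \<in> W" using that * by blast
    moreover have "x \<in> carrier V" using that * by blast
    ultimately show ?thesis using smult_neg1[of x] by simp
  qed
  show "x \<in> W \<Longrightarrow> \<ominus> x \<in> W" by (rule neg)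
  show "x \<in> W \<Longrightarrow> y \<in> W \<Longrightarrow> x \<ominus> y \<in> W" using neg[of y] * by (simp add: a_minus_def)
qed

lemma subsp_carrier: "VectorSpace.subspace class_ring (carrier V) V"
  by (auto simp: subsp_iff)

lemma subsp_zero: "VectorSpace.subspace class_ring {\<zero>} V"
  by (auto simp: subsp_iff)

lemma subsp_vsp: "VectorSpace.subspace class_ring W V \<Longrightarrow> vsp (V\<lparr>carrier := W\<rparr>)"
  by (simp add: vsp_def subspace_is_vs)

lemma subsp_nested: "VectorSpace.subspace class_ring W V \<Longrightarrow>
   VectorSpace.subspace class_ring X (V\<lparr>carrier := W\<rparr>) \<longleftrightarrow> VectorSpace.subspace class_ring X V \<and> X \<subseteq> W"
  unfolding vsp.subsp_iff[OF subsp_vsp] by (subst (asm) subsp_iff, subst subsp_iff, auto)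

end

lemma vspI:
  fixes V :: "('k::field, 'v) module" (structure)
  assumes zero: "\<zero> \<in> carrier V"
    and add: "\<And>v w. v\<in>carrier V \<Longrightarrow> w\<in>carrier V \<Longrightarrow> v \<oplus> w\<in> carrier V"
    and neg: "\<And>v. v\<in>carrier V \<Longrightarrow> (\<exists>neg_v\<in>carrier V. v \<oplus> neg_v = \<zero>)"
    and smult: "\<And>c v. v\<in>carrier V \<Longrightarrow> c \<odot> v \<in> carrier V"
    and comm: "\<And>v w. v\<in>carrier V \<Longrightarrow> w\<in>carrier V \<Longrightarrow> v \<oplus> w = w \<oplus> v"
    and assoc: "\<And>v w x. v\<in>carrier V \<Longrightarrow> w\<in>carrier V \<Longrightarrow> x\<in>carrier V \<Longrightarrow> (v \<oplus> w) \<oplus> x= v \<oplus> (w \<oplus> x)"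
    and add_id: "\<And>v. v\<in>carrier V \<Longrightarrow> v \<oplus> \<zero> = v"
    and compat: "\<And>a b v. v\<in>carrier V \<Longrightarrow> (a * b) \<odot> v = a \<odot> (b \<odot> v)"
    and smult_id: "\<And>v. v\<in>carrier V \<Longrightarrow> 1 \<odot> v = v"
    and dist_f: "\<And>a b v. v\<in>carrier V \<Longrightarrow> (a + b) \<odot> v = a \<odot> v \<oplus> b \<odot> v"
    and dist_add: "\<And>a v w. v\<in>carrier V \<Longrightarrow> w\<in>carrier V \<Longrightarrow> a \<odot> (v \<oplus> w) = a \<odot> v \<oplus> a \<odot> w"
  shows "vsp V"
  unfolding vsp_def
  by (rule vs_criteria) (use class_field assms in auto)

subsection \<open>Linear maps\<close>

abbreviation lhom :: "('k::field, 'v) module \<Rightarrow> ('k, 'w) module \<Rightarrow> ('v \<Rightarrow> 'w) set" where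
  "lhom V W \<equiv> LinearCombinations.module_hom class_ring V W"

lemma lhomI:
  assumes "\<And>x. x \<in> carrier V \<Longrightarrow> f x \<in> carrier W"
    and "\<And>x y. x \<in> carrier V \<Longrightarrow> y \<in> carrier V \<Longrightarrow> f (x \<oplus>\<^bsub>V\<^esub> y) = f x \<oplus>\<^bsub>W\<^esub> f y"
    and "\<And>c x. x \<in> carrier V \<Longrightarrow> f (c \<odot>\<^bsub>V\<^esub> x) = c \<odot>\<^bsub>W\<^esub> f x"
  shows "f \<in> lhom V W"
  using assms by (auto simp: LinearCombinations.module_hom_def)

lemma lhomD:
  assumes "f \<in> lhom V W"
  shows "x \<in> carrier V \<Longrightarrow> f x \<in> carrier W"
    and "x \<in> carrier V \<Longrightarrow> y \<in> carrier V \<Longrightarrow> f (x \<oplus>\<^bsub>V\<^esub> y) = f x \<oplus>\<^bsub>W\<^esub> f y"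
    and "x \<in> carrier V \<Longrightarrow> f (c \<odot>\<^bsub>V\<^esub> x) = c \<odot>\<^bsub>W\<^esub> f x"
  using assms by (auto simp: LinearCombinations.module_hom_def)

lemma lhom_zero: "vsp V \<Longrightarrow> vsp W \<Longrightarrow> f \<in> lhom V W \<Longrightarrow> f \<zero>\<^bsub>V\<^esub> = \<zero>\<^bsub>W\<^esub>"
proof -
  assume a: "vsp V" "vsp W" and f: "f \<in> lhom V W"
  interpret V: vsp V by fact
  interpret W: vsp W by fact
  have "f \<zero>\<^bsub>V\<^esub> = f (0 \<odot>\<^bsub>V\<^esub> \<zero>\<^bsub>V\<^esub>)" by simp
  also have "\<dots> = 0 \<odot>\<^bsub>W\<^esub> f \<zero>\<^bsub>V\<^esub>" using lhomD(3)[OF f] by blast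
  also have "\<dots> = \<zero>\<^bsub>W\<^esub>" using lhomD(1)[OF f] by simp
  finally show ?thesis .
qed

lemma lhom_neg: "vsp V \<Longrightarrow> vsp W \<Longrightarrow> f \<in> lhom V W \<Longrightarrow> x \<in> carrier V \<Longrightarrow> f (\<ominus>\<^bsub>V\<^esub> x) = \<ominus>\<^bsub>W\<^esub> f x"
  by (metis vsp.smult_neg1 lhomD(1,3))

lemma lhom_diff: "vsp V \<Longrightarrow> vsp W \<Longrightarrow> f \<in> lhom V W \<Longrightarrow> x \<in> carrier V \<Longrightarrow> y \<in> carrier V \<Longrightarrow>
   f (x \<ominus>\<^bsub>V\<^esub> y) = f x \<ominus>\<^bsub>W\<^esub> f y"
proof -
  assume a: "vsp V" "vsp W" and f: "f \<in> lhom V W" and x: "x \<in> carrier V" "y \<in> carrier V"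
  interpret V: vsp V by fact
  show ?thesis using lhom_neg[OF a f x(2)] lhomD(2)[OF f, of x "\<ominus>\<^bsub>V\<^esub> y"] x
    by (simp add: a_minus_def)
qed

lemma lhom_comp: "f \<in> lhom U V \<Longrightarrow> g \<in> lhom V W \<Longrightarrow> (\<lambda>x. g (f x)) \<in> lhom U W"
  by (rule lhomI) (auto simp: lhomD)

lemma lhom_finsum:
  assumes "vsp V" "vsp W" "f \<in> lhom V W" "g \<in> A \<rightarrow> carrier V"
  shows "f (finsum V g A) = finsum W (\<lambda>a. f (g a)) A"
proof -
  interpret V: vsp V by fact
  interpret W: vsp W by fact
  show ?thesis using assms(4)
  proof (induction A rule: infinite_finite_induct)
    case (infinite A) then show ?case by (simp add: lhom_zero[OF assms(1-3)])
  next
    case empty then show ?case by (simp add: lhom_zero[OF assms(1-3)])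
  next
    case (insert x F)
    then show ?case using assms(3)
      by (subst V.finsum_insert, simp, simp, blast, blast, subst W.finsum_insert)
        (auto simp: lhomD Pi_iff V.finsum_closed)
  qed
qed

lemma lhom_mod_hom:
  assumes "vsp V" "vsp W" "f \<in> lhom V W"
  shows "linear_map class_ring V W f"
  using assms by (auto simp: linear_map_def mod_hom_def mod_hom_axioms_def vsp_def vectorspace_def)

lemma lhom_image_subsp:
  assumes "vsp V" "vsp W" "f \<in> lhom V W" "VectorSpace.subspace class_ring X V"
  shows "VectorSpace.subspace class_ring (f ` X) W"
proof -
  interpret V: vsp V by fact
  interpret W: vsp W by fact
  note D = V.subspD[OF assms(4)]
  show ?thesis unfolding W.subsp_iff
  proof (intro conjI ballI allI)
    show "f ` X \<subseteq> carrier W" using D lhomD(1)[OF assms(3)] by auto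
    show "\<zero>\<^bsub>W\<^esub> \<in> f ` X" using D(2) lhom_zero[OF assms(1-3)] by force
    fix x y assume "x \<in> f ` X" "y \<in> f ` X"
    then obtain a b where "x = f a" "y = f b" "a \<in> X" "b \<in> X" by auto
    then show "x \<oplus>\<^bsub>W\<^esub> y \<in> f ` X"
      using D(3)[of a b] D(5) lhomD(2)[OF assms(3), of a b] by (simp add: image_iff) metis
  next
    fix c x assume "x \<in> f ` X"
    then obtain a where "x = f a" "a \<in> X" by auto
    then show "c \<odot>\<^bsub>W\<^esub> x \<in> f ` X"
      using D(4)[of a c] D(5) lhomD(3)[OF assms(3), of a c] by (simp add: image_iff) metis
  qed
qed

lemma lhom_vimage_subsp:
  assumes "vsp V" "vsp W" "f \<in> lhom V W" "VectorSpace.subspace class_ring X W"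
  shows "VectorSpace.subspace class_ring {x \<in> carrier V. f x \<in> X} V"
proof -
  interpret V: vsp V by fact
  interpret W: vsp W by fact
  note D = W.subspD[OF assms(4)]
  show ?thesis unfolding V.subsp_iff
    using lhom_zero[OF assms(1-3)] D by (auto simp: lhomD[OF assms(3)])
qed

lemma lhom_restrict: "f \<in> lhom V W \<Longrightarrow> X \<subseteq> carrier V \<Longrightarrow> (\<And>x. x \<in> X \<Longrightarrow> f x \<in> Y) \<Longrightarrow>
   f \<in> lhom (V\<lparr>carrier := X\<rparr>) (W\<lparr>carrier := Y\<rparr>)"
  by (rule lhomI) (simp_all add: lhomD(2,3)[of f V W] subset_iff)

lemma lhom_restrict_dom: "f \<in> lhom V W \<Longrightarrow> X \<subseteq> carrier V \<Longrightarrow> f \<in> lhom (V\<lparr>carrier := X\<rparr>) W"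
  by (rule lhomI) (simp_all add: lhomD[of f V W] subset_iff)

lemma lhom_inj:
  assumes "vsp V" "vsp W" "f \<in> lhom V W" "\<And>x. x \<in> carrier V \<Longrightarrow> f x = \<zero>\<^bsub>W\<^esub> \<Longrightarrow> x = \<zero>\<^bsub>V\<^esub>"
  shows "inj_on f (carrier V)"
proof (rule inj_onI)
  interpret V: vsp V by fact
  interpret W: vsp W by fact
  fix x y assume a: "x \<in> carrier V" "y \<in> carrier V" "f x = f y"
  have "f (x \<ominus>\<^bsub>V\<^esub> y) = \<zero>\<^bsub>W\<^esub>" using a lhom_diff[OF assms(1-3)] lhomD(1)[OF assms(3)] by simp
  then have "x \<ominus>\<^bsub>V\<^esub> y = \<zero>\<^bsub>V\<^esub>" using a assms(4) by (meson V.minus_closed)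
  then show "x = y" using a by simp
qed

subsection \<open>Dimension\<close>

abbreviation vdim :: "('k::field, 'v) module \<Rightarrow> nat" where
  "vdim V \<equiv> vectorspace.dim class_ring V"

locale fvsp = vsp + assumes fin: "fin_dim"

lemma (in fvsp) li_card: "lin_indpt A \<Longrightarrow> A \<subseteq> carrier V \<Longrightarrow> finite A \<and> card A \<le> dim"
  using li_le_dim[OF fin] by blast

lemma (in vsp) subsp_li:
  assumes "VectorSpace.subspace class_ring W V" "A \<subseteq> W"
  shows "LinearCombinations.module.lin_indpt class_ring (V\<lparr>carrier := W\<rparr>) A \<longleftrightarrow> lin_indpt A"
    "LinearCombinations.module.span class_ring (V\<lparr>carrier := W\<rparr>) A = span A"
  using span_li_not_depend[of A W] assms is_module by auto

text \<open>Independence in \<open>W\<close> and in \<open>V\<close> agree, so independent subsets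
  of \<open>W\<close> have at most \<open>dim\<close> elements; a maximal one is finite and, being
  maximal, generates \<open>W\<close>.\<close>

lemma (in fvsp) subsp_fin:
  assumes "VectorSpace.subspace class_ring W V"
  shows "fvsp (V\<lparr>carrier := W\<rparr>)"
proof -
  interpret W: vsp "V\<lparr>carrier := W\<rparr>" using subsp_vsp[OF assms] .
  have WV: "W \<subseteq> carrier V" using subspD[OF assms] by auto
  have "\<exists>A. finite A \<and> maximal A (\<lambda>S. S \<subseteq> carrier (V\<lparr>carrier := W\<rparr>) \<and> W.lin_indpt S)"
  proof (rule maximal_exists)
    show "\<And>A. A \<subseteq> carrier (V\<lparr>carrier := W\<rparr>) \<and> W.lin_indpt A \<Longrightarrow> finite A \<and> card A \<le> dim"
      using li_card subsp_li(1)[OF assms] WV by auto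
    have "W.lin_indpt {}" by (auto simp: W.lin_dep_def)
    then show "{} \<subseteq> carrier (V\<lparr>carrier := W\<rparr>) \<and> W.lin_indpt {}" by simp
  qed
  then obtain A where "finite A" "maximal A (\<lambda>S. S \<subseteq> carrier (V\<lparr>carrier := W\<rparr>) \<and> W.lin_indpt S)" by auto
  then have "W.gen_set A" "A \<subseteq> carrier (V\<lparr>carrier := W\<rparr>)" using W.max_li_is_gen unfolding maximal_def by auto
  then have "W.fin_dim" unfolding W.fin_dim_def using \<open>finite A\<close> by blast
  then show ?thesis by unfold_locales
qed

lemma (in fvsp) subsp_dim_le:
  assumes "VectorSpace.subspace class_ring W V"
  shows "vdim (V\<lparr>carrier := W\<rparr>) \<le> dim"
  using subspace_dim[OF assms fin] subsp_fin[OF assms] fvsp.fin by blast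

text \<open>A basis of \<open>W\<close> is independent in \<open>V\<close> and has at least
  \<open>dim\<close> elements, hence is already a basis of \<open>V\<close>. Used later to turn
  equal dimensions into equal subspaces.\<close>

lemma (in fvsp) subsp_dim_eq:
  assumes "VectorSpace.subspace class_ring W V" "dim \<le> vdim (V\<lparr>carrier := W\<rparr>)"
  shows "W = carrier V"
proof -
  interpret W: fvsp "V\<lparr>carrier := W\<rparr>" using subsp_fin[OF assms(1)] .
  have WV: "W \<subseteq> carrier V" using subspD[OF assms(1)] by auto
  obtain B where B: "finite B" "W.basis B" using W.finite_basis_exists[OF W.fin] by auto
  then have BW: "B \<subseteq> W" "W.lin_indpt B" "W.gen_set B" by (auto simp: W.basis_def)
  have "card B \<ge> dim" using W.dim_basis[OF B] assms by simp
  then have "basis B" using dim_li_is_basis[OF fin B(1)] subsp_li(1)[OF assms(1) BW(1)] BW WV by auto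
  then have "span B = carrier V" by (simp add: basis_def)
  then show ?thesis using subsp_li(2)[OF assms(1) BW(1)] BW by simp
qed

lemma rank_nullity':
  assumes "fvsp V" "vsp W" "f \<in> lhom V W"
  shows "vdim (W\<lparr>carrier := f ` carrier V\<rparr>) + vdim (V\<lparr>carrier := {x \<in> carrier V. f x = \<zero>\<^bsub>W\<^esub>}\<rparr>) = vdim V"
proof -
  interpret V: fvsp V by fact
  interpret linear_map class_ring V W f using lhom_mod_hom assms V.vsp_axioms by blast
  show ?thesis using rank_nullity[OF V.fin] unfolding im_def ker_def by simp
qed

lemma lhom_surj_fin:
  assumes "fvsp V" "vsp W" "f \<in> lhom V W" "f ` carrier V = carrier W"
  shows "fvsp W"
proof -
  interpret V: fvsp V by fact
  interpret W: vsp W by fact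
  interpret linear_map class_ring V W f using lhom_mod_hom assms V.vsp_axioms by blast
  show ?thesis using surj_fin_dim[OF V.fin assms(4)] by unfold_locales
qed

lemma lhom_bij_dim:
  assumes "fvsp V" "vsp W" "f \<in> lhom V W" "bij_betw f (carrier V) (carrier W)"
  shows "vdim V = vdim W"
proof -
  interpret V: fvsp V by fact
  interpret linear_map class_ring V W f using lhom_mod_hom assms V.vsp_axioms by blast
  show ?thesis using dim_eq[OF V.fin] assms(4) by (auto simp: bij_betw_def)
qed

lemma (in vsp) dim_trivial: "carrier V = {\<zero>} \<Longrightarrow> dim = 0"
  using dim_basis[of "{}"] span_empty by (simp add: basis_def lin_dep_def)

lemma (in vsp) dim_one:
  assumes "v \<in> carrier V" "v \<noteq> \<zero>" "\<And>x. x \<in> carrier V \<Longrightarrow> \<exists>c. x = c \<odot> v"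
  shows "dim = 1"
proof -
  have sub: "VectorSpace.subspace class_ring (span {v}) V" using span_is_subspace assms(1) by simp
  have "v \<in> span {v}" using span_self assms(1) by simp
  then have "c \<odot> v \<in> span {v}" for c using subspD(4)[OF sub] by simp
  then have "carrier V \<subseteq> span {v}" using assms(3) by auto
  then have "gen_set {v}" using subspD(1)[OF sub] by (simp only: set_eq_subset)
  then show ?thesis by (rule dim1I) (use assms in auto)
qed

lemma (in fvsp) dim_zeroD: "dim = 0 \<Longrightarrow> carrier V = {\<zero>}"
  using subsp_dim_eq[OF subsp_zero] by simp

subsection \<open>Quotients\<close>

text \<open>Every axiom is an identity or a closure condition, so it descends along a surjection
  that respects the operations. The record \<open>W\<close> is arbitrary because the quotient
  carries its own operations on cosets.\<close>

lemma vsp_surj: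
  assumes "vsp V"
    and carr: "carrier W = q ` carrier V" and zero: "\<zero>\<^bsub>W\<^esub> = q \<zero>\<^bsub>V\<^esub>"
    and add: "\<And>x y. x \<in> carrier V \<Longrightarrow> y \<in> carrier V \<Longrightarrow> q x \<oplus>\<^bsub>W\<^esub> q y = q (x \<oplus>\<^bsub>V\<^esub> y)"
    and smult: "\<And>c x. x \<in> carrier V \<Longrightarrow> c \<odot>\<^bsub>W\<^esub> q x = q (c \<odot>\<^bsub>V\<^esub> x)"
  shows "vsp W"
proof -
  interpret V: vsp V by fact
  show ?thesis
  proof (rule vspI)
    show "\<exists>y\<in>carrier W. v \<oplus>\<^bsub>W\<^esub> y = \<zero>\<^bsub>W\<^esub>" if v: "v \<in> carrier W" for v
    proof -
      obtain x where "x \<in> carrier V" "v = q x" using v carr by auto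
      then show ?thesis by (intro bexI[of _ "q (\<ominus>\<^bsub>V\<^esub> x)"]) (auto simp: carr zero add V.r_neg)
    qed
  qed (auto simp: carr zero add smult V.a_ac V.smult_ass V.smult_left_distr V.smult_right_distr)
qed

context vsp
begin

lemma mem_coset: "z \<in> A +> x \<longleftrightarrow> (\<exists>h\<in>A. z = h \<oplus> x)"
  by (auto simp: a_r_coset_def')

lemma coset_eq_iff:
  assumes A: "VectorSpace.subspace class_ring A V" and x: "x \<in> carrier V" "y \<in> carrier V"
  shows "A +> x = A +> y \<longleftrightarrow> x \<ominus> y \<in> A"
proof
  note D = subspD[OF A]
  assume "A +> x = A +> y"
  moreover have "x \<in> A +> x" unfolding mem_coset using D(2) x by (intro bexI[of _ \<zero>]) auto
  ultimately obtain h where "h \<in> A" "x = h \<oplus> y" by (auto simp: mem_coset)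
  then show "x \<ominus> y \<in> A" using D(5)[of h] x by (simp add: a_minus_def a_assoc r_neg)
next
  note D = subspD[OF A]
  assume a: "x \<ominus> y \<in> A"
  have sub: "A +> x \<subseteq> A +> y" if "x \<ominus> y \<in> A" "x \<in> carrier V" "y \<in> carrier V" for x y
  proof
    fix z assume "z \<in> A +> x"
    then obtain h where h: "h \<in> A" "z = h \<oplus> x" by (auto simp: mem_coset)
    have "h \<oplus> (x \<ominus> y) \<in> A" using D(3)[OF h(1) that(1)] .
    moreover have "z = (h \<oplus> (x \<ominus> y)) \<oplus> y"
      using D(5)[OF h(1)] that h by (simp add: a_minus_def a_assoc l_neg)
    ultimately show "z \<in> A +> y" by (auto simp: mem_coset)
  qed
  have "\<ominus> (x \<ominus> y) \<in> A" using D(6)[OF a] .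
  moreover have "\<ominus> (x \<ominus> y) = y \<ominus> x" using x by (simp add: a_minus_def minus_add a_comm)
  ultimately show "A +> x = A +> y" using sub[OF a x] sub[of y x] x by auto
qed

lemma coset_zero: "VectorSpace.subspace class_ring A V \<Longrightarrow> A +> \<zero> = A"
  using subspD by (auto simp: mem_coset)

lemma coset_eq_self: "VectorSpace.subspace class_ring A V \<Longrightarrow> x \<in> carrier V \<Longrightarrow> A +> x = A \<longleftrightarrow> x \<in> A"
  using coset_eq_iff[of A x \<zero>] coset_zero[of A] smult_neg1[of \<zero>] by (simp add: a_minus_def)

lemma coset_add:
  assumes A: "VectorSpace.subspace class_ring A V" and x: "x \<in> carrier V" "y \<in> carrier V"
  shows "(A +> x) <+>\<^bsub>V\<^esub> (A +> y) = A +> (x \<oplus> y)"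
proof -
  note D = subspD[OF A]
  show ?thesis
  proof (intro equalityI subsetI)
    fix z assume "z \<in> (A +> x) <+>\<^bsub>V\<^esub> (A +> y)"
    then obtain h k where h: "h \<in> A" "k \<in> A" "z = (h \<oplus> x) \<oplus> (k \<oplus> y)"
      by (auto simp: set_add_def' mem_coset)
    then have "z = (h \<oplus> k) \<oplus> (x \<oplus> y)" using D(5)[of h] D(5)[of k] x by (simp add: a_ac)
    then show "z \<in> A +> (x \<oplus> y)" using h D(3) by (auto simp: mem_coset)
  next
    fix z assume "z \<in> A +> (x \<oplus> y)"
    then obtain h where h: "h \<in> A" "z = h \<oplus> (x \<oplus> y)" by (auto simp: mem_coset)
    then have "z = (h \<oplus> x) \<oplus> (\<zero> \<oplus> y)" using D(5)[of h] x by (simp add: a_ac)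
    then show "z \<in> (A +> x) <+>\<^bsub>V\<^esub> (A +> y)" unfolding set_add_def' using h D(2) by (fastforce simp: mem_coset)
  qed
qed

text \<open>Every element of \<open>X\<close> is sent into the same coset of \<open>A\<close>, so
  the union over \<open>X\<close> that defines \<open>quot_map\<close> collapses to one
  coset.\<close>

lemma quot_map_coset:
  assumes A: "VectorSpace.subspace class_ring A V" and x: "f x \<in> carrier V"
    and f: "\<And>h. h \<in> A \<Longrightarrow> f h \<in> A" "\<And>h. h \<in> A \<Longrightarrow> f (h \<oplus>\<^bsub>U\<^esub> x) = f h \<oplus> f x"
    and A': "C \<noteq> {}" "C \<subseteq> A" "X = (\<Union>h\<in>C. {h \<oplus>\<^bsub>U\<^esub> x})"
  shows "quot_map V A f X = A +> f x"
proof -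
  note D = subspD[OF A]
  have "A +> (f (h \<oplus>\<^bsub>U\<^esub> x)) = A +> f x" if "h \<in> A" for h
    unfolding f(2)[OF that] using f(1)[OF that] D(5)[of "f h"] x
    by (subst coset_eq_iff[OF A]) (auto simp: a_minus_def a_assoc r_neg)
  then show ?thesis unfolding quot_map_def A'(3) using A' by (auto simp: subset_iff)
qed

lemma quot_map_coset':
  assumes A: "VectorSpace.subspace class_ring A V" and x: "f x \<in> carrier V"
    and f: "\<And>h. h \<in> A \<Longrightarrow> f h \<in> A" "\<And>h. h \<in> A \<Longrightarrow> f (h \<oplus> x) = f h \<oplus> f x"
  shows "quot_map V A f (A +> x) = A +> f x"
  by (rule quot_map_coset[OF A x f, where C=A]) (use subspD[OF A] in \<open>auto simp: a_r_coset_def'\<close>)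

end

locale subquot = vsp +
  fixes A B
  assumes A: "VectorSpace.subspace class_ring A V" and B: "VectorSpace.subspace class_ring B V"
    and AB: "A \<subseteq> B"
begin

abbreviation "Q \<equiv> subquotient V B A"
abbreviation "q x \<equiv> A +> x"

lemma B_carr: "x \<in> B \<Longrightarrow> x \<in> carrier V" using subspD[OF B] by blast

lemma Q_carr: "carrier Q = q ` B"
  by (auto simp: quot_module_def A_RCOSETS_def' a_r_coset_def')

lemma Q_zero: "\<zero>\<^bsub>Q\<^esub> = A" by (simp add: quot_module_def)

lemma Q_add: "x \<in> carrier V \<Longrightarrow> y \<in> carrier V \<Longrightarrow> q x \<oplus>\<^bsub>Q\<^esub> q y = q (x \<oplus> y)"
  using coset_add[OF A, of x y] by (simp add: quot_module_def set_add_def' )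

lemma Q_smult: "x \<in> carrier V \<Longrightarrow> c \<odot>\<^bsub>Q\<^esub> q x = q (c \<odot> x)"
proof -
  assume x: "x \<in> carrier V"
  note D = subspD[OF A]
  have "quot_map V A (\<lambda>x. c \<odot> x) (A +> x) = A +> c \<odot> x"
    by (rule quot_map_coset'[OF A]) (use x D smult_right_distr in auto)
  moreover have "c \<odot>\<^bsub>Q\<^esub> q x = quot_map V A (\<lambda>x. c \<odot> x) (A +> x)"
    by (simp add: quot_module_def quot_map_def a_r_coset_def')
  ultimately show ?thesis by simp
qed

lemma Q_vsp: "vsp Q"
proof (rule vsp_surj[OF subsp_vsp[OF B]])
  show "carrier Q = q ` carrier (V\<lparr>carrier := B\<rparr>)" using Q_carr by simp
  show "\<zero>\<^bsub>Q\<^esub> = q \<zero>\<^bsub>V\<lparr>carrier := B\<rparr>\<^esub>" using Q_zero coset_zero[OF A] by simp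
qed (simp_all add: Q_add Q_smult B_carr)

lemma q_hom: "q \<in> lhom (V\<lparr>carrier := B\<rparr>) Q"
  by (rule lhomI) (simp_all add: Q_add Q_smult B_carr Q_carr)

lemma q_zero_iff: "x \<in> B \<Longrightarrow> q x = \<zero>\<^bsub>Q\<^esub> \<longleftrightarrow> x \<in> A"
  using coset_eq_self[OF A] B_carr Q_zero by simp

lemma Q_dim:
  assumes "fvsp (V\<lparr>carrier := B\<rparr>)"
  shows "vdim Q + vdim (V\<lparr>carrier := A\<rparr>) = vdim (V\<lparr>carrier := B\<rparr>)" "fvsp Q"
proof -
  have *: "{x \<in> carrier (V\<lparr>carrier := B\<rparr>). q x = \<zero>\<^bsub>Q\<^esub>} = A" using AB q_zero_iff by auto
  have **: "Q\<lparr>carrier := q ` carrier (V\<lparr>carrier := B\<rparr>)\<rparr> = Q" using Q_carr by (cases Q) simp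
  show "vdim Q + vdim (V\<lparr>carrier := A\<rparr>) = vdim (V\<lparr>carrier := B\<rparr>)"
    using rank_nullity'[OF assms Q_vsp q_hom] unfolding * ** by simp
  show "fvsp Q" by (rule lhom_surj_fin[OF assms Q_vsp q_hom]) (simp add: Q_carr)
qed

lemma Q_map:
  assumes "\<And>x. x \<in> A \<Longrightarrow> f x \<in> A" "\<And>x. x \<in> B \<Longrightarrow> f x \<in> carrier V"
    "\<And>x y. x \<in> B \<Longrightarrow> y \<in> B \<Longrightarrow> f (x \<oplus> y) = f x \<oplus> f y" "x \<in> B"
  shows "quot_map V A f (q x) = q (f x)"
  by (rule quot_map_coset'[OF A]) (use assms AB in auto)

end

lemma lhom_quot:
  assumes "subquot V A B" "subquot V' A' B'" and f: "f \<in> lhom (V\<lparr>carrier := B\<rparr>) (V'\<lparr>carrier := B'\<rparr>)"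
    and fA: "\<And>x. x \<in> A \<Longrightarrow> f x \<in> A'"
  shows "quot_map V' A' f \<in> lhom (subquotient V B A) (subquotient V' B' A')"
    and "x \<in> B \<Longrightarrow> quot_map V' A' f (A +>\<^bsub>V\<^esub> x) = A' +>\<^bsub>V'\<^esub> f x"
proof -
  interpret V: subquot V A B by fact
  interpret V': subquot V' A' B' by fact
  have A0: "\<zero>\<^bsub>V\<^esub> \<in> A" using V.subspD[OF V.A] by blast
  have *: "quot_map V' A' f (A +>\<^bsub>V\<^esub> x) = A' +>\<^bsub>V'\<^esub> f x" if x: "x \<in> B" for x
  proof -
    note D = V'.subspD[OF V'.A]
    have fx: "f x \<in> carrier V'" using lhomD(1)[OF f, of x] x V'.B_carr by simp
    have "A' +>\<^bsub>V'\<^esub> (f (h \<oplus>\<^bsub>V\<^esub> x)) = A' +>\<^bsub>V'\<^esub> f x" if h: "h \<in> A" for h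
    proof -
      have "f (h \<oplus>\<^bsub>V\<^esub> x) = f h \<oplus>\<^bsub>V'\<^esub> f x" using lhomD(2)[OF f, of h x] h x V.AB by auto
      then show ?thesis using fA[OF h] D(5)[of "f h"] fx
        by (simp add: V'.coset_eq_iff[OF V'.A] a_minus_def V'.a_assoc V'.r_neg)
    qed
    then show ?thesis unfolding quot_map_def a_r_coset_def'[of V] using A0 by blast
  qed
  show "x \<in> B \<Longrightarrow> quot_map V' A' f (A +>\<^bsub>V\<^esub> x) = A' +>\<^bsub>V'\<^esub> f x" by (rule *)
  show "quot_map V' A' f \<in> lhom (subquotient V B A) (subquotient V' B' A')"
  proof (rule lhomI)
    note D = lhomD[OF f, simplified]
    note B = V.subspD[OF V.B]
    fix X Y c assume "X \<in> carrier V.Q"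
    then obtain x where x: "x \<in> B" "X = V.q x" unfolding V.Q_carr by auto
    show "quot_map V' A' f X \<in> carrier V'.Q" using x * D(1)[of x] V'.Q_carr by simp
    show "quot_map V' A' f (c \<odot>\<^bsub>V.Q\<^esub> X) = c \<odot>\<^bsub>V'.Q\<^esub> quot_map V' A' f X"
      using x * D(1)[of x] V'.B_carr V.B_carr B(4)[of x c] D(3) by (simp add: V.Q_smult V'.Q_smult)
    assume "Y \<in> carrier V.Q"
    then obtain y where y: "y \<in> B" "Y = V.q y" unfolding V.Q_carr by auto
    show "quot_map V' A' f (X \<oplus>\<^bsub>V.Q\<^esub> Y) = quot_map V' A' f X \<oplus>\<^bsub>V'.Q\<^esub> quot_map V' A' f Y"
      using x y * D(1)[of x] D(1)[of y] V'.B_carr V.B_carr B(3)[of x y] D(2)[of x y] by (simp add: V.Q_add V'.Q_add)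
  qed
qed

subsection \<open>Representations\<close>

lemma lrepI:
  assumes "group G" "vsp V" "\<And>g. g \<in> carrier G \<Longrightarrow> \<rho> g \<in> lhom V V"
    "\<And>v. v \<in> carrier V \<Longrightarrow> \<rho> \<one>\<^bsub>G\<^esub> v = v"
    "\<And>g h v. g \<in> carrier G \<Longrightarrow> h \<in> carrier G \<Longrightarrow> v \<in> carrier V \<Longrightarrow> \<rho> (g \<otimes>\<^bsub>G\<^esub> h) v = \<rho> g (\<rho> h v)"
  shows "linear_rep G V \<rho>"
  using assms by (auto simp: linear_rep_def linear_rep_axioms_def vsp_def)

locale lrep = linear_rep G V \<rho>
  for G :: "('g, 'c) monoid_scheme" and V :: "('k::field, 'v) module" and \<rho>
begin

lemma vsp: "vsp V" using vectorspace_axioms by (simp add: vsp_def)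
lemma grp: "group G" by (rule group_axioms)

lemma act_cl: "g \<in> carrier G \<Longrightarrow> x \<in> carrier V \<Longrightarrow> \<rho> g x \<in> carrier V"
  using lhomD(1)[OF act_hom] by blast

lemma subrepD:
  assumes "subrep G V \<rho> W"
  shows "VectorSpace.subspace class_ring W V" "g \<in> carrier G \<Longrightarrow> w \<in> W \<Longrightarrow> \<rho> g w \<in> W"
    "w \<in> W \<Longrightarrow> w \<in> carrier V"
  using assms vsp.subspD(5)[OF vsp, of W w] by (auto simp: subrep_def)

lemma subrep_carrier: "subrep G V \<rho> (carrier V)"
  using vsp.subsp_carrier[OF vsp] act_cl by (auto simp: subrep_def)

lemma subrep_zero: "subrep G V \<rho> {\<zero>\<^bsub>V\<^esub>}"
  using vsp.subsp_zero[OF vsp] lhom_zero[OF vsp vsp act_hom] by (auto simp: subrep_def)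

lemma subrep_lrep: "subrep G V \<rho> W \<Longrightarrow> linear_rep G (V\<lparr>carrier := W\<rparr>) \<rho>"
proof (rule lrepI)
  assume s: "subrep G V \<rho> W"
  note D = subrepD[OF s]
  show "group G" by (rule grp)
  show "vsp (V\<lparr>carrier := W\<rparr>)" using vsp.subsp_vsp[OF vsp D(1)] .
  show "\<rho> g \<in> lhom (V\<lparr>carrier := W\<rparr>) (V\<lparr>carrier := W\<rparr>)" if "g \<in> carrier G" for g
    by (rule lhom_restrict[OF act_hom[OF that]]) (use that D in auto)
qed (use subrepD act_one act_mult in auto)

end

locale rep_subquot = lrep +
  fixes A B
  assumes sA: "subrep G V \<rho> A" and sB: "subrep G V \<rho> B" and sAB: "A \<subseteq> B"
begin

sublocale sq: subquot V A B
  using vsp subrepD(1)[OF sA] subrepD(1)[OF sB] sAB by (simp add: subquot_def subquot_axioms_def)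

abbreviation "qact \<equiv> \<lambda>g. quot_map V A (\<rho> g)"

lemma qact_q: "g \<in> carrier G \<Longrightarrow> x \<in> B \<Longrightarrow> qact g (sq.q x) = sq.q (\<rho> g x)"
  by (rule sq.Q_map) (use subrepD[OF sA] subrepD[OF sB] lhomD(2)[OF act_hom] in auto)

lemma Q_lrep: "linear_rep G sq.Q qact"
proof (rule lrepI)
  show "group G" by (rule grp)
  show "vsp sq.Q" by (rule sq.Q_vsp)
  show "qact g \<in> lhom sq.Q sq.Q" if g: "g \<in> carrier G" for g
    by (rule lhom_quot(1)[OF sq.subquot_axioms sq.subquot_axioms])
      (use g subrepD[OF sA] subrepD[OF sB] in \<open>auto intro!: lhom_restrict[OF act_hom]\<close>)
  fix v assume "v \<in> carrier sq.Q"
  then obtain x where x: "x \<in> B" "v = sq.q x" unfolding sq.Q_carr by auto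
  have xV: "x \<in> carrier V" using x sq.B_carr by blast
  have one: "\<one>\<^bsub>G\<^esub> \<in> carrier G" using grp by (simp add: group.is_monoid)
  show "qact \<one>\<^bsub>G\<^esub> v = v" using x qact_q[OF one x(1)] act_one[OF xV] by simp
  fix g h assume gh: "g \<in> carrier G" "h \<in> carrier G"
  then have ghc: "g \<otimes>\<^bsub>G\<^esub> h \<in> carrier G" using grp by (simp add: group.is_monoid monoid.m_closed)
  show "qact (g \<otimes>\<^bsub>G\<^esub> h) v = qact g (qact h v)"
    using x qact_q[OF ghc x(1)] qact_q[OF gh(2) x(1)] qact_q[OF gh(1) subrepD(2)[OF sB gh(2) x(1)]] act_mult[OF gh xV] by simp
qed

text \<open>Pulling back along the quotient map gives the correspondence theorem, by which
  simplicity of the factor reduces to the absence of subrepresentations strictly between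
  \<open>A\<close> and \<open>B\<close>.\<close>

lemma Q_subrep_vimage:
  assumes "subrep G sq.Q qact W"
  shows "subrep G V \<rho> {x \<in> B. sq.q x \<in> W}" "A \<subseteq> {x \<in> B. sq.q x \<in> W}" "W = sq.q ` {x \<in> B. sq.q x \<in> W}"
proof -
  interpret Q: lrep G sq.Q qact using Q_lrep by (simp add: lrep_def)
  note D = Q.subrepD[OF assms]
  have "VectorSpace.subspace class_ring {x \<in> carrier (V\<lparr>carrier := B\<rparr>). sq.q x \<in> W} (V\<lparr>carrier := B\<rparr>)"
    by (rule lhom_vimage_subsp[OF _ sq.Q_vsp sq.q_hom D(1)]) (rule vsp.subsp_vsp[OF vsp sq.B])
  then have "VectorSpace.subspace class_ring {x \<in> B. sq.q x \<in> W} V"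
    using vsp.subsp_nested[OF vsp sq.B] by simp
  then show "subrep G V \<rho> {x \<in> B. sq.q x \<in> W}" unfolding subrep_def
  proof (intro conjI ballI)
    fix g w assume g: "g \<in> carrier G" and w: "w \<in> {x \<in> B. sq.q x \<in> W}"
    then show "\<rho> g w \<in> {x \<in> B. sq.q x \<in> W}" using D(2)[OF g, of "sq.q w"] qact_q[OF g, of w] subrepD(2)[OF sB g, of w] by simp
  qed
  show "A \<subseteq> {x \<in> B. sq.q x \<in> W}"
  proof
    fix x assume x: "x \<in> A"
    then have "x \<in> B" using sq.AB by blast
    moreover have "sq.q x \<in> W" using x sq.q_zero_iff[OF \<open>x \<in> B\<close>] vsp.subspD(2)[OF Q.vsp D(1)] by simp
    ultimately show "x \<in> {x \<in> B. sq.q x \<in> W}" by simp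
  qed
  show "W = sq.q ` {x \<in> B. sq.q x \<in> W}"
  proof (intro equalityI subsetI)
    fix w assume w: "w \<in> W"
    then obtain x where "x \<in> B" "w = sq.q x" using D(3)[OF w] unfolding sq.Q_carr by blast
    then show "w \<in> sq.q ` {x \<in> B. sq.q x \<in> W}" using w by blast
  qed blast
qed

lemma Q_simpleI:
  assumes "A \<noteq> B" "\<And>W. subrep G V \<rho> W \<Longrightarrow> A \<subseteq> W \<Longrightarrow> W \<subseteq> B \<Longrightarrow> W = A \<or> W = B"
  shows "simple_rep G sq.Q qact"
  unfolding simple_rep_def
proof (intro conjI allI impI)
  show "linear_rep G sq.Q qact" by (rule Q_lrep)
  obtain x where "x \<in> B" "x \<notin> A" using assms(1) sAB by blast
  then have "sq.q x \<in> carrier sq.Q" "sq.q x \<noteq> \<zero>\<^bsub>sq.Q\<^esub>" using sq.q_zero_iff[of x] unfolding sq.Q_carr by auto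
  then show "carrier sq.Q \<noteq> {\<zero>\<^bsub>sq.Q\<^esub>}" by auto
  fix W assume W: "subrep G sq.Q qact W"
  note v = Q_subrep_vimage[OF W]
  consider "{x \<in> B. sq.q x \<in> W} = A" | "{x \<in> B. sq.q x \<in> W} = B" using assms(2)[OF v(1,2)] by blast
  then show "W = {\<zero>\<^bsub>sq.Q\<^esub>} \<or> W = carrier sq.Q"
  proof cases
    case 1
    have "sq.q x = \<zero>\<^bsub>sq.Q\<^esub>" if "x \<in> A" for x using sq.q_zero_iff[of x] that sAB by auto
    moreover have "\<zero>\<^bsub>V\<^esub> \<in> A" using sq.subspD(2)[OF sq.A] .
    ultimately have "sq.q ` A = {\<zero>\<^bsub>sq.Q\<^esub>}" by blast
    then show ?thesis using v(3) 1 by simp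
  next
    case 2 then show ?thesis using v(3) sq.Q_carr by simp
  qed
qed

end

subsection \<open>The group algebra\<close>

text \<open>A list of pairs \<open>(c, g)\<close> stands for the group algebra element \<open>\<Sum> c g\<close>.\<close>

definition glist :: "('g, 'c) monoid_scheme \<Rightarrow> ('k::field \<times> 'g) list \<Rightarrow> bool" where
  "glist G a \<longleftrightarrow> (\<forall>(c, g)\<in>set a. g \<in> carrier G)"

text \<open>Lists are not normalised: different lists may stand for the same element, and they are
  compared only through the operators \<open>lact\<close> and the values
  \<open>lext\<close>.\<close>

primrec lact :: "('k::field, 'v) module \<Rightarrow> ('g \<Rightarrow> 'v \<Rightarrow> 'v) \<Rightarrow> ('k \<times> 'g) list \<Rightarrow> 'v \<Rightarrow> 'v" where
  "lact V \<rho> [] x = \<zero>\<^bsub>V\<^esub>"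
| "lact V \<rho> (cg # a) x = (fst cg \<odot>\<^bsub>V\<^esub> \<rho> (snd cg) x) \<oplus>\<^bsub>V\<^esub> lact V \<rho> a x"

definition lsc :: "'k::field \<Rightarrow> ('k \<times> 'g) list \<Rightarrow> ('k \<times> 'g) list" where
  "lsc c a = map (\<lambda>(e, g). (c * e, g)) a"

definition lshift :: "('g, 'c) monoid_scheme \<Rightarrow> 'k::field \<Rightarrow> 'g \<Rightarrow> ('k \<times> 'g) list \<Rightarrow> ('k \<times> 'g) list" where
  "lshift G c g b = map (\<lambda>(e, h). (c * e, g \<otimes>\<^bsub>G\<^esub> h)) b"

definition lmul :: "('g, 'c) monoid_scheme \<Rightarrow> ('k::field \<times> 'g) list \<Rightarrow> ('k \<times> 'g) list \<Rightarrow> ('k \<times> 'g) list" where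
  "lmul G a b = concat (map (\<lambda>(c, g). lshift G c g b) a)"

text \<open>Linear extension of \<open>F\<close> to the group algebra. If \<open>F\<close> is the
  matrix coefficient of \<open>v\<close> and \<xi>, this is the value of \<xi> at
  \<open>a v\<close>, see \<open>functional_lact\<close>.\<close>

definition lext :: "('g \<Rightarrow> 'k::field) \<Rightarrow> ('k \<times> 'g) list \<Rightarrow> 'k" where
  "lext F a = (\<Sum>(c, g)\<leftarrow>a. c * F g)"

lemma lext_simps [simp]: "lext F [] = 0" "lext F (cg # a) = fst cg * F (snd cg) + lext F a"
  by (auto simp: lext_def split: prod.splits)

lemma glist_simps [simp]: "glist G []" "glist G (cg # a) \<longleftrightarrow> snd cg \<in> carrier G \<and> glist G a"
  "glist G (a @ b) \<longleftrightarrow> glist G a \<and> glist G b"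
  by (auto simp: glist_def split: prod.splits)

lemma glist_lsc [simp]: "glist G (lsc c a) \<longleftrightarrow> glist G a"
  by (induction a) (auto simp: lsc_def)

lemma glist_lmul: "group G \<Longrightarrow> glist G a \<Longrightarrow> glist G b \<Longrightarrow> glist G (lmul G a b)"
  by (fastforce simp: glist_def lmul_def lshift_def group.is_monoid monoid.m_closed)

lemma lact_carrier [simp]: "lact (V\<lparr>carrier := W\<rparr>) \<rho> a x = lact V \<rho> a x"
  by (induction a) auto

context lrep
begin

lemma lact_cl: "glist G a \<Longrightarrow> x \<in> carrier V \<Longrightarrow> lact V \<rho> a x \<in> carrier V"
  by (induction a) (auto simp: act_cl vsp.smult_cl[OF vsp])

lemma lact_add: "glist G a \<Longrightarrow> x \<in> carrier V \<Longrightarrow> y \<in> carrier V \<Longrightarrow>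
  lact V \<rho> a (x \<oplus>\<^bsub>V\<^esub> y) = lact V \<rho> a x \<oplus>\<^bsub>V\<^esub> lact V \<rho> a y"
proof (induction a)
  case (Cons cg a)
  interpret v: vsp V by (rule vsp)
  show ?case using Cons lact_cl[of a] act_cl lhomD(2)[OF act_hom, of "snd cg" x y]
    by (simp add: v.smult_right_distr a_ac)
qed (simp add: vsp)

lemma lact_smult: "glist G a \<Longrightarrow> x \<in> carrier V \<Longrightarrow>
  lact V \<rho> a (c \<odot>\<^bsub>V\<^esub> x) = c \<odot>\<^bsub>V\<^esub> lact V \<rho> a x"
proof (induction a)
  case Nil then show ?case using vsp.smult_zero_right[OF vsp] by simp
next
  case (Cons cg a)
  interpret v: vsp V by (rule vsp)
  show ?case using Cons lact_cl[of a] act_cl lhomD(3)[OF act_hom, of "snd cg" x c]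
    by (simp add: v.smult_right_distr v.smult_ass mult.commute)
qed

lemma lact_hom: "glist G a \<Longrightarrow> lact V \<rho> a \<in> lhom V V"
  by (rule lhomI) (auto simp: lact_cl lact_add lact_smult)

lemma lact_append: "glist G a \<Longrightarrow> glist G b \<Longrightarrow> x \<in> carrier V \<Longrightarrow>
  lact V \<rho> (a @ b) x = lact V \<rho> a x \<oplus>\<^bsub>V\<^esub> lact V \<rho> b x"
proof (induction a)
  case (Cons cg a)
  interpret v: vsp V by (rule vsp)
  show ?case using Cons lact_cl act_cl by (simp add: a_ac)
qed (simp add: lact_cl)

lemma lact_lsc: "glist G a \<Longrightarrow> x \<in> carrier V \<Longrightarrow> lact V \<rho> (lsc c a) x = c \<odot>\<^bsub>V\<^esub> lact V \<rho> a x"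
proof (induction a)
  case Nil then show ?case using vsp.smult_zero_right[OF vsp] by (simp add: lsc_def)
next
  case (Cons cg a)
  interpret v: vsp V by (rule vsp)
  show ?case using Cons lact_cl act_cl
    by (simp add: lsc_def split_def v.smult_right_distr v.smult_ass)
qed

lemma lact_lshift: "g \<in> carrier G \<Longrightarrow> glist G b \<Longrightarrow> x \<in> carrier V \<Longrightarrow>
  lact V \<rho> (lshift G c g b) x = c \<odot>\<^bsub>V\<^esub> \<rho> g (lact V \<rho> b x)"
proof (induction b)
  case Nil
  then show ?case using vsp.smult_zero_right[OF vsp] lhom_zero[OF vsp vsp act_hom] by (simp add: lshift_def)
next
  case (Cons cg b)
  interpret v: vsp V by (rule vsp)
  have "\<rho> g (fst cg \<odot>\<^bsub>V\<^esub> \<rho> (snd cg) x \<oplus>\<^bsub>V\<^esub> lact V \<rho> b x) =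
    fst cg \<odot>\<^bsub>V\<^esub> \<rho> g (\<rho> (snd cg) x) \<oplus>\<^bsub>V\<^esub> \<rho> g (lact V \<rho> b x)"
    using Cons.prems lact_cl[of b x] act_cl
    by (simp add: lhomD(2)[OF act_hom] lhomD(3)[OF act_hom] v.smult_cl)
  then show ?case using Cons lact_cl act_cl
    by (simp add: lshift_def split_def v.smult_right_distr v.smult_ass act_mult)
qed

lemma lact_lmul: "glist G a \<Longrightarrow> glist G b \<Longrightarrow> x \<in> carrier V \<Longrightarrow>
  lact V \<rho> (lmul G a b) x = lact V \<rho> a (lact V \<rho> b x)"
proof (induction a)
  case (Cons cg a)
  interpret v: vsp V by (rule vsp)
  have g: "glist G (lmul G a b)" "glist G (lshift G (fst cg) (snd cg) b)"
    using glist_lmul[OF grp] Cons.prems glist_lmul[OF grp, of "[cg]" b] by (auto simp: lmul_def split_def)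
  have "lmul G (cg # a) b = lshift G (fst cg) (snd cg) b @ lmul G a b"
    by (simp add: lmul_def split_def)
  then show ?case using Cons g by (simp add: lact_append lact_lshift)
qed (simp add: lmul_def)

lemma lact_subrep: "subrep G V \<rho> W \<Longrightarrow> glist G a \<Longrightarrow> x \<in> W \<Longrightarrow> lact V \<rho> a x \<in> W"
proof (induction a)
  case Nil then show ?case using vsp.subspD(2)[OF vsp subrepD(1)] by simp
next
  case (Cons cg a)
  note s = subrepD[OF Cons.prems(1)]
  show ?case using Cons s(2) vsp.subspD(3,4)[OF vsp s(1)] by simp
qed

lemma lact_equivariant:
  assumes "linear_rep G W \<sigma>" "f \<in> lhom V W"
    "\<And>g x. g \<in> carrier G \<Longrightarrow> x \<in> carrier V \<Longrightarrow> f (\<rho> g x) = \<sigma> g (f x)"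
  shows "glist G a \<Longrightarrow> x \<in> carrier V \<Longrightarrow> f (lact V \<rho> a x) = lact W \<sigma> a (f x)"
proof (induction a)
  case Nil
  interpret W: lrep G W \<sigma> using assms(1) by (simp add: lrep_def)
  show ?case using lhom_zero[OF vsp W.vsp assms(2)] by simp
next
  case (Cons cg a)
  interpret v: vsp V by (rule vsp)
  show ?case using Cons act_cl lact_cl assms(3) by (simp add: lhomD[OF assms(2)])
qed

lemma lact_one: "x \<in> carrier V \<Longrightarrow> lact V \<rho> [(c, \<one>\<^bsub>G\<^esub>)] x = c \<odot>\<^bsub>V\<^esub> x"
  using act_one vsp.smult_cl[OF vsp] by simp

lemma lact_single: "g \<in> carrier G \<Longrightarrow> x \<in> carrier V \<Longrightarrow> lact V \<rho> [(1, g)] x = \<rho> g x"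
  using act_cl vsp.smult_one'[OF vsp] by simp

lemma one_G: "\<one>\<^bsub>G\<^esub> \<in> carrier G" using grp by (simp add: group.is_monoid)

lemma orbit_subrep:
  assumes x: "x \<in> carrier V"
  shows "subrep G V \<rho> {lact V \<rho> a x | a. glist G a}"
  unfolding subrep_def vsp.subsp_iff[OF vsp]
proof (intro conjI ballI allI)
  let ?O = "{lact V \<rho> a x | a. glist G a}"
  show "?O \<subseteq> carrier V" using lact_cl x by auto
  show "\<zero>\<^bsub>V\<^esub> \<in> ?O" by (rule CollectI, rule exI[of _ "[]"]) simp
  fix y assume "y \<in> ?O"
  then obtain a where a: "glist G a" "y = lact V \<rho> a x" by auto
  { fix c show "c \<odot>\<^bsub>V\<^esub> y \<in> ?O"
      by (rule CollectI, rule exI[of _ "lsc c a"]) (use a x in \<open>auto simp: lact_lsc\<close>) }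
  { fix z assume "z \<in> ?O"
    then obtain b where b: "glist G b" "z = lact V \<rho> b x" by auto
    show "y \<oplus>\<^bsub>V\<^esub> z \<in> ?O"
      by (rule CollectI, rule exI[of _ "a @ b"]) (use a b x in \<open>auto simp: lact_append\<close>) }
  { fix g assume g: "g \<in> carrier G"
    have "lact V \<rho> (lmul G [(1, g)] a) x = \<rho> g y"
      using g a x lact_cl by (simp only: lact_lmul glist_simps snd_conv simp_thms lact_single)
    moreover have "glist G (lmul G [(1, g)] a)" using glist_lmul[OF grp, of "[(1, g)]" a] g a by simp
    ultimately show "\<rho> g y \<in> ?O" unfolding mem_Collect_eq by (intro exI[of _ "lmul G [(1, g)] a"] conjI) simp_all }
qed

lemma simpleD: "simple_rep G V \<rho> \<Longrightarrow> subrep G V \<rho> W \<Longrightarrow> W = {\<zero>\<^bsub>V\<^esub>} \<or> W = carrier V"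
  unfolding simple_rep_def by simp

text \<open>The orbit of \<open>y\<close> under the group algebra is a subrepresentation containing
  the nonzero vector \<open>y\<close>, hence is everything.\<close>

lemma simple_orbit:
  assumes "simple_rep G V \<rho>" "y \<in> carrier V" "y \<noteq> \<zero>\<^bsub>V\<^esub>" "x \<in> carrier V"
  shows "\<exists>a. glist G a \<and> lact V \<rho> a y = x"
proof -
  define S where "S = {lact V \<rho> a y | a. glist G a}"
  have "lact V \<rho> [(1, \<one>\<^bsub>G\<^esub>)] y = y"
    using assms(2) lact_one[of y 1] vsp.smult_one'[OF vsp] by simp
  moreover have "glist G [(1, \<one>\<^bsub>G\<^esub>)]" using one_G by simp
  ultimately have "y \<in> S" unfolding S_def mem_Collect_eq by (intro exI[of _ "[(1, \<one>\<^bsub>G\<^esub>)]"] conjI) (rule sym)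
  moreover have "S = {\<zero>\<^bsub>V\<^esub>} \<or> S = carrier V"
    unfolding S_def by (rule simpleD[OF assms(1) orbit_subrep[OF assms(2)]])
  ultimately have "S = carrier V" using assms(3) by auto
  then have "x \<in> S" using assms(4) by simp
  then obtain a where "x = lact V \<rho> a y \<and> glist G a" unfolding S_def mem_Collect_eq by (rule exE)
  then show ?thesis by (intro exI[of _ a] conjI) simp_all
qed

end

subsection \<open>Matrix coefficients of simple modules\<close>

definition functional :: "('k::field, 'v) module \<Rightarrow> ('v \<Rightarrow> 'k) \<Rightarrow> bool" where
  "functional V \<xi> \<longleftrightarrow> (\<forall>x\<in>carrier V. \<forall>y\<in>carrier V. \<xi> (x \<oplus>\<^bsub>V\<^esub> y) = \<xi> x + \<xi> y) \<and>
     (\<forall>c. \<forall>x\<in>carrier V. \<xi> (c \<odot>\<^bsub>V\<^esub> x) = c * \<xi> x)"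

definition coefficient :: "('g, 'c) monoid_scheme \<Rightarrow> ('k::field, 'v) module \<Rightarrow> ('g \<Rightarrow> 'v \<Rightarrow> 'v) \<Rightarrow> ('g \<Rightarrow> 'k) \<Rightarrow> bool" where
  "coefficient G V \<rho> F \<longleftrightarrow> (\<exists>v\<in>carrier V. \<exists>\<xi>. functional V \<xi> \<and> (\<forall>g\<in>carrier G. \<xi> (\<rho> g v) = F g))"

lemma (in vsp) functional_zero: "functional V \<xi> \<Longrightarrow> \<xi> \<zero> = 0"
  using smult_zero_left[of \<zero>] unfolding functional_def by (metis mult_zero_left zero_closed)

lemma (in lrep) functional_lact:
  assumes "functional V \<xi>" "v \<in> carrier V" "\<And>g. g \<in> carrier G \<Longrightarrow> \<xi> (\<rho> g v) = F g"
  shows "glist G a \<Longrightarrow> \<xi> (lact V \<rho> a v) = lext F a"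
proof (induction a)
  case Nil then show ?case using vsp.functional_zero[OF vsp assms(1)] by simp
next
  case (Cons cg a)
  then show ?case using assms act_cl lact_cl vsp.smult_cl[OF vsp] by (simp add: functional_def)
qed

text \<open>If \<open>a u\<close> is nonzero, simplicity gives \<open>b\<close> with
  \<open>b a u = u\<close>, and then the coefficient takes the nonzero value \<open>F 1\<close> on
  \<open>b a\<close>. Hence the annihilator of \<open>u\<close> can be read off from
  \<open>F\<close> alone.\<close>

lemma (in lrep) coefficient_zero_iff:
  assumes X: "simple_rep G V \<rho>" and u: "u \<in> carrier V" "functional V \<zeta>" "\<And>g. g \<in> carrier G \<Longrightarrow> \<zeta> (\<rho> g u) = F g"
    and F1: "F \<one>\<^bsub>G\<^esub> \<noteq> 0" and a: "glist G a"
  shows "lact V \<rho> a u = \<zero>\<^bsub>V\<^esub> \<longleftrightarrow> (\<forall>b. glist G b \<longrightarrow> lext F (lmul G b a) = 0)"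
proof -
  have *: "\<zeta> (lact V \<rho> b (lact V \<rho> a u)) = lext F (lmul G b a)" if "glist G b" for b
    using functional_lact[OF u(2,1,3) glist_lmul[OF grp that a]] lact_lmul[OF that a u(1)] by simp
  show ?thesis
  proof (intro iffI allI impI)
    fix b :: "('k \<times> 'g) list" assume "lact V \<rho> a u = \<zero>\<^bsub>V\<^esub>" "glist G b"
    then show "lext F (lmul G b a) = 0"
      using *[of b] lhom_zero[OF vsp vsp lact_hom[of b]] vsp.functional_zero[OF vsp u(2)] by simp
  next
    assume all: "\<forall>b. glist G b \<longrightarrow> lext F (lmul G b a) = 0"
    show "lact V \<rho> a u = \<zero>\<^bsub>V\<^esub>"
    proof (rule ccontr)
      assume "lact V \<rho> a u \<noteq> \<zero>\<^bsub>V\<^esub>"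
      then obtain b where "glist G b" "lact V \<rho> b (lact V \<rho> a u) = u"
        using simple_orbit[OF X lact_cl[OF a u(1)] _ u(1)] by blast
      then have "\<zeta> u = 0" using *[of b] all by simp
      then show False using u(3)[OF one_G] act_one[OF u(1)] F1 by simp
    qed
  qed
qed

text \<open>The vectors behind the two coefficients have the same annihilator in the group algebra,
  so sending \<open>a v\<close> to \<open>a w\<close> is a well-defined bijection between their
  orbits, which are everything by simplicity.\<close>

lemma iso_of_coefficient:
  assumes Q: "simple_rep G Q \<rho>" and L: "simple_rep G L \<tau>"
    and cQ: "coefficient G Q \<rho> F" and cL: "coefficient G L \<tau> F" and F1: "F \<one>\<^bsub>G\<^esub> \<noteq> 0"
  shows "isomorphic_reps G Q \<rho> L \<tau>"
proof -
  interpret Q: lrep G Q \<rho> using Q by (simp add: simple_rep_def lrep_def)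
  interpret L: lrep G L \<tau> using L by (simp add: simple_rep_def lrep_def)
  interpret Qv: vsp Q by (rule Q.vsp)
  interpret Lv: vsp L by (rule L.vsp)
  obtain v \<xi> where v: "v \<in> carrier Q" "functional Q \<xi>" "\<And>g. g \<in> carrier G \<Longrightarrow> \<xi> (\<rho> g v) = F g"
    using cQ by (auto simp: coefficient_def)
  obtain w \<eta> where w: "w \<in> carrier L" "functional L \<eta>" "\<And>g. g \<in> carrier G \<Longrightarrow> \<eta> (\<tau> g w) = F g"
    using cL by (auto simp: coefficient_def)
  have zQ: "lact Q \<rho> a v = \<zero>\<^bsub>Q\<^esub> \<longleftrightarrow> (\<forall>b. glist G b \<longrightarrow> lext F (lmul G b a) = 0)" if "glist G a" for a
    by (rule Q.coefficient_zero_iff[where \<zeta> = \<xi> and F = F, OF Q v(1,2) _ F1 that]) (rule v(3))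
  have zL: "lact L \<tau> a w = \<zero>\<^bsub>L\<^esub> \<longleftrightarrow> (\<forall>b. glist G b \<longrightarrow> lext F (lmul G b a) = 0)" if "glist G a" for a
    by (rule L.coefficient_zero_iff[where \<zeta> = \<eta> and F = F, OF L w(1,2) _ F1 that]) (rule w(3))
  have "\<xi> v \<noteq> 0" "\<eta> w \<noteq> 0"
    using v(3)[OF Q.one_G] w(3)[OF L.one_G] Q.act_one[OF v(1)] L.act_one[OF w(1)] F1 by simp_all
  then have nz: "v \<noteq> \<zero>\<^bsub>Q\<^esub>" "w \<noteq> \<zero>\<^bsub>L\<^esub>"
    using Qv.functional_zero[OF v(2)] Lv.functional_zero[OF w(2)] by metis+
  \<comment> \<open>Equality is tested on the list that represents \<open>a - b\<close>.\<close>
  have eq_iff: "lact Q \<rho> a v = lact Q \<rho> b v \<longleftrightarrow> lact L \<tau> a w = lact L \<tau> b w" if "glist G a" "glist G b" for a b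
  proof -
    have g: "glist G (a @ lsc (-1) b)" using that by simp
    have "lact Q \<rho> (a @ lsc (-1) b) v = lact Q \<rho> a v \<ominus>\<^bsub>Q\<^esub> lact Q \<rho> b v"
      using that v Q.lact_cl by (simp add: Q.lact_append Q.lact_lsc Qv.smult_neg1 a_minus_def)
    moreover have "lact L \<tau> (a @ lsc (-1) b) w = lact L \<tau> a w \<ominus>\<^bsub>L\<^esub> lact L \<tau> b w"
      using that w L.lact_cl by (simp add: L.lact_append L.lact_lsc Lv.smult_neg1 a_minus_def)
    ultimately show ?thesis using zQ[OF g] zL[OF g] Q.lact_cl[OF that(1) v(1)] Q.lact_cl[OF that(2) v(1)]
       L.lact_cl[OF that(1) w(1)] L.lact_cl[OF that(2) w(1)] by simp
  qed
  \<comment> \<open>Any list that leads from \<open>v\<close> to \<open>x\<close> will do;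
    independence of the choice is \<open>eq_iff\<close>.\<close>
  define f where "f x = lact L \<tau> (SOME a. glist G a \<and> lact Q \<rho> a v = x) w" for x
  have f: "f (lact Q \<rho> a v) = lact L \<tau> a w" if "glist G a" for a
  proof -
    define b where "b = (SOME b. glist G b \<and> lact Q \<rho> b v = lact Q \<rho> a v)"
    have "glist G b \<and> lact Q \<rho> b v = lact Q \<rho> a v"
      unfolding b_def by (rule someI[of _ a]) (use that in simp)
    then have b: "glist G b" "lact Q \<rho> b v = lact Q \<rho> a v" by simp_all
    have "f (lact Q \<rho> a v) = lact L \<tau> b w" by (simp add: f_def b_def)
    also have "\<dots> = lact L \<tau> a w" using b(2) eq_iff[OF b(1) that] by simp
    finally show ?thesis .
  qed
  have ex: "\<exists>a. glist G a \<and> x = lact Q \<rho> a v" if "x \<in> carrier Q" for x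
    using Q.simple_orbit[OF Q v(1) nz(1) that] by (elim exE conjE) (intro exI conjI, assumption, rule sym)
  have exL: "\<exists>a. glist G a \<and> x = lact L \<tau> a w" if "x \<in> carrier L" for x
    using L.simple_orbit[OF L w(1) nz(2) that] by (elim exE conjE) (intro exI conjI, assumption, rule sym)
  have hom: "f \<in> lhom Q L"
  proof (rule lhomI)
    fix x y c assume x: "x \<in> carrier Q"
    obtain a where a: "glist G a" "x = lact Q \<rho> a v" using ex[OF x] by auto
    show "f x \<in> carrier L" using a f w L.lact_cl by simp
    show "f (c \<odot>\<^bsub>Q\<^esub> x) = c \<odot>\<^bsub>L\<^esub> f x"
      using f[of "lsc c a"] f[of a] a v w by (simp add: Q.lact_lsc L.lact_lsc)
    assume y: "y \<in> carrier Q"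
    obtain b where b: "glist G b" "y = lact Q \<rho> b v" using ex[OF y] by auto
    show "f (x \<oplus>\<^bsub>Q\<^esub> y) = f x \<oplus>\<^bsub>L\<^esub> f y"
      using f[of "a @ b"] f[of a] f[of b] a b v w by (simp add: Q.lact_append L.lact_append)
  qed
  have "bij_betw f (carrier Q) (carrier L)"
  proof (rule bij_betw_imageI)
    show "inj_on f (carrier Q)"
    proof (rule inj_onI)
      fix x y assume xy: "x \<in> carrier Q" "y \<in> carrier Q" "f x = f y"
      obtain a where a: "glist G a" "x = lact Q \<rho> a v" using ex[OF xy(1)] by auto
      obtain b where b: "glist G b" "y = lact Q \<rho> b v" using ex[OF xy(2)] by auto
      show "x = y" using a b xy(3) f[of a] f[of b] eq_iff[OF a(1) b(1)] by simp
    qed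
    show "f ` carrier Q = carrier L"
    proof (rule equalityI)
      show "f ` carrier Q \<subseteq> carrier L" by (rule image_subsetI) (rule lhomD(1)[OF hom])
      show "carrier L \<subseteq> f ` carrier Q"
      proof
      fix y assume "y \<in> carrier L"
      then obtain a where a: "glist G a" "y = lact L \<tau> a w" using exL by auto
      then have "y = f (lact Q \<rho> a v)" using f by simp
      then show "y \<in> f ` carrier Q" using Q.lact_cl[OF a(1) v(1)] by blast
      qed
    qed
  qed
  moreover have "f (\<rho> g x) = \<tau> g (f x)" if g: "g \<in> carrier G" and x: "x \<in> carrier Q" for g x
  proof -
    obtain a where a: "glist G a" "x = lact Q \<rho> a v" using ex[OF x] by auto
    have gg: "glist G [(1, g)]" using g by simp
    have "f (lact Q \<rho> (lmul G [(1, g)] a) v) = lact L \<tau> (lmul G [(1, g)] a) w"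
      using f[OF glist_lmul[OF Q.grp gg a(1)]] .
    then show ?thesis
      unfolding Q.lact_lmul[OF gg a(1) v(1)] L.lact_lmul[OF gg a(1) w(1)]
      using a f[of a] g Q.lact_single[OF g x] L.lact_single[OF g L.lact_cl[OF a(1) w(1)]] by simp
  qed
  ultimately show ?thesis unfolding isomorphic_reps_def by (intro bexI[OF _ hom] conjI ballI)
qed

subsection \<open>Composition multiplicities\<close>

abbreviation composition_factor where
  "composition_factor G V \<rho> A B \<equiv> simple_rep G (subquotient V B A) (\<lambda>g. quot_map V A (\<rho> g))"

abbreviation factor_iso where
  "factor_iso G V \<rho> L \<tau> A B \<equiv> isomorphic_reps G (subquotient V B A) (\<lambda>g. quot_map V A (\<rho> g)) L \<tau>"

context lrep
begin

text \<open>Induction on the dimension of \<open>W\<close>: a proper subrepresentation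
  \<open>X\<close> of largest dimension is maximal, so the factor of \<open>W\<close> by
  \<open>X\<close> is simple and tops a series for \<open>X\<close>. Treating all \<open>W\<close>
  inside the fixed \<open>V\<close> keeps every term a subset of the same space.\<close>

lemma composition_series_exists:
  assumes fin: "fvsp V" and W: "subrep G V \<rho> W"
  shows "\<exists>Ws. Ws \<noteq> [] \<and> hd Ws = {\<zero>\<^bsub>V\<^esub>} \<and> last Ws = W \<and> (\<forall>X\<in>set Ws. subrep G V \<rho> X) \<and>
    (\<forall>j. Suc j < length Ws \<longrightarrow> Ws ! j \<subseteq> Ws ! Suc j \<and> composition_factor G V \<rho> (Ws ! j) (Ws ! Suc j))"
  using W
proof (induction "vdim (V\<lparr>carrier := W\<rparr>)" arbitrary: W rule: less_induct)
  case less
  show ?case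
  proof (cases "W = {\<zero>\<^bsub>V\<^esub>}")
    case True
    then show ?thesis using less.prems by (intro exI[of _ "[{\<zero>\<^bsub>V\<^esub>}]"]) simp
  next
    case False
    interpret V: fvsp V by (rule fin)
    have sW: "VectorSpace.subspace class_ring W V" by (rule subrepD(1)[OF less.prems])
    interpret W: fvsp "V\<lparr>carrier := W\<rparr>" by (rule V.subsp_fin[OF sW])
    let ?P = "\<lambda>X. subrep G V \<rho> X \<and> X \<subset> W"
    have P0: "?P {\<zero>\<^bsub>V\<^esub>}"
      using subrep_zero V.subspD(2)[OF sW] False by auto
    have lt: "vdim (V\<lparr>carrier := X\<rparr>) < vdim (V\<lparr>carrier := Y\<rparr>)"
      if X: "subrep G V \<rho> X" "subrep G V \<rho> Y" "X \<subset> Y" for X Y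
    proof -
      interpret Y: fvsp "V\<lparr>carrier := Y\<rparr>" by (rule V.subsp_fin[OF subrepD(1)[OF X(2)]])
      have s: "VectorSpace.subspace class_ring X (V\<lparr>carrier := Y\<rparr>)"
        unfolding V.subsp_nested[OF subrepD(1)[OF X(2)]] using X subrepD(1)[OF X(1)] by simp
      show ?thesis
      proof (rule ccontr)
        assume "\<not> ?thesis"
        then have "X = carrier (V\<lparr>carrier := Y\<rparr>)" using Y.subsp_dim_eq[OF s] by simp
        then show False using X(3) by simp
      qed
    qed
    have bound: "\<forall>X. ?P X \<longrightarrow> vdim (V\<lparr>carrier := X\<rparr>) < vdim (V\<lparr>carrier := W\<rparr>)"
      using lt[OF _ less.prems] by simp
    have "\<exists>X. ?P X \<and> (\<forall>Y. ?P Y \<longrightarrow> vdim (V\<lparr>carrier := Y\<rparr>) \<le> vdim (V\<lparr>carrier := X\<rparr>))"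
      by (rule ex_has_greatest_nat[of ?P, OF P0 bound])
 then obtain X where X: "?P X" "\<And>Y. ?P Y \<Longrightarrow> vdim (V\<lparr>carrier := Y\<rparr>) \<le> vdim (V\<lparr>carrier := X\<rparr>)" by (elim exE conjE) simp
    have sX: "subrep G V \<rho> X" "X \<subset> W" using X(1) by simp_all
    interpret sq: rep_subquot G V \<rho> X W by unfold_locales (use sX less.prems in auto)
    have simple: "composition_factor G V \<rho> X W"
    proof (rule sq.Q_simpleI)
      show "X \<noteq> W" using sX by blast
      fix Y assume Y: "subrep G V \<rho> Y" "X \<subseteq> Y" "Y \<subseteq> W"
      show "Y = X \<or> Y = W"
      proof (rule ccontr)
        assume n: "\<not> (Y = X \<or> Y = W)"
        then have "?P Y" using Y by blast
        then have "vdim (V\<lparr>carrier := Y\<rparr>) \<le> vdim (V\<lparr>carrier := X\<rparr>)" by (rule X(2))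
        moreover have "X \<subset> Y" using n Y by blast
        ultimately show False using lt[OF sX(1) Y(1)] by simp
      qed
    qed
    obtain Ws where Ws: "Ws \<noteq> []" "hd Ws = {\<zero>\<^bsub>V\<^esub>}" "last Ws = X" "\<forall>X\<in>set Ws. subrep G V \<rho> X"
      "\<forall>j. Suc j < length Ws \<longrightarrow> Ws ! j \<subseteq> Ws ! Suc j \<and> composition_factor G V \<rho> (Ws ! j) (Ws ! Suc j)"
      using less.hyps[OF lt[OF sX(1) less.prems sX(2)] sX(1)] by (elim exE conjE)
    show ?thesis
    proof (intro exI[of _ "Ws @ [W]"] conjI allI impI)
      fix j assume j: "Suc j < length (Ws @ [W])"
      have "(Ws @ [W]) ! j \<subseteq> (Ws @ [W]) ! Suc j \<and> composition_factor G V \<rho> ((Ws @ [W]) ! j) ((Ws @ [W]) ! Suc j)"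
      proof (cases "Suc j < length Ws")
        case True then show ?thesis using Ws(5)[rule_format, OF True] by (simp add: nth_append)
      next
        case False
        then have jj: "Suc j = length Ws" using j by simp
        then have "j = length Ws - 1" by simp
        then have "Ws ! j = X" using Ws(1,3) by (simp add: last_conv_nth)
        then have e: "(Ws @ [W]) ! j = X" "(Ws @ [W]) ! Suc j = W" using jj by (simp_all add: nth_append)
        show ?thesis unfolding e using sX simple by blast
      qed
      then show "(Ws @ [W]) ! j \<subseteq> (Ws @ [W]) ! Suc j"
        "composition_factor G V \<rho> ((Ws @ [W]) ! j) ((Ws @ [W]) ! Suc j)" by simp_all
    qed (use Ws less.prems in auto)
  qed
qed

text \<open>This takes the place of the Jordan--Hoelder theorem.\<close>

lemma composition_mult_eq:
  assumes fin: "fvsp V" and d0: "d {\<zero>\<^bsub>V\<^esub>} = 0"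
    and step: "\<And>A B. subrep G V \<rho> A \<Longrightarrow> subrep G V \<rho> B \<Longrightarrow> A \<subseteq> B \<Longrightarrow> composition_factor G V \<rho> A B \<Longrightarrow>
      d B = d A + (if factor_iso G V \<rho> L \<tau> A B then 1 else 0 :: nat)"
  shows "composition_mult G V \<rho> L \<tau> = d (carrier V)"
proof -
  have count: "card {j. Suc j < length Ws \<and> factor_iso G V \<rho> L \<tau> (Ws ! j) (Ws ! Suc j)} = d (carrier V)"
    if "composition_series G V \<rho> Ws" for Ws
  proof -
    note Ws = that[unfolded composition_series_def]
    \<comment> \<open>The partial counts telescope to \<open>d\<close>, so the total depends only on
      the last term of the series.\<close>
    have "m < length Ws \<Longrightarrow> card {j. Suc j \<le> m \<and> factor_iso G V \<rho> L \<tau> (Ws ! j) (Ws ! Suc j)} = d (Ws ! m)" for m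
    proof (induction m)
      case 0
      then have "Ws ! 0 = {\<zero>\<^bsub>V\<^esub>}" using Ws by (metis hd_conv_nth)
      then show ?case using d0 by simp
    next
      case (Suc m)
      let ?S = "\<lambda>m. {j. Suc j \<le> m \<and> factor_iso G V \<rho> L \<tau> (Ws ! j) (Ws ! Suc j)}"
      have f: "finite (?S m)" by (rule finite_subset[of _ "{..m}"]) auto
      have n: "m \<notin> ?S m" by simp
      have "?S (Suc m) = (if factor_iso G V \<rho> L \<tau> (Ws ! m) (Ws ! Suc m) then insert m (?S m) else ?S m)"
        by (auto simp: le_Suc_eq)
      then have "card (?S (Suc m)) = card (?S m) + (if factor_iso G V \<rho> L \<tau> (Ws ! m) (Ws ! Suc m) then 1 else 0)"
        using f n by simp
      also have "\<dots> = d (Ws ! m) + (if factor_iso G V \<rho> L \<tau> (Ws ! m) (Ws ! Suc m) then 1 else 0)"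
        using Suc by simp
      also have "\<dots> = d (Ws ! Suc m)"
        by (rule step[symmetric]) (use Ws Suc.prems in simp_all)
      finally show ?case .
    qed
    note * = this[of "length Ws - 1"]
    have "Ws ! (length Ws - 1) = carrier V" using Ws by (metis last_conv_nth)
    moreover have "{j. Suc j < length Ws \<and> factor_iso G V \<rho> L \<tau> (Ws ! j) (Ws ! Suc j)} =
      {j. Suc j \<le> length Ws - 1 \<and> factor_iso G V \<rho> L \<tau> (Ws ! j) (Ws ! Suc j)}"
      using Ws by (auto simp: Suc_le_eq)
    ultimately show ?thesis using * Ws by simp
  qed
  obtain Ws where Ws: "composition_series G V \<rho> Ws"
    using composition_series_exists[OF fin subrep_carrier] unfolding composition_series_def by blast
  show ?thesis unfolding composition_mult_def
  proof (rule the_equality)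
    show "\<exists>Ws. composition_series G V \<rho> Ws \<and> d (carrier V) =
      card {j. Suc j < length Ws \<and> factor_iso G V \<rho> L \<tau> (Ws ! j) (Ws ! Suc j)}"
      using Ws count[OF Ws] by (intro exI[of _ Ws]) simp
  next
    fix n assume "\<exists>Ws. composition_series G V \<rho> Ws \<and> n =
      card {j. Suc j < length Ws \<and> factor_iso G V \<rho> L \<tau> (Ws ! j) (Ws ! Suc j)}"
    then show "n = d (carrier V)" using count by (elim exE conjE) simp
  qed
qed

end

context rep_subquot
begin

lemma lact_q: "glist G a \<Longrightarrow> x \<in> B \<Longrightarrow> lact sq.Q qact a (sq.q x) = sq.q (lact V \<rho> a x)"
proof -
  assume a: "glist G a" and x: "x \<in> B"
  interpret B: lrep G "V\<lparr>carrier := B\<rparr>" \<rho> using subrep_lrep[OF sB] by (simp add: lrep_def)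
  have "sq.q (lact (V\<lparr>carrier := B\<rparr>) \<rho> a x) = lact sq.Q qact a (sq.q x)"
    by (rule B.lact_equivariant[OF Q_lrep sq.q_hom _ a]) (use x qact_q in simp_all)
  then show ?thesis by simp
qed

text \<open>Rank-nullity for the quotient map on \<open>e B\<close>: its image is \<open>e\<close>
  applied to the factor, and its kernel, the part of \<open>e B\<close> inside \<open>A\<close>, is
  \<open>e A\<close> because \<open>e\<close> fixes its image. So passing from \<open>W\<close> to
  \<open>e W\<close> is exact.\<close>

lemma idempotent_dim:
  assumes fin: "fvsp V" and e: "glist G e" and idem: "\<And>x. x \<in> carrier V \<Longrightarrow> lact V \<rho> e (lact V \<rho> e x) = lact V \<rho> e x"
  shows "vdim (V\<lparr>carrier := lact V \<rho> e ` B\<rparr>) = vdim (V\<lparr>carrier := lact V \<rho> e ` A\<rparr>)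
    + vdim (sq.Q\<lparr>carrier := lact sq.Q qact e ` carrier sq.Q\<rparr>)"
proof -
  let ?e = "lact V \<rho> e"
  interpret V: fvsp V by (rule fin)
  interpret Q: lrep G sq.Q qact using Q_lrep by (simp add: lrep_def)
  have sub: "VectorSpace.subspace class_ring (?e ` B) V"
    by (rule lhom_image_subsp[OF vsp vsp lact_hom[OF e] sq.B])
  have eB: "?e x \<in> B" if "x \<in> B" for x using lact_subrep[OF sB e that] .
  have eA: "?e x \<in> A" if "x \<in> A" for x using lact_subrep[OF sA e that] .
  have hom: "sq.q \<in> lhom (V\<lparr>carrier := ?e ` B\<rparr>) sq.Q"
    using lhom_restrict_dom[OF sq.q_hom, of "?e ` B"] eB by auto
  have im: "sq.q ` ?e ` B = lact sq.Q qact e ` carrier sq.Q"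
    unfolding sq.Q_carr image_image using lact_q[OF e] by (intro image_cong refl) simp
  have ker: "{x \<in> ?e ` B. sq.q x = \<zero>\<^bsub>sq.Q\<^esub>} = ?e ` A"
  proof (intro equalityI subsetI)
    fix x assume "x \<in> {x \<in> ?e ` B. sq.q x = \<zero>\<^bsub>sq.Q\<^esub>}"
    then obtain b where b: "b \<in> B" "x = ?e b" "sq.q x = \<zero>\<^bsub>sq.Q\<^esub>" by auto
    then have "x \<in> A" using sq.q_zero_iff[OF eB[OF b(1)]] by simp
    moreover have "x = ?e x" using b idem[OF sq.B_carr[OF b(1)]] by simp
    ultimately show "x \<in> ?e ` A" by (rule rev_image_eqI)
  next
    fix x assume "x \<in> ?e ` A"
    then obtain a where a: "a \<in> A" "x = ?e a" by auto
    have aB: "a \<in> B" using a sAB by blast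
    have "x \<in> A" using eA[OF a(1)] a(2) by simp
    moreover have "x \<in> ?e ` B" using aB a(2) by (intro rev_image_eqI)
    ultimately show "x \<in> {x \<in> ?e ` B. sq.q x = \<zero>\<^bsub>sq.Q\<^esub>}" using sq.q_zero_iff[of x] sAB by auto
  qed
  have "?e ` B \<subseteq> carrier V" using sq.subspD(1)[OF sub] .
  then show ?thesis
    using rank_nullity'[OF V.subsp_fin[OF sub] sq.Q_vsp hom] ker im by simp
qed

end

text \<open>\<open>e\<close> acts on \<open>E\<close> as an idempotent whose corner algebra acts on \<open>w\<close> through the character \<open>F\<close>, with
  nilpotent kernel. If the relations of \<open>E\<close> hold in \<open>V\<close>, simple subquotients of \<open>V\<close> not killed by \<open>e\<close>
  have \<open>F\<close> as a matrix coefficient.\<close>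

definition satisfies_relations where
  "satisfies_relations G E \<rho>E V \<rho> \<longleftrightarrow> (\<forall>a. glist G a \<longrightarrow> (\<forall>T\<in>carrier E. lact E \<rho>E a T = \<zero>\<^bsub>E\<^esub>) \<longrightarrow>
     (\<forall>x\<in>carrier V. lact V \<rho> a x = \<zero>\<^bsub>V\<^esub>))"

locale primitive_idempotent = E: lrep G E \<rho>E
  for G :: "('g, 'c) monoid_scheme" and E :: "('k::field, 'e) module" and \<rho>E +
  fixes e :: "('k \<times> 'g) list" and w :: 'e and F :: "'g \<Rightarrow> 'k"
  assumes e: "glist G e"
    and e_idem: "T \<in> carrier E \<Longrightarrow> lact E \<rho>E e (lact E \<rho>E e T) = lact E \<rho>E e T"
    and w: "w \<in> carrier E" "lact E \<rho>E e w = w"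
    and char: "glist G a \<Longrightarrow> lact E \<rho>E e (lact E \<rho>E a w) = lext F a \<odot>\<^bsub>E\<^esub> w"
    and nilp: "glist G b \<Longrightarrow> lact E \<rho>E e (lact E \<rho>E b w) = \<zero>\<^bsub>E\<^esub> \<Longrightarrow>
       \<exists>N. \<forall>T\<in>carrier E. ((\<lambda>T. lact E \<rho>E e (lact E \<rho>E b (lact E \<rho>E e T))) ^^ N) T = \<zero>\<^bsub>E\<^esub>"
    and Fe: "lext F e = 1" and F1: "F \<one>\<^bsub>G\<^esub> = 1"
begin

text \<open>The difference of the two lists acts as zero on \<open>E\<close>, hence on
  \<open>V\<close>.\<close>

lemma relation_eq:
  assumes "satisfies_relations G E \<rho>E V \<rho>" "linear_rep G V \<rho>" "glist G a" "glist G b"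
    "\<And>T. T \<in> carrier E \<Longrightarrow> lact E \<rho>E a T = lact E \<rho>E b T" "x \<in> carrier V"
  shows "lact V \<rho> a x = lact V \<rho> b x"
proof -
  interpret V: lrep G V \<rho> using assms(2) by (simp add: lrep_def)
  interpret Vv: vsp V by (rule V.vsp)
  interpret Ev: vsp E by (rule E.vsp)
  have g: "glist G (a @ lsc (-1) b)" using assms by simp
  have "lact E \<rho>E (a @ lsc (-1) b) T = \<zero>\<^bsub>E\<^esub>" if T: "T \<in> carrier E" for T
    using assms(5)[OF T] E.lact_cl[OF assms(4) T] assms(3,4) T
    by (simp add: E.lact_append E.lact_lsc Ev.smult_neg1 E.r_neg)
  then have "lact V \<rho> (a @ lsc (-1) b) x = \<zero>\<^bsub>V\<^esub>"
    using assms(1) g assms(6) unfolding satisfies_relations_def by blast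
  moreover have "lact V \<rho> (a @ lsc (-1) b) x = lact V \<rho> a x \<ominus>\<^bsub>V\<^esub> lact V \<rho> b x"
    using assms V.lact_cl by (simp add: V.lact_append V.lact_lsc Vv.smult_neg1 a_minus_def)
  ultimately show ?thesis using V.lact_cl[OF assms(3,6)] V.lact_cl[OF assms(4,6)] by simp
qed

text \<open>Put \<open>b = e a e - F(a) e\<close>; it kills \<open>w\<close> by \<open>char\<close>.
  If it did not kill \<open>q = e x0\<close>, simplicity would give \<open>c = b2 b\<close> with
  \<open>c q = q\<close>. But \<open>c\<close> kills \<open>w\<close>, so \<open>e c e\<close> is
  nilpotent on \<open>E\<close> by \<open>nilp\<close>, hence on \<open>V\<close> by the relations,
  although it fixes \<open>q\<close>.\<close>

lemma simple_corner:
  assumes rel: "satisfies_relations G E \<rho>E V \<rho>" and simple: "simple_rep G V \<rho>"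
    and x0: "x0 \<in> carrier V" "lact V \<rho> e x0 \<noteq> \<zero>\<^bsub>V\<^esub>" and a: "glist G a"
  shows "lact V \<rho> e (lact V \<rho> a (lact V \<rho> e x0)) = lext F a \<odot>\<^bsub>V\<^esub> lact V \<rho> e x0"
proof -
  have V': "linear_rep G V \<rho>" using simple by (simp add: simple_rep_def)
  interpret V: lrep G V \<rho> using V' by (simp add: lrep_def)
  interpret Vv: vsp V by (rule V.vsp)
  interpret Ev: vsp E by (rule E.vsp)
  let ?V = "lact V \<rho>" and ?E = "lact E \<rho>E"
  note m = glist_lmul[OF E.grp]
  define q where "q = ?V e x0"
  have q: "q \<in> carrier V" "q \<noteq> \<zero>\<^bsub>V\<^esub>" unfolding q_def using x0 V.lact_cl[OF e] by auto
  have Ve: "?V e (?V e x) = ?V e x" if "x \<in> carrier V" for x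
    using relation_eq[OF rel V' m[OF e e] e _ that] e_idem
    by (simp add: E.lact_lmul[OF e e] V.lact_lmul[OF e e that])
  have eq: "?V e q = q" unfolding q_def using Ve x0 by simp
  define b where "b = lmul G e (lmul G a e) @ lsc (- lext F a) e"
  have g1: "glist G (lmul G a e)" "glist G (lmul G e (lmul G a e))" by (intro m e a)+
  have b: "glist G b" unfolding b_def using e g1 by simp
  have Vb: "?V b x = ?V e (?V a (?V e x)) \<ominus>\<^bsub>V\<^esub> lext F a \<odot>\<^bsub>V\<^esub> ?V e x" if x: "x \<in> carrier V" for x
    unfolding b_def using x e a g1 V.lact_cl[OF e x]
    by (simp add: V.lact_append V.lact_lsc V.lact_lmul Vv.smult_minus_left a_minus_def)
  have Eb: "?E b x = ?E e (?E a (?E e x)) \<ominus>\<^bsub>E\<^esub> lext F a \<odot>\<^bsub>E\<^esub> ?E e x" if x: "x \<in> carrier E" for x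
    unfolding b_def using x e a g1 E.lact_cl[OF e x]
    by (simp add: E.lact_append E.lact_lsc E.lact_lmul Ev.smult_minus_left a_minus_def)
  have bw: "?E b w = \<zero>\<^bsub>E\<^esub>" using Eb[OF w(1)] w char[OF a] Ev.smult_cl by (simp add: a_minus_def E.r_neg)
  have "?V b q = \<zero>\<^bsub>V\<^esub>"
  proof (rule ccontr)
    assume y: "?V b q \<noteq> \<zero>\<^bsub>V\<^esub>"
    obtain b2 where b2: "glist G b2" "?V b2 (?V b q) = q"
      using V.simple_orbit[OF simple V.lact_cl[OF b q(1)] y q(1)] by blast
    define c where "c = lmul G b2 b"
    have c: "glist G c" unfolding c_def using m[OF b2(1) b] .
    have "?E e (?E c w) = \<zero>\<^bsub>E\<^esub>"
      unfolding c_def E.lact_lmul[OF b2(1) b w(1)] bw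
      using lhom_zero[OF E.vsp E.vsp E.lact_hom] b2(1) e by simp
    then obtain N where N: "\<And>T. T \<in> carrier E \<Longrightarrow> ((\<lambda>T. ?E e (?E c (?E e T))) ^^ N) T = \<zero>\<^bsub>E\<^esub>"
      using nilp[OF c] by blast
    define n where "n = lmul G e (lmul G c e)"
    have g2: "glist G (lmul G c e)" by (intro m e c)
    have n: "glist G n" unfolding n_def by (intro m e c)
    have nE: "?E n T = ?E e (?E c (?E e T))" if "T \<in> carrier E" for T
      unfolding n_def using e c g2 that E.lact_cl by (simp add: E.lact_lmul)
    have nV: "?V n T = ?V e (?V c (?V e T))" if "T \<in> carrier V" for T
      unfolding n_def using e c g2 that V.lact_cl by (simp add: V.lact_lmul)
    \<comment> \<open>The powers of \<open>n\<close> are formed as lists, since it is a list acting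
      as zero on \<open>E\<close> that can be transferred to \<open>V\<close>.\<close>
    define pw where "pw = rec_nat [(1::'k, \<one>\<^bsub>G\<^esub>)] (\<lambda>_ r. lmul G n r)"
    have pw_g: "glist G (pw k)" for k unfolding pw_def by (induction k) (simp_all add: E.one_G m n)
    have pwE: "?E (pw k) T = ((\<lambda>T. ?E e (?E c (?E e T))) ^^ k) T" if "T \<in> carrier E" for k T
    proof (induction k)
      case 0 show ?case unfolding pw_def using E.lact_one[OF that, of 1] that by simp
    next
      case (Suc k)
      have "pw (Suc k) = lmul G n (pw k)" unfolding pw_def by simp
      then have "?E (pw (Suc k)) T = ?E n (?E (pw k) T)" using E.lact_lmul[OF n pw_g that] by simp
      then show ?case using Suc nE[OF E.lact_cl[OF pw_g[of k] that]] by simp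
    qed
    have pwV: "?V (pw k) q = q" for k
    proof (induction k)
      case 0 show ?case unfolding pw_def using V.lact_one[OF q(1), of 1] q by simp
    next
      case (Suc k)
      have "pw (Suc k) = lmul G n (pw k)" unfolding pw_def by simp
      then have "?V (pw (Suc k)) q = ?V n q" using V.lact_lmul[OF n pw_g q(1)] Suc by simp
      also have "\<dots> = ?V e (?V c q)" using nV[OF q(1)] eq by simp
      also have "?V c q = q" unfolding c_def V.lact_lmul[OF b2(1) b q(1)] by (rule b2(2))
      finally show ?case using eq by simp
    qed
    have "?E (pw N) T = \<zero>\<^bsub>E\<^esub>" if "T \<in> carrier E" for T using N pwE that by simp
    then have "?V (pw N) q = \<zero>\<^bsub>V\<^esub>" using rel pw_g q(1) unfolding satisfies_relations_def by blast
    then show False using pwV q by simp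
  qed
  then have "?V e (?V a q) \<ominus>\<^bsub>V\<^esub> lext F a \<odot>\<^bsub>V\<^esub> q = \<zero>\<^bsub>V\<^esub>" using Vb[OF q(1)] eq by simp
  moreover have "?V e (?V a q) \<in> carrier V" using V.lact_cl e a q by simp
  ultimately have "?V e (?V a q) = lext F a \<odot>\<^bsub>V\<^esub> q" using q Vv.smult_cl by simp
  then show ?thesis unfolding q_def .
qed

text \<open>If \<open>e\<close> is nonzero on \<open>V\<close>, then by \<open>simple_corner\<close>
  its image is a line, the coordinate of \<open>e x\<close> on this line is a functional with
  coefficient \<open>F\<close>, and \<open>V\<close> is isomorphic to \<open>L\<close>. If
  \<open>e\<close> is zero on \<open>V\<close>, then \<open>V\<close> cannot be \<open>L\<close>, on
  which \<open>e\<close> is nonzero by \<open>Fe\<close>.\<close>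

lemma simple_corner_dim:
  assumes rel: "satisfies_relations G E \<rho>E V \<rho>" and simple: "simple_rep G V \<rho>"
    and L: "simple_rep G L \<tau>" "coefficient G L \<tau> F"
  shows "vdim (V\<lparr>carrier := lact V \<rho> e ` carrier V\<rparr>) = (if isomorphic_reps G V \<rho> L \<tau> then 1 else 0)"
proof -
  have V': "linear_rep G V \<rho>" using simple by (simp add: simple_rep_def)
  interpret V: lrep G V \<rho> using V' by (simp add: lrep_def)
  interpret L: lrep G L \<tau> using L by (simp add: lrep_def simple_rep_def)
  interpret Vv: vsp V by (rule V.vsp)
  let ?V = "lact V \<rho>"
  have sub: "VectorSpace.subspace class_ring (?V e ` carrier V) V"
    by (rule lhom_image_subsp[OF V.vsp V.vsp V.lact_hom[OF e] Vv.subsp_carrier])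
  interpret eV: vsp "V\<lparr>carrier := ?V e ` carrier V\<rparr>" by (rule Vv.subsp_vsp[OF sub])
  show ?thesis
  proof (cases "\<exists>x0\<in>carrier V. ?V e x0 \<noteq> \<zero>\<^bsub>V\<^esub>")
    case True
    then obtain x0 where x0: "x0 \<in> carrier V" "?V e x0 \<noteq> \<zero>\<^bsub>V\<^esub>" by auto
    define q where "q = ?V e x0"
    have q: "q \<in> carrier V" "q \<noteq> \<zero>\<^bsub>V\<^esub>" unfolding q_def using x0 V.lact_cl[OF e] by auto
    have corner: "?V e (?V a q) = lext F a \<odot>\<^bsub>V\<^esub> q" if "glist G a" for a
      unfolding q_def by (rule simple_corner[OF rel simple x0 that])
    have ex: "\<exists>c. ?V e x = c \<odot>\<^bsub>V\<^esub> q" if x: "x \<in> carrier V" for x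
    proof -
      obtain a where "glist G a" "?V a q = x" using V.simple_orbit[OF simple q x] by blast
      then show ?thesis using corner[of a] by (intro exI[of _ "lext F a"]) simp
    qed
    have uniq: "c = c'" if "c \<odot>\<^bsub>V\<^esub> q = c' \<odot>\<^bsub>V\<^esub> q" for c c'
    proof -
      have "(c - c') \<odot>\<^bsub>V\<^esub> q = c \<odot>\<^bsub>V\<^esub> q \<oplus>\<^bsub>V\<^esub> (- c') \<odot>\<^bsub>V\<^esub> q"
        using Vv.smult_left_distr[OF q(1), of c "-c'"] by simp
      also have "\<dots> = \<zero>\<^bsub>V\<^esub>" using that Vv.smult_minus_left[OF q(1)] Vv.smult_cl[OF q(1)] by (simp add: V.r_neg)
      finally show ?thesis using Vv.smult_eq_zeroD[OF q(1)] q(2) by fastforce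
    qed
    \<comment> \<open>The coordinate of \<open>e x\<close> on the line spanned by \<open>q\<close>;
      it is unique since \<open>q\<close> is nonzero.\<close>
    define \<xi> where "\<xi> x = (SOME c. ?V e x = c \<odot>\<^bsub>V\<^esub> q)" for x
    have \<xi>: "?V e x = \<xi> x \<odot>\<^bsub>V\<^esub> q" if "x \<in> carrier V" for x
      unfolding \<xi>_def by (rule someI_ex[OF ex[OF that]])
    have \<xi>_eq: "\<xi> x = c" if "x \<in> carrier V" "?V e x = c \<odot>\<^bsub>V\<^esub> q" for x c
      by (rule uniq) (use that \<xi> in simp)
    have lin: "functional V \<xi>" unfolding functional_def
    proof (intro conjI ballI allI)
      fix x y assume x: "x \<in> carrier V" and y: "y \<in> carrier V"
      show "\<xi> (x \<oplus>\<^bsub>V\<^esub> y) = \<xi> x + \<xi> y"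
        by (rule \<xi>_eq) (use x y q(1) in \<open>simp_all add: V.lact_add[OF e] \<xi>[OF x] \<xi>[OF y] Vv.smult_left_distr\<close>)
    next
      fix c x assume x: "x \<in> carrier V"
      show "\<xi> (c \<odot>\<^bsub>V\<^esub> x) = c * \<xi> x"
        by (rule \<xi>_eq) (use x q(1) in \<open>simp_all add: V.lact_smult[OF e] \<xi>[OF x] Vv.smult_ass Vv.smult_cl\<close>)
    qed
    have "\<xi> (\<rho> g q) = F g" if g: "g \<in> carrier G" for g
    proof (rule \<xi>_eq[OF V.act_cl[OF g q(1)]])
      show "?V e (\<rho> g q) = F g \<odot>\<^bsub>V\<^esub> q"
        using corner[of "[(1, g)]"] V.lact_single[OF g q(1)] g by simp
    qed
    then have "coefficient G V \<rho> F" unfolding coefficient_def using lin q(1) by blast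
    then have iso: "isomorphic_reps G V \<rho> L \<tau>" using iso_of_coefficient[OF simple L(1) _ L(2)] F1 by simp
    have "eV.dim = 1"
    proof (rule eV.dim_one)
      show "q \<in> carrier (V\<lparr>carrier := ?V e ` carrier V\<rparr>)" unfolding q_def using x0 by simp
      show "q \<noteq> \<zero>\<^bsub>V\<lparr>carrier := ?V e ` carrier V\<rparr>\<^esub>" using q by simp
      fix x assume "x \<in> carrier (V\<lparr>carrier := ?V e ` carrier V\<rparr>)"
      then obtain z where "z \<in> carrier V" "x = ?V e z" by auto
      then show "\<exists>c. x = c \<odot>\<^bsub>V\<lparr>carrier := ?V e ` carrier V\<rparr>\<^esub> q" using ex by simp
    qed
    then show ?thesis using iso by simp
  next
    case False
    \<comment> \<open>An isomorphism would make \<open>e\<close> kill the vector with coefficient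
      \<open>F\<close>, forcing \<open>lext F e = 0\<close> against \<open>Fe\<close>.\<close>
    have "\<not> isomorphic_reps G V \<rho> L \<tau>"
    proof
      assume "isomorphic_reps G V \<rho> L \<tau>"
      then obtain f where f: "f \<in> lhom V L" "bij_betw f (carrier V) (carrier L)"
        "\<And>g v. g \<in> carrier G \<Longrightarrow> v \<in> carrier V \<Longrightarrow> f (\<rho> g v) = \<tau> g (f v)"
        unfolding isomorphic_reps_def by blast
      obtain v \<xi> where v: "v \<in> carrier L" "functional L \<xi>" "\<And>g. g \<in> carrier G \<Longrightarrow> \<xi> (\<tau> g v) = F g"
        using L(2) unfolding coefficient_def by blast
      have "v \<in> f ` carrier V" using bij_betw_imp_surj_on[OF f(2)] v(1) by simp
      then obtain x where x: "x \<in> carrier V" "f x = v" by (elim imageE) simp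
      have "lact L \<tau> e v = f (?V e x)" using V.lact_equivariant[OF _ f(1,3) e x(1)] L.linear_rep_axioms x(2) by simp
      also have "\<dots> = \<zero>\<^bsub>L\<^esub>" using False x(1) lhom_zero[OF V.vsp L.vsp f(1)] by simp
      finally have "lext F e = 0"
        using L.functional_lact[OF v(2,1,3) e] vsp.functional_zero[OF L.vsp v(2)] by simp
      then show False using Fe by simp
    qed
    moreover have "?V e ` carrier V = {\<zero>\<^bsub>V\<^esub>}"
    proof (intro equalityI subsetI)
      fix x assume "x \<in> ?V e ` carrier V" then show "x \<in> {\<zero>\<^bsub>V\<^esub>}" using False by auto
    next
      fix x assume "x \<in> {\<zero>\<^bsub>V\<^esub>}" then show "x \<in> ?V e ` carrier V" using Vv.subspD(2)[OF sub] by simp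
    qed
    then have "eV.dim = 0" by (intro eV.dim_trivial) simp
    ultimately show ?thesis by simp
  qed
qed

text \<open>Exactness makes the dimension of \<open>e W\<close> additive over subrepresentations,
  and each simple factor contributes 1 or 0 according to \<open>simple_corner_dim\<close>. So this
  dimension is a counting function as required by \<open>composition_mult_eq\<close>.\<close>

theorem composition_mult_idempotent:
  assumes U: "linear_rep G U \<rho>" and fin: "fvsp U" and rel: "satisfies_relations G E \<rho>E U \<rho>"
    and L: "simple_rep G L \<tau>" "coefficient G L \<tau> F"
  shows "composition_mult G U \<rho> L \<tau> = vdim (U\<lparr>carrier := lact U \<rho> e ` carrier U\<rparr>)"
proof -
  interpret U: lrep G U \<rho> using U by (simp add: lrep_def)
  interpret Uv: fvsp U by (rule fin)
  have idem: "lact U \<rho> e (lact U \<rho> e x) = lact U \<rho> e x" if "x \<in> carrier U" for x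
    using relation_eq[OF rel U glist_lmul[OF E.grp e e] e _ that] e_idem
    by (simp add: E.lact_lmul[OF e e] U.lact_lmul[OF e e that])
  show ?thesis
  proof (rule U.composition_mult_eq[OF fin, where d="\<lambda>W. vdim (U\<lparr>carrier := lact U \<rho> e ` W\<rparr>)"])
    have z: "lact U \<rho> e ` {\<zero>\<^bsub>U\<^esub>} = {\<zero>\<^bsub>U\<^esub>}" using lhom_zero[OF U.vsp U.vsp U.lact_hom[OF e]] by simp
    show "vdim (U\<lparr>carrier := lact U \<rho> e ` {\<zero>\<^bsub>U\<^esub>}\<rparr>) = 0"
      unfolding z by (rule vsp.dim_trivial[OF Uv.subsp_vsp[OF Uv.subsp_zero]]) simp
  next
    fix A B assume AB: "subrep G U \<rho> A" "subrep G U \<rho> B" "A \<subseteq> B" "composition_factor G U \<rho> A B"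
    interpret sq: rep_subquot G U \<rho> A B by unfold_locales (use AB in auto)
    \<comment> \<open>A list acting as zero on \<open>U\<close> acts as zero on every subquotient,
      so the factors satisfy the same relations.\<close>
    have rQ: "satisfies_relations G E \<rho>E sq.sq.Q sq.qact"
      unfolding satisfies_relations_def
    proof (intro allI impI ballI)
      fix a x assume a: "glist G a" "\<forall>T\<in>carrier E. lact E \<rho>E a T = \<zero>\<^bsub>E\<^esub>" and "x \<in> carrier sq.sq.Q"
      then obtain y where y: "y \<in> B" "x = sq.sq.q y" unfolding sq.sq.Q_carr by auto
      have "lact U \<rho> a y = \<zero>\<^bsub>U\<^esub>" using rel a sq.sq.B_carr[OF y(1)] unfolding satisfies_relations_def by blast
      then have "lact sq.sq.Q sq.qact a x = sq.sq.q \<zero>\<^bsub>U\<^esub>" using sq.lact_q[OF a(1) y(1)] y(2) by simp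
      then show "lact sq.sq.Q sq.qact a x = \<zero>\<^bsub>sq.sq.Q\<^esub>" using Uv.coset_zero[OF sq.sq.A] sq.sq.Q_zero by simp
    qed
    show "vdim (U\<lparr>carrier := lact U \<rho> e ` B\<rparr>) = vdim (U\<lparr>carrier := lact U \<rho> e ` A\<rparr>) +
       (if factor_iso G U \<rho> L \<tau> A B then 1 else 0)"
      using sq.idempotent_dim[OF fin e idem] simple_corner_dim[OF rQ AB(4) L] by simp
  qed
qed

end

subsection \<open>Function spaces and adjoint maps\<close>

lemma coeff_space_simps [simp]:
  "carrier (coeff_space I) = {f. \<forall>x. x \<notin> I \<longrightarrow> f x = 0}" "\<zero>\<^bsub>coeff_space I\<^esub> = (\<lambda>_. 0)"
  "f \<oplus>\<^bsub>coeff_space I\<^esub> h = (\<lambda>x. f x + h x)" "c \<odot>\<^bsub>coeff_space I\<^esub> f = (\<lambda>x. c * f x)"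
  by (simp_all add: coeff_space_def)

lemma coeff_space_vsp: "vsp (coeff_space I)"
proof (rule vspI)
  fix v :: "'a \<Rightarrow> 'b" assume "v \<in> carrier (coeff_space I)"
  then show "\<exists>w\<in>carrier (coeff_space I). v \<oplus>\<^bsub>coeff_space I\<^esub> w = \<zero>\<^bsub>coeff_space I\<^esub>"
    by (intro bexI[of _ "\<lambda>x. - v x"]) auto
qed (auto simp: algebra_simps)

definition delta :: "'b \<Rightarrow> 'b \<Rightarrow> 'k::field" where
  "delta k = (\<lambda>x. if x = k then 1 else 0)"

lemma delta_in: "k \<in> I \<Longrightarrow> delta k \<in> carrier (coeff_space I)" by (auto simp: delta_def)

text \<open>Phrased with a subspace so that it serves as an induction principle: a linear condition
  on \<open>k^I\<close> need only be checked on the unit vectors.\<close>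

lemma coeff_space_subsp_deltas:
  fixes W :: "('b \<Rightarrow> 'k::field) set"
  assumes "finite I" "VectorSpace.subspace class_ring W (coeff_space I)" "\<And>k. k \<in> I \<Longrightarrow> delta k \<in> W"
  shows "carrier (coeff_space I) \<subseteq> W"
proof
  interpret C: vsp "coeff_space I" by (rule coeff_space_vsp)
  note D = C.subspD[OF assms(2)]
  have *: "\<forall>x. x \<notin> F \<longrightarrow> f x = 0 \<Longrightarrow> F \<subseteq> I \<Longrightarrow> f \<in> W" if "finite F" for F :: "'b set" and f :: "'b \<Rightarrow> 'k"
    using that
  proof (induction F arbitrary: f rule: finite_induct)
    case empty
    then have "f = (\<lambda>_. 0)" by auto
    then show ?case using D(2) by simp
  next
    case (insert k F)
    define h where "h = (\<lambda>x. if x = k then 0 else f x)"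
    have "h \<in> W" by (rule insert.IH) (use insert.prems in \<open>auto simp: h_def\<close>)
    moreover have "f k \<odot>\<^bsub>coeff_space I\<^esub> delta k \<in> W" using D(4) assms(3) insert.prems by blast
    ultimately have "h \<oplus>\<^bsub>coeff_space I\<^esub> (f k \<odot>\<^bsub>coeff_space I\<^esub> delta k) \<in> W" by (rule D(3))
    moreover have "h \<oplus>\<^bsub>coeff_space I\<^esub> (f k \<odot>\<^bsub>coeff_space I\<^esub> delta k) = f" by (auto simp: h_def delta_def)
    ultimately show ?case by simp
  qed
  fix f :: "'b \<Rightarrow> 'k" assume "f \<in> carrier (coeff_space I)"
  then show "f \<in> W" using *[OF assms(1), of f] by simp
qed

lemma coeff_space_fin:
  assumes "finite I"
  shows "fvsp (coeff_space I :: ('k::field, 'b \<Rightarrow> 'k) module)" "vdim (coeff_space I :: ('k::field, 'b \<Rightarrow> 'k) module) \<le> card I"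
proof -
  interpret C: vsp "coeff_space I :: ('k, 'b \<Rightarrow> 'k) module" by (rule coeff_space_vsp)
  let ?D = "delta ` I :: ('b \<Rightarrow> 'k) set"
  have D: "?D \<subseteq> carrier (coeff_space I)" by (rule image_subsetI) (rule delta_in)
  have s: "VectorSpace.subspace class_ring (C.span ?D) (coeff_space I)" by (rule C.span_is_subspace[OF D])
  have "delta k \<in> C.span ?D" if "k \<in> I" for k
    by (rule C.span_mem[OF D]) (rule imageI[OF that])
  then have "carrier (coeff_space I) \<subseteq> C.span ?D"
    by (rule coeff_space_subsp_deltas[OF assms s])
  then have gen: "C.gen_set ?D" by (rule equalityI[OF C.subspD(1)[OF s]])
  have f: "finite ?D" using assms by simp
  show fd: "fvsp (coeff_space I :: ('k, 'b \<Rightarrow> 'k) module)"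
  proof (intro_locales)
    show "fvsp_axioms (coeff_space I :: ('k, 'b \<Rightarrow> 'k) module)"
      unfolding fvsp_axioms_def C.fin_dim_def by (intro exI[of _ ?D] conjI f D gen)
  qed
  have "C.dim \<le> card ?D" using C.gen_ge_dim[OF f D gen] .
  also have "\<dots> \<le> card I" by (rule card_image_le[OF assms])
  finally show "C.dim \<le> card I" .
qed

text \<open>The inverse of \<open>f\<close> on its image is linear and onto \<open>V\<close>, so
  finite dimension passes from the image back to \<open>V\<close>.\<close>

lemma lhom_inj_fin:
  assumes "vsp V" "fvsp W" "f \<in> lhom V W" "inj_on f (carrier V)"
  shows "fvsp V" "vdim V \<le> vdim W"
proof -
  interpret V: vsp V by fact
  interpret W: fvsp W by fact
  have s: "VectorSpace.subspace class_ring (f ` carrier V) W"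
    by (rule lhom_image_subsp[OF assms(1) W.vsp_axioms assms(3) V.subsp_carrier])
  interpret f: fvsp "W\<lparr>carrier := f ` carrier V\<rparr>" by (rule W.subsp_fin[OF s])
  define h where "h = the_inv_into (carrier V) f"
  have h: "h (f x) = x" if "x \<in> carrier V" for x
    unfolding h_def by (rule the_inv_into_f_f[OF assms(4) that])
  have hom: "h \<in> lhom (W\<lparr>carrier := f ` carrier V\<rparr>) V"
  proof (rule lhomI)
    fix x y c assume "x \<in> carrier (W\<lparr>carrier := f ` carrier V\<rparr>)"
    then obtain a where a: "a \<in> carrier V" "x = f a" by auto
    show "h x \<in> carrier V" using a h by simp
    show "h (c \<odot>\<^bsub>W\<lparr>carrier := f ` carrier V\<rparr>\<^esub> x) = c \<odot>\<^bsub>V\<^esub> h x"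
      using a h[OF a(1)] h[OF V.smult_cl[OF a(1), of c]] lhomD(3)[OF assms(3) a(1)] by simp
    assume "y \<in> carrier (W\<lparr>carrier := f ` carrier V\<rparr>)"
    then obtain b where b: "b \<in> carrier V" "y = f b" by auto
    show "h (x \<oplus>\<^bsub>W\<lparr>carrier := f ` carrier V\<rparr>\<^esub> y) = h x \<oplus>\<^bsub>V\<^esub> h y"
      using a b h[OF a(1)] h[OF b(1)] h[OF V.a_closed[OF a(1) b(1)]] lhomD(2)[OF assms(3) a(1) b(1)] by simp
  qed
  have surj: "h ` carrier (W\<lparr>carrier := f ` carrier V\<rparr>) = carrier V"
    using h by (simp add: image_image)
  show fin: "fvsp V" by (rule lhom_surj_fin[OF f.fvsp_axioms assms(1) hom surj])
  have "vdim V = vdim (W\<lparr>carrier := f ` carrier V\<rparr>)"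
    by (rule lhom_bij_dim[OF fin f.vsp_axioms lhom_restrict[of f V W "carrier V" "f ` carrier V", simplified]])
      (use assms in \<open>auto simp: bij_betw_def\<close>)
  then show "vdim V \<le> vdim W" using W.subsp_dim_le[OF s] by simp
qed

text \<open>Pairing with preimages of a basis of the image of \<open>T'\<close> gives coordinates on
  the image of \<open>T\<close>. They are injective: if they vanish on \<open>T v\<close>, then
  \<open>BV v\<close> vanishes on the whole image of \<open>T'\<close>, so \<open>T v\<close> pairs
  to zero with all of \<open>W\<close> and is zero by nondegeneracy. Equality of ranks follows by
  applying the bound to both maps.\<close>

lemma adjoint_rank_le:
  assumes V: "vsp V" and W: "fvsp W" and V': "fvsp V" and T: "T \<in> lhom V W" and T': "T' \<in> lhom W V"
    and adj: "\<And>v w. v \<in> carrier V \<Longrightarrow> w \<in> carrier W \<Longrightarrow> BW (T v) w = BV v (T' w)"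
    and BV: "\<And>v. v \<in> carrier V \<Longrightarrow> functional V (BV v)"
    and BW: "\<And>w. w \<in> carrier W \<Longrightarrow> functional W (\<lambda>z. BW z w)"
    and nondeg: "\<And>z. z \<in> carrier W \<Longrightarrow> (\<And>w. w \<in> carrier W \<Longrightarrow> BW z w = 0) \<Longrightarrow> z = \<zero>\<^bsub>W\<^esub>"
  shows "vdim (W\<lparr>carrier := T ` carrier V\<rparr>) \<le> vdim (V\<lparr>carrier := T' ` carrier W\<rparr>)"
proof -
  interpret V: fvsp V by fact
  interpret W: fvsp W by fact
  have sX: "VectorSpace.subspace class_ring (T' ` carrier W) V"
    by (rule lhom_image_subsp[OF W.vsp_axioms V T' W.subsp_carrier])
  have sY: "VectorSpace.subspace class_ring (T ` carrier V) W"
    by (rule lhom_image_subsp[OF V W.vsp_axioms T V.subsp_carrier])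
  interpret X: fvsp "V\<lparr>carrier := T' ` carrier W\<rparr>" by (rule V.subsp_fin[OF sX])
  interpret Y: fvsp "W\<lparr>carrier := T ` carrier V\<rparr>" by (rule W.subsp_fin[OF sY])
  obtain B where B: "finite B" "X.basis B" using X.finite_basis_exists[OF X.fin] by auto
  then have BX: "B \<subseteq> T' ` carrier W" "X.gen_set B" by (auto simp: X.basis_def)
  define wb where "wb b = (SOME w. w \<in> carrier W \<and> T' w = b)" for b
  have wb: "wb b \<in> carrier W" "T' (wb b) = b" if "b \<in> B" for b
  proof -
    have "\<exists>w. w \<in> carrier W \<and> T' w = b" using BX(1) that by auto
    from someI_ex[OF this] show "wb b \<in> carrier W" "T' (wb b) = b" unfolding wb_def by auto
  qed
  define \<Phi> where "\<Phi> z = (\<lambda>b. if b \<in> B then BW z (wb b) else 0)" for z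
  have YW: "T ` carrier V \<subseteq> carrier W" using W.subspD(1)[OF sY] .
  have hom: "\<Phi> \<in> lhom (W\<lparr>carrier := T ` carrier V\<rparr>) (coeff_space B)"
  proof (rule lhomI)
    fix x y c assume "x \<in> carrier (W\<lparr>carrier := T ` carrier V\<rparr>)"
    then have x: "x \<in> carrier W" using YW by auto
    show "\<Phi> x \<in> carrier (coeff_space B)" by (simp add: \<Phi>_def)
    show "\<Phi> (c \<odot>\<^bsub>W\<lparr>carrier := T ` carrier V\<rparr>\<^esub> x) = c \<odot>\<^bsub>coeff_space B\<^esub> \<Phi> x"
      using BW[OF wb(1)] x by (auto simp: \<Phi>_def functional_def)
    assume "y \<in> carrier (W\<lparr>carrier := T ` carrier V\<rparr>)"
    then have y: "y \<in> carrier W" using YW by auto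
    show "\<Phi> (x \<oplus>\<^bsub>W\<lparr>carrier := T ` carrier V\<rparr>\<^esub> y) = \<Phi> x \<oplus>\<^bsub>coeff_space B\<^esub> \<Phi> y"
      using BW[OF wb(1)] x y by (auto simp: \<Phi>_def functional_def)
  qed
  have inj: "inj_on \<Phi> (carrier (W\<lparr>carrier := T ` carrier V\<rparr>))"
  proof (rule lhom_inj[OF Y.vsp_axioms coeff_space_vsp hom])
    fix z assume "z \<in> carrier (W\<lparr>carrier := T ` carrier V\<rparr>)" and z0: "\<Phi> z = \<zero>\<^bsub>coeff_space B\<^esub>"
    then obtain v where v: "v \<in> carrier V" "z = T v" by auto
    let ?K = "{y \<in> carrier V. BV v y = 0}"
    have sK: "VectorSpace.subspace class_ring ?K V"
      unfolding V.subsp_iff using BV[OF v(1)] V.functional_zero[OF BV[OF v(1)]] unfolding functional_def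
      by (intro conjI ballI allI subsetI) simp_all
    have "B \<subseteq> ?K"
    proof
      fix b assume b: "b \<in> B"
      have "\<Phi> z b = 0" using z0 by simp
      then have "BW (T v) (wb b) = 0" using b v by (simp add: \<Phi>_def)
      then have "BV v b = 0" using adj[OF v(1) wb(1)[OF b]] wb(2)[OF b] by simp
      moreover have "b \<in> carrier V" using b BX(1) V.subspD(1)[OF sX] by blast
      ultimately show "b \<in> ?K" by simp
    qed
    then have "V.span B \<subseteq> ?K" by (rule V.span_is_subset) (rule V.is_module[OF sK])
    moreover have "V.span B = T' ` carrier W" using V.subsp_li(2)[OF sX BX(1)] BX(2) by simp
    ultimately have *: "BV v (T' w) = 0" if "w \<in> carrier W" for w using that by blast
    have "z = \<zero>\<^bsub>W\<^esub>"
      by (rule nondeg) (use v adj[OF v(1)] * lhomD(1)[OF T v(1)] in simp_all)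
    then show "z = \<zero>\<^bsub>W\<lparr>carrier := T ` carrier V\<rparr>\<^esub>" by simp
  qed
  have "vdim (W\<lparr>carrier := T ` carrier V\<rparr>) \<le> card B"
    using lhom_inj_fin(2)[OF Y.vsp_axioms coeff_space_fin(1)[OF B(1)] hom inj] coeff_space_fin(2)[OF B(1)]
    by (rule order_trans)
  also have "card B = vdim (V\<lparr>carrier := T' ` carrier W\<rparr>)" using X.dim_basis[OF B] by simp
  finally show ?thesis .
qed

subsection \<open>The bar complex\<close>

lemma bar_simps [simp]:
  "carrier (bar_space G V n) = {f. (\<forall>gs\<in>tuples G n. f gs \<in> carrier V) \<and> (\<forall>gs. gs \<notin> tuples G n \<longrightarrow> f gs = \<zero>\<^bsub>V\<^esub>)}"
  "\<zero>\<^bsub>bar_space G V n\<^esub> = (\<lambda>_. \<zero>\<^bsub>V\<^esub>)"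
  "f \<oplus>\<^bsub>bar_space G V n\<^esub> h = (\<lambda>gs. f gs \<oplus>\<^bsub>V\<^esub> h gs)"
  "c \<odot>\<^bsub>bar_space G V n\<^esub> f = (\<lambda>gs. c \<odot>\<^bsub>V\<^esub> f gs)"
  by (simp_all add: bar_space_def)

lemma bar_mem: "vsp V \<Longrightarrow> f \<in> carrier (bar_space G V n) \<Longrightarrow> f gs \<in> carrier V"
  using vsp.subspD(2)[OF _ vsp.subsp_carrier] by (cases "gs \<in> tuples G n") (auto)

lemma bar_vsp: assumes "vsp V" shows "vsp (bar_space G V n)"
proof -
  interpret V: vsp V by fact
  note m = bar_mem[OF assms]
  show ?thesis
  proof (rule vspI)
    fix v assume v: "v \<in> carrier (bar_space G V n)"
    show "\<exists>w\<in>carrier (bar_space G V n). v \<oplus>\<^bsub>bar_space G V n\<^esub> w = \<zero>\<^bsub>bar_space G V n\<^esub>"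
      by (intro bexI[of _ "\<lambda>gs. (-1) \<odot>\<^bsub>V\<^esub> v gs"])
        (use v in \<open>auto simp: V.smult_neg1 V.r_neg m[OF v]\<close>)
  next
    fix a b v assume v: "v \<in> carrier (bar_space G V n)"
    show "(a * b) \<odot>\<^bsub>bar_space G V n\<^esub> v = a \<odot>\<^bsub>bar_space G V n\<^esub> (b \<odot>\<^bsub>bar_space G V n\<^esub> v)"
      using m[OF v] by (simp add: V.smult_ass)
    show "(a + b) \<odot>\<^bsub>bar_space G V n\<^esub> v = a \<odot>\<^bsub>bar_space G V n\<^esub> v \<oplus>\<^bsub>bar_space G V n\<^esub> b \<odot>\<^bsub>bar_space G V n\<^esub> v"
      using m[OF v] by (simp add: V.smult_left_distr)
    show "1 \<odot>\<^bsub>bar_space G V n\<^esub> v = v" using m[OF v] by simp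
    show "v \<oplus>\<^bsub>bar_space G V n\<^esub> \<zero>\<^bsub>bar_space G V n\<^esub> = v" using m[OF v] by simp
    fix w assume w: "w \<in> carrier (bar_space G V n)"
    show "v \<oplus>\<^bsub>bar_space G V n\<^esub> w = w \<oplus>\<^bsub>bar_space G V n\<^esub> v" using m[OF v] m[OF w] by (simp add: V.a_comm)
    show "a \<odot>\<^bsub>bar_space G V n\<^esub> (v \<oplus>\<^bsub>bar_space G V n\<^esub> w) = a \<odot>\<^bsub>bar_space G V n\<^esub> v \<oplus>\<^bsub>bar_space G V n\<^esub> a \<odot>\<^bsub>bar_space G V n\<^esub> w"
      using m[OF v] m[OF w] by (simp add: V.smult_right_distr)
    fix x assume x: "x \<in> carrier (bar_space G V n)"
    show "v \<oplus>\<^bsub>bar_space G V n\<^esub> w \<oplus>\<^bsub>bar_space G V n\<^esub> x = v \<oplus>\<^bsub>bar_space G V n\<^esub> (w \<oplus>\<^bsub>bar_space G V n\<^esub> x)"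
      using m[OF v] m[OF w] m[OF x] by (simp add: V.a_assoc)
  qed auto
qed

lemma bar_map_hom:
  assumes "vsp V" "vsp W" "\<phi> \<in> lhom V W"
  shows "(\<lambda>c gs. \<phi> (c gs)) \<in> lhom (bar_space G V n) (bar_space G W n)"
proof (rule lhomI)
  fix x y c assume x: "x \<in> carrier (bar_space G V n)"
  note mx = bar_mem[OF assms(1) x]
  show "(\<lambda>gs. \<phi> (x gs)) \<in> carrier (bar_space G W n)"
    using x lhom_zero[OF assms] lhomD(1)[OF assms(3) mx] by simp
  show "(\<lambda>gs. \<phi> ((c \<odot>\<^bsub>bar_space G V n\<^esub> x) gs)) = c \<odot>\<^bsub>bar_space G W n\<^esub> (\<lambda>gs. \<phi> (x gs))"
    using lhomD(3)[OF assms(3) mx] by simp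
  assume y: "y \<in> carrier (bar_space G V n)"
  show "(\<lambda>gs. \<phi> ((x \<oplus>\<^bsub>bar_space G V n\<^esub> y) gs)) = (\<lambda>gs. \<phi> (x gs)) \<oplus>\<^bsub>bar_space G W n\<^esub> (\<lambda>gs. \<phi> (y gs))"
    using lhomD(2)[OF assms(3) mx bar_mem[OF assms(1) y]] by simp
qed

lemma finite_tuples: "finite (carrier G) \<Longrightarrow> finite (tuples G n)"
  unfolding tuples_def by (rule finite_lists_length_eq)

lemma (in group) bar_face_tuples:
  assumes "gs \<in> tuples G (Suc n)" "j \<le> Suc n"
  shows "bar_face G j gs \<in> tuples G n"
proof -
  have gs: "set gs \<subseteq> carrier G" "length gs = Suc n" using assms by (auto simp: tuples_def)
  consider "j = 0" | "j = Suc n" | "0 < j" "j < Suc n" using assms(2) by linarith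
  then show ?thesis
  proof cases
    case 1 then show ?thesis using gs by (cases gs) (auto simp: bar_face_def tuples_def)
  next
    case 2 then show ?thesis using gs by (auto simp: bar_face_def tuples_def dest: in_set_butlastD)
  next
    case 3
    have "gs ! (j - 1) \<in> carrier G" "gs ! j \<in> carrier G" using gs 3 nth_mem[of "j - 1" gs] nth_mem[of j gs] by auto
    then show ?thesis using gs 3 by (auto simp: bar_face_def tuples_def dest: in_set_takeD in_set_dropD)
  qed
qed

declare bar_simps(1) [simp del]

subsection \<open>Faces of the bar construction\<close>

lemma bar_face_0: "bar_face G 0 gs = tl gs" by (simp add: bar_face_def)

lemma bar_face_Suc_0: "bar_face G (Suc 0) (g # h # gs) = (g \<otimes>\<^bsub>G\<^esub> h) # gs"
  by (simp add: bar_face_def)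

lemma bar_face_Suc_0_single: "bar_face G (Suc 0) [g] = []"
  by (simp add: bar_face_def)

lemma bar_face_Suc_Suc:
  assumes "Suc j \<le> length gs"
  shows "bar_face G (Suc (Suc j)) (g # gs) = g # bar_face G (Suc j) gs"
proof (cases "Suc j = length gs")
  case True
  then have "gs \<noteq> []" by auto
  then show ?thesis using True by (simp add: bar_face_def)
next
  case False
  then show ?thesis using assms by (simp add: bar_face_def)
qed

lemma length_bar_face: "gs \<noteq> [] \<Longrightarrow> j \<le> length gs \<Longrightarrow> length (bar_face G j gs) = length gs - 1"
  by (auto simp: bar_face_def)

text \<open>The simplicial identity. Peeling off the common first entry reduces the general case to
  faces that touch the beginning of the list.\<close>

lemma (in group) bar_face_bar_face:
  "set gs \<subseteq> carrier G \<Longrightarrow> i < j \<Longrightarrow> j \<le> length gs \<Longrightarrow>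
   bar_face G i (bar_face G j gs) = bar_face G (j - 1) (bar_face G i gs)"
proof (induction gs arbitrary: i j)
  case Nil then show ?case by simp
next
  case (Cons g gs)
  obtain j' where j: "j = Suc j'" using Cons.prems by (cases j) auto
  show ?case
  proof (cases i)
    case 0
    show ?thesis
    proof (cases j')
      case 0
      then show ?thesis using \<open>i = 0\<close> j by (cases gs) (simp_all add: bar_face_0 bar_face_Suc_0 bar_face_Suc_0_single)
    next
      case (Suc k)
      then show ?thesis using \<open>i = 0\<close> j Cons.prems by (simp add: bar_face_0 bar_face_Suc_Suc)
    qed
  next
    case (Suc i')
    obtain k where k: "j' = Suc k" using Cons.prems j Suc by (cases j') auto
    have len: "Suc k \<le> length gs" using Cons.prems j k by simp
    have L: "bar_face G j (g # gs) = g # bar_face G (Suc k) gs"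
      unfolding j k by (rule bar_face_Suc_Suc[OF len])
    show ?thesis
    proof (cases i')
      case 0
      obtain h r where gs: "gs = h # r" using len by (cases gs) auto
      show ?thesis
      proof (cases k)
        case 0
        show ?thesis
        proof (cases r)
          case Nil then show ?thesis unfolding L using gs j k 0 Suc \<open>i' = 0\<close> by (simp add: bar_face_Suc_0_single bar_face_Suc_0)
        next
          \<comment> \<open>The one place where associativity is used: both sides merge the first
            three entries.\<close>
          case (Cons m s)
          then show ?thesis unfolding L using gs j k 0 Suc \<open>i' = 0\<close> Cons.prems(1) \<open>i = Suc i'\<close> Cons
            using \<open>set (g # gs) \<subseteq> carrier G\<close> by (simp add: bar_face_Suc_0 m_assoc)
        qed
      next
        case (Suc k')
        have len': "Suc k' \<le> length r" using len gs Suc by simp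
        show ?thesis unfolding L using gs j k Suc \<open>i = Suc i'\<close> \<open>i' = 0\<close> len'
          by (simp add: bar_face_Suc_Suc bar_face_Suc_0)
      qed
    next
      case (Suc i'')
      have ik: "i' < Suc k" using Cons.prems \<open>i = Suc i'\<close> j k by simp
      obtain k' where k': "k = Suc k'" using ik Suc by (cases k) auto
      have ne: "gs \<noteq> []" using len by auto
      have l1: "Suc i'' \<le> length (bar_face G (Suc k) gs)" using length_bar_face[OF ne len, of G] ik Suc len by simp
      have l2: "Suc i'' \<le> length gs" using ik Suc len by simp
      have l3: "Suc k' \<le> length (bar_face G (Suc i'') gs)" using length_bar_face[OF ne l2, of G] len k' by simp
      have IH: "bar_face G (Suc i'') (bar_face G (Suc k) gs) = bar_face G (Suc k') (bar_face G (Suc i'') gs)"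
        using Cons.IH[of "Suc i''" "Suc k"] Cons.prems(1) ik Suc len k' by simp
      show ?thesis unfolding L using \<open>i = Suc i'\<close> Suc j k k' IH
        by (simp add: bar_face_Suc_Suc[OF l1[unfolded k']] bar_face_Suc_Suc[OF l2] bar_face_Suc_Suc[OF l3])
    qed
  qed
qed

text \<open>The pairs (j, i) with i < j are matched with (i, j - 1). The hypothesis identifies the
  matched terms and their exponents differ by one, so they cancel.\<close>

lemma alternating_double_sum:
  fixes D :: "nat \<Rightarrow> nat \<Rightarrow> 'k::comm_ring_1"
  assumes "\<And>i j. i < j \<Longrightarrow> j \<le> Suc N \<Longrightarrow> D i j = D (j - 1) i"
  shows "(\<Sum>j\<le>Suc N. \<Sum>i\<le>N. (-1) ^ j * ((-1) ^ i * D i j)) = 0"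
proof -
  let ?f = "\<lambda>(j, i). (-1) ^ j * ((-1) ^ i * D i j)"
  let ?A = "{(j, i). j \<le> Suc N \<and> i \<le> N \<and> i < j}" and ?B = "{(j, i). j \<le> Suc N \<and> i \<le> N \<and> j \<le> i}"
  have fin: "finite ?A" "finite ?B"
    by (rule finite_subset[of _ "{..Suc N} \<times> {..N}"]; auto)+
  have "(\<Sum>j\<le>Suc N. \<Sum>i\<le>N. (-1) ^ j * ((-1) ^ i * D i j)) = sum ?f ({..Suc N} \<times> {..N})"
    by (simp add: sum.cartesian_product)
  also have "{..Suc N} \<times> {..N} = ?A \<union> ?B" by auto
  also have "sum ?f (?A \<union> ?B) = sum ?f ?A + sum ?f ?B"
    by (rule sum.union_disjoint) (use fin in auto)
  also have "sum ?f ?A = (\<Sum>x\<in>?B. - ?f x)"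
  proof (rule sum.reindex_bij_witness[of _ "\<lambda>(j, i). (Suc i, j)" "\<lambda>(j, i). (i, j - 1)"])
    fix a assume "a \<in> ?A"
    then obtain j i where a: "a = (j, i)" "j \<le> Suc N" "i \<le> N" "i < j" by auto
    obtain k where k: "j = Suc k" using a by (cases j) auto
    show "- ?f ((\<lambda>(j, i). (i, j - 1)) a) = ?f a"
      using a k assms[of i j] by (simp add: algebra_simps)
  qed auto
  finally show ?thesis by (simp add: sum_negf)
qed

lemma sum_atMost_split: "(\<Sum>j\<le>Suc n. f j) = f 0 + (\<Sum>j\<in>{1..Suc n}. f j)" for f :: "nat \<Rightarrow> 'a::comm_monoid_add"
proof -
  have "{..Suc n} = insert 0 {1..Suc n}" by auto
  then have "(\<Sum>j\<le>Suc n. f j) = sum f (insert 0 {1..Suc n})" by (rule arg_cong)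
  also have "\<dots> = f 0 + (\<Sum>j\<in>{1..Suc n}. f j)" by (rule sum.insert) auto
  finally show ?thesis .
qed

subsection \<open>Homology and cohomology with a nondegenerate invariant form\<close>

text \<open>\<open>Y\<close> may be a proper subspace of \<open>k^I\<close> with the standard form
  restricted to it, so that tensor space, \<open>M^\<lambda>\<close> and the Young modules are all
  instances. A restricted form can degenerate, so nondegeneracy is an assumption of its own.\<close>

locale form_rep = lrep G V \<rho>
  for G :: "('g, 'c) monoid_scheme" and V :: "('k::field, 'b \<Rightarrow> 'k) module" and \<rho> +
  fixes I :: "'b set" and Y :: "('b \<Rightarrow> 'k) set"
  assumes finG: "finite (carrier G)" and finI: "finite I"
    and V_eq: "V = (coeff_space I)\<lparr>carrier := Y\<rparr>"
    and subY: "VectorSpace.subspace class_ring Y (coeff_space I)"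
    and invariant: "g \<in> carrier G \<Longrightarrow> u \<in> Y \<Longrightarrow> v \<in> Y \<Longrightarrow>
      (\<Sum>x\<in>I. \<rho> g u x * \<rho> g v x) = (\<Sum>x\<in>I. u x * v x)"
    and nondegenerate: "u \<in> Y \<Longrightarrow> (\<And>v. v \<in> Y \<Longrightarrow> (\<Sum>x\<in>I. u x * v x) = 0) \<Longrightarrow> u = (\<lambda>_. 0)"
begin

lemma V_simps [simp]: "carrier V = Y" "\<zero>\<^bsub>V\<^esub> = (\<lambda>_. 0)" "f \<oplus>\<^bsub>V\<^esub> h = (\<lambda>x. f x + h x)" "c \<odot>\<^bsub>V\<^esub> f = (\<lambda>x. c * f x)"
  by (simp_all add: V_eq)

lemma Y_closed: "u \<in> Y \<Longrightarrow> v \<in> Y \<Longrightarrow> (\<lambda>x. u x + v x) \<in> Y" "u \<in> Y \<Longrightarrow> (\<lambda>x. c * u x) \<in> Y" "(\<lambda>_. 0) \<in> Y"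
  using vsp.subspD(2,3,4)[OF coeff_space_vsp subY] by simp_all

lemma Y_off: "u \<in> Y \<Longrightarrow> x \<notin> I \<Longrightarrow> u x = 0"
  using vsp.subspD(1)[OF coeff_space_vsp subY] by auto

lemma finsum_apply: "f \<in> A \<rightarrow> Y \<Longrightarrow> finsum V f A = (\<lambda>x. \<Sum>a\<in>A. f a x)"
proof (induction A rule: infinite_finite_induct)
  case (insert a A)
  interpret V: vsp V by (rule vsp)
  show ?case using insert by (subst finsum_insert) auto
qed simp_all

lemma Y_sum: "(\<And>a. a \<in> A \<Longrightarrow> f a \<in> Y) \<Longrightarrow> (\<lambda>x. \<Sum>a\<in>A. f a x) \<in> Y"
  using finsum_apply[of f A] finsum_closed[of f A] by (simp add: Pi_iff)

lemma act_Y: "g \<in> carrier G \<Longrightarrow> u \<in> Y \<Longrightarrow> \<rho> g u \<in> Y" using act_cl by simp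

lemma act_lin: "g \<in> carrier G \<Longrightarrow> u \<in> Y \<Longrightarrow> v \<in> Y \<Longrightarrow> \<rho> g (\<lambda>x. u x + v x) = (\<lambda>x. \<rho> g u x + \<rho> g v x)"
  "g \<in> carrier G \<Longrightarrow> u \<in> Y \<Longrightarrow> \<rho> g (\<lambda>x. c * u x) = (\<lambda>x. c * \<rho> g u x)"
  using lhomD(2,3)[OF act_hom, of g u] by simp_all

lemma act_sum: "g \<in> carrier G \<Longrightarrow> (\<And>a. a \<in> A \<Longrightarrow> f a \<in> Y) \<Longrightarrow> \<rho> g (\<lambda>x. \<Sum>a\<in>A. f a x) = (\<lambda>x. \<Sum>a\<in>A. \<rho> g (f a) x)"
  using lhom_finsum[OF vsp vsp act_hom, of g f A] finsum_apply[of f A] finsum_apply[of "\<lambda>a. \<rho> g (f a)" A]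
  by (simp add: Pi_iff act_Y)

abbreviation "C n \<equiv> bar_space G V n"
abbreviation "T n \<equiv> tuples G n"
abbreviation "\<delta> n \<equiv> coboundary G V \<rho> n"
abbreviation "bd n \<equiv> boundary G V \<rho> n"

lemma C_iff: "f \<in> carrier (C n) \<longleftrightarrow> (\<forall>gs\<in>T n. f gs \<in> Y) \<and> (\<forall>gs. gs \<notin> T n \<longrightarrow> f gs = (\<lambda>_. 0))"
  by (simp add: bar_simps(1))

lemma C_Y: "f \<in> carrier (C n) \<Longrightarrow> f gs \<in> Y" using bar_mem[OF vsp, of f] by simp

lemma C_vsp: "vsp (C n)" by (rule bar_vsp[OF vsp])

lemma T_face: "gs \<in> T (Suc n) \<Longrightarrow> j \<le> Suc n \<Longrightarrow> bar_face G j gs \<in> T n"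
  by (rule group.bar_face_tuples[OF grp])

lemma finT: "finite (T n)" by (rule finite_tuples[OF finG])

lemma T_ends: "gs \<in> T (Suc n) \<Longrightarrow> hd gs \<in> carrier G" "gs \<in> T (Suc n) \<Longrightarrow> last gs \<in> carrier G"
  unfolding tuples_def by (cases gs; simp) (cases gs rule: rev_cases; simp)

text \<open>A cochain is determined by finitely many scalars, one for each tuple and each index in
  \<open>I\<close>.\<close>

lemma C_fin: "fvsp (C n)"
proof (rule lhom_inj_fin(1)[OF C_vsp coeff_space_fin(1)[of "T n \<times> I"]])
  show "finite (T n \<times> I)" using finT finI by simp
  show hom: "(\<lambda>f (gs, x). f gs x) \<in> lhom (C n) (coeff_space (T n \<times> I))"
  proof (rule lhomI)
    fix f :: "'g list \<Rightarrow> 'b \<Rightarrow> 'k" assume f: "f \<in> carrier (C n)"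
    have "f gs x = 0" if "(gs, x) \<notin> T n \<times> I" for gs x
      using that f Y_off[OF C_Y[OF f]] by (cases "gs \<in> T n") (auto simp: C_iff)
    then show "(\<lambda>(gs, x). f gs x) \<in> carrier (coeff_space (T n \<times> I))" by auto
  qed (simp_all add: split_def)
  show "inj_on (\<lambda>f (gs, x). f gs x) (carrier (C n))"
  proof (rule inj_onI)
    fix f h :: "'g list \<Rightarrow> 'b \<Rightarrow> 'k" assume eq: "(\<lambda>(gs, x). f gs x) = (\<lambda>(gs, x). h gs x)"
    show "f = h" using fun_cong[OF eq, of "(gs, x)" for gs x] by (intro ext) simp
  qed
qed

text \<open>The summands of the coboundary without their signs. Giving the term with the group
  action the index 0 makes all terms uniform, as the double sum argument requires.\<close>

definition ct :: "('g list \<Rightarrow> 'b \<Rightarrow> 'k) \<Rightarrow> 'g list \<Rightarrow> nat \<Rightarrow> 'b \<Rightarrow> 'k" where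
  "ct f gs j = (if j = 0 then \<rho> (hd gs) (f (bar_face G 0 gs)) else f (bar_face G j gs))"

lemma ct_Y: "f \<in> carrier (C n) \<Longrightarrow> gs \<in> T (Suc m) \<Longrightarrow> ct f gs j \<in> Y"
  unfolding ct_def using C_Y act_Y T_ends by simp

lemma coboundary_apply:
  assumes f: "f \<in> carrier (C n)" and gs: "gs \<in> T (Suc n)"
  shows "\<delta> n f gs = (\<lambda>x. \<Sum>j\<le>Suc n. (-1) ^ j * ct f gs j x)"
proof -
  have "(\<lambda>j. (- 1) ^ j \<odot>\<^bsub>V\<^esub> f (bar_face G j gs)) \<in> {1..Suc n} \<rightarrow> Y"
    using C_Y[OF f] Y_closed(2) by simp
  then have "\<delta> n f gs = (\<lambda>x. \<rho> (hd gs) (f (bar_face G 0 gs)) x + (\<Sum>j\<in>{1..Suc n}. (-1) ^ j * f (bar_face G j gs) x))"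
    unfolding coboundary_def by (simp only: gs if_True finsum_apply V_simps)
  also have "\<dots> = (\<lambda>x. \<Sum>j\<le>Suc n. (-1) ^ j * ct f gs j x)"
    unfolding sum_atMost_split by (intro ext arg_cong2[where f="(+)"] sum.cong refl) (simp_all add: ct_def)
  finally show ?thesis .
qed

lemma coboundary_off: "gs \<notin> T (Suc n) \<Longrightarrow> \<delta> n f gs = (\<lambda>_. 0)"
  unfolding coboundary_def by simp

lemma coboundary_C: "f \<in> carrier (C n) \<Longrightarrow> \<delta> n f \<in> carrier (C (Suc n))"
  unfolding C_iff[of _ "Suc n"]
  by (intro conjI ballI allI impI coboundary_off, simp only: coboundary_apply, intro Y_sum Y_closed ct_Y)

lemma coboundary_hom: "\<delta> n \<in> lhom (C n) (C (Suc n))"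
proof (rule lhomI)
  fix f h c assume f: "f \<in> carrier (C n)"
  show "\<delta> n f \<in> carrier (C (Suc n))" by (rule coboundary_C[OF f])
  have cf: "c \<odot>\<^bsub>C n\<^esub> f \<in> carrier (C n)" using vsp.smult_cl[OF C_vsp f] .
  have "ct (c \<odot>\<^bsub>C n\<^esub> f) gs j = (\<lambda>x. c * ct f gs j x)" if "gs \<in> T (Suc n)" for gs j
    unfolding ct_def using act_lin(2)[OF T_ends(1)[OF that] C_Y[OF f]] by simp
  note * = this
  have "\<delta> n (c \<odot>\<^bsub>C n\<^esub> f) gs = c \<odot>\<^bsub>V\<^esub> \<delta> n f gs" for gs
  proof (cases "gs \<in> T (Suc n)")
    case True
    show ?thesis unfolding coboundary_apply[OF cf True] coboundary_apply[OF f True] *[OF True] V_simps sum_distrib_left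
      by (intro ext sum.cong refl) (rule mult.left_commute)
  qed (simp add: coboundary_off)
  then show "\<delta> n (c \<odot>\<^bsub>C n\<^esub> f) = c \<odot>\<^bsub>C (Suc n)\<^esub> \<delta> n f" by (intro ext) simp
  assume h: "h \<in> carrier (C n)"
  have fh: "f \<oplus>\<^bsub>C n\<^esub> h \<in> carrier (C n)" using f h Y_closed(1) by (simp add: C_iff)
  have "ct (f \<oplus>\<^bsub>C n\<^esub> h) gs j = (\<lambda>x. ct f gs j x + ct h gs j x)" if "gs \<in> T (Suc n)" for gs j
    unfolding ct_def using act_lin(1)[OF T_ends(1)[OF that] C_Y[OF f] C_Y[OF h]] by simp
  note * = this
  have "\<delta> n (f \<oplus>\<^bsub>C n\<^esub> h) gs = \<delta> n f gs \<oplus>\<^bsub>V\<^esub> \<delta> n h gs" for gs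
  proof (cases "gs \<in> T (Suc n)")
    case True
    show ?thesis unfolding coboundary_apply[OF fh True] coboundary_apply[OF f True] coboundary_apply[OF h True] *[OF True]
        V_simps sum.distrib[symmetric] by (intro ext sum.cong refl) (rule distrib_left)
  qed (simp add: coboundary_off)
  then show "\<delta> n (f \<oplus>\<^bsub>C n\<^esub> h) = \<delta> n f \<oplus>\<^bsub>C (Suc n)\<^esub> \<delta> n h" by (intro ext) simp
qed

text \<open>Acting by the dropped leading entry makes the twisted faces satisfy the same simplicial
  identity as the plain ones, so the double sum cancels in pairs.\<close>

lemma coboundary_coboundary:
  assumes f: "f \<in> carrier (C n)"
  shows "\<delta> (Suc n) (\<delta> n f) = (\<lambda>_ _. 0)"
proof (rule ext, rule ext)
  fix gs x
  show "\<delta> (Suc n) (\<delta> n f) gs x = 0"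
  proof (cases "gs \<in> T (Suc (Suc n))")
    case False then show ?thesis by (simp add: coboundary_off)
  next
    case gs: True
    note F = T_face[OF gs]
    have gsc: "set gs \<subseteq> carrier G" "length gs = Suc (Suc n)" using gs by (auto simp: tuples_def)
    obtain g h r where gsd: "gs = g # h # r" using gsc(2) by (cases gs; cases "tl gs") auto
    have gh: "g \<in> carrier G" "h \<in> carrier G" using gsc gsd by auto
    \<comment> \<open>\<open>D i j\<close> belongs to face \<open>j\<close> of the tuple followed by
      face \<open>i\<close>, each with the action of the leading entry that it drops when it is face
      0.\<close>
    define D where "D i j = (if j = 0 then \<rho> g (ct f (bar_face G 0 gs) i) else ct f (bar_face G j gs) i)" for i j
    have ctd: "ct (\<delta> n f) gs j = (\<lambda>x. \<Sum>i\<le>Suc n. (-1) ^ i * D i j x)" if j: "j \<le> Suc (Suc n)" for j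
    proof (cases "j = 0")
      case True
      have "ct (\<delta> n f) gs j = \<rho> g (\<lambda>x. \<Sum>i\<le>Suc n. (-1) ^ i * ct f (bar_face G 0 gs) i x)"
        using True coboundary_apply[OF f F[of 0]] gsd by (simp add: ct_def)
      also have "\<dots> = (\<lambda>x. \<Sum>i\<le>Suc n. \<rho> g (\<lambda>x. (-1) ^ i * ct f (bar_face G 0 gs) i x) x)"
        by (rule act_sum[OF gh(1)]) (intro Y_closed ct_Y[OF f F], simp)
      also have "\<dots> = (\<lambda>x. \<Sum>i\<le>Suc n. (-1) ^ i * D i j x)"
        using True act_lin(2)[OF gh(1) ct_Y[OF f F[of 0]]] by (simp add: D_def)
      finally show ?thesis .
    next
      case False
      then show ?thesis using coboundary_apply[OF f F[OF j]] by (simp add: ct_def D_def)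
    qed
    have DD: "D i j = D (j - 1) i" if ij: "i < j" "j \<le> Suc (Suc n)" for i j
    proof -
      have face: "bar_face G i (bar_face G j gs) = bar_face G (j - 1) (bar_face G i gs)"
        by (rule group.bar_face_bar_face[OF grp gsc(1)]) (use ij gsc in auto)
      show ?thesis
      proof (cases "i = 0")
        case False
        then show ?thesis using ij face by (simp add: D_def ct_def)
      next
        case i0: True
        show ?thesis
        \<comment> \<open>Dropping two leading entries one after the other acts by their product,
          which is the leading entry created by face 1.\<close>
        proof (cases "j = 1")
          case True
          have fY: "f (bar_face G 0 (h # r)) \<in> Y" by (rule C_Y[OF f])
          show ?thesis using i0 True gsd gh act_mult[OF gh, of "f (bar_face G 0 (h # r))"] fY
            by (simp add: D_def ct_def bar_face_0 bar_face_Suc_0)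
        next
          case False
          then obtain k where k: "j = Suc (Suc k)" using ij i0 by (cases j; cases "j - 1") auto
          have "hd (bar_face G j gs) = g" unfolding k gsd
            by (subst bar_face_Suc_Suc) (use ij k gsc gsd in auto)
          then show ?thesis using i0 ij face k by (simp add: D_def ct_def)
        qed
      qed
    qed
    have "\<delta> (Suc n) (\<delta> n f) gs x = (\<Sum>j\<le>Suc (Suc n). (-1) ^ j * (\<Sum>i\<le>Suc n. (-1) ^ i * D i j x))"
      unfolding coboundary_apply[OF coboundary_C[OF f] gs] using ctd by (intro sum.cong refl) simp
    also have "\<dots> = (\<Sum>j\<le>Suc (Suc n). \<Sum>i\<le>Suc n. (-1) ^ j * ((-1) ^ i * D i j x))"
      by (simp only: sum_distrib_left)
    also have "\<dots> = 0" by (rule alternating_double_sum) (use DD in simp)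
    finally show ?thesis .
  qed
qed

end

section \<open>The boundary and its adjoint under the pairing of chains\<close>

context form_rep
begin

definition pr :: "('b \<Rightarrow> 'k) \<Rightarrow> ('b \<Rightarrow> 'k) \<Rightarrow> 'k" where
  "pr u v = (\<Sum>x\<in>I. u x * v x)"

definition bp :: "nat \<Rightarrow> ('g list \<Rightarrow> 'b \<Rightarrow> 'k) \<Rightarrow> ('g list \<Rightarrow> 'b \<Rightarrow> 'k) \<Rightarrow> 'k" where
  "bp n c f = (\<Sum>gs\<in>T n. pr (c gs) (f gs))"

lemma pr_lin: "pr (\<lambda>x. u x + u' x) v = pr u v + pr u' v" "pr u (\<lambda>x. v x + v' x) = pr u v + pr u v'"
  "pr (\<lambda>x. c * u x) v = c * pr u v" "pr u (\<lambda>x. c * v x) = c * pr u v"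
  "pr (\<lambda>_. 0) v = 0" "pr u (\<lambda>_. 0) = 0"
  by (simp_all add: pr_def sum.distrib algebra_simps sum_distrib_left)

lemma pr_sum: "pr (\<lambda>x. \<Sum>a\<in>A. f a x) v = (\<Sum>a\<in>A. pr (f a) v)" "pr u (\<lambda>x. \<Sum>a\<in>A. f a x) = (\<Sum>a\<in>A. pr u (f a))"
proof -
  show "pr (\<lambda>x. \<Sum>a\<in>A. f a x) v = (\<Sum>a\<in>A. pr (f a) v)"
    unfolding pr_def sum_distrib_right by (rule sum.swap)
  show "pr u (\<lambda>x. \<Sum>a\<in>A. f a x) = (\<Sum>a\<in>A. pr u (f a))"
    unfolding pr_def sum_distrib_left by (rule sum.swap)
qed

lemma pr_inv: "g \<in> carrier G \<Longrightarrow> u \<in> Y \<Longrightarrow> v \<in> Y \<Longrightarrow> pr (\<rho> g u) v = pr u (\<rho> (inv\<^bsub>G\<^esub> g) v)"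
proof -
  assume g: "g \<in> carrier G" and u: "u \<in> Y" and v: "v \<in> Y"
  have i: "inv\<^bsub>G\<^esub> g \<in> carrier G" using group.inv_closed[OF grp g] .
  have "\<rho> g (\<rho> (inv\<^bsub>G\<^esub> g) v) = v"
    using act_mult[OF g i, of v] act_one[of v] v group.r_inv[OF grp g] by simp
  then show ?thesis using invariant[OF g u act_Y[OF i v]] by (simp add: pr_def)
qed

lemma bp_functional: "functional (C n) (bp n c)" "functional (C n) (\<lambda>c. bp n c f)"
  by (simp_all add: functional_def bp_def pr_lin sum.distrib sum_distrib_left)

lemma bp_nondegenerate:
  assumes c: "c \<in> carrier (C n)" and z: "\<And>f. f \<in> carrier (C n) \<Longrightarrow> bp n c f = 0"
  shows "c = \<zero>\<^bsub>C n\<^esub>"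
proof
  fix gs
  show "c gs = \<zero>\<^bsub>C n\<^esub> gs"
  proof (cases "gs \<in> T n")
    case False then show ?thesis using c by (simp add: C_iff)
  next
    case gs: True
    have "c gs = (\<lambda>_. 0)"
    proof (rule nondegenerate[OF C_Y[OF c]])
      fix v assume v: "v \<in> Y"
      define f where "f = (\<lambda>hs. if hs = gs then v else (\<lambda>_. 0))"
      have f: "f \<in> carrier (C n)" unfolding C_iff f_def using v gs Y_closed(3) by auto
      have "bp n c f = (\<Sum>hs\<in>T n. if hs = gs then pr (c gs) v else 0)"
        unfolding bp_def f_def by (intro sum.cong refl) (simp add: pr_lin)
      also have "\<dots> = pr (c gs) v" using gs finT by simp
      finally show "(\<Sum>x\<in>I. c gs x * v x) = 0" using z[OF f] by (simp add: pr_def)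
    qed
    then show ?thesis by simp
  qed
qed

definition bt :: "nat \<Rightarrow> ('g list \<Rightarrow> 'b \<Rightarrow> 'k) \<Rightarrow> 'g list \<Rightarrow> nat \<Rightarrow> 'b \<Rightarrow> 'k" where
  "bt n c gs j = (if j = Suc n then \<rho> (last gs) (c gs) else c gs)"

lemma bt_Y: "c \<in> carrier (C (Suc n)) \<Longrightarrow> gs \<in> T (Suc m) \<Longrightarrow> bt n c gs j \<in> Y"
  unfolding bt_def using C_Y[of c "Suc n" gs] act_Y[of "last gs" "c gs"] T_ends(2)[of gs m] by simp

lemma boundary_apply:
  assumes c: "c \<in> carrier (C (Suc n))" and hs: "hs \<in> T n"
  shows "bd n c hs = (\<lambda>x. \<Sum>gs\<in>T (Suc n). \<Sum>j\<in>{j. j \<le> Suc n \<and> bar_face G j gs = hs}. (-1) ^ j * bt n c gs j x)"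
proof -
  let ?J = "\<lambda>gs. {j. j \<le> Suc n \<and> bar_face G j gs = hs}"
  have inner: "(\<Oplus>\<^bsub>V\<^esub>j\<in>?J gs. (- 1) ^ j \<odot>\<^bsub>V\<^esub> (if j = Suc n then \<rho> (last gs) (c gs) else c gs)) =
    (\<lambda>x. \<Sum>j\<in>?J gs. (-1) ^ j * bt n c gs j x)" if gs: "gs \<in> T (Suc n)" for gs
    unfolding bt_def[symmetric] by (subst finsum_apply) (use Y_closed(2)[OF bt_Y[OF c gs]] in simp_all)
  have Yi: "(\<lambda>x. \<Sum>j\<in>?J gs. (-1) ^ j * bt n c gs j x) \<in> Y" if gs: "gs \<in> T (Suc n)" for gs
    by (rule Y_sum) (rule Y_closed(2)[OF bt_Y[OF c gs]])
  have "bd n c hs = (\<Oplus>\<^bsub>V\<^esub>gs\<in>T (Suc n). (\<lambda>x. \<Sum>j\<in>?J gs. (-1) ^ j * bt n c gs j x))"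
    unfolding boundary_def using hs inner Yi by (simp only: if_True) (intro finsum_cong' refl, simp_all add: Pi_iff)
  also have "\<dots> = (\<lambda>x. \<Sum>gs\<in>T (Suc n). \<Sum>j\<in>?J gs. (-1) ^ j * bt n c gs j x)"
    by (rule finsum_apply) (use Yi in \<open>simp add: Pi_iff\<close>)
  finally show ?thesis .
qed

lemma boundary_off: "hs \<notin> T n \<Longrightarrow> bd n c hs = (\<lambda>_. 0)"
  unfolding boundary_def by simp

lemma boundary_C: "c \<in> carrier (C (Suc n)) \<Longrightarrow> bd n c \<in> carrier (C n)"
  unfolding C_iff[of _ n]
  by (intro conjI ballI allI impI boundary_off, simp only: boundary_apply, intro Y_sum Y_closed bt_Y)

lemma boundary_hom: "bd n \<in> lhom (C (Suc n)) (C n)"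
proof (rule lhomI)
  fix f h c assume f: "f \<in> carrier (C (Suc n))"
  show "bd n f \<in> carrier (C n)" by (rule boundary_C[OF f])
  have cf: "c \<odot>\<^bsub>C (Suc n)\<^esub> f \<in> carrier (C (Suc n))" using vsp.smult_cl[OF C_vsp f] .
  have *: "bt n (c \<odot>\<^bsub>C (Suc n)\<^esub> f) gs j = (\<lambda>x. c * bt n f gs j x)" if "gs \<in> T (Suc n)" for gs j
    unfolding bt_def using act_lin(2)[OF T_ends(2)[OF that] C_Y[OF f]] by simp
  have "bd n (c \<odot>\<^bsub>C (Suc n)\<^esub> f) hs = c \<odot>\<^bsub>V\<^esub> bd n f hs" for hs
  proof (cases "hs \<in> T n")
    case True
    show ?thesis unfolding boundary_apply[OF cf True] boundary_apply[OF f True] V_simps sum_distrib_left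
      by (intro ext sum.cong refl) (simp only: * mult.left_commute[of c])
  qed (simp add: boundary_off)
  then show "bd n (c \<odot>\<^bsub>C (Suc n)\<^esub> f) = c \<odot>\<^bsub>C n\<^esub> bd n f" by (intro ext) simp
  assume h: "h \<in> carrier (C (Suc n))"
  have fh: "f \<oplus>\<^bsub>C (Suc n)\<^esub> h \<in> carrier (C (Suc n))" using f h Y_closed(1) by (simp add: C_iff)
  have *: "bt n (f \<oplus>\<^bsub>C (Suc n)\<^esub> h) gs j = (\<lambda>x. bt n f gs j x + bt n h gs j x)" if "gs \<in> T (Suc n)" for gs j
    unfolding bt_def using act_lin(1)[OF T_ends(2)[OF that] C_Y[OF f] C_Y[OF h]] by simp
  have "bd n (f \<oplus>\<^bsub>C (Suc n)\<^esub> h) hs = bd n f hs \<oplus>\<^bsub>V\<^esub> bd n h hs" for hs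
  proof (cases "hs \<in> T n")
    case True
    show ?thesis unfolding boundary_apply[OF fh True] boundary_apply[OF f True] boundary_apply[OF h True] V_simps
      sum.distrib[symmetric]
      by (intro ext sum.cong refl) (simp only: * distrib_left)
  qed (simp add: boundary_off)
  then show "bd n (f \<oplus>\<^bsub>C (Suc n)\<^esub> h) = bd n f \<oplus>\<^bsub>C n\<^esub> bd n h" by (intro ext) simp
qed

text \<open>Inverting and reversing tuples turns the adjoint of the boundary into the coboundary.\<close>

definition rv :: "'g list \<Rightarrow> 'g list" where
  "rv gs = rev (map (\<lambda>g. inv\<^bsub>G\<^esub> g) gs)"

definition R :: "nat \<Rightarrow> ('g list \<Rightarrow> 'b \<Rightarrow> 'k) \<Rightarrow> 'g list \<Rightarrow> 'b \<Rightarrow> 'k" where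
  "R n f gs = (if gs \<in> T n then f (rv gs) else (\<lambda>_. 0))"

lemma rv_T: "gs \<in> T n \<Longrightarrow> rv gs \<in> T n"
  using group.inv_closed[OF grp] by (auto simp: tuples_def rv_def)

lemma rv_rv: "gs \<in> T n \<Longrightarrow> rv (rv gs) = gs"
proof -
  assume "gs \<in> T n"
  then have "set gs \<subseteq> carrier G" by (simp add: tuples_def)
  then have "map (\<lambda>g. inv\<^bsub>G\<^esub> (inv\<^bsub>G\<^esub> g)) gs = gs" by (intro map_idI) (use group.inv_inv[OF grp] in blast)
  then show ?thesis by (simp add: rv_def rev_map o_def)
qed

lemma R_C: "f \<in> carrier (C n) \<Longrightarrow> R n f \<in> carrier (C n)"
  unfolding C_iff R_def by (simp add: rv_T)

lemma R_R: "f \<in> carrier (C n) \<Longrightarrow> R n (R n f) = f"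
  by (rule ext) (simp add: R_def rv_T rv_rv C_iff)

lemma R_hom: "R n \<in> lhom (C n) (C n)"
  by (rule lhomI) (auto simp: R_C R_def fun_eq_iff)

text \<open>Inversion reverses products and reversal exchanges the two ends of a tuple, so face
  \<open>j\<close> becomes face n + 1 - j.\<close>

lemma rv_face:
  assumes gs: "gs \<in> T (Suc n)" and j: "j \<le> Suc n"
  shows "bar_face G j (rv gs) = rv (bar_face G (Suc n - j) gs)"
proof -
  have g: "set gs \<subseteq> carrier G" "length gs = Suc n" using gs by (auto simp: tuples_def)
  have len: "length (rv gs) = Suc n" using g by (simp add: rv_def)
  consider "j = 0" | "j = Suc n" | "0 < j" "j < Suc n" using j by linarith
  then show ?thesis
  proof cases
    case 1
    have "tl (rev xs) = rev (butlast xs)" for xs :: "'g list" by (induction xs rule: rev_induct) auto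
    then show ?thesis using 1 g by (simp add: bar_face_def rv_def map_butlast)
  next
    case 2
    have "butlast (rev xs) = rev (tl xs)" for xs :: "'g list" by (cases xs) auto
    then show ?thesis using 2 g len by (simp add: bar_face_def rv_def map_tl)
  next
    case 3
    define m where "m = Suc n - j"
    have m: "0 < m" "m < Suc n" "j = Suc n - m" using 3 by (auto simp: m_def)
    have c: "gs ! (m - 1) \<in> carrier G" "gs ! m \<in> carrier G" using g m nth_mem[of "m - 1" gs] nth_mem[of m gs] by auto
    have n1: "rv gs ! (j - 1) = inv\<^bsub>G\<^esub> (gs ! m)" "rv gs ! j = inv\<^bsub>G\<^esub> (gs ! (m - 1))"
      using g m by (simp_all add: rv_def rev_nth)
    have t: "take (j - 1) (rv gs) = rv (drop (Suc m) gs)" "drop (Suc j) (rv gs) = rv (take (m - 1) gs)"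
      using g m by (simp_all add: rv_def take_rev drop_rev drop_map take_map Suc_diff_Suc)
    have "bar_face G j (rv gs) = rv (drop (Suc m) gs) @ [inv\<^bsub>G\<^esub> (gs ! m) \<otimes>\<^bsub>G\<^esub> inv\<^bsub>G\<^esub> (gs ! (m - 1))] @ rv (take (m - 1) gs)"
      using 3 len by (simp add: bar_face_def n1 t del: One_nat_def)
    also have "inv\<^bsub>G\<^esub> (gs ! m) \<otimes>\<^bsub>G\<^esub> inv\<^bsub>G\<^esub> (gs ! (m - 1)) = inv\<^bsub>G\<^esub> (gs ! (m - 1) \<otimes>\<^bsub>G\<^esub> gs ! m)"
      using group.inv_mult_group[OF grp c] by simp
    finally show ?thesis unfolding m_def[symmetric] using m g by (simp add: bar_face_def rv_def)
  qed
qed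

text \<open>The factor between (-1)^j and (-1)^(n+1-j), needed because face \<open>j\<close> of a
  reversed tuple comes from face n + 1 - j.\<close>

definition sg :: "nat \<Rightarrow> 'k" where
  "sg n = (-1) ^ Suc n"

lemma sg_nonzero [simp]: "sg n \<noteq> 0" by (simp add: sg_def)

lemma scaling_hom: "(\<lambda>f gs x. c * f gs x) \<in> lhom (C m) (C m)"
  by (rule lhomI) (auto simp: C_iff Y_closed algebra_simps fun_eq_iff)

text \<open>The coboundary conjugated by the reversal and corrected by the sign of the reordered
  faces. It is the transpose of the boundary, by \<open>boundary_adjoint\<close>.\<close>

definition adj :: "nat \<Rightarrow> ('g list \<Rightarrow> 'b \<Rightarrow> 'k) \<Rightarrow> 'g list \<Rightarrow> 'b \<Rightarrow> 'k" where
  "adj n f = (\<lambda>gs x. sg n * R (Suc n) (\<delta> n (R n f)) gs x)"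

text \<open>Under reversal the element acting in face 0 becomes the inverse of the last entry and
  acts in face n + 1, which is where the boundary has its twisted term.\<close>

lemma adj_apply:
  assumes f: "f \<in> carrier (C n)" and gs: "gs \<in> T (Suc n)"
  shows "adj n f gs = (\<lambda>x. \<Sum>j\<le>Suc n. (-1) ^ j *
    (if j = Suc n then \<rho> (inv\<^bsub>G\<^esub> (last gs)) (f (bar_face G j gs)) else f (bar_face G j gs)) x)"
proof
  fix x
  let ?t = "\<lambda>j. if j = Suc n then \<rho> (inv\<^bsub>G\<^esub> (last gs)) (f (bar_face G j gs)) else f (bar_face G j gs)"
  have gs0: "gs \<noteq> []" using gs by (auto simp: tuples_def)
  have hd: "hd (rv gs) = inv\<^bsub>G\<^esub> (last gs)" using gs0 by (simp add: rv_def hd_rev last_map)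
  have ct: "ct (R n f) (rv gs) j = ?t (Suc n - j)" if j: "j \<le> Suc n" for j
  proof -
    have "R n f (bar_face G j (rv gs)) = f (bar_face G (Suc n - j) gs)"
      unfolding rv_face[OF gs j] R_def using T_face[OF gs, of "Suc n - j"] by (simp add: rv_T rv_rv)
    then show ?thesis using j hd by (auto simp: ct_def)
  qed
  have "adj n f gs x = sg n * (\<Sum>j\<le>Suc n. (-1) ^ j * ct (R n f) (rv gs) j x)"
    unfolding adj_def R_def[of "Suc n"] coboundary_apply[OF R_C[OF f] rv_T[OF gs]] using gs by simp
  also have "\<dots> = sg n * (\<Sum>j\<le>Suc n. (-1) ^ j * ?t (Suc n - j) x)"
    by (intro arg_cong[of _ _ "\<lambda>z. sg n * z"] sum.cong refl) (simp add: ct)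
  also have "\<dots> = (\<Sum>j\<le>Suc n. (-1) ^ (Suc n - j) * ?t (Suc n - j) x)"
    unfolding sum_distrib_left
  proof (intro sum.cong refl)
    fix j assume "j \<in> {..Suc n}"
    then obtain m where m: "Suc n = j + m" by (auto simp: le_iff_add)
    have "sg n * (-1) ^ j = (-1) ^ m"
      unfolding sg_def m power_add by (simp add: power_mult_distrib[symmetric] mult.commute mult.left_commute)
    then show "sg n * ((-1) ^ j * ?t (Suc n - j) x) = (-1) ^ (Suc n - j) * ?t (Suc n - j) x"
      using m by (simp add: mult.assoc[symmetric])
  qed
  also have "\<dots> = (\<Sum>j\<le>Suc n. (-1) ^ j * ?t j x)"
    by (rule sum.reindex_bij_witness[of _ "\<lambda>j. Suc n - j" "\<lambda>j. Suc n - j"]) auto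
  finally show "adj n f gs x = (\<Sum>j\<le>Suc n. (-1) ^ j * ?t j x)" .
qed

lemma adj_hom: "adj n \<in> lhom (C n) (C (Suc n))"
proof -
  show ?thesis
    using lhom_comp[OF lhom_comp[OF lhom_comp[OF R_hom coboundary_hom] R_hom] scaling_hom] unfolding adj_def .
qed

lemma boundary_adjoint:
  assumes c: "c \<in> carrier (C (Suc n))" and f: "f \<in> carrier (C n)"
  shows "bp n (bd n c) f = bp (Suc n) c (adj n f)"
proof -
  let ?J = "\<lambda>gs hs. {j \<in> {..Suc n}. bar_face G j gs = hs}"
  let ?a = "\<lambda>gs j hs. (-1) ^ j * pr (bt n c gs j) (f hs)"
  have "bp n (bd n c) f = (\<Sum>hs\<in>T n. \<Sum>gs\<in>T (Suc n). \<Sum>j\<in>?J gs hs. ?a gs j hs)"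
    unfolding bp_def by (intro sum.cong refl) (simp add: boundary_apply[OF c] pr_sum pr_lin)
  also have "\<dots> = (\<Sum>gs\<in>T (Suc n). \<Sum>hs\<in>T n. \<Sum>j\<in>?J gs hs. ?a gs j hs)" by (rule sum.swap)
  also have "\<dots> = (\<Sum>gs\<in>T (Suc n). \<Sum>hs\<in>T n. \<Sum>j\<in>?J gs hs. ?a gs j (bar_face G j gs))"
    by (intro sum.cong refl) simp
  \<comment> \<open>Each face of \<open>gs\<close> is exactly one \<open>hs\<close>, so the sum over
    \<open>hs\<close> only partitions the indices \<open>j\<close>.\<close>
  also have "\<dots> = (\<Sum>gs\<in>T (Suc n). \<Sum>j\<le>Suc n. ?a gs j (bar_face G j gs))"
    by (intro sum.cong refl sum.group) (use finT T_face in auto)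
  also have "\<dots> = bp (Suc n) c (adj n f)"
    unfolding bp_def
  proof (intro sum.cong refl)
    fix gs assume gs: "gs \<in> T (Suc n)"
    have l: "last gs \<in> carrier G" by (rule T_ends(2)[OF gs])
    have "pr (c gs) (adj n f gs) = (\<Sum>j\<le>Suc n. (-1) ^ j * pr (c gs)
      (if j = Suc n then \<rho> (inv\<^bsub>G\<^esub> (last gs)) (f (bar_face G j gs)) else f (bar_face G j gs)))"
      unfolding adj_apply[OF f gs] pr_sum(2) pr_lin(4) ..
    also have "\<dots> = (\<Sum>j\<le>Suc n. ?a gs j (bar_face G j gs))"
      by (intro sum.cong refl) (simp add: bt_def pr_inv[OF l C_Y[OF c] C_Y[OF f]])
    finally show "(\<Sum>j\<le>Suc n. ?a gs j (bar_face G j gs)) = pr (c gs) (adj n f gs)" ..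
  qed
  finally show ?thesis .
qed

lemma pr_commute: "pr u v = pr v u" by (simp add: pr_def mult.commute)
lemma bp_commute: "bp n c f = bp n f c" by (simp add: bp_def pr_commute[of "c _"])

lemma adj_adj:
  assumes f: "f \<in> carrier (C n)"
  shows "adj (Suc n) (adj n f) = (\<lambda>_ _. 0)"
proof -
  have d: "\<delta> n (R n f) \<in> carrier (C (Suc n))" by (rule coboundary_C[OF R_C[OF f]])
  have "R (Suc n) (adj n f) = sg n \<odot>\<^bsub>C (Suc n)\<^esub> \<delta> n (R n f)"
  proof
    fix gs
    show "R (Suc n) (adj n f) gs = (sg n \<odot>\<^bsub>C (Suc n)\<^esub> \<delta> n (R n f)) gs"
      by (cases "gs \<in> T (Suc n)") (simp_all add: R_def[of "Suc n"] adj_def rv_T rv_rv coboundary_off)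
  qed
  then have "\<delta> (Suc n) (R (Suc n) (adj n f)) = sg n \<odot>\<^bsub>C (Suc (Suc n))\<^esub> \<delta> (Suc n) (\<delta> n (R n f))"
    using lhomD(3)[OF coboundary_hom d, of "sg n"] by (simp only:)
  then have "\<delta> (Suc n) (R (Suc n) (adj n f)) = (\<lambda>_ _. 0)"
    using coboundary_coboundary[OF R_C[OF f]] by simp
  then show ?thesis unfolding adj_def[of "Suc n"] by (simp add: R_def fun_eq_iff)
qed

text \<open>Obtained by duality instead of a second simplicial computation: pairing with a cochain
  moves both boundaries across, where their transposes compose to zero by
  \<open>coboundary_coboundary\<close>.\<close>

lemma boundary_boundary:
  assumes c: "c \<in> carrier (C (Suc (Suc n)))"
  shows "bd n (bd (Suc n) c) = (\<lambda>_ _. 0)"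
proof -
  have "bd n (bd (Suc n) c) = \<zero>\<^bsub>C n\<^esub>"
  proof (rule bp_nondegenerate[OF boundary_C[OF boundary_C[OF c]]])
    fix f assume f: "f \<in> carrier (C n)"
    have "bp n (bd n (bd (Suc n) c)) f = bp (Suc (Suc n)) c (adj (Suc n) (adj n f))"
      using boundary_adjoint[OF boundary_C[OF c] f] boundary_adjoint[OF c lhomD(1)[OF adj_hom f]] by simp
    then show "bp n (bd n (bd (Suc n) c)) f = 0" using adj_adj[OF f] by (simp add: bp_def pr_lin)
  qed
  then show ?thesis by simp
qed

text \<open>Each map is the transpose of the other under nondegenerate pairings, so the rank bound
  applies both ways.\<close>

lemma rank_adj: "vdim ((C (Suc n))\<lparr>carrier := adj n ` carrier (C n)\<rparr>) = vdim ((C n)\<lparr>carrier := bd n ` carrier (C (Suc n))\<rparr>)"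
proof (rule antisym)
  show "vdim ((C (Suc n))\<lparr>carrier := adj n ` carrier (C n)\<rparr>) \<le> vdim ((C n)\<lparr>carrier := bd n ` carrier (C (Suc n))\<rparr>)"
    by (rule adjoint_rank_le[OF C_vsp C_fin C_fin adj_hom boundary_hom, where BW="bp (Suc n)" and BV="bp n"])
      (use bp_functional bp_nondegenerate boundary_adjoint bp_commute in auto)
  show "vdim ((C n)\<lparr>carrier := bd n ` carrier (C (Suc n))\<rparr>) \<le> vdim ((C (Suc n))\<lparr>carrier := adj n ` carrier (C n)\<rparr>)"
    by (rule adjoint_rank_le[OF C_vsp C_fin C_fin boundary_hom adj_hom, where BW="bp n" and BV="bp (Suc n)"])
      (use bp_functional bp_nondegenerate boundary_adjoint in auto)
qed

text \<open>Reversal and multiplication by a sign are bijective on cochains and do not change the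
  rank.\<close>

lemma rank_coboundary: "vdim ((C (Suc n))\<lparr>carrier := \<delta> n ` carrier (C n)\<rparr>) = vdim ((C (Suc n))\<lparr>carrier := adj n ` carrier (C n)\<rparr>)"
proof -
  let ?X = "\<delta> n ` carrier (C n)" and ?Z = "adj n ` carrier (C n)"
  interpret CS: fvsp "C (Suc n)" by (rule C_fin)
  have sX: "VectorSpace.subspace class_ring ?X (C (Suc n))"
    by (rule lhom_image_subsp[OF C_vsp C_vsp coboundary_hom vsp.subsp_carrier[OF C_vsp]])
  have sZ: "VectorSpace.subspace class_ring ?Z (C (Suc n))"
    by (rule lhom_image_subsp[OF C_vsp C_vsp adj_hom vsp.subsp_carrier[OF C_vsp]])
  define h where "h f = (\<lambda>gs x. sg n * R (Suc n) f gs x)" for f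
  have h: "h \<in> lhom (C (Suc n)) (C (Suc n))" unfolding h_def using lhom_comp[OF R_hom scaling_hom] .
  have adj_h: "adj n f = h (\<delta> n (R n f))" for f by (simp add: adj_def h_def)
  have RC: "R n ` carrier (C n) = carrier (C n)"
  proof (intro equalityI subsetI)
    fix f assume "f \<in> carrier (C n)"
    then show "f \<in> R n ` carrier (C n)" using R_R[of f n] R_C[of f n] by (metis imageI)
  qed (use R_C in auto)
  have im: "h ` ?X = ?Z"
  proof -
    have "?Z = (\<lambda>f. h (\<delta> n f)) ` R n ` carrier (C n)" by (simp add: adj_h image_image)
    then show ?thesis by (simp add: RC image_image)
  qed
  have inj: "h f = h f' \<Longrightarrow> f = f'" if "f \<in> carrier (C (Suc n))" "f' \<in> carrier (C (Suc n))" for f f'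
  proof -
    assume "h f = h f'"
    then have "R (Suc n) f = R (Suc n) f'" by (auto simp: h_def fun_eq_iff)
    then show "f = f'" using R_R that by metis
  qed
  have XC: "?X \<subseteq> carrier (C (Suc n))" using CS.subspD(1)[OF sX] .
  show ?thesis
  proof (rule lhom_bij_dim[OF CS.subsp_fin[OF sX] CS.subsp_vsp[OF sZ]])
    show "h \<in> lhom ((C (Suc n))\<lparr>carrier := ?X\<rparr>) ((C (Suc n))\<lparr>carrier := ?Z\<rparr>)"
      by (rule lhom_restrict[OF h XC]) (use im in blast)
    have "inj_on h ?X" by (rule inj_onI) (use inj XC in blast)
    then show "bij_betw h (carrier ((C (Suc n))\<lparr>carrier := ?X\<rparr>)) (carrier ((C (Suc n))\<lparr>carrier := ?Z\<rparr>))"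
      unfolding bij_betw_def using im by simp
  qed
qed

end

section \<open>Homology and cohomology as subquotients, and their dimensions\<close>

context form_rep
begin

lemma boundaries_subsp: "VectorSpace.subspace class_ring (boundaries G V \<rho> n) (C n)"
  unfolding boundaries_def by (rule lhom_image_subsp[OF C_vsp C_vsp boundary_hom vsp.subsp_carrier[OF C_vsp]])

lemma cycles_subsp: "VectorSpace.subspace class_ring (cycles G V \<rho> n) (C n)"
proof (cases n)
  case 0 then show ?thesis using vsp.subsp_carrier[OF C_vsp] by (simp add: cycles_def)
next
  case (Suc m)
  have "VectorSpace.subspace class_ring {c \<in> carrier (C (Suc m)). bd m c \<in> {\<zero>\<^bsub>C m\<^esub>}} (C (Suc m))"
    by (rule lhom_vimage_subsp[OF C_vsp C_vsp boundary_hom vsp.subsp_zero[OF C_vsp]])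
  then show ?thesis using Suc by (simp add: cycles_def)
qed

lemma boundaries_cycles: "boundaries G V \<rho> n \<subseteq> cycles G V \<rho> n"
proof (cases n)
  case 0 then show ?thesis using boundary_C by (auto simp: cycles_def boundaries_def)
next
  case (Suc m) then show ?thesis using boundary_C boundary_boundary by (auto simp: cycles_def boundaries_def)
qed

lemma coboundaries_subsp: "VectorSpace.subspace class_ring (coboundaries G V \<rho> n) (C n)"
proof (cases n)
  case 0 then show ?thesis using vsp.subsp_zero[OF C_vsp, of 0] by (simp add: coboundaries_def)
next
  case (Suc m)
  then show ?thesis
    using lhom_image_subsp[OF C_vsp C_vsp coboundary_hom vsp.subsp_carrier[OF C_vsp], of m] by (simp add: coboundaries_def)
qed

lemma cocycles_subsp: "VectorSpace.subspace class_ring (cocycles G V \<rho> n) (C n)"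
proof -
  have "VectorSpace.subspace class_ring {c \<in> carrier (C n). \<delta> n c \<in> {\<zero>\<^bsub>C (Suc n)\<^esub>}} (C n)"
    by (rule lhom_vimage_subsp[OF C_vsp C_vsp coboundary_hom vsp.subsp_zero[OF C_vsp]])
  then show ?thesis by (simp add: cocycles_def)
qed

lemma coboundaries_cocycles: "coboundaries G V \<rho> n \<subseteq> cocycles G V \<rho> n"
proof (cases n)
  case 0
  have "\<zero>\<^bsub>C 0\<^esub> \<in> cocycles G V \<rho> 0" using vsp.subspD(2)[OF C_vsp cocycles_subsp] .
  then show ?thesis using 0 by (simp add: coboundaries_def)
next
  case (Suc m) then show ?thesis using coboundary_C coboundary_coboundary by (auto simp: cocycles_def coboundaries_def)
qed

lemma homology_subquot: "subquot (C n) (boundaries G V \<rho> n) (cycles G V \<rho> n)"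
  using C_vsp boundaries_subsp cycles_subsp boundaries_cycles by (simp add: subquot_def subquot_axioms_def)

lemma cohomology_subquot: "subquot (C n) (coboundaries G V \<rho> n) (cocycles G V \<rho> n)"
  using C_vsp coboundaries_subsp cocycles_subsp coboundaries_cocycles by (simp add: subquot_def subquot_axioms_def)

lemma homology_fin: "fvsp (group_homology G V \<rho> n)"
  unfolding group_homology_def by (rule subquot.Q_dim(2)[OF homology_subquot fvsp.subsp_fin[OF C_fin cycles_subsp]])

text \<open>With \<open>r m\<close> the rank of the boundary from degree m + 1 to degree m, both
  dimensions equal the dimension of \<open>C n\<close> minus \<open>r n\<close> and
  \<open>r (n - 1)\<close>: by transposition the coboundary out of degree n has rank
  \<open>r n\<close>.\<close>

theorem cohomology_dim_eq: "vdim (group_cohomology G V \<rho> n) = vdim (group_homology G V \<rho> n)"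
proof -
  let ?r = "\<lambda>m. vdim ((C m)\<lparr>carrier := bd m ` carrier (C (Suc m))\<rparr>)"
  \<comment> \<open>The rank of the boundary out of degree \<open>n\<close>; in degree 0 there is
    none.\<close>
  let ?p = "case n of 0 \<Rightarrow> 0 | Suc m \<Rightarrow> ?r m"
  have z: "vdim ((C m)\<lparr>carrier := {\<zero>\<^bsub>C m\<^esub>}\<rparr>) = 0" for m
    by (rule vsp.dim_trivial[OF vsp.subsp_vsp[OF C_vsp vsp.subsp_zero[OF C_vsp]]]) simp
  have 1: "vdim (group_homology G V \<rho> n) + ?r n = vdim ((C n)\<lparr>carrier := cycles G V \<rho> n\<rparr>)"
    using subquot.Q_dim(1)[OF homology_subquot fvsp.subsp_fin[OF C_fin cycles_subsp]]
    unfolding group_homology_def boundaries_def .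
  have 2: "vdim ((C n)\<lparr>carrier := cycles G V \<rho> n\<rparr>) + ?p = vdim (C n)"
  proof (cases n)
    case 0
    then have "(C n)\<lparr>carrier := cycles G V \<rho> n\<rparr> = C n" by (simp add: cycles_def)
    then show ?thesis using 0 by simp
  next
    case (Suc m)
    have "{x \<in> carrier (C (Suc m)). bd m x = \<zero>\<^bsub>C m\<^esub>} = cycles G V \<rho> n" using Suc by (simp add: cycles_def)
    then show ?thesis using rank_nullity'[OF C_fin C_vsp boundary_hom, of m] Suc by simp
  qed
  have 3: "vdim (group_cohomology G V \<rho> n) + ?p = vdim ((C n)\<lparr>carrier := cocycles G V \<rho> n\<rparr>)"
  proof -
    have "vdim ((C n)\<lparr>carrier := coboundaries G V \<rho> n\<rparr>) = ?p"
    proof (cases n)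
      case 0 then show ?thesis using z[of 0] by (simp add: coboundaries_def)
    next
      case (Suc m) then show ?thesis using rank_coboundary[of m] rank_adj[of m] by (simp add: coboundaries_def)
    qed
    then show ?thesis
      using subquot.Q_dim(1)[OF cohomology_subquot fvsp.subsp_fin[OF C_fin cocycles_subsp], of n]
      unfolding group_cohomology_def by simp
  qed
  have 4: "vdim ((C n)\<lparr>carrier := cocycles G V \<rho> n\<rparr>) + ?r n = vdim (C n)"
  proof -
    have "{x \<in> carrier (C n). \<delta> n x = \<zero>\<^bsub>C (Suc n)\<^esub>} = cocycles G V \<rho> n" by (simp add: cocycles_def)
    then show ?thesis using rank_nullity'[OF C_fin C_vsp coboundary_hom, of n] rank_coboundary[of n] rank_adj[of n] by simp
  qed
  show ?thesis using 1 2 3 4 by linarith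
qed

abbreviation "hclass n c \<equiv> boundaries G V \<rho> n +>\<^bsub>C n\<^esub> c"

lemma homology_carrier: "carrier (group_homology G V \<rho> n) = hclass n ` cycles G V \<rho> n"
  unfolding group_homology_def by (rule subquot.Q_carr[OF homology_subquot])

lemma cycles_C: "c \<in> cycles G V \<rho> n \<Longrightarrow> c \<in> carrier (C n)"
  using vsp.subspD(5)[OF C_vsp cycles_subsp] .

end

section \<open>Maps induced on homology by equivariant maps\<close>

locale equivariant_map = V: form_rep G V \<rho> I Y + W: form_rep G W \<sigma> J X
  for G :: "('g, 'c) monoid_scheme" and V :: "('k::field, 'b \<Rightarrow> 'k) module" and \<rho> I Y
    and W :: "('k::field, 'd \<Rightarrow> 'k) module" and \<sigma> J X +
  fixes \<phi>
  assumes hom: "\<phi> \<in> lhom V W" and equi: "g \<in> carrier G \<Longrightarrow> v \<in> carrier V \<Longrightarrow> \<phi> (\<rho> g v) = \<sigma> g (\<phi> v)"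
begin

lemma comp_C: "c \<in> carrier (V.C n) \<Longrightarrow> (\<lambda>gs. \<phi> (c gs)) \<in> carrier (W.C n)"
  using lhomD(1)[OF bar_map_hom[OF V.vsp W.vsp hom]] .

text \<open>Linearity lets \<phi> pass through the signed sums, and equivariance lets it pass
  through the twisted last face.\<close>

lemma boundary_comp:
  assumes c: "c \<in> carrier (V.C (Suc n))"
  shows "boundary G W \<sigma> n (\<lambda>gs. \<phi> (c gs)) = (\<lambda>gs. \<phi> (boundary G V \<rho> n c gs))"
proof
  fix hs
  show "boundary G W \<sigma> n (\<lambda>gs. \<phi> (c gs)) hs = \<phi> (boundary G V \<rho> n c hs)"
  proof (cases "hs \<in> tuples G n")
    case False
    then show ?thesis using lhom_zero[OF V.vsp W.vsp hom] unfolding boundary_def by simp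
  next
    case True
    let ?J = "\<lambda>gs. {j. j \<le> Suc n \<and> bar_face G j gs = hs}"
    let ?t = "\<lambda>gs j. (- 1) ^ j \<odot>\<^bsub>V\<^esub> (if j = Suc n then \<rho> (last gs) (c gs) else c gs)"
    let ?t' = "\<lambda>gs j. (- 1) ^ j \<odot>\<^bsub>W\<^esub> (if j = Suc n then \<sigma> (last gs) (\<phi> (c gs)) else \<phi> (c gs))"
    have cY: "c gs \<in> carrier V" for gs using V.C_Y[OF c] by simp
    have tV: "?t gs j \<in> carrier V" if "gs \<in> tuples G (Suc n)" for gs j
      using cY V.act_cl[OF V.T_ends(2)[OF that]] vsp.smult_cl[OF V.vsp] by (simp del: V.V_simps)
    have t': "\<phi> (?t gs j) = ?t' gs j" if "gs \<in> tuples G (Suc n)" for gs j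
      using lhomD(3)[OF hom] cY V.act_cl[OF V.T_ends(2)[OF that]] equi[OF V.T_ends(2)[OF that]]
      by (simp del: V.V_simps W.V_simps)
    have inner: "finsum V (?t gs) (?J gs) \<in> carrier V" if "gs \<in> tuples G (Suc n)" for gs
      by (rule V.finsum_closed) (use tV[OF that] in \<open>simp add: Pi_iff\<close>)
    have "\<phi> (boundary G V \<rho> n c hs) = \<phi> (finsum V (\<lambda>gs. finsum V (?t gs) (?J gs)) (tuples G (Suc n)))"
      unfolding boundary_def using True by simp
    also have "\<dots> = finsum W (\<lambda>gs. \<phi> (finsum V (?t gs) (?J gs))) (tuples G (Suc n))"
      by (rule lhom_finsum[OF V.vsp W.vsp hom]) (use inner in blast)
    also have "\<dots> = finsum W (\<lambda>gs. finsum W (?t' gs) (?J gs)) (tuples G (Suc n))"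
    proof (rule W.finsum_cong')
      have in': "?t' gs j \<in> carrier W" if "gs \<in> tuples G (Suc n)" for gs j
        using t'[OF that] lhomD(1)[OF hom tV[OF that]] by metis
      show "(\<lambda>gs. finsum W (?t' gs) (?J gs)) \<in> tuples G (Suc n) \<rightarrow> carrier W"
        by (intro Pi_I W.finsum_closed) (rule in')
      fix gs assume gs: "gs \<in> tuples G (Suc n)"
      have "\<phi> (finsum V (?t gs) (?J gs)) = finsum W (\<lambda>j. \<phi> (?t gs j)) (?J gs)"
        by (rule lhom_finsum[OF V.vsp W.vsp hom]) (rule Pi_I, rule tV[OF gs])
      then show "\<phi> (finsum V (?t gs) (?J gs)) = finsum W (?t' gs) (?J gs)" unfolding t'[OF gs] .
    qed simp
    also have "\<dots> = boundary G W \<sigma> n (\<lambda>gs. \<phi> (c gs)) hs"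
      unfolding boundary_def using True by simp
    finally show ?thesis ..
  qed
qed

lemma comp_cycles: "c \<in> cycles G V \<rho> n \<Longrightarrow> (\<lambda>gs. \<phi> (c gs)) \<in> cycles G W \<sigma> n"
proof (cases n)
  case 0
  then show "c \<in> cycles G V \<rho> n \<Longrightarrow> ?thesis" using comp_C[of c 0] by (simp add: cycles_def)
next
  case (Suc m)
  then show "c \<in> cycles G V \<rho> n \<Longrightarrow> ?thesis"
    using comp_C[of c "Suc m"] boundary_comp[of c m] lhom_zero[OF V.vsp W.vsp hom] by (simp add: cycles_def)
qed

lemma comp_boundaries: "c \<in> boundaries G V \<rho> n \<Longrightarrow> (\<lambda>gs. \<phi> (c gs)) \<in> boundaries G W \<sigma> n"
proof -
  assume "c \<in> boundaries G V \<rho> n"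
  then obtain b where b: "b \<in> carrier (V.C (Suc n))" "c = boundary G V \<rho> n b" unfolding boundaries_def by auto
  then have "(\<lambda>gs. \<phi> (c gs)) = boundary G W \<sigma> n (\<lambda>gs. \<phi> (b gs))" using boundary_comp by simp
  then show ?thesis unfolding boundaries_def using comp_C[OF b(1)] by (rule image_eqI)
qed

abbreviation "hmap n \<equiv> quot_map (bar_space G W n) (boundaries G W \<sigma> n) (\<lambda>c. \<phi> \<circ> c)"

lemma hmap_hom: "hmap n \<in> lhom (group_homology G V \<rho> n) (group_homology G W \<sigma> n)"
  and hmap_class: "c \<in> cycles G V \<rho> n \<Longrightarrow> hmap n (V.hclass n c) = W.hclass n (\<lambda>gs. \<phi> (c gs))"
proof -
  have l: "(\<lambda>c. \<phi> \<circ> c) \<in> lhom ((V.C n)\<lparr>carrier := cycles G V \<rho> n\<rparr>) ((W.C n)\<lparr>carrier := cycles G W \<sigma> n\<rparr>)"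
    unfolding comp_def
    by (rule lhom_restrict[OF bar_map_hom[OF V.vsp W.vsp hom]]) (auto simp: V.cycles_C comp_cycles)
  have b: "\<phi> \<circ> c \<in> boundaries G W \<sigma> n" if "c \<in> boundaries G V \<rho> n" for c
    unfolding comp_def by (rule comp_boundaries[OF that])
  show "hmap n \<in> lhom (group_homology G V \<rho> n) (group_homology G W \<sigma> n)"
    unfolding group_homology_def by (rule lhom_quot(1)[OF V.homology_subquot W.homology_subquot l b])
  show "c \<in> cycles G V \<rho> n \<Longrightarrow> hmap n (V.hclass n c) = W.hclass n (\<lambda>gs. \<phi> (c gs))"
    using lhom_quot(2)[OF V.homology_subquot W.homology_subquot l b, of c] by (simp add: comp_def)
qed

end

text \<open>\<open>j\<close> identifies \<open>V\<close> with the summand \<open>j r W\<close> of \<open>W\<close>.\<close>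

lemma homology_retract_dim:
  assumes i: "equivariant_map G V \<rho> I Y W \<sigma> J X j" and r: "equivariant_map G W \<sigma> J X V \<rho> I Y r"
    and ret: "\<And>v. v \<in> carrier V \<Longrightarrow> r (j v) = v"
  shows "vdim (group_homology G V \<rho> n) = vdim ((group_homology G W \<sigma> n)\<lparr>carrier :=
     quot_map (bar_space G W n) (boundaries G W \<sigma> n) (\<lambda>c. (\<lambda>w. j (r w)) \<circ> c) ` carrier (group_homology G W \<sigma> n)\<rparr>)"
proof -
  interpret i: equivariant_map G V \<rho> I Y W \<sigma> J X j by (rule i)
  interpret r: equivariant_map G W \<sigma> J X V \<rho> I Y r by (rule r)
  interpret jr: equivariant_map G W \<sigma> J X W \<sigma> J X "\<lambda>w. j (r w)"
  proof
    show "(\<lambda>w. j (r w)) \<in> lhom W W" using lhom_comp[OF r.hom i.hom] .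
    show "j (r (\<sigma> g v)) = \<sigma> g (j (r v))" if "g \<in> carrier G" "v \<in> carrier W" for g v
      using that r.equi i.equi lhomD(1)[OF r.hom that(2)] by (simp del: i.V.V_simps i.W.V_simps)
  qed
  let ?HV = "group_homology G V \<rho> n" and ?HW = "group_homology G W \<sigma> n"
  have cV: "c gs \<in> carrier V" if "c \<in> cycles G V \<rho> n" for c gs
    using i.V.C_Y[OF i.V.cycles_C[OF that], of gs] by simp
  have ri: "r.hmap n (i.hmap n x) = x" if x: "x \<in> carrier ?HV" for x
  proof -
    obtain c where c: "c \<in> cycles G V \<rho> n" "x = i.V.hclass n c" using x unfolding i.V.homology_carrier by auto
    show ?thesis unfolding c(2) i.hmap_class[OF c(1)] r.hmap_class[OF i.comp_cycles[OF c(1)]]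
      by (simp only: ret[OF cV[OF c(1)]])
  qed
  \<comment> \<open>Since \<open>r\<close> undoes \<open>j\<close>, a class coming from
    \<open>V\<close> is reached by applying \<open>j r\<close> to its own image, and conversely
    \<open>j r\<close> factors through \<open>j\<close>.\<close>
  have im: "i.hmap n ` carrier ?HV = jr.hmap n ` carrier ?HW"
  proof (intro equalityI subsetI)
    fix y assume "y \<in> i.hmap n ` carrier ?HV"
    then obtain c where c: "c \<in> cycles G V \<rho> n" "y = i.hmap n (i.V.hclass n c)" unfolding i.V.homology_carrier by auto
    have jc: "(\<lambda>gs. j (c gs)) \<in> cycles G W \<sigma> n" by (rule i.comp_cycles[OF c(1)])
    have "y = jr.hmap n (i.W.hclass n (\<lambda>gs. j (c gs)))"
      unfolding c(2) i.hmap_class[OF c(1)] jr.hmap_class[OF jc] by (simp only: ret[OF cV[OF c(1)]])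
    then show "y \<in> jr.hmap n ` carrier ?HW" unfolding i.W.homology_carrier using jc by blast
  next
    fix y assume "y \<in> jr.hmap n ` carrier ?HW"
    then obtain c where c: "c \<in> cycles G W \<sigma> n" "y = jr.hmap n (i.W.hclass n c)" unfolding i.W.homology_carrier by auto
    have rc: "(\<lambda>gs. r (c gs)) \<in> cycles G V \<rho> n" by (rule r.comp_cycles[OF c(1)])
    have "y = i.hmap n (i.V.hclass n (\<lambda>gs. r (c gs)))"
      unfolding c(2) i.hmap_class[OF rc] jr.hmap_class[OF c(1)] ..
    then show "y \<in> i.hmap n ` carrier ?HV" unfolding i.V.homology_carrier using rc by blast
  qed
  interpret HV: fvsp ?HV by (rule i.V.homology_fin)
  interpret HW: fvsp ?HW by (rule i.W.homology_fin)
  have sub: "VectorSpace.subspace class_ring (jr.hmap n ` carrier ?HW) ?HW"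
    by (rule lhom_image_subsp[OF HW.vsp_axioms HW.vsp_axioms jr.hmap_hom HW.subsp_carrier])
  show ?thesis
  proof (rule lhom_bij_dim[OF HV.fvsp_axioms HW.subsp_vsp[OF sub]])
    show "i.hmap n \<in> lhom ?HV (?HW\<lparr>carrier := jr.hmap n ` carrier ?HW\<rparr>)"
      by (rule lhomI) (use im lhomD(2,3)[OF i.hmap_hom[of n]] in auto)
    have "inj_on (i.hmap n) (carrier ?HV)" by (rule inj_on_inverseI[where g="r.hmap n"]) (rule ri)
    then show "bij_betw (i.hmap n) (carrier ?HV) (carrier (?HW\<lparr>carrier := jr.hmap n ` carrier ?HW\<rparr>))"
      unfolding bij_betw_def using im by simp
  qed
qed

subsection \<open>Commuting actions on homology\<close>

locale commuting_action = form_rep G V \<rho> I Y + T: lrep A V \<tau>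
  for G :: "('g, 'c) monoid_scheme" and V :: "('k::field, 'b \<Rightarrow> 'k) module" and \<rho> I Y
    and A :: "('a, 'e) monoid_scheme" and \<tau> +
  assumes commute: "a \<in> carrier A \<Longrightarrow> g \<in> carrier G \<Longrightarrow> v \<in> carrier V \<Longrightarrow> \<tau> a (\<rho> g v) = \<rho> g (\<tau> a v)"
begin

lemma em: "a \<in> carrier A \<Longrightarrow> equivariant_map G V \<rho> I Y V \<rho> I Y (\<tau> a)"
  unfolding equivariant_map_def equivariant_map_axioms_def
  using form_rep_axioms T.act_hom commute by blast

abbreviation "hact n \<equiv> \<lambda>a. group_homology_map G V \<rho> n (\<tau> a)"

lemma hact_class: "a \<in> carrier A \<Longrightarrow> c \<in> cycles G V \<rho> n \<Longrightarrow> hact n a (hclass n c) = hclass n (\<lambda>gs. \<tau> a (c gs))"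
  unfolding group_homology_map_def by (rule equivariant_map.hmap_class[OF em])

lemma hact_lrep: "linear_rep A (group_homology G V \<rho> n) (hact n)"
proof (rule lrepI)
  show "group A" by (rule T.grp)
  show "vsp (group_homology G V \<rho> n)" using homology_fin by (simp add: fvsp_def)
  show "hact n a \<in> lhom (group_homology G V \<rho> n) (group_homology G V \<rho> n)" if "a \<in> carrier A" for a
    unfolding group_homology_map_def by (rule equivariant_map.hmap_hom[OF em[OF that]])
  fix x assume "x \<in> carrier (group_homology G V \<rho> n)"
  then obtain c where c: "c \<in> cycles G V \<rho> n" "x = hclass n c" unfolding homology_carrier by auto
  have cV: "c gs \<in> carrier V" for gs using C_Y[OF cycles_C[OF c(1)], of gs] by simp
  show "hact n \<one>\<^bsub>A\<^esub> x = x" unfolding c(2) hact_class[OF T.one_G c(1)] T.act_one[OF cV] ..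
  fix a b assume ab: "a \<in> carrier A" "b \<in> carrier A"
  have abA: "a \<otimes>\<^bsub>A\<^esub> b \<in> carrier A" using T.grp ab by (simp add: group.is_monoid monoid.m_closed)
  have bc: "(\<lambda>gs. \<tau> b (c gs)) \<in> cycles G V \<rho> n" by (rule equivariant_map.comp_cycles[OF em[OF ab(2)] c(1)])
  show "hact n (a \<otimes>\<^bsub>A\<^esub> b) x = hact n a (hact n b x)"
    unfolding c(2) hact_class[OF abA c(1)] hact_class[OF ab(2) c(1)] hact_class[OF ab(1) bc] T.act_mult[OF ab cV] ..
qed

lemma lact_cycles: "glist A a \<Longrightarrow> c \<in> cycles G V \<rho> n \<Longrightarrow> (\<lambda>gs. lact V \<tau> a (c gs)) \<in> cycles G V \<rho> n"
  and lact_class: "glist A a \<Longrightarrow> c \<in> cycles G V \<rho> n \<Longrightarrow>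
    lact (group_homology G V \<rho> n) (hact n) a (hclass n c) = hclass n (\<lambda>gs. lact V \<tau> a (c gs))"
proof (induction a)
  case Nil
  interpret sq: subquot "C n" "boundaries G V \<rho> n" "cycles G V \<rho> n" by (rule homology_subquot)
  { case 1 then show ?case using sq.subspD(2)[OF sq.B] by simp }
  { case 2 show ?case using sq.coset_zero[OF sq.A] by (simp add: group_homology_def sq.Q_zero) }
next
  case (Cons x a)
  interpret sq: subquot "C n" "boundaries G V \<rho> n" "cycles G V \<rho> n" by (rule homology_subquot)
  note D = sq.subspD[OF sq.B]
  have tc: "(\<lambda>gs. \<tau> (snd x) (c gs)) \<in> cycles G V \<rho> n" if "glist A (x # a)" "c \<in> cycles G V \<rho> n"
    using equivariant_map.comp_cycles[OF em that(2), of "snd x"] that by simp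
  have e: "(\<lambda>gs. lact V \<tau> (x # a) (c gs)) =
    (fst x \<odot>\<^bsub>C n\<^esub> (\<lambda>gs. \<tau> (snd x) (c gs))) \<oplus>\<^bsub>C n\<^esub> (\<lambda>gs. lact V \<tau> a (c gs))" by simp
  { case 1
    then have g: "glist A a" by simp
    show ?case unfolding e by (rule D(3)[OF D(4)[OF tc[OF 1]] Cons.IH(1)[OF g 1(2)]]) }
  { case 2
    then have g: "glist A a" "snd x \<in> carrier A" by simp_all
    have s: "fst x \<odot>\<^bsub>C n\<^esub> (\<lambda>gs. \<tau> (snd x) (c gs)) \<in> carrier (C n)" by (rule D(5)[OF D(4)[OF tc[OF 2]]])
    show ?case
      unfolding e lact.simps Cons.IH(2)[OF g(1) 2(2)] hact_class[OF g(2) 2(2)]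
      unfolding group_homology_def
      by (subst sq.Q_smult[OF D(5)[OF tc[OF 2]]], subst sq.Q_add[OF s D(5)[OF Cons.IH(1)[OF g(1) 2(2)]]])
        (simp only: bar_simps(3,4)) }
qed

text \<open>The group algebra acts on a class through the values of a cycle, so a list acting as
  zero on the coefficients acts as zero on homology. This is the substitute for a module structure
  over the Schur algebra.\<close>

lemma homology_relations: "satisfies_relations A V \<tau> (group_homology G V \<rho> n) (hact n)"
  unfolding satisfies_relations_def
proof (intro allI impI ballI)
  fix a x assume a: "glist A a" "\<forall>T\<in>carrier V. lact V \<tau> a T = \<zero>\<^bsub>V\<^esub>" and "x \<in> carrier (group_homology G V \<rho> n)"
  then obtain c where c: "c \<in> cycles G V \<rho> n" "x = hclass n c" unfolding homology_carrier by auto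
  have cV: "c gs \<in> carrier V" for gs using C_Y[OF cycles_C[OF c(1)], of gs] by simp
  have "(\<lambda>gs. lact V \<tau> a (c gs)) = \<zero>\<^bsub>C n\<^esub>" using a(2) cV by simp
  then show "lact (group_homology G V \<rho> n) (hact n) a x = \<zero>\<^bsub>group_homology G V \<rho> n\<^esub>"
    unfolding c(2) lact_class[OF a(1) c(1)]
    using subquot.Q_zero[OF homology_subquot, of n] vsp.coset_zero[OF C_vsp boundaries_subsp, of n]
    by (simp add: group_homology_def)
qed

text \<open>Once an equivariant operator \<phi> on the coefficients is realised by a list, the list
  acts on homology as the induced map of \<phi>. This transports \<open>wproj\<close> and the
  idempotent \<open>eps\<close> to homology.\<close>

lemma lact_homology_image:
  assumes a: "glist A a" and eq: "\<And>v. v \<in> carrier V \<Longrightarrow> lact V \<tau> a v = \<phi> v"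
    and \<phi>: "equivariant_map G V \<rho> I Y V \<rho> I Y \<phi>" and x: "x \<in> carrier (group_homology G V \<rho> n)"
  shows "lact (group_homology G V \<rho> n) (hact n) a x = quot_map (bar_space G V n) (boundaries G V \<rho> n) (\<lambda>c. \<phi> \<circ> c) x"
proof -
  obtain c where c: "c \<in> cycles G V \<rho> n" "x = hclass n c" using x unfolding homology_carrier by auto
  have cV: "c gs \<in> carrier V" for gs using C_Y[OF cycles_C[OF c(1)], of gs] by simp
  show ?thesis unfolding c(2) lact_class[OF a c(1)] equivariant_map.hmap_class[OF \<phi> c(1)] eq[OF cV] ..
qed

end

subsection \<open>Tensor space as a representation\<close>

lemma GL_simps: "carrier (GL d) = {g \<in> carrier_mat d d. det g \<noteq> (0::'k::field)}"
  "mult (GL d) = (*)" "one (GL d) = (1\<^sub>m d :: 'k mat)"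
  using unit_imp_det_non_zero[of _ d "()"] det_non_zero_imp_unit[of _ d "()"]
  by (auto simp: GL_def units_of_def ring_mat_def Units_def)

lemma GL_group: "group (GL d :: 'k::field mat monoid)"
  unfolding GL_def by (rule monoid.units_group) (rule ring.is_monoid[OF ring_mat])

text \<open>The matrix entry of the \<open>d\<close>-fold tensor power of \<open>g\<close> at the
  basis tensors indexed by \<open>I\<close> and \<open>J\<close>.\<close>

abbreviation "kern d g I J \<equiv> (\<Prod>s\<in>{1..d::nat}. g $$ (I s, J s))"

lemma finite_multi_indices: "finite (multi_indices d)"
  unfolding multi_indices_def by (rule finite_PiE) auto

lemma multi_indices_less: "I \<in> multi_indices d \<Longrightarrow> s \<in> {1..d} \<Longrightarrow> I s < d"
  unfolding multi_indices_def by (auto simp: PiE_def Pi_def)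

lemma multi_indices_eqI: "I \<in> multi_indices d \<Longrightarrow> J \<in> multi_indices d \<Longrightarrow> (\<And>s. s \<in> {1..d} \<Longrightarrow> I s = J s) \<Longrightarrow> I = J"
  unfolding multi_indices_def by (rule PiE_ext)

lemma multi_indices_comp: "I \<in> multi_indices d \<Longrightarrow> \<sigma> permutes {1..d} \<Longrightarrow> I \<circ> \<sigma> \<in> multi_indices d"
  unfolding multi_indices_def
  by (auto simp: PiE_def Pi_def extensional_def permutes_in_image permutes_not_in)
     (metis atLeastAtMost_iff permutes_in_image)

lemma multi_indices_comp_iff: "\<sigma> permutes {1..d} \<Longrightarrow> I \<circ> \<sigma> \<in> multi_indices d \<longleftrightarrow> I \<in> multi_indices d"
  using multi_indices_comp[of I d \<sigma>] multi_indices_comp[of "I \<circ> \<sigma>" d "inv' \<sigma>"]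
  by (auto simp: o_assoc[symmetric] permutes_inv_o permutes_inv)

lemma comp_bij_multi_indices: "\<sigma> permutes {1..d} \<Longrightarrow> bij_betw (\<lambda>I. I \<circ> \<sigma>) (multi_indices d) (multi_indices d)"
  by (rule bij_betw_byWitness[where f'="\<lambda>I. I \<circ> inv' \<sigma>"])
    (auto simp: o_assoc[symmetric] permutes_inv_o multi_indices_comp permutes_inv)

lemma kern_comp: "\<sigma> permutes {1..d} \<Longrightarrow> kern d g (I \<circ> \<sigma>) (J \<circ> \<sigma>) = kern d g I J"
  using prod.permute[of \<sigma> "{1..d}" "\<lambda>s. g $$ (I s, J s)"] by (simp add: o_def)

text \<open>A product over places of sums over inner indices expands into a sum over all choices of
  inner indices, that is, over multi-indices.\<close>

lemma kern_mult:
  fixes g h :: "'k::field mat"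
  assumes "g \<in> carrier_mat d d" "h \<in> carrier_mat d d" "I \<in> multi_indices d" "J \<in> multi_indices d"
  shows "kern d (g * h) I J = (\<Sum>L\<in>multi_indices d. kern d g I L * kern d h L J)"
proof -
  have "kern d (g * h) I J = (\<Prod>s\<in>{1..d}. \<Sum>l<d. g $$ (I s, l) * h $$ (l, J s))"
    by (intro prod.cong refl) (use assms multi_indices_less[of _ d] in \<open>auto simp: scalar_prod_def lessThan_atLeast0
      intro!: sum.cong\<close>)
  also have "\<dots> = (\<Sum>L\<in>{1..d} \<rightarrow>\<^sub>E {..<d}. \<Prod>s\<in>{1..d}. g $$ (I s, L s) * h $$ (L s, J s))"
    by (rule prod_sum_PiE) auto
  finally show ?thesis by (simp add: multi_indices_def prod.distrib)
qed

lemma kern_one: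
  assumes "I \<in> multi_indices d" "J \<in> multi_indices d"
  shows "kern d (1\<^sub>m d) I J = (if I = J then 1 else (0 :: 'k::field))"
proof (cases "I = J")
  case True
  have "kern d (1\<^sub>m d :: 'k mat) I J = (\<Prod>s\<in>{1..d}. 1)"
    by (intro prod.cong refl) (use True multi_indices_less[OF assms(1)] in auto)
  then show ?thesis using True by simp
next
  case False
  then obtain s where s: "s \<in> {1..d}" "I s \<noteq> J s" using multi_indices_eqI[OF assms] by blast
  have "(1\<^sub>m d :: 'k mat) $$ (I s, J s) = 0"
    using s multi_indices_less[OF assms(1) s(1)] multi_indices_less[OF assms(2) s(1)] by simp
  then have "kern d (1\<^sub>m d :: 'k mat) I J = 0" using s(1) by (intro prod_zero) auto
  then show ?thesis using False by simp
qed

lemma tensor_space_iff: "T \<in> carrier (tensor_space d) \<longleftrightarrow> (\<forall>I. I \<notin> multi_indices d \<longrightarrow> T I = 0)"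
  by (simp add: tensor_space_def)

lemma tensor_space_simps [simp]: "\<zero>\<^bsub>tensor_space d\<^esub> = (\<lambda>_. 0)" "f \<oplus>\<^bsub>tensor_space d\<^esub> h = (\<lambda>x. f x + h x)"
  "c \<odot>\<^bsub>tensor_space d\<^esub> f = (\<lambda>x. c * f x)"
  by (simp_all add: tensor_space_def)

lemma tensor_vsp: "vsp (tensor_space d)" unfolding tensor_space_def by (rule coeff_space_vsp)

lemma tensor_act_hom: "tensor_act d g \<in> lhom (tensor_space d) (tensor_space d)"
  by (rule lhomI) (auto simp: tensor_space_iff tensor_act_def fun_eq_iff sum.distrib algebra_simps sum_distrib_left)

lemma tensor_rep: "linear_rep (GL d) (tensor_space d :: ('k::field, _) module) (tensor_act d)"
proof (rule lrepI)
  fix v :: "(nat \<Rightarrow> nat) \<Rightarrow> 'k" assume v: "v \<in> carrier (tensor_space d)"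
  show "tensor_act d \<one>\<^bsub>GL d\<^esub> v = v"
  proof
    fix I
    show "tensor_act d \<one>\<^bsub>GL d\<^esub> v I = v I"
    proof (cases "I \<in> multi_indices d")
      case True
      have "tensor_act d \<one>\<^bsub>GL d\<^esub> v I = (\<Sum>J\<in>multi_indices d. if I = J then v J else 0)"
        unfolding tensor_act_def if_P[OF True] GL_simps(3) by (intro sum.cong refl) (simp only: kern_one[OF True], simp)
      then show ?thesis using True finite_multi_indices by simp
    next
      case False then show ?thesis using v by (simp add: tensor_act_def tensor_space_iff)
    qed
  qed
  fix g h :: "'k mat" assume gh: "g \<in> carrier (GL d)" "h \<in> carrier (GL d)"
  show "tensor_act d (g \<otimes>\<^bsub>GL d\<^esub> h) v = tensor_act d g (tensor_act d h v)"
  proof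
    fix I
    show "tensor_act d (g \<otimes>\<^bsub>GL d\<^esub> h) v I = tensor_act d g (tensor_act d h v) I"
    proof (cases "I \<in> multi_indices d")
      case True
      have "tensor_act d (g \<otimes>\<^bsub>GL d\<^esub> h) v I = (\<Sum>J\<in>multi_indices d. \<Sum>L\<in>multi_indices d. kern d g I L * kern d h L J * v J)"
        unfolding tensor_act_def if_P[OF True] GL_simps(2) sum_distrib_right[symmetric]
        by (intro sum.cong refl arg_cong2[where f="(*)"] kern_mult) (use True gh in \<open>auto simp: GL_simps\<close>)
      also have "\<dots> = (\<Sum>L\<in>multi_indices d. \<Sum>J\<in>multi_indices d. kern d g I L * kern d h L J * v J)" by (rule sum.swap)
      also have "\<dots> = tensor_act d g (tensor_act d h v) I"
        using True by (simp add: tensor_act_def sum_distrib_left mult.assoc)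
      finally show ?thesis .
    qed (simp add: tensor_act_def)
  qed
qed (auto intro: GL_group tensor_vsp tensor_act_hom)

lemma sym_simps: "\<sigma> \<in> carrier (sym_group d) \<longleftrightarrow> \<sigma> permutes {1..d}" "mult (sym_group d) = (\<circ>)" "one (sym_group d) = id"
  by (simp_all add: sym_group_def)

lemma sym_finite: "finite (carrier (sym_group d))"
  unfolding sym_group_def by (simp add: finite_permutations)

lemma place_act_in: "\<sigma> permutes {1..d} \<Longrightarrow> T \<in> carrier (tensor_space d) \<Longrightarrow> place_act \<sigma> T \<in> carrier (tensor_space d)"
  by (auto simp: tensor_space_iff place_act_def multi_indices_comp_iff)

lemma place_rep: "linear_rep (sym_group d) (tensor_space d :: ('k::field, _) module) place_act"
  by (rule lrepI)
    (auto simp: sym_group_is_group tensor_vsp sym_simps place_act_in place_act_def o_assoc intro!: lhomI)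

lemma tensor_form_rep: "form_rep (sym_group d) (tensor_space d :: ('k::field, _) module) place_act (multi_indices d)
  (carrier (tensor_space d))"
proof -
  show ?thesis unfolding form_rep_def form_rep_axioms_def lrep_def
  proof (intro conjI allI impI)
    show "tensor_space d = coeff_space (multi_indices d)\<lparr>carrier := carrier (tensor_space d)\<rparr>"
      by (simp add: tensor_space_def coeff_space_def)
    show "VectorSpace.subspace class_ring (carrier (tensor_space d)) (coeff_space (multi_indices d))"
      unfolding tensor_space_def by (rule vsp.subsp_carrier[OF coeff_space_vsp])
    fix \<sigma> u v assume "\<sigma> \<in> carrier (sym_group d)"
    then have "\<sigma> permutes {1..d}" by (simp add: sym_simps)
    then show "(\<Sum>x\<in>multi_indices d. place_act \<sigma> u x * place_act \<sigma> v x) = (\<Sum>x\<in>multi_indices d. u x * v x :: 'k)"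
      using sum.reindex_bij_betw[OF comp_bij_multi_indices, of \<sigma> d "\<lambda>x. u x * v x"] by (simp add: place_act_def)
  next
    fix u :: "(nat \<Rightarrow> nat) \<Rightarrow> 'k" assume u: "u \<in> carrier (tensor_space d)"
      and z': "\<forall>v. v \<in> carrier (tensor_space d) \<longrightarrow> (\<Sum>x\<in>multi_indices d. u x * v x) = 0"
    note z = z'[rule_format]

    show "u = (\<lambda>_. 0)"
    proof
      fix I
      show "u I = 0"
      proof (cases "I \<in> multi_indices d")
        case True
        have "(\<Sum>x\<in>multi_indices d. u x * delta I x) = 0"
          by (rule z) (use True in \<open>auto simp: tensor_space_iff delta_def\<close>)
        also have "(\<Sum>x\<in>multi_indices d. u x * delta I x) = (\<Sum>x\<in>multi_indices d. if x = I then u x else 0)"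
          by (intro sum.cong refl) (simp add: delta_def)
        finally show ?thesis using True finite_multi_indices by simp
      qed (use u in \<open>simp add: tensor_space_iff\<close>)
    qed
  qed (simp_all add: sym_finite finite_multi_indices place_rep)
qed

lemma tensor_place_commute:
  assumes "\<sigma> permutes {1..d}"
  shows "tensor_act d g (place_act \<sigma> T) = place_act \<sigma> (tensor_act d g T)"
proof
  fix I
  show "tensor_act d g (place_act \<sigma> T) I = place_act \<sigma> (tensor_act d g T) I"
  proof (cases "I \<in> multi_indices d")
    case True
    have "place_act \<sigma> (tensor_act d g T) I = (\<Sum>J\<in>multi_indices d. kern d g (I \<circ> \<sigma>) J * T J)"
      using multi_indices_comp[OF True assms] by (simp add: place_act_def tensor_act_def)
    also have "\<dots> = (\<Sum>J\<in>multi_indices d. kern d g (I \<circ> \<sigma>) (J \<circ> \<sigma>) * T (J \<circ> \<sigma>))"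
      by (rule sum.reindex_bij_betw[OF comp_bij_multi_indices[OF assms], symmetric])
    also have "\<dots> = tensor_act d g (place_act \<sigma> T) I"
      using True kern_comp[OF assms, of g I] by (simp add: place_act_def tensor_act_def)
    finally show ?thesis ..
  qed (simp add: place_act_def tensor_act_def multi_indices_comp_iff[OF assms])
qed

lemma tensor_commuting: "commuting_action (sym_group d) (tensor_space d :: ('k::field, _) module) place_act
   (multi_indices d) (carrier (tensor_space d)) (GL d) (tensor_act d)"
  unfolding commuting_action_def commuting_action_axioms_def lrep_def
  using tensor_form_rep tensor_rep tensor_place_commute by (auto simp: sym_simps simp del: One_nat_def)

subsection \<open>Equivariant maps of tensor space come from the general linear group\<close>

text \<open>Over a finite field the product of all \<open>x - a\<close> vanishes everywhere, so
  adding 1 gives a polynomial of positive degree without roots.\<close>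

lemma alg_closed_infinite: "infinite (UNIV :: 'k::alg_closed_field set)"
proof
  assume fin: "finite (UNIV :: 'k set)"
  define p where "p = (\<Prod>a\<in>(UNIV :: 'k set). [:- a, 1:]) + 1"
  have deg: "degree (\<Prod>a\<in>(UNIV :: 'k set). [:- a, 1:]) = card (UNIV :: 'k set)"
    by (subst degree_prod_eq_sum_degree) auto
  have "card (UNIV :: 'k set) > 0" using fin by (simp add: card_gt_0_iff)
  then have "degree p > 0" using deg unfolding p_def by (subst degree_add_eq_left) auto
  then obtain z where "poly p z = 0" using alg_closed_imp_poly_has_root by blast
  moreover have "poly (\<Prod>a\<in>(UNIV :: 'k set). [:- a, 1:]) z = 0"
    using fin by (simp add: poly_prod)
  ultimately show False by (simp add: p_def)
qed

text \<open>The predicate \<open>W\<close> plays the part of a linear subspace of functions.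
  Splitting off the factor \<open>X - t0\<close> expresses the values of the quotient at the other
  points of \<open>S\<close> as combinations of values of \<open>P\<close>, so the coefficients
  follow by induction on the degree without inverting a Vandermonde matrix.\<close>

lemma coeffs_in_closed_family:
  fixes P :: "'x \<Rightarrow> 'k::field poly"
  assumes add: "\<And>f h. W f \<Longrightarrow> W h \<Longrightarrow> W (\<lambda>x. f x + h x)" and scale: "\<And>c f. W f \<Longrightarrow> W (\<lambda>x. c * f x)"
  shows "infinite S \<Longrightarrow> (\<And>t. t \<in> S \<Longrightarrow> W (\<lambda>x. poly (P x) t)) \<Longrightarrow> (\<And>x. degree (P x) \<le> n) \<Longrightarrow> W (\<lambda>x. coeff (P x) k)"
proof (induction n arbitrary: P S k)
  case 0
  obtain t where t: "t \<in> S" using 0(1) by fastforce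
  have "W (\<lambda>x. (if k = 0 then 1 else 0) * poly (P x) t)" by (rule scale[OF 0(2)[OF t]])
  moreover have "(if k = 0 then 1 else 0) * poly (P x) t = coeff (P x) k" for x
  proof -
    obtain c where "P x = [:c:]" using 0(3)[of x] degree_eq_zeroE by auto
    then show ?thesis by (cases k) auto
  qed
  ultimately show ?case by simp
next
  case (Suc n)
  obtain t0 where t0: "t0 \<in> S" using Suc(2) by fastforce
  define Q where "Q x = synthetic_div (P x) t0" for x
  have PQ: "P x = [:- t0, 1:] * Q x + [:poly (P x) t0:]" for x
    unfolding Q_def by (rule synthetic_div_correct'[symmetric])
  have WQ: "W (\<lambda>x. coeff (Q x) k)" for k
  proof (rule Suc.IH)
    show "infinite (S - {t0})" using Suc(2) by simp
    show "degree (Q x) \<le> n" for x using Suc(4)[of x] by (simp add: Q_def degree_synthetic_div)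
    fix t assume t: "t \<in> S - {t0}"
    have "W (\<lambda>x. inverse (t - t0) * (poly (P x) t + (-1) * poly (P x) t0))"
      by (intro scale add Suc(3)) (use t t0 in auto)
    moreover have "inverse (t - t0) * (poly (P x) t + (-1) * poly (P x) t0) = poly (Q x) t" for x
    proof -
      have "poly (P x) t = (t - t0) * poly (Q x) t + poly (P x) t0"
        by (subst PQ) (simp add: algebra_simps)
      then show ?thesis using t by simp
    qed
    ultimately show "W (\<lambda>x. poly (Q x) t)" by simp
  qed
  have c0: "coeff (P x) k = (if k = 0 then 0 else coeff (Q x) (k - 1)) - t0 * coeff (Q x) k + (if k = 0 then poly (P x)
    t0 else 0)" for x
    by (subst PQ) (auto simp: coeff_pCons split: nat.split)
  show ?case
  proof (cases "k = 0")
    case True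
    have "W (\<lambda>x. (- t0) * coeff (Q x) k + poly (P x) t0)" by (intro add scale WQ Suc(3) t0)
    then show ?thesis unfolding c0 using True by simp
  next
    case False
    have "W (\<lambda>x. coeff (Q x) (k - 1) + (- t0) * coeff (Q x) k)" by (intro add scale WQ)
    then show ?thesis unfolding c0 using False by simp
  qed
qed

text \<open>The multiplicities are the digits in base \<open>B\<close>. The parts of
  \<open>M\<close> and \<open>N\<close> that are not common are compared: the one with the largest
  exponent would have the larger sum.\<close>

lemma sum_powers_inj:
  fixes M N :: "nat multiset"
  assumes "size M < B" "size N < B" "(\<Sum>x\<in>#M. B ^ x) = (\<Sum>x\<in>#N. B ^ x)"
  shows "M = N"
proof (rule ccontr)
  assume ne: "M \<noteq> N"
  \<comment> \<open>If \<open>y\<close> in \<open>D\<close> exceeds all exponents in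
    \<open>D'\<close>, then the sum over \<open>D'\<close> times \<open>B\<close> is at most
    \<open>size D'\<close> times \<open>B^y\<close>, which is less than \<open>B\<close> times
    \<open>B^y\<close> and hence less than the sum over \<open>D\<close> times
    \<open>B\<close>.\<close>
  have key: "D = {#}" if sz: "size D' < B" and s: "(\<Sum>x\<in>#D. B ^ x) = (\<Sum>x\<in>#D'. B ^ x)" and disj: "D \<inter># D' = {#}"
    and mx: "\<forall>x\<in>#D. \<exists>y\<in>#D. x \<le> y \<and> (\<forall>z\<in>#D'. z < y)" for D D' :: "nat multiset"
  proof (rule ccontr)
    assume "D \<noteq> {#}"
    then obtain y where y: "y \<in># D" "\<forall>z\<in>#D'. z < y" using mx by (meson multiset_nonemptyE)
    obtain D1 where D1: "D = add_mset y D1" using y(1) by (rule mset_add)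
    have B0: "B > 0" using sz by simp
    have le: "(\<Sum>x\<in>#E. B ^ x) * B \<le> size E * B ^ y" if "\<forall>z\<in>#E. z < y" for E :: "nat multiset"
      using that
    proof (induction E)
      case (add z E)
      have "B ^ Suc z \<le> B ^ y" by (rule power_increasing) (use add.prems B0 in auto)
      then have "B ^ z * B \<le> B ^ y" by (simp only: power_Suc2)
      moreover have "(\<Sum>x\<in>#E. B ^ x) * B \<le> size E * B ^ y" by (rule add.IH) (use add.prems in simp)
      moreover have "(\<Sum>x\<in>#add_mset z E. B ^ x) * B = B ^ z * B + (\<Sum>x\<in>#E. B ^ x) * B"
        by (simp only: image_mset_add_mset sum_mset.add_mset distrib_right)
      ultimately show ?case unfolding size_add_mset mult_Suc by linarith
    qed simp
    have "B ^ y * B \<le> (\<Sum>x\<in>#D. B ^ x) * B" unfolding D1 by simp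
    also have "\<dots> \<le> size D' * B ^ y" using le[OF y(2)] s by simp
    also have "\<dots> < B * B ^ y" using sz B0 by simp
    finally show False by (simp add: mult.commute)
  qed
  define D where "D = M - N" define D' where "D' = N - M"
  have M: "M = D + (M \<inter># N)" and N: "N = D' + (M \<inter># N)"
    unfolding D_def D'_def by (auto simp: multiset_eq_iff)
  have s: "(\<Sum>x\<in>#D. B ^ x) = (\<Sum>x\<in>#D'. B ^ x)"
    using assms(3) arg_cong[OF M, of "\<lambda>M. \<Sum>x\<in>#M. B ^ x"] arg_cong[OF N, of "\<lambda>M. \<Sum>x\<in>#M. B ^ x"] by simp
  have sz: "size D < B" "size D' < B"
    using assms(1,2) size_mset_mono[of D M] size_mset_mono[of D' N] by (auto simp: D_def D'_def)
  have disj: "D \<inter># D' = {#}" "D' \<inter># D = {#}" unfolding D_def D'_def by (auto simp: multiset_eq_iff)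
  have B0: "B > 0" using assms(1) by simp
  have z: "E = {#}" if "(\<Sum>x\<in>#E. B ^ x) = 0" for E :: "nat multiset"
    using that B0 by (cases E) auto
  have "D = {#} \<longleftrightarrow> D' = {#}" using z[of D] z[of D'] s by auto
  moreover have "\<not> (D = {#} \<and> D' = {#})" using M N ne by auto
  ultimately have neD: "D \<noteq> {#}" "D' \<noteq> {#}" by auto
  define x where "x = Max (set_mset D)" define y where "y = Max (set_mset D')"
  have x: "x \<in># D" "\<forall>z\<in>#D. z \<le> x" unfolding x_def using neD by auto
  have y: "y \<in># D'" "\<forall>z\<in>#D'. z \<le> y" unfolding y_def using neD by auto
  have "x \<noteq> y"
  proof
    assume "x = y"
    then have "x \<in># D \<inter># D'" using x y by simp
    then show False using disj by simp
  qed
  then consider "y < x" | "x < y" by linarith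
  then show False
  proof cases
    case 1
    have "D = {#}" by (rule key[OF sz(2) s disj(1)]) (use 1 x y in \<open>meson le_less_trans\<close>)
    then show False using neD by simp
  next
    case 2
    have "D' = {#}" by (rule key[OF sz(1) s[symmetric] disj(2)]) (use 2 x y in \<open>meson le_less_trans\<close>)
    then show False using neD by simp
  qed
qed

text \<open>The families of matrix entries of those operators on tensor space that come from the
  group algebra of GL. They are closed under linear combinations, so interpolation in a parameter
  applies to them.\<close>

definition kernel_span :: "nat \<Rightarrow> ((nat \<Rightarrow> nat) \<times> (nat \<Rightarrow> nat) \<Rightarrow> 'k::field) \<Rightarrow> bool" where
  "kernel_span d K \<longleftrightarrow> (\<exists>l. glist (GL d) l \<and> (\<forall>I\<in>multi_indices d. \<forall>J\<in>multi_indices d.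
     lext (\<lambda>g. kern d g I J) l = K (I, J)))"

lemma lext_append: "lext F (a @ b) = lext F a + lext F b" by (simp add: lext_def)
lemma lext_lsc: "lext F (lsc c a) = c * lext F a" by (induction a) (auto simp: lsc_def algebra_simps)

lemma kernel_span_add: "kernel_span d K \<Longrightarrow> kernel_span d K' \<Longrightarrow> kernel_span d (\<lambda>x. K x + K' x)"
  unfolding kernel_span_def
proof (elim exE conjE)
  fix l l' assume a: "glist (GL d) l" "glist (GL d) l'"
    "\<forall>I\<in>multi_indices d. \<forall>J\<in>multi_indices d. lext (\<lambda>g. kern d g I J) l = K (I, J)"
    "\<forall>I\<in>multi_indices d. \<forall>J\<in>multi_indices d. lext (\<lambda>g. kern d g I J) l' = K' (I, J)"
  show "\<exists>l. glist (GL d) l \<and> (\<forall>I\<in>multi_indices d. \<forall>J\<in>multi_indices d. lext (\<lambda>g. kern d g I J) l = K (I, J) + K' (I, J))"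
    by (intro exI[of _ "l @ l'"] conjI ballI) (simp_all add: a lext_append del: One_nat_def)
qed

lemma kernel_span_scale: "kernel_span d K \<Longrightarrow> kernel_span d (\<lambda>x. c * K x)"
  unfolding kernel_span_def
proof (elim exE conjE)
  fix l assume a: "glist (GL d) l"
    "\<forall>I\<in>multi_indices d. \<forall>J\<in>multi_indices d. lext (\<lambda>g. kern d g I J) l = K (I, J)"
  show "\<exists>l. glist (GL d) l \<and> (\<forall>I\<in>multi_indices d. \<forall>J\<in>multi_indices d. lext (\<lambda>g. kern d g I J) l = c * K (I, J))"
    by (intro exI[of _ "lsc c l"] conjI ballI) (simp_all add: a lext_lsc del: One_nat_def)
qed

lemma kernel_span_zero: "kernel_span d (\<lambda>_. 0)"
  unfolding kernel_span_def by (intro exI[of _ "[]"]) simp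

lemma kernel_span_sum: "(\<And>a. a \<in> A \<Longrightarrow> kernel_span d (K a)) \<Longrightarrow> kernel_span d (\<lambda>x. \<Sum>a\<in>A. K a x)"
  by (induction A rule: infinite_finite_induct) (simp_all add: kernel_span_zero kernel_span_add)

lemma kernel_span_cong: "kernel_span d K \<Longrightarrow> (\<And>I J. I \<in> multi_indices d \<Longrightarrow> J \<in> multi_indices d \<Longrightarrow> K (I, J) = K' (I, J)) \<Longrightarrow>
  kernel_span d K'"
  unfolding kernel_span_def by auto

lemma kernel_span_GL: "g \<in> carrier (GL d) \<Longrightarrow> kernel_span d (\<lambda>(I, J). kern d g I J)"
  unfolding kernel_span_def by (intro exI[of _ "[(1, g)]"]) simp

text \<open>Even if \<open>A\<close> is singular, \<open>A + t\<close> is invertible for all but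
  finitely many \<open>t\<close>. The entries of its tensor power are polynomials in
  \<open>t\<close> whose constant coefficients are the entries for \<open>A\<close>.\<close>

lemma kernel_span_matrix:
  fixes A :: "'k::field mat"
  assumes inf: "infinite (UNIV :: 'k set)" and A: "A \<in> carrier_mat d d"
  shows "kernel_span d (\<lambda>(I, J). kern d A I J)"
proof -
  define P where "P = (\<lambda>(I, J). \<Prod>s\<in>{1..d}. [:A $$ (I s, J s), if I s = J s then 1 else 0:])"
  define S where "S = {t. det (A + t \<cdot>\<^sub>m 1\<^sub>m d) \<noteq> 0}"
  have mA: "- A \<in> carrier_mat d d" using A by simp
  \<comment> \<open>The determinant of \<open>A + t\<close> is the characteristic polynomial of
    \<open>- A\<close> at \<open>t\<close>, which has finitely many roots.\<close>
  have "t \<in> S" if "poly (char_poly (- A)) t \<noteq> 0" for t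
  proof -
    have "poly (char_poly (- A)) t = det (- char_matrix (- A) t)"
      by (rule char_poly_matrix[OF mA])
    moreover have "- char_matrix (- A) t = A + t \<cdot>\<^sub>m 1\<^sub>m d"
      using A by (intro eq_matI) (auto simp: char_matrix_def)
    ultimately show ?thesis using that unfolding S_def by simp
  qed
  then have "UNIV - S \<subseteq> {t. poly (char_poly (- A)) t = 0}" by blast
  moreover have "char_poly (- A) \<noteq> 0" using degree_monic_char_poly[OF mA] by auto
  ultimately have "finite (UNIV - S)" using poly_roots_finite finite_subset by blast
  then have "infinite S" using inf finite_UnI[of "UNIV - S" S] by auto
  have W: "kernel_span d (\<lambda>x. poly (P x) t)" if "t \<in> S" for t
  proof (rule kernel_span_cong[OF kernel_span_GL[of "A + t \<cdot>\<^sub>m 1\<^sub>m d"]])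
    show "A + t \<cdot>\<^sub>m 1\<^sub>m d \<in> carrier (GL d)" using that A by (simp add: GL_simps S_def)
    fix I J assume I: "I \<in> multi_indices d" and J: "J \<in> multi_indices d"
    have "kern d (A + t \<cdot>\<^sub>m 1\<^sub>m d) I J = poly (P (I, J)) t"
      unfolding P_def poly_prod split
      by (intro prod.cong refl) (use A multi_indices_less[OF I] multi_indices_less[OF J] in auto)
    then show "(case (I, J) of (I, J) \<Rightarrow> kern d (A + t \<cdot>\<^sub>m 1\<^sub>m d) I J) = poly (P (I, J)) t" by simp
  qed
  have deg: "degree (P x) \<le> d" for x
  proof -
    obtain I J where x: "x = (I, J)" by (cases x)
    have "degree (P x) \<le> (\<Sum>s\<in>{1..d}. degree [:A $$ (I s, J s), if I s = J s then 1 else 0:])"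
      unfolding x P_def split by (rule degree_prod_sum_le[OF finite_atLeastAtMost, unfolded o_def])
    also have "\<dots> \<le> (\<Sum>s\<in>{1..d}. 1)" by (rule sum_mono) simp
    finally show ?thesis by simp
  qed
  have "kernel_span d (\<lambda>x. coeff (P x) 0)"
    by (rule coeffs_in_closed_family[where W="kernel_span d", OF kernel_span_add kernel_span_scale \<open>infinite S\<close> W deg])
  then show ?thesis
    by (rule kernel_span_cong) (simp add: P_def poly_0_coeff_0[symmetric] poly_prod)
qed

text \<open>An orbit of pairs (I, J) corresponds to the monomial in variables \<open>x_ab\<close>
  with one factor for each place. Kronecker's substitution of \<open>t^(B^(a d + b))\<close> for
  \<open>x_ab\<close> turns different monomials into different powers of \<open>t\<close>. So each
  coefficient is the indicator of one orbit, and an invariant family is a combination of these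
  indicators.\<close>

lemma equivariant_kernel_span:
  fixes A :: "(nat \<Rightarrow> nat) \<times> (nat \<Rightarrow> nat) \<Rightarrow> 'k::field"
  assumes inf: "infinite (UNIV :: 'k set)"
    and eq: "\<And>\<sigma> I J. \<sigma> permutes {1..d} \<Longrightarrow> I \<in> multi_indices d \<Longrightarrow> J \<in> multi_indices d \<Longrightarrow> A (I \<circ> \<sigma>, J \<circ> \<sigma>) = A (I, J)"
  shows "kernel_span d A"
proof -
  \<comment> \<open>The base exceeds \<open>d\<close>, the number of places, so that no digit
    overflows.\<close>
  let ?M = "multi_indices d" and ?B = "Suc d"
  \<comment> \<open>Division by \<open>d\<close> recovers both indices, as
    \<open>J s < d\<close>.\<close>
  define e where "e I J s = I s * d + J s" for I J :: "nat \<Rightarrow> nat" and s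
  define N where "N I J = (\<Sum>s\<in>{1..d}. ?B ^ e I J s)" for I J
  have sep: "A (I, J) = A (I', J')" if M: "I \<in> ?M" "J \<in> ?M" "I' \<in> ?M" "J' \<in> ?M" and n: "N I J = N I' J'" for I J I' J'
  proof -
    have "image_mset (e I J) (mset_set {1..d}) = image_mset (e I' J') (mset_set {1..d})"
    proof (rule sum_powers_inj[of _ ?B])
      show "(\<Sum>x\<in>#image_mset (e I J) (mset_set {1..d}). ?B ^ x) = (\<Sum>x\<in>#image_mset (e I' J') (mset_set {1..d}). ?B ^ x)"
        using n by (simp add: N_def image_mset.compositionality o_def sum_unfold_sum_mset)
    qed simp_all
    then obtain p where p: "p permutes {1..d}" "\<forall>s\<in>{1..d}. e I J s = e I' J' (p s)"
      by (rule image_mset_eq_implies_permutes[OF finite_atLeastAtMost])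
    have *: "I s = I' (p s) \<and> J s = J' (p s)" if s: "s \<in> {1..d}" for s
    proof -
      have ps: "p s \<in> {1..d}" using permutes_in_image[OF p(1)] s by blast
      have J: "J s < d" "J' (p s) < d" using multi_indices_less[OF M(2) s] multi_indices_less[OF M(4) ps] .
      have eq: "I s * d + J s = I' (p s) * d + J' (p s)" using p(2) s by (simp add: e_def)
      have "(I s * d + J s) div d = I s" "(I' (p s) * d + J' (p s)) div d = I' (p s)"
        using J by simp_all
      then have "I s = I' (p s)" using eq by metis
      then show ?thesis using eq by simp
    qed
    have "I = I' \<circ> p" by (rule multi_indices_eqI[OF M(1) multi_indices_comp[OF M(3) p(1)]]) (use * in simp)
    moreover have "J = J' \<circ> p" by (rule multi_indices_eqI[OF M(2) multi_indices_comp[OF M(4) p(1)]]) (use * in simp)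
    ultimately show ?thesis using eq[OF p(1) M(3,4)] by simp
  qed
  define P where "P = (\<lambda>(I, J). if I \<in> ?M \<and> J \<in> ?M then monom (1::'k) (N I J) else 0)"
  define R where "R = (\<lambda>(I, J). N I J) ` (?M \<times> ?M)"
  have finR: "finite R" unfolding R_def using finite_multi_indices by simp
  have deg: "degree (P x) \<le> Max (insert 0 R)" for x
    using finR by (auto simp: P_def R_def degree_monom_eq split: prod.splits intro!: Max_ge)
  \<comment> \<open>The substituted matrix can be singular, which is why arbitrary matrices were
    treated beforehand.\<close>
  have W: "kernel_span d (\<lambda>x. poly (P x) t)" for t
  proof (rule kernel_span_cong[OF kernel_span_matrix[OF inf, of "mat d d (\<lambda>(a, b). t ^ (?B ^ (a * d + b)))"]])
    fix I J assume I: "I \<in> ?M" and J: "J \<in> ?M"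
    have "kern d (mat d d (\<lambda>(a, b). t ^ (?B ^ (a * d + b)))) I J = (\<Prod>s\<in>{1..d}. t ^ (?B ^ e I J s))"
      by (intro prod.cong refl) (use multi_indices_less[OF I] multi_indices_less[OF J] in \<open>auto simp: e_def\<close>)
    also have "\<dots> = t ^ N I J" unfolding N_def by (rule power_sum[symmetric])
    finally show "(case (I, J) of (I, J) \<Rightarrow> kern d (mat d d (\<lambda>(a, b). t ^ (?B ^ (a * d + b)))) I J) = poly (P (I, J)) t"
      using I J by (simp add: P_def poly_monom)
  qed simp
  have Wc: "kernel_span d (\<lambda>x. coeff (P x) n)" for n
    by (rule coeffs_in_closed_family[where W="kernel_span d" and S=UNIV, OF kernel_span_add kernel_span_scale inf W deg])
  \<comment> \<open>The common value of \<open>A\<close> on the pairs with exponent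
    \<open>n\<close>; by \<open>sep\<close> the choice does not matter.\<close>
  define \<alpha> where "\<alpha> n = A (SOME x. case x of (I, J) \<Rightarrow> I \<in> ?M \<and> J \<in> ?M \<and> N I J = n)" for n
  have "kernel_span d (\<lambda>x. \<Sum>n\<in>R. \<alpha> n * coeff (P x) n)"
    by (intro kernel_span_sum kernel_span_scale Wc)
  then show ?thesis
  proof (rule kernel_span_cong)
    fix I J assume M: "I \<in> ?M" "J \<in> ?M"
    have NR: "N I J \<in> R" unfolding R_def by (rule image_eqI[of _ _ "(I, J)"]) (use M in simp_all)
    have "(\<Sum>n\<in>R. \<alpha> n * coeff (P (I, J)) n) = (\<Sum>n\<in>R. if n = N I J then \<alpha> n else 0)"
    proof (intro sum.cong refl)
      fix n show "\<alpha> n * coeff (P (I, J)) n = (if n = N I J then \<alpha> n else 0)"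
        unfolding P_def split using M by simp
    qed
    also have "\<dots> = \<alpha> (N I J)" by (subst sum.delta[OF finR]) (simp add: NR)
    finally have s: "(\<Sum>n\<in>R. \<alpha> n * coeff (P (I, J)) n) = \<alpha> (N I J)" .
    define x where "x = (SOME x. case x of (I', J') \<Rightarrow> I' \<in> ?M \<and> J' \<in> ?M \<and> N I' J' = N I J)"
    have x: "case x of (I', J') \<Rightarrow> I' \<in> ?M \<and> J' \<in> ?M \<and> N I' J' = N I J"
      unfolding x_def by (rule someI[of _ "(I, J)"]) (simp add: M)
    obtain I' J' where xx: "x = (I', J')" by (rule prod.exhaust)
    have x': "I' \<in> ?M" "J' \<in> ?M" "N I' J' = N I J" using x unfolding xx by simp_all
    have "\<alpha> (N I J) = A x" unfolding \<alpha>_def x_def ..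
    also have "A x = A (I, J)" unfolding xx by (rule sep[OF x'(1,2) M x'(3)])
    finally show "(\<Sum>n\<in>R. \<alpha> n * coeff (P (I, J)) n) = A (I, J)" unfolding s .
  qed
qed

lemma lact_tensor:
  "glist (GL d) l \<Longrightarrow> lact (tensor_space d) (tensor_act d) l T =
    (\<lambda>I. if I \<in> multi_indices d then \<Sum>J\<in>multi_indices d. lext (\<lambda>g. kern d g I J) l * T J else 0)"
  by (induction l) (auto simp: fun_eq_iff tensor_act_def sum.distrib sum_distrib_left algebra_simps)

text \<open>One half of Schur-Weyl duality over an infinite field: the matrix of an equivariant map
  is constant on the orbits of pairs of multi-indices, so \<open>equivariant_kernel_span\<close>
  applies to it.\<close>

theorem equivariant_from_GL:
  fixes a :: "((nat \<Rightarrow> nat) \<Rightarrow> 'k::field) \<Rightarrow> (nat \<Rightarrow> nat) \<Rightarrow> 'k"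
  assumes inf: "infinite (UNIV :: 'k set)" and a: "a \<in> lhom (tensor_space d) (tensor_space d)"
    and eq: "\<And>\<sigma> T. \<sigma> permutes {1..d} \<Longrightarrow> T \<in> carrier (tensor_space d) \<Longrightarrow> a (place_act \<sigma> T) = place_act \<sigma> (a T)"
  shows "\<exists>l. glist (GL d) l \<and> (\<forall>T\<in>carrier (tensor_space d). lact (tensor_space d) (tensor_act d) l T = a T)"
proof -
  let ?M = "multi_indices d" and ?E = "tensor_space d :: ('k, _) module"
  have dE: "delta J \<in> carrier ?E" if "J \<in> ?M" for J using delta_in[OF that] by (simp add: tensor_space_def)
  define A where "A = (\<lambda>(I, J). a (delta J) I)"
  have eqA: "A (I \<circ> \<sigma>, J \<circ> \<sigma>) = A (I, J)" if \<sigma>: "\<sigma> permutes {1..d}" and I: "I \<in> ?M" and J: "J \<in> ?M" for \<sigma> I J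
  proof -
    have "place_act \<sigma> (delta (J \<circ> \<sigma>)) = (delta J :: _ \<Rightarrow> 'k)"
    proof
      fix L
      have "L \<circ> \<sigma> = J \<circ> \<sigma> \<longleftrightarrow> L = J"
      proof
        assume "L \<circ> \<sigma> = J \<circ> \<sigma>"
        then have "L \<circ> \<sigma> \<circ> inv' \<sigma> = J \<circ> \<sigma> \<circ> inv' \<sigma>" by (rule arg_cong)
        then show "L = J" by (simp only: o_assoc[symmetric] permutes_inv_o(1)[OF \<sigma>] o_id)
      qed simp
      then show "place_act \<sigma> (delta (J \<circ> \<sigma>)) L = (delta J L :: 'k)" by (simp add: place_act_def delta_def)
    qed
    then have "a (delta J) = place_act \<sigma> (a (delta (J \<circ> \<sigma>)))"
      using eq[OF \<sigma> dE[OF multi_indices_comp[OF J \<sigma>]]] by simp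
    then show ?thesis by (simp add: A_def place_act_def)
  qed
  have "kernel_span d A" by (rule equivariant_kernel_span[OF inf eqA])
  then obtain l where l': "glist (GL d) l \<and> (\<forall>I\<in>?M. \<forall>J\<in>?M. lext (\<lambda>g. kern d g I J) l = A (I, J))"
    unfolding kernel_span_def by (rule exE)
  have l: "glist (GL d) l" "\<And>I J. I \<in> ?M \<Longrightarrow> J \<in> ?M \<Longrightarrow> lext (\<lambda>g. kern d g I J) l = A (I, J)"
    using l' by simp_all
  have "lact ?E (tensor_act d) l T = a T" if T: "T \<in> carrier ?E" for T
  proof -
    let ?K = "{T \<in> carrier ?E. lact ?E (tensor_act d) l T = a T}"
    interpret E: lrep "GL d" ?E "tensor_act d" using tensor_rep by (simp add: lrep_def)
    have "VectorSpace.subspace class_ring ?K ?E"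
      unfolding vsp.subsp_iff[OF E.vsp]
    proof (intro conjI ballI allI)
      show "\<zero>\<^bsub>?E\<^esub> \<in> ?K"
        using vsp.subspD(2)[OF E.vsp vsp.subsp_carrier[OF E.vsp]] lhom_zero[OF E.vsp E.vsp a]
          lhom_zero[OF E.vsp E.vsp E.lact_hom[OF l(1)]] by simp
      show "x \<oplus>\<^bsub>?E\<^esub> y \<in> ?K" if "x \<in> ?K" "y \<in> ?K" for x y
        using that vsp.subspD(3)[OF E.vsp vsp.subsp_carrier[OF E.vsp]] lhomD(2)[OF a] E.lact_add[OF l(1)]
        by (simp del: tensor_space_simps)
      show "c \<odot>\<^bsub>?E\<^esub> x \<in> ?K" if "x \<in> ?K" for c x
        using that vsp.subspD(4)[OF E.vsp vsp.subsp_carrier[OF E.vsp]] lhomD(3)[OF a] E.lact_smult[OF l(1)]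
        by (simp del: tensor_space_simps)
    qed auto
    then have "carrier ?E \<subseteq> ?K" unfolding tensor_space_def
    proof (rule coeff_space_subsp_deltas[OF finite_multi_indices])
      fix J assume J: "J \<in> ?M"
      have "lact ?E (tensor_act d) l (delta J) I = a (delta J) I" for I
      proof (cases "I \<in> ?M")
        case True
        have "lact ?E (tensor_act d) l (delta J) I = (\<Sum>L\<in>?M. if L = J then A (I, L) else 0)"
          unfolding lact_tensor[OF l(1)] if_P[OF True]
            by (intro sum.cong refl) (simp add: delta_def l(2)[OF True] del: One_nat_def)
        then show ?thesis using J finite_multi_indices by (simp add: A_def)
      next
        case False
        then show ?thesis using lhomD(1)[OF a dE[OF J]] by (simp add: lact_tensor[OF l(1)] tensor_space_iff)
      qed
      then show "delta J \<in> {T \<in> carrier (coeff_space ?M). lact (coeff_space ?M) (tensor_act d) l T = a T}"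
        using dE[OF J] by (auto simp: tensor_space_def)
    qed
    then show ?thesis using T by blast
  qed
  then show ?thesis using l(1) by (intro exI[of _ l] conjI ballI)
qed

subsection \<open>The standard tableau of a partition\<close>

locale partition_shape =
  fixes d :: nat and lam :: "nat list"
  assumes part: "partition_of d lam"
begin

abbreviation "S r \<equiv> sum_list (take r lam)"
abbreviation "rw \<equiv> tableau_row lam"
abbreviation "cl \<equiv> tableau_col lam"

lemma lam_facts: "sorted_wrt (\<ge>) lam" "x \<in> set lam \<Longrightarrow> 0 < x" "sum_list lam = d"
  using part by (auto simp: partition_of_def)

lemma S_Suc: "r < length lam \<Longrightarrow> S (Suc r) = S r + lam ! r"
  by (simp add: take_Suc_conv_app_nth)

lemma S_mono: "r \<le> r' \<Longrightarrow> S r \<le> S r'"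
proof -
  assume "r \<le> r'"
  then obtain k where "r' = r + k" by (auto simp: le_iff_add)
  then show ?thesis by (simp add: take_add)
qed

lemma S_le: "S r \<le> d" using S_mono[of r "r + length lam"] lam_facts(3) by simp

lemma lam_decreasing: "r \<le> r' \<Longrightarrow> r' < length lam \<Longrightarrow> lam ! r' \<le> lam ! r"
  using lam_facts(1) by (cases "r = r'") (auto simp: sorted_wrt_iff_nth_less)

text \<open>Each part is at least 1. Consequently every row number is an index below
  \<open>d\<close>, so the space \<open>k^d\<close> has enough basis vectors for the rows.\<close>

lemma length_le: "length lam \<le> d"
proof -
  have "(\<forall>x\<in>set xs. 0 < x) \<Longrightarrow> length xs \<le> sum_list xs" for xs :: "nat list" by (induction xs) auto
  then show ?thesis using lam_facts by auto
qed

lemma cell: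
  assumes "r < length lam" "1 \<le> c" "c \<le> lam ! r"
  shows "S r + c \<in> {1..d}" "rw (S r + c) = r" "cl (S r + c) = c"
proof -
  show "S r + c \<in> {1..d}" using assms S_Suc[OF assms(1)] S_le[of "Suc r"] by simp
  show "rw (S r + c) = r" unfolding tableau_row_def
  proof (rule Least_equality)
    show "S r + c \<le> S (Suc r)" using S_Suc assms by simp
    fix y assume "S r + c \<le> S (Suc y)"
    then show "r \<le> y" using S_mono[of "Suc y" r] assms(2) by linarith
  qed
  then show "cl (S r + c) = c" by (simp add: tableau_col_def)
qed

lemma row_col:
  assumes "x \<in> {1..d}"
  shows "rw x < length lam" "1 \<le> cl x" "cl x \<le> lam ! rw x" "x = S (rw x) + cl x"
proof -
  have "d > 0" using assms by simp
  then have l: "length lam > 0" using lam_facts(3) by auto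
  have ex: "x \<le> S (Suc (length lam - 1))" using l assms lam_facts(3) by simp
  have le: "x \<le> S (Suc (rw x))" unfolding tableau_row_def by (rule LeastI[of "\<lambda>r. x \<le> S (Suc r)", OF ex])
  have "rw x \<le> length lam - 1" unfolding tableau_row_def by (rule Least_le[of "\<lambda>r. x \<le> S (Suc r)", OF ex])
  then show r: "rw x < length lam" using l by linarith
  have gt: "S (rw x) < x"
  proof (cases "rw x")
    case 0 then show ?thesis using assms by simp
  next
    case (Suc k)
    then have "k < rw x" by simp
    then have "\<not> x \<le> S (Suc k)" unfolding tableau_row_def by (rule not_less_Least)
    then show ?thesis using Suc by simp
  qed
  then show "1 \<le> cl x" "x = S (rw x) + cl x" by (auto simp: tableau_col_def)
  show "cl x \<le> lam ! rw x" using le S_Suc[OF r] gt by (simp add: tableau_col_def)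
qed

lemma row_less: "x \<in> {1..d} \<Longrightarrow> rw x < d" using row_col(1) length_le by (meson less_le_trans)

lemma row_col_inj: "x \<in> {1..d} \<Longrightarrow> y \<in> {1..d} \<Longrightarrow> rw x = rw y \<Longrightarrow> cl x = cl y \<Longrightarrow> x = y"
  using row_col(4)[of x] row_col(4)[of y] by simp

text \<open>Columns of a Young diagram have no gaps, because the rows are weakly decreasing.\<close>

lemma cell_above:
  assumes "x \<in> {1..d}" "r \<le> rw x"
  obtains y where "y \<in> {1..d}" "rw y = r" "cl y = cl x"
proof -
  note rc = row_col[OF assms(1)]
  have "r < length lam" using rc assms by simp
  moreover have "cl x \<le> lam ! r" using rc lam_decreasing[OF assms(2) rc(1)] by simp
  ultimately show thesis using that[of "S r + cl x"] cell[of r "cl x"] rc(2) by simp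
qed

text \<open>The basis tensor of the standard tableau; its weight is \<lambda> by
  \<open>wt_i0\<close>. The restriction makes it extensional, as members of
  \<open>multi_indices d\<close> are.\<close>

definition i0 :: "nat \<Rightarrow> nat" where "i0 = restrict rw {1..d}"

lemma i0_apply: "s \<in> {1..d} \<Longrightarrow> i0 s = rw s" by (simp add: i0_def)

lemma i0_M: "i0 \<in> multi_indices d" unfolding i0_def multi_indices_def using row_less by auto

definition wt :: "(nat \<Rightarrow> nat) \<Rightarrow> nat \<Rightarrow> nat" where
  "wt J a = card {s \<in> {1..d}. J s = a}"

lemma wt_comp: "\<sigma> permutes {1..d} \<Longrightarrow> wt (J \<circ> \<sigma>) = wt J"
proof
  fix a assume \<sigma>: "\<sigma> permutes {1..d}"
  have "{s \<in> {1..d}. J s = a} = \<sigma> ` {s \<in> {1..d}. (J \<circ> \<sigma>) s = a}"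
  proof (intro equalityI subsetI)
    fix s assume s: "s \<in> {s \<in> {1..d}. J s = a}"
    have "inv' \<sigma> s \<in> {1..d}" using permutes_in_image[OF permutes_inv[OF \<sigma>]] s by blast
    moreover have "\<sigma> (inv' \<sigma> s) = s" using permutes_inverses(1)[OF \<sigma>] .
    ultimately show "s \<in> \<sigma> ` {s \<in> {1..d}. (J \<circ> \<sigma>) s = a}" using s by (intro image_eqI[of _ _ "inv' \<sigma> s"]) auto
  next
    fix s assume "s \<in> \<sigma> ` {s \<in> {1..d}. (J \<circ> \<sigma>) s = a}"
    then show "s \<in> {s \<in> {1..d}. J s = a}" using permutes_in_image[OF \<sigma>] by auto
  qed
  then have "wt J a = card (\<sigma> ` {s \<in> {1..d}. (J \<circ> \<sigma>) s = a})" unfolding wt_def by (rule arg_cong)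
  also have "\<dots> = wt (J \<circ> \<sigma>) a" unfolding wt_def by (rule card_image[OF inj_on_subset[OF permutes_inj[OF \<sigma>] subset_UNIV]])
  finally show "wt (J \<circ> \<sigma>) a = wt J a" ..
qed

lemma wt_i0: "a < d \<Longrightarrow> int (wt i0 a) = partition_weight lam a"
proof -
  assume a: "a < d"
  have e: "{s \<in> {1..d}. i0 s = a} = (if a < length lam then (\<lambda>c. S a + c) ` {1..lam ! a} else {})"
  proof (cases "a < length lam")
    case True
    have "{s \<in> {1..d}. i0 s = a} = (\<lambda>c. S a + c) ` {1..lam ! a}"
    proof (intro equalityI subsetI)
      fix s assume s: "s \<in> {s \<in> {1..d}. i0 s = a}"
      then have s1: "s \<in> {1..d}" and "rw s = a" using i0_apply by auto
      then show "s \<in> (\<lambda>c. S a + c) ` {1..lam ! a}" using row_col[OF s1] by (intro image_eqI[of _ _ "cl s"]) auto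
    next
      fix s assume "s \<in> (\<lambda>c. S a + c) ` {1..lam ! a}"
      then obtain c where c': "s = S a + c" "c \<in> {1..lam ! a}" by (rule imageE)
      have c: "1 \<le> c" "c \<le> lam ! a" "s = S a + c" using c' by simp_all
      show "s \<in> {s \<in> {1..d}. i0 s = a}" using cell[OF True c(1,2)] i0_apply[of s] c(3) by simp
    qed
    then show ?thesis using True by simp
  next
    case False
    then show ?thesis using row_col(1) i0_apply by fastforce
  qed
  have "wt i0 a = (if a < length lam then lam ! a else 0)"
    unfolding wt_def e by (simp add: card_image)
  then show ?thesis by (simp add: partition_weight_def)
qed

text \<open>Equal weights say that the two multi-indices have the same multiset of values.\<close>

lemma same_weight_permute:
  assumes "I \<in> multi_indices d" "J \<in> multi_indices d" "wt I = wt J"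
  shows "\<exists>\<sigma>. \<sigma> permutes {1..d} \<and> I = J \<circ> \<sigma>"
proof -
  have "image_mset I (mset_set {1..d}) = image_mset J (mset_set {1..d})"
  proof (rule multiset_eqI)
    fix a
    have c: "count (image_mset K (mset_set {1..d})) a = wt K a" for K
      unfolding wt_def by (simp add: count_image_mset Int_def vimage_def conj_commute)
    show "count (image_mset I (mset_set {1..d})) a = count (image_mset J (mset_set {1..d})) a"
      unfolding c using assms(3) by simp
  qed
  then obtain p where p: "p permutes {1..d}" "\<forall>s\<in>{1..d}. I s = J (p s)"
    by (rule image_mset_eq_implies_permutes[OF finite_atLeastAtMost])
  have "I = J \<circ> p" by (rule multi_indices_eqI[OF assms(1) multi_indices_comp[OF assms(2) p(1)]]) (use p(2) in simp)
  then show ?thesis using p(1) by blast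
qed

text \<open>Count the entries below \<open>m\<close> column by column: injectivity bounds the number in each column by that of the standard
  tableau, and the totals agree.\<close>

lemma column_injective_filling:
  assumes J: "J \<in> multi_indices d" and wt: "wt J = wt i0"
    and inj: "\<And>s s'. s \<in> {1..d} \<Longrightarrow> s' \<in> {1..d} \<Longrightarrow> s \<noteq> s' \<Longrightarrow> cl s = cl s' \<Longrightarrow> J s \<noteq> J s'"
  shows "\<exists>p. p permutes {1..d} \<and> (\<forall>s\<in>{1..d}. cl (p s) = cl s) \<and> J = i0 \<circ> p"
proof -
  define K where "K c = {s \<in> {1..d}. cl s = c}" for c
  have finK: "finite (K c)" for c unfolding K_def by simp
  have injJ: "inj_on J (K c)" for c
  proof (rule inj_onI, rule ccontr)
    fix x y assume "x \<in> K c" "y \<in> K c" "J x = J y" "x \<noteq> y"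
    then show False using inj[of x y] by (simp add: K_def)
  qed
  have injR: "inj_on rw (K c)" for c
  proof (rule inj_onI)
    fix x y assume "x \<in> K c" "y \<in> K c" "rw x = rw y"
    then show "x = y" using row_col_inj[of x y] by (simp add: K_def)
  qed
  define h where "h c = card (K c)" for c
  \<comment> \<open>The rows met by a column form an initial segment, so \<open>h c\<close> is both
    the length of the column and the first row it misses.\<close>
  have down: "rw ` K c = {..<h c}" for c
  proof -
    have dc: "b \<in> rw ` K c" if a: "a \<in> rw ` K c" and b: "b \<le> a" for a b
    proof -
      obtain x where x: "x \<in> {1..d}" "cl x = c" "a = rw x" using a unfolding K_def by blast
      obtain y where y: "y \<in> {1..d}" "rw y = b" "cl y = cl x"
        by (rule cell_above[OF x(1), of b]) (use x b in simp)
      then have "y \<in> K c" using x by (simp add: K_def)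
      then show ?thesis using y(2) by blast
    qed
    have card: "card (rw ` K c) = h c" unfolding h_def by (rule card_image[OF injR])
    have fin: "finite (rw ` K c)" using finK by simp
    have sub: "rw ` K c \<subseteq> {..<h c}"
    proof
      fix a assume a: "a \<in> rw ` K c"
      have "{..a} \<subseteq> rw ` K c" using dc[OF a] by auto
      then have "card {..a} \<le> h c" using card_mono[OF fin] card by metis
      then show "a \<in> {..<h c}" by simp
    qed
    then show ?thesis using card by (simp add: card_subset_eq)
  qed
  have rc: "card {s \<in> K c. rw s < m} = min m (h c)" for c m
  proof -
    have "card {s \<in> K c. rw s < m} = card (rw ` {s \<in> K c. rw s < m})"
      by (rule card_image[symmetric]) (rule inj_on_subset[OF injR[of c]], auto)
    also have "rw ` {s \<in> K c. rw s < m} = rw ` K c \<inter> {..<m}" by auto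
    also have "\<dots> = {..<min m (h c)}" unfolding down by auto
    finally show ?thesis by simp
  qed
  have jc: "card {s \<in> K c. J s < m} \<le> min m (h c)" for c m
  proof -
    have "card {s \<in> K c. J s < m} = card (J ` {s \<in> K c. J s < m})"
      by (rule card_image[symmetric]) (rule inj_on_subset[OF injJ[of c]], auto)
    also have "\<dots> \<le> card {..<m}" by (rule card_mono) auto
    finally have "card {s \<in> K c. J s < m} \<le> m" by simp
    moreover have "card {s \<in> K c. J s < m} \<le> h c" unfolding h_def by (rule card_mono[OF finK]) auto
    ultimately show ?thesis by simp
  qed
  define Cs where "Cs = cl ` {1..d}"
  have split: "card {s \<in> {1..d}. f s < m} = (\<Sum>c\<in>Cs. card {s \<in> K c. f s < m})" for f :: "nat \<Rightarrow> nat" and m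
  proof -
    have "{s \<in> {1..d}. f s < m} = (\<Union>c\<in>Cs. {s \<in> K c. f s < m})" unfolding Cs_def K_def by auto
    also have "card \<dots> = (\<Sum>c\<in>Cs. card {s \<in> K c. f s < m})"
      by (rule card_UN_disjoint) (auto simp: Cs_def K_def)
    finally show ?thesis .
  qed
  have byweight: "card {s \<in> {1..d}. f s < m} = (\<Sum>a<m. wt f a)" for f m
  proof -
    have "{s \<in> {1..d}. f s < m} = (\<Union>a\<in>{..<m}. {s \<in> {1..d}. f s = a})" by auto
    also have "card \<dots> = (\<Sum>a<m. card {s \<in> {1..d}. f s = a})"
      by (rule card_UN_disjoint) auto
    finally show ?thesis by (simp add: wt_def)
  qed
  have tot: "(\<Sum>c\<in>Cs. card {s \<in> K c. J s < m}) = (\<Sum>c\<in>Cs. card {s \<in> K c. rw s < m})" for m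
  proof -
    have "{s \<in> {1..d}. rw s < m} = {s \<in> {1..d}. i0 s < m}" using i0_apply by auto
    then have "card {s \<in> {1..d}. rw s < m} = (\<Sum>a<m. wt i0 a)" using byweight[of i0 m] by (simp only:)
    moreover have "card {s \<in> {1..d}. J s < m} = (\<Sum>a<m. wt i0 a)" using byweight[of J m] wt by (simp only:)
    ultimately show ?thesis unfolding split[symmetric] by simp
  qed
  have eq: "card {s \<in> K c. J s < m} = card {s \<in> K c. rw s < m}" if c: "c \<in> Cs" for c m
  proof (rule ccontr)
    assume "card {s \<in> K c. J s < m} \<noteq> card {s \<in> K c. rw s < m}"
    moreover have "card {s \<in> K c. J s < m} \<le> card {s \<in> K c. rw s < m}" using jc[of c m] unfolding rc .
    ultimately have "card {s \<in> K c. J s < m} < card {s \<in> K c. rw s < m}" by linarith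
    then have "(\<Sum>c\<in>Cs. card {s \<in> K c. J s < m}) < (\<Sum>c\<in>Cs. card {s \<in> K c. rw s < m})"
      by (intro sum_strict_mono_ex1) (use jc rc c in \<open>auto simp: Cs_def\<close>)
    then show False using tot by simp
  qed
  \<comment> \<open>With \<open>m = h c\<close> the counts show that all entries in column
    \<open>c\<close> are row numbers of that column.\<close>
  have small: "J s < h (cl s)" if s: "s \<in> {1..d}" for s
  proof -
    let ?c = "cl s"
    have cs: "?c \<in> Cs" using s by (auto simp: Cs_def)
    have "card {x \<in> K ?c. J x < h ?c} = card (K ?c)" using eq[OF cs, of "h ?c"] rc[of ?c "h ?c"] by (simp add: h_def)
    then have "{x \<in> K ?c. J x < h ?c} = K ?c" by (intro card_subset_eq[OF finK]) auto
    moreover have "s \<in> K ?c" using s by (simp add: K_def)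
    ultimately show ?thesis by blast
  qed
  have ex: "\<exists>y. y \<in> {1..d} \<and> rw y = J s \<and> cl y = cl s" if s: "s \<in> {1..d}" for s
  proof -
    have "J s \<in> rw ` K (cl s)" using small[OF s] down by simp
    then obtain y where "J s = rw y" "y \<in> K (cl s)" by (rule imageE)
    then show ?thesis by (intro exI[of _ y]) (simp add: K_def)
  qed
  \<comment> \<open>A place is sent to the cell of its column whose row is the entry there; off
    \<open>{1..d}\<close> the map is the identity, as a permutation of \<open>{1..d}\<close> must
    be.\<close>
  define p where "p s = (if s \<in> {1..d} then SOME y. y \<in> {1..d} \<and> rw y = J s \<and> cl y = cl s else s)" for s
  have p: "p s \<in> {1..d}" "rw (p s) = J s" "cl (p s) = cl s" if s: "s \<in> {1..d}" for s
  proof -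
    have "p s = (SOME y. y \<in> {1..d} \<and> rw y = J s \<and> cl y = cl s)" using s unfolding p_def by (rule if_P)
    then have "p s \<in> {1..d} \<and> rw (p s) = J s \<and> cl (p s) = cl s" using someI_ex[OF ex[OF s]] by (simp only:)
    then show "p s \<in> {1..d}" "rw (p s) = J s" "cl (p s) = cl s" by blast+
  qed
  have "inj_on p {1..d}"
  proof (rule inj_onI)
    fix s s' assume s: "s \<in> {1..d}" "s' \<in> {1..d}" "p s = p s'"
    have "J s = J s'" "cl s = cl s'" using p(2,3)[OF s(1)] p(2,3)[OF s(2)] s(3) by simp_all
    then show "s = s'" using inj[OF s(1,2)] by blast
  qed
  moreover have "p ` {1..d} = {1..d}"
    by (rule endo_inj_surj[OF finite_atLeastAtMost _ calculation]) (use p(1) in blast)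
  ultimately have "bij_betw p {1..d} {1..d}" by (simp add: bij_betw_def)
  then have perm: "p permutes {1..d}" by (rule bij_imp_permutes) (simp only: p_def if_False)
  have "J = i0 \<circ> p"
    by (rule multi_indices_eqI[OF J multi_indices_comp[OF i0_M perm]]) (use p i0_apply in simp)
  then show ?thesis using perm p(3) by blast
qed

end

subsection \<open>Signed column sums\<close>

definition ip :: "nat \<Rightarrow> ((nat \<Rightarrow> nat) \<Rightarrow> 'k::field) \<Rightarrow> ((nat \<Rightarrow> nat) \<Rightarrow> 'k) \<Rightarrow> 'k" where
  "ip d u v = (\<Sum>I\<in>multi_indices d. u I * v I)"

lemma ip_simps: "ip d (\<lambda>I. c * u I) v = c * ip d u v" "ip d (\<lambda>I. u I + u' I) v = ip d u v + ip d u' v"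
  "ip d (\<lambda>_. 0) v = 0"
  by (simp_all add: ip_def sum_distrib_left sum.distrib algebra_simps)

lemma ip_sum: "ip d (\<lambda>I. \<Sum>a\<in>A. f a I) v = (\<Sum>a\<in>A. ip d (f a) v)"
  unfolding ip_def sum_distrib_right by (rule sum.swap)

lemma ip_commute: "ip d u v = ip d v u" by (simp add: ip_def mult.commute)

lemma ip_delta: "J \<in> multi_indices d \<Longrightarrow> ip d (delta J) v = v J"
proof -
  assume J: "J \<in> multi_indices d"
  have "ip d (delta J) v = (\<Sum>I\<in>multi_indices d. if I = J then v I else 0)"
    unfolding ip_def by (intro sum.cong refl) (simp add: delta_def)
  then show ?thesis using J finite_multi_indices by simp
qed

lemma ip_place: "\<sigma> permutes {1..d} \<Longrightarrow> ip d (place_act \<sigma> u) v = ip d u (place_act (inv' \<sigma>) v)"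
proof -
  assume \<sigma>: "\<sigma> permutes {1..d}"
  have "ip d u (place_act (inv' \<sigma>) v) = (\<Sum>I\<in>multi_indices d. u (I \<circ> \<sigma>) * v (I \<circ> \<sigma> \<circ> inv' \<sigma>))"
    unfolding ip_def place_act_def by (rule sum.reindex_bij_betw[OF comp_bij_multi_indices[OF \<sigma>], symmetric])
  also have "\<dots> = ip d (place_act \<sigma> u) v"
    unfolding ip_def place_act_def by (simp only: o_assoc[symmetric] permutes_inv_o(1)[OF \<sigma>] o_id)
  finally show ?thesis ..
qed

lemma ip_tensor: "g \<in> carrier_mat d d \<Longrightarrow> ip d (tensor_act d g u) v = ip d u (tensor_act d (transpose_mat g) v)"
proof -
  assume g: "g \<in> carrier_mat d d"
  have "ip d (tensor_act d g u) v = (\<Sum>I\<in>multi_indices d. \<Sum>J\<in>multi_indices d. kern d g I J * u J * v I)"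
    unfolding ip_def tensor_act_def by (intro sum.cong refl) (simp add: sum_distrib_right)
  also have "\<dots> = (\<Sum>J\<in>multi_indices d. \<Sum>I\<in>multi_indices d. kern d g I J * u J * v I)" by (rule sum.swap)
  also have "\<dots> = ip d u (tensor_act d (transpose_mat g) v)"
    unfolding ip_def
  proof (intro sum.cong refl)
    fix J assume J: "J \<in> multi_indices d"
    have k: "kern d (transpose_mat g) J I = kern d g I J" if "I \<in> multi_indices d" for I
      by (intro prod.cong refl) (use g multi_indices_less[OF J] multi_indices_less[OF that] in auto)
    have "(\<Sum>I\<in>multi_indices d. kern d g I J * u J * v I) = u J * (\<Sum>I\<in>multi_indices d. kern d (transpose_mat g) J I * v I)"
      unfolding sum_distrib_left by (intro sum.cong refl) (simp only: k mult.assoc mult.left_commute[of "u J"])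
    then show "(\<Sum>I\<in>multi_indices d. kern d g I J * u J * v I) = u J * tensor_act d (transpose_mat g) v J"
      using J by (simp add: tensor_act_def)
  qed
  finally show ?thesis .
qed

lemma tensor_expand: "T \<in> carrier (tensor_space d) \<Longrightarrow> T = (\<lambda>I. \<Sum>J\<in>multi_indices d. T J * delta J I)"
proof
  fix I assume T: "T \<in> carrier (tensor_space d)"
  have "(\<Sum>J\<in>multi_indices d. T J * delta J I) = (\<Sum>J\<in>multi_indices d. if J = I then T J else 0)"
    by (intro sum.cong refl) (simp add: delta_def)
  also have "\<dots> = T I" using T finite_multi_indices by (auto simp: tensor_space_iff)
  finally show "T I = (\<Sum>J\<in>multi_indices d. T J * delta J I)" ..
qed

lemma tensor_closed: "u \<in> carrier (tensor_space d) \<Longrightarrow> v \<in> carrier (tensor_space d) \<Longrightarrow> (\<lambda>I. u I + v I) \<in> carrier (tensor_space d)"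
  "u \<in> carrier (tensor_space d) \<Longrightarrow> (\<lambda>I. c * u I) \<in> carrier (tensor_space d)" "(\<lambda>_. 0) \<in> carrier (tensor_space d)"
  "(\<And>a. a \<in> A \<Longrightarrow> f a \<in> carrier (tensor_space d)) \<Longrightarrow> (\<lambda>I. \<Sum>a\<in>A. f a I) \<in> carrier (tensor_space d)"
  by (auto simp: tensor_space_iff)

lemma delta_tensor: "J \<in> multi_indices d \<Longrightarrow> delta J \<in> carrier (tensor_space d)"
  by (auto simp: tensor_space_iff delta_def)

lemma lhom_tensor:
  assumes a: "a \<in> lhom (tensor_space d) (tensor_space d)"
  shows "u \<in> carrier (tensor_space d) \<Longrightarrow> v \<in> carrier (tensor_space d) \<Longrightarrow> a (\<lambda>I. u I + v I) = (\<lambda>I. a u I + a v I)"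
    and "u \<in> carrier (tensor_space d) \<Longrightarrow> a (\<lambda>I. c * u I) = (\<lambda>I. c * a u I)" and "a (\<lambda>_. 0) = (\<lambda>_. 0)"
  using lhomD(2,3)[OF a] lhom_zero[OF tensor_vsp tensor_vsp a] by simp_all

lemma lhom_tensor_sum:
  assumes a: "a \<in> lhom (tensor_space d) (tensor_space d)" and f: "\<And>x. x \<in> A \<Longrightarrow> f x \<in> carrier (tensor_space d)"
  shows "a (\<lambda>I. \<Sum>x\<in>A. c x * f x I) = (\<lambda>I. \<Sum>x\<in>A. c x * a (f x) I)"
  using f
proof (induction A rule: infinite_finite_induct)
  case (insert x A)
  have "(\<lambda>I. \<Sum>x\<in>A. c x * f x I) \<in> carrier (tensor_space d)"
    by (rule tensor_closed(4)) (rule tensor_closed(2), use insert.prems in simp)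
  then show ?case
    using insert lhom_tensor(1)[OF a, of "\<lambda>I. c x * f x I" "\<lambda>I. \<Sum>x\<in>A. c x * f x I"] lhom_tensor(2)[OF a, of "f x" "c x"]
      tensor_closed(2)[of "f x" d "c x"] by simp
qed (simp_all add: lhom_tensor[OF a])

context partition_shape
begin

abbreviation "M \<equiv> multi_indices d"
abbreviation "sg \<pi> \<equiv> of_int (sign \<pi>) :: 'k::field"

definition colgrp :: "(nat \<Rightarrow> nat) set" where
  "colgrp = {\<pi>. \<pi> permutes {1..d} \<and> (\<forall>x\<in>{1..d}. cl (\<pi> x) = cl x)}"

lemma colgrp_eq: "column_stabilizer d lam = colgrp"
  by (auto simp: column_stabilizer_def colgrp_def sym_simps)

lemma colgrp_perm: "\<pi> \<in> colgrp \<Longrightarrow> \<pi> permutes {1..d}" by (simp add: colgrp_def)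

lemma colgrp_permutation: "\<pi> \<in> colgrp \<Longrightarrow> permutation \<pi>"
  using colgrp_perm permutation_permutes finite_atLeastAtMost by blast

lemma finite_colgrp: "finite colgrp"
  by (rule finite_subset[OF _ finite_permutations[of "{1..d}"]]) (auto simp: colgrp_def)

lemma colgrp_id: "id \<in> colgrp" by (simp add: colgrp_def permutes_id)

lemma colgrp_comp: "\<pi> \<in> colgrp \<Longrightarrow> \<tau> \<in> colgrp \<Longrightarrow> \<pi> \<circ> \<tau> \<in> colgrp"
proof -
  assume p: "\<pi> \<in> colgrp" and t: "\<tau> \<in> colgrp"
  have "cl (\<pi> (\<tau> x)) = cl x" if x: "x \<in> {1..d}" for x
  proof -
    have "\<tau> x \<in> {1..d}" using permutes_in_image[OF colgrp_perm[OF t]] x by blast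
    then have "cl (\<pi> (\<tau> x)) = cl (\<tau> x)" using p unfolding colgrp_def by blast
    also have "\<dots> = cl x" using t x unfolding colgrp_def by blast
    finally show ?thesis .
  qed
  then show ?thesis unfolding colgrp_def using permutes_compose[OF colgrp_perm[OF t] colgrp_perm[OF p]] by simp
qed

lemma colgrp_inv: "\<pi> \<in> colgrp \<Longrightarrow> inv' \<pi> \<in> colgrp"
proof -
  assume \<pi>: "\<pi> \<in> colgrp"
  note p = colgrp_perm[OF \<pi>]
  have "cl (inv' \<pi> x) = cl x" if x: "x \<in> {1..d}" for x
  proof -
    have "inv' \<pi> x \<in> {1..d}" using permutes_in_image[OF permutes_inv[OF p]] x by blast
    then have "cl (\<pi> (inv' \<pi> x)) = cl (inv' \<pi> x)" using \<pi> unfolding colgrp_def by blast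
    then show ?thesis using permutes_inverses(1)[OF p] by simp
  qed
  then show ?thesis using permutes_inv[OF p] by (simp add: colgrp_def)
qed

lemma colgrp_cancel: "\<pi> \<in> colgrp \<Longrightarrow> \<pi> \<circ> inv' \<pi> = id" "\<pi> \<in> colgrp \<Longrightarrow> inv' \<pi> \<circ> \<pi> = id"
  using permutes_inv_o[OF colgrp_perm] by blast+

text \<open>James's signed column sum, acting on tensors by place permutations.\<close>

definition kap :: "((nat \<Rightarrow> nat) \<Rightarrow> 'k::field) \<Rightarrow> (nat \<Rightarrow> nat) \<Rightarrow> 'k" where
  "kap T = (\<lambda>I. \<Sum>\<pi>\<in>colgrp. sg \<pi> * place_act \<pi> T I)"

definition e0 :: "(nat \<Rightarrow> nat) \<Rightarrow> 'k::field" where "e0 = delta i0"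

definition et :: "(nat \<Rightarrow> nat) \<Rightarrow> 'k::field" where "et = kap e0"

lemma e0_E: "e0 \<in> carrier (tensor_space d)" unfolding e0_def by (rule delta_tensor[OF i0_M])

lemma kap_E: "T \<in> carrier (tensor_space d) \<Longrightarrow> kap T \<in> carrier (tensor_space d)"
  unfolding kap_def by (intro tensor_closed(4) tensor_closed(2) place_act_in colgrp_perm)

lemma et_E: "et \<in> carrier (tensor_space d)" unfolding et_def by (rule kap_E[OF e0_E])

lemma kap_sum: "kap (\<lambda>I. \<Sum>x\<in>A. c x * f x I) = (\<lambda>I. \<Sum>x\<in>A. c x * kap (f x) I)"
proof
  fix I
  have "kap (\<lambda>I. \<Sum>x\<in>A. c x * f x I) I = (\<Sum>\<pi>\<in>colgrp. \<Sum>x\<in>A. c x * (sg \<pi> * f x (I \<circ> \<pi>)))"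
    unfolding kap_def place_act_def sum_distrib_left by (intro sum.cong refl) (rule mult.left_commute)
  also have "\<dots> = (\<Sum>x\<in>A. \<Sum>\<pi>\<in>colgrp. c x * (sg \<pi> * f x (I \<circ> \<pi>)))" by (rule sum.swap)
  also have "\<dots> = (\<Sum>x\<in>A. c x * kap (f x) I)" unfolding kap_def place_act_def sum_distrib_left ..
  finally show "kap (\<lambda>I. \<Sum>x\<in>A. c x * f x I) I = (\<Sum>x\<in>A. c x * kap (f x) I)" .
qed

text \<open>Right translation by \<tau> permutes the column group and multiplies all signs by that
  of \<tau>.\<close>

lemma kap_place:
  fixes T :: "(nat \<Rightarrow> nat) \<Rightarrow> 'k::field"
  assumes \<tau>: "\<tau> \<in> colgrp"
  shows "kap (place_act \<tau> T) = (\<lambda>I. sg \<tau> * kap T I)"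
proof
  fix I
  have "kap (place_act \<tau> T) I = (\<Sum>\<pi>\<in>colgrp. sg \<tau> * (sg (\<pi> \<circ> \<tau>) * place_act (\<pi> \<circ> \<tau>) T I))"
    unfolding kap_def
  proof (intro sum.cong refl)
    fix \<pi> assume \<pi>: "\<pi> \<in> colgrp"
    have "sign \<tau> * sign (\<pi> \<circ> \<tau>) = sign \<pi> * (sign \<tau> * sign \<tau>)"
      unfolding sign_compose[OF colgrp_permutation[OF \<pi>] colgrp_permutation[OF \<tau>]] by (simp only: mult.left_commute)
    then have "sign \<tau> * sign (\<pi> \<circ> \<tau>) = sign \<pi>" by (simp add: sign_idempotent)
    then have "(sg \<pi> :: 'k) = sg \<tau> * sg (\<pi> \<circ> \<tau>)" unfolding of_int_mult[symmetric] by (simp only:)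
    then show "sg \<pi> * place_act \<pi> (place_act \<tau> T) I = sg \<tau> * (sg (\<pi> \<circ> \<tau>) * place_act (\<pi> \<circ> \<tau>) T I)"
      by (simp add: place_act_def o_assoc mult.assoc)
  qed
  also have "\<dots> = (\<Sum>\<pi>\<in>colgrp. sg \<tau> * (sg \<pi> * place_act \<pi> T I))"
    by (rule sum.reindex_bij_witness[of _ "\<lambda>\<pi>. \<pi> \<circ> inv' \<tau>" "\<lambda>\<pi>. \<pi> \<circ> \<tau>"])
      (simp_all add: o_assoc[symmetric] colgrp_cancel[OF \<tau>] colgrp_comp colgrp_inv \<tau>)
  finally show "kap (place_act \<tau> T) I = sg \<tau> * kap T I" unfolding kap_def sum_distrib_left .
qed

text \<open>The adjoint of a place permutation is its inverse, which lies in the column group with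
  the same sign.\<close>

lemma kap_adjoint: "ip d (kap u) v = ip d u (kap v)"
proof -
  have "ip d (kap u) v = (\<Sum>\<pi>\<in>colgrp. sg \<pi> * ip d (place_act \<pi> u) v)"
    unfolding kap_def ip_sum ip_simps ..
  also have "\<dots> = (\<Sum>\<pi>\<in>colgrp. sg \<pi> * ip d u (place_act (inv' \<pi>) v))"
    by (intro sum.cong refl) (simp only: ip_place[OF colgrp_perm])
  also have "\<dots> = (\<Sum>\<pi>\<in>colgrp. sg \<pi> * ip d u (place_act \<pi> v))"
    by (rule sum.reindex_bij_witness[of _ "inv'" "inv'"])
      (simp_all add: colgrp_inv inv_inv_eq[OF permutes_bij[OF colgrp_perm]] sign_inverse[OF colgrp_permutation])
  also have "\<dots> = ip d (kap v) u" unfolding kap_def ip_sum ip_simps by (simp only: ip_commute[of d u])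
  finally show ?thesis by (simp only: ip_commute[of d _ u])
qed

lemma kap_equivariant:
  assumes a: "a \<in> lhom (tensor_space d) (tensor_space d)"
    and eq: "\<And>\<sigma> T. \<sigma> permutes {1..d} \<Longrightarrow> T \<in> carrier (tensor_space d) \<Longrightarrow> a (place_act \<sigma> T) = place_act \<sigma> (a T)"
    and T: "T \<in> carrier (tensor_space d)"
  shows "a (kap T) = kap (a T)"
proof -
  have "a (kap T) = (\<lambda>I. \<Sum>\<pi>\<in>colgrp. sg \<pi> * a (place_act \<pi> T) I)"
    unfolding kap_def by (rule lhom_tensor_sum[OF a]) (rule place_act_in[OF colgrp_perm T])
  also have "\<dots> = kap (a T)" unfolding kap_def
    by (intro ext sum.cong refl) (simp only: eq[OF colgrp_perm T])
  finally show ?thesis .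
qed

lemma kap_tensor: "T \<in> carrier (tensor_space d) \<Longrightarrow> tensor_act d g (kap T) = kap (tensor_act d g T)"
  by (rule kap_equivariant[OF tensor_act_hom]) (simp_all only: tensor_place_commute)

text \<open>Pairing even with odd elements keeps this valid in characteristic 2.\<close>

lemma kap_repeated:
  assumes s: "s \<in> {1..d}" "s' \<in> {1..d}" "s \<noteq> s'" "cl s = cl s'" and J: "J s = J s'"
  shows "kap (delta J) = (\<lambda>_. 0)"
proof
  fix I
  let ?\<tau> = "transpose s s'"
  have \<tau>: "?\<tau> \<in> colgrp"
    unfolding colgrp_def using s by (auto simp: permutes_swap_id transpose_def)
  have \<tau>\<tau>: "?\<tau> \<circ> ?\<tau> = id" by simp
  have J\<tau>: "J \<circ> ?\<tau> = J" using J by (auto simp: fun_eq_iff transpose_def)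
  have inv: "delta J (L \<circ> ?\<tau>) = (delta J L :: 'a)" for L
  proof -
    have "L \<circ> ?\<tau> = J \<longleftrightarrow> L = J"
    proof
      assume "L \<circ> ?\<tau> = J"
      then have "L \<circ> ?\<tau> \<circ> ?\<tau> = J \<circ> ?\<tau>" by simp
      then show "L = J" by (simp only: o_assoc[symmetric] \<tau>\<tau> o_id J\<tau>)
    qed (simp add: J\<tau>)
    then show ?thesis by (simp add: delta_def)
  qed
  let ?Ev = "{\<pi> \<in> colgrp. evenperm \<pi>}" and ?Od = "{\<pi> \<in> colgrp. \<not> evenperm \<pi>}"
  have ev\<tau>: "evenperm (\<pi> \<circ> ?\<tau>) \<longleftrightarrow> \<not> evenperm \<pi>" if "\<pi> \<in> colgrp" for \<pi>
    using evenperm_comp[OF colgrp_permutation[OF that] permutation_swap_id, of s s'] evenperm_swap[of s s'] s(3) by simp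
  have "kap (delta J) I = (\<Sum>\<pi>\<in>?Ev \<union> ?Od. sg \<pi> * (delta J (I \<circ> \<pi>) :: 'a))"
    unfolding kap_def place_act_def by (rule sum.cong) auto
  also have "\<dots> = (\<Sum>\<pi>\<in>?Ev. sg \<pi> * delta J (I \<circ> \<pi>)) + (\<Sum>\<pi>\<in>?Od. sg \<pi> * delta J (I \<circ> \<pi>))"
    by (rule sum.union_disjoint) (use finite_colgrp in auto)
  also have "(\<Sum>\<pi>\<in>?Od. sg \<pi> * (delta J (I \<circ> \<pi>) :: 'a)) = (\<Sum>\<pi>\<in>?Ev. - (sg \<pi> * delta J (I \<circ> \<pi>)))"
  proof (rule sum.reindex_bij_witness[of _ "\<lambda>\<pi>. \<pi> \<circ> ?\<tau>" "\<lambda>\<pi>. \<pi> \<circ> ?\<tau>"])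
    fix \<pi> assume \<pi>: "\<pi> \<in> ?Od"
    show "- (sg (\<pi> \<circ> ?\<tau>) * (delta J (I \<circ> (\<pi> \<circ> ?\<tau>)) :: 'a)) = sg \<pi> * delta J (I \<circ> \<pi>)"
      unfolding o_assoc inv using \<pi> ev\<tau>[of \<pi>] by (simp add: sign_def)
  qed (auto simp: o_assoc[symmetric] \<tau>\<tau> ev\<tau> colgrp_comp[OF _ \<tau>])
  finally show "kap (delta J) I = (0 :: 'a)" by (simp add: sum_negf o_def)
qed

text \<open>A column permutation that also preserves rows fixes every cell, so only the identity
  contributes.\<close>

lemma et_i0: "et i0 = (1 :: 'k::field)"
proof -
  have "et i0 = (\<Sum>\<pi>\<in>colgrp. if \<pi> = id then (1 :: 'k) else 0)"
    unfolding et_def kap_def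
  proof (intro sum.cong refl)
    fix \<pi> assume \<pi>: "\<pi> \<in> colgrp"
    note p = colgrp_perm[OF \<pi>]
    have "i0 \<circ> \<pi> = i0 \<longleftrightarrow> \<pi> = id"
    proof
      assume e: "i0 \<circ> \<pi> = i0"
      show "\<pi> = id"
      proof
        fix x
        show "\<pi> x = id x"
        proof (cases "x \<in> {1..d}")
          case True
          have px: "\<pi> x \<in> {1..d}" using permutes_in_image[OF p] True by blast
          have "rw (\<pi> x) = rw x" using fun_cong[OF e, of x] i0_apply[OF True] i0_apply[OF px] by simp
          moreover have "cl (\<pi> x) = cl x" using \<pi> True unfolding colgrp_def by blast
          ultimately show ?thesis using row_col_inj[OF px True] by simp
        next
          case False then show ?thesis using permutes_not_in[OF p] by simp
        qed
      qed
    qed simp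
    then show "sg \<pi> * place_act \<pi> e0 i0 = (if \<pi> = id then (1 :: 'k) else 0)"
      by (simp add: place_act_def e0_def delta_def sign_id)
  qed
  also have "\<dots> = 1" using finite_colgrp colgrp_id by simp
  finally show ?thesis .
qed

text \<open>If \<open>J\<close> repeats an entry in a column, both sides vanish by
  \<open>kap_repeated\<close>. Otherwise \<open>column_injective_filling\<close> makes
  \<open>delta J\<close> a column permutation of \<open>e0\<close>, and \<open>kap\<close> gives a
  sign times \<open>et\<close>. The factor \<open>et J\<close> is 0 in the first case and that sign
  in the second.\<close>

lemma kap_delta:
  assumes J: "J \<in> M" and wt: "wt J = wt i0"
  shows "kap (delta J) = (\<lambda>I. et J * et I :: 'k::field)"
proof -
  \<comment> \<open>Self-adjointness reads \<open>et J\<close> off \<open>kap (delta J)\<close>,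
    which identifies the factor in both cases.\<close>
  have etJ: "et J = ip d (kap (delta J)) (e0 :: _ \<Rightarrow> 'k)"
    using ip_delta[OF J, of "et :: _ \<Rightarrow> 'k"] by (simp add: kap_adjoint et_def)
  show ?thesis
  proof (cases "\<exists>s s'. s \<in> {1..d} \<and> s' \<in> {1..d} \<and> s \<noteq> s' \<and> cl s = cl s' \<and> J s = J s'")
    case True
    then obtain s s' where "s \<in> {1..d}" "s' \<in> {1..d}" "s \<noteq> s'" "cl s = cl s'" "J s = J s'" by (elim exE conjE)
    then have "kap (delta J) = ((\<lambda>_. 0) :: _ \<Rightarrow> 'k)" by (rule kap_repeated)
    then show ?thesis using etJ by (simp add: ip_simps)
  next
    case False
    obtain p where p: "p permutes {1..d}" "\<forall>s\<in>{1..d}. cl (p s) = cl s" "J = i0 \<circ> p"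
      using column_injective_filling[OF J wt] False by blast
    have pc: "p \<in> colgrp" using p by (simp add: colgrp_def)
    have "delta J = place_act (inv' p) (e0 :: _ \<Rightarrow> 'k)"
    proof
      fix I
      have "I = J \<longleftrightarrow> I \<circ> inv' p = i0"
      proof
        assume "I \<circ> inv' p = i0"
        then have "I \<circ> inv' p \<circ> p = i0 \<circ> p" by simp
        then show "I = J" unfolding p(3) by (simp only: o_assoc[symmetric] colgrp_cancel[OF pc] o_id)
      qed (simp only: p(3) o_assoc[symmetric] colgrp_cancel[OF pc] o_id)
      then show "delta J I = place_act (inv' p) (e0 :: _ \<Rightarrow> 'k) I" by (simp add: place_act_def e0_def delta_def)
    qed
    then have k: "kap (delta J) = (\<lambda>I. sg (inv' p) * et I :: 'k)"
      using kap_place[OF colgrp_inv[OF pc]] by (simp add: et_def)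
    have "et J = (sg (inv' p) :: 'k)"
      unfolding etJ k ip_simps ip_commute[of d et] e0_def ip_delta[OF i0_M] et_i0 by simp
    then show ?thesis using k by simp
  qed
qed

definition wproj :: "((nat \<Rightarrow> nat) \<Rightarrow> 'k::field) \<Rightarrow> (nat \<Rightarrow> nat) \<Rightarrow> 'k" where
  "wproj T I = (if I \<in> M \<and> wt I = wt i0 then T I else 0)"

lemma wproj_E: "wproj T \<in> carrier (tensor_space d)" by (simp add: tensor_space_iff wproj_def)

lemma wproj_place: "\<sigma> permutes {1..d} \<Longrightarrow> wproj (place_act \<sigma> T) = place_act \<sigma> (wproj T)"
  by (rule ext) (simp only: wproj_def place_act_def multi_indices_comp_iff wt_comp)

lemma wproj_hom: "wproj \<in> lhom (tensor_space d) (tensor_space d)"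
  by (rule lhomI) (auto simp: wproj_E fun_eq_iff wproj_def)

text \<open>On the \<lambda>-weight space \<open>kap\<close> has rank one with image spanned by
  \<open>et\<close>, by linear extension of \<open>kap_delta\<close>.\<close>

lemma kap_weight:
  assumes T: "wproj T = T"
  shows "kap T = (\<lambda>I. ip d T et * et I :: 'k::field)"
proof -
  have TE: "T \<in> carrier (tensor_space d)" using wproj_E[of T] T by simp
  have "kap T = kap (\<lambda>I. \<Sum>J\<in>M. T J * delta J I)" using tensor_expand[OF TE] by simp
  also have "\<dots> = (\<lambda>I. \<Sum>J\<in>M. T J * kap (delta J) I)" by (rule kap_sum)
  also have "\<dots> = (\<lambda>I. \<Sum>J\<in>M. T J * (et J * et I))"
  proof (intro ext sum.cong refl)
    fix I J assume J: "J \<in> M"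
    show "T J * kap (delta J) I = T J * (et J * et I)"
    proof (cases "wt J = wt i0")
      case True then show ?thesis using kap_delta[OF J True, where 'k='k] by simp
    next
      case False
      then have "T J = 0" using fun_cong[OF T, of J] by (simp add: wproj_def)
      then show ?thesis by simp
    qed
  qed
  also have "\<dots> = (\<lambda>I. ip d T et * et I)" by (simp add: ip_def sum_distrib_right mult.assoc)
  finally show ?thesis .
qed

lemma wproj_kap: "T \<in> carrier (tensor_space d) \<Longrightarrow> wproj (kap T) = kap (wproj T)"
  by (rule kap_equivariant[OF wproj_hom]) (simp_all only: wproj_place)

lemma wproj_e0: "wproj e0 = e0"
  by (rule ext) (auto simp: wproj_def e0_def delta_def i0_M)

lemma wproj_et: "wproj et = et"
  unfolding et_def wproj_kap[OF e0_E] wproj_e0 ..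

lemma ip_wproj: "ip d (wproj T) v = ip d T (wproj v)"
  unfolding ip_def by (intro sum.cong refl) (simp add: wproj_def)

text \<open>Since \<open>et = kap e0\<close> and both \<open>a\<close> and \<open>wproj\<close>
  commute with \<open>kap\<close>, the \<lambda>-part of \<open>a et\<close> is \<open>kap\<close>
  of a vector in the weight space, where \<open>kap\<close> has rank one.\<close>

theorem equivariant_et:
  assumes a: "a \<in> lhom (tensor_space d) (tensor_space d)"
    and eq: "\<And>\<sigma> T. \<sigma> permutes {1..d} \<Longrightarrow> T \<in> carrier (tensor_space d) \<Longrightarrow> a (place_act \<sigma> T) = place_act \<sigma> (a T)"
  shows "wproj (a et) = (\<lambda>I. ip d (a e0) et * et I :: 'k::field)"
proof -
  have ae: "a e0 \<in> carrier (tensor_space d)" by (rule lhomD(1)[OF a e0_E])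
  have "a (kap e0) = kap (a e0)" by (rule kap_equivariant[OF a _ e0_E]) (rule eq)
  then have "wproj (a et) = wproj (kap (a e0))" unfolding et_def by (rule arg_cong)
  also have "\<dots> = kap (wproj (a e0))" by (rule wproj_kap[OF ae])
  also have "\<dots> = (\<lambda>I. ip d (wproj (a e0)) et * et I)"
    by (rule kap_weight) (auto simp: wproj_def fun_eq_iff)
  also have "ip d (wproj (a e0)) et = ip d (a e0) et" unfolding ip_wproj wproj_et ..
  finally show ?thesis .
qed

end

subsection \<open>Polynomial dependence on root subgroups\<close>

definition polyf :: "('k::field \<Rightarrow> 'k) \<Rightarrow> bool" where
  "polyf F \<longleftrightarrow> (\<exists>p. \<forall>s. F s = poly p s)"

lemma polyf_const: "polyf (\<lambda>s. c)" unfolding polyf_def by (intro exI[of _ "[:c:]"]) simp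
lemma polyf_id: "polyf (\<lambda>s. s)" unfolding polyf_def by (intro exI[of _ "[:0, 1:]"]) simp
lemma polyf_add: "polyf F \<Longrightarrow> polyf H \<Longrightarrow> polyf (\<lambda>s. F s + H s)"
  unfolding polyf_def by (metis poly_add)
lemma polyf_mult: "polyf F \<Longrightarrow> polyf H \<Longrightarrow> polyf (\<lambda>s. F s * H s)"
  unfolding polyf_def by (metis poly_mult)

lemma polyf_sum: "(\<And>a. a \<in> A \<Longrightarrow> polyf (F a)) \<Longrightarrow> polyf (\<lambda>s. \<Sum>a\<in>A. F a s)"
  by (induction A rule: infinite_finite_induct) (simp_all add: polyf_const polyf_add)

lemma polyf_prod: "(\<And>a. a \<in> A \<Longrightarrow> polyf (F a)) \<Longrightarrow> polyf (\<lambda>s. \<Prod>a\<in>A. F a s)"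
  by (induction A rule: infinite_finite_induct) (simp_all add: polyf_const polyf_mult)

text \<open>The difference has infinitely many roots even when 0 is left out.\<close>

lemma poly_eq_off_zero:
  fixes p q :: "'k::field poly"
  assumes "infinite (UNIV :: 'k set)" "\<And>s. s \<noteq> 0 \<Longrightarrow> poly p s = poly q s"
  shows "p = q"
proof (rule ccontr)
  assume "p \<noteq> q"
  then have "finite {x. poly (p - q) x = 0}" by (intro poly_roots_finite) simp
  moreover have "- {0} \<subseteq> {x. poly (p - q) x = 0}" using assms(2) by auto
  ultimately have "finite (- {0 :: 'k})" by (rule rev_finite_subset)
  then show False using assms(1) by simp
qed

lemma polyf_eq_off_zero:
  fixes F H :: "'k::field \<Rightarrow> 'k"
  assumes "infinite (UNIV :: 'k set)" "polyf F" "polyf H" "\<And>s. s \<noteq> 0 \<Longrightarrow> F s = H s"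
  shows "F s = H s"
proof -
  obtain p q where pq: "\<And>s. F s = poly p s" "\<And>s. H s = poly q s" using assms(2,3) unfolding polyf_def by metis
  then have "p = q" using assms(4) by (intro poly_eq_off_zero[OF assms(1)]) simp
  then show ?thesis using pq by simp
qed

text \<open>\<open>addrow_mat d s k j\<close> has \<open>s\<close> at position (k, j), so from the
  left it adds \<open>s\<close> times row \<open>j\<close> to row \<open>k\<close>. For k < j these
  matrices form the upper root subgroups, for k > j the lower ones.\<close>

lemma addrow_entry:
  assumes "g \<in> carrier_mat d d" "j < d" "a < d" "b < d"
  shows "(addrow_mat d s k j * g) $$ (a, b) = (if a = k then s * g $$ (j, b) + g $$ (a, b) else g $$ (a, b))"
  unfolding addrow_mat[OF assms(1,2), symmetric] using assms by auto

lemma transpose_addrow: "transpose_mat (addrow_mat d s k j) = addrow_mat d (s :: 'k::field) j k"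
  by (rule eq_matI) (auto simp: addrow_mat_def)

lemma addcol_entry:
  fixes g :: "'k::field mat"
  assumes "g \<in> carrier_mat d d" "j < d" "a < d" "b < d"
  shows "(g * addrow_mat d s j k) $$ (a, b) = (if b = k then s * g $$ (a, j) + g $$ (a, b) else g $$ (a, b))"
proof -
  have "g * addrow_mat d s j k = transpose_mat (addrow_mat d s k j * transpose_mat g)"
    by (subst transpose_mult[of _ d d _ d]) (use assms in \<open>auto simp: transpose_addrow\<close>)
  then have "(g * addrow_mat d s j k) $$ (a, b) = (addrow_mat d s k j * transpose_mat g) $$ (b, a)" using assms by simp
  also have "\<dots> = (if b = k then s * g $$ (a, j) + g $$ (a, b) else g $$ (a, b))"
    by (subst addrow_entry) (use assms in auto)
  finally show ?thesis .
qed

lemma addrow_GL: "k \<noteq> j \<Longrightarrow> addrow_mat d (s :: 'k::field) k j \<in> carrier (GL d)"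
  by (simp add: GL_simps det_addrow_mat)

lemma GL_mult_closed: "g \<in> carrier (GL d) \<Longrightarrow> h \<in> carrier (GL d) \<Longrightarrow> g * h \<in> carrier (GL d :: 'k::field mat monoid)"
  using monoid.m_closed[OF group.is_monoid[OF GL_group], of g d h] by (simp add: GL_simps)

lemma addrow_zero: "addrow_mat d (0 :: 'k::field) k j = 1\<^sub>m d"
  by (rule eq_matI) auto

text \<open>Gaussian elimination: \<open>U\<^sup>- T U\<^sup>+\<close> is dense in \<open>GL\<^sub>d\<close>, so left invariance under lower unitriangular matrices, right
  invariance under upper ones and the action of the torus leave no freedom. A vanishing pivot is the value at \<open>s = 0\<close> of a curve
  whose other pivots do not vanish.\<close>

theorem big_cell_unique:
  fixes \<phi> \<psi> :: "'k::field mat \<Rightarrow> 'k"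
  assumes inf: "infinite (UNIV :: 'k set)"
    and lower: "\<And>i j s g. i < j \<Longrightarrow> j < d \<Longrightarrow> g \<in> carrier (GL d) \<Longrightarrow>
      \<phi> (addrow_mat d s j i * g) = \<phi> g \<and> \<psi> (addrow_mat d s j i * g) = \<psi> g"
    and upper: "\<And>i j s g. i < j \<Longrightarrow> j < d \<Longrightarrow> g \<in> carrier (GL d) \<Longrightarrow>
      \<phi> (g * addrow_mat d s i j) = \<phi> g \<and> \<psi> (g * addrow_mat d s i j) = \<psi> g"
    and torus: "\<And>t. t \<in> carrier (GL d) \<Longrightarrow> diagonal_mat t \<Longrightarrow> \<phi> t = \<psi> t"
    and poly: "\<And>i j g. i \<noteq> j \<Longrightarrow> i < d \<Longrightarrow> j < d \<Longrightarrow> g \<in> carrier (GL d) \<Longrightarrow>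
      polyf (\<lambda>s. \<phi> (addrow_mat d s i j * g)) \<and> polyf (\<lambda>s. \<psi> (addrow_mat d s i j * g))"
  shows "g \<in> carrier (GL d) \<Longrightarrow> \<phi> g = \<psi> g"
proof -
  define cleared where "cleared k g \<longleftrightarrow> (\<forall>i<d. \<forall>j<d. i \<noteq> j \<and> (i < k \<or> j < k) \<longrightarrow> g $$ (i, j) = 0)" for k and g :: "'k mat"
  have clearedD: "g $$ (i, j) = 0" if "cleared k g" "i < d" "j < d" "i \<noteq> j" "i < k \<or> j < k" for k g i j
    using that unfolding cleared_def by blast
  \<comment> \<open>Counts what is left to clear below and to the right of the pivot; each
    elementary operation used later lowers it.\<close>
  define bad where "bad k g = card {j \<in> {k<..<d}. g $$ (j, k) \<noteq> 0} + card {j \<in> {k<..<d}. g $$ (k, j) \<noteq> 0}" for k and g :: "'k mat"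
  have cm: "g \<in> carrier_mat d d" if "g \<in> carrier (GL d)" for g :: "'k mat" using that by (simp add: GL_simps)
  \<comment> \<open>Downward induction on the number \<open>k\<close> of finished rows and columns:
    for \<open>k = d\<close> the matrix is diagonal, for \<open>k = 0\<close> nothing is
    required.\<close>
  have "cleared k g \<Longrightarrow> g \<in> carrier (GL d) \<Longrightarrow> \<phi> g = \<psi> g" if "k \<le> d" for k g
    using that
  proof (induction k arbitrary: g rule: inc_induct)
    case base
    have "diagonal_mat g" using clearedD[OF base(1)] cm[OF base(2)] unfolding diagonal_mat_def by auto
    then show ?case using torus base(2) by blast
  next
    case (step k)
    have kd: "k < d" using step.hyps by simp
    have pivot: "g $$ (k, k) \<noteq> 0 \<Longrightarrow> cleared k g \<Longrightarrow> g \<in> carrier (GL d) \<Longrightarrow> \<phi> g = \<psi> g" for g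
    proof (induction "bad k g" arbitrary: g rule: less_induct)
      case less
      note g = cm[OF less.prems(3)]
      show ?case
      proof (cases "\<exists>j. k < j \<and> j < d \<and> (g $$ (j, k) \<noteq> 0 \<or> g $$ (k, j) \<noteq> 0)")
        case False
        have "cleared (Suc k) g" unfolding cleared_def
        proof (intro allI impI)
          fix i j assume ij: "i < d" "j < d" "i \<noteq> j \<and> (i < Suc k \<or> j < Suc k)"
          show "g $$ (i, j) = 0"
          proof (cases "i < k \<or> j < k")
            case True then show ?thesis using clearedD[OF less.prems(2) ij(1,2)] ij(3) by blast
          next
            case nk: False
            then have "i = k \<and> k < j \<or> j = k \<and> k < i" using ij(3) by linarith
            then show ?thesis using False ij(1,2) by blast
          qed
        qed
        then show ?thesis using step.IH less.prems(3) by blast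
      next
        case True
        then obtain j where j: "k < j" "j < d" "g $$ (j, k) \<noteq> 0 \<or> g $$ (k, j) \<noteq> 0" by blast
        show ?thesis
        proof (cases "g $$ (j, k) = 0")
          case False
          define c where "c = - g $$ (j, k) / g $$ (k, k)"
          let ?h = "addrow_mat d c j k * g"
          have e: "?h $$ (a, b) = (if a = j then c * g $$ (k, b) + g $$ (a, b) else g $$ (a, b))" if "a < d" "b < d" for a b
            using addrow_entry[OF g kd that, of c j] by simp
          have hG: "?h \<in> carrier (GL d)" using GL_mult_closed[OF addrow_GL less.prems(3)] j by simp
          have h0: "?h $$ (j, k) = 0" using e[OF j(2) kd] less.prems(1) by (simp add: c_def)
          have hk: "?h $$ (k, b) = g $$ (k, b)" if "b < d" for b using e[OF kd that] j by simp
          have cl: "cleared k ?h" unfolding cleared_def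
          proof (intro allI impI)
            fix a b assume ab: "a < d" "b < d" "a \<noteq> b \<and> (a < k \<or> b < k)"
            have "g $$ (a, b) = 0" using clearedD[OF less.prems(2) ab(1,2)] ab(3) by blast
            moreover have "a = j \<Longrightarrow> g $$ (k, b) = 0" using clearedD[OF less.prems(2) kd ab(2)] ab(3) j(1) by force
            ultimately show "?h $$ (a, b) = 0" using e[OF ab(1,2)] by (cases "a = j") simp_all
          qed
          have "{i \<in> {k<..<d}. ?h $$ (i, k) \<noteq> 0} \<subset> {i \<in> {k<..<d}. g $$ (i, k) \<noteq> 0}"
          proof (rule psubsetI)
            show "{i \<in> {k<..<d}. ?h $$ (i, k) \<noteq> 0} \<subseteq> {i \<in> {k<..<d}. g $$ (i, k) \<noteq> 0}"
            proof (rule subsetI)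
              fix i assume i: "i \<in> {i \<in> {k<..<d}. ?h $$ (i, k) \<noteq> 0}"
              then have "i \<noteq> j" using h0 by auto
              then show "i \<in> {i \<in> {k<..<d}. g $$ (i, k) \<noteq> 0}" using i e[of i k] kd by simp
            qed
            have "j \<in> {i \<in> {k<..<d}. g $$ (i, k) \<noteq> 0}" "j \<notin> {i \<in> {k<..<d}. ?h $$ (i, k) \<noteq> 0}" using j False h0 by simp_all
            then show "{i \<in> {k<..<d}. ?h $$ (i, k) \<noteq> 0} \<noteq> {i \<in> {k<..<d}. g $$ (i, k) \<noteq> 0}" by metis
          qed
          then have "card {i \<in> {k<..<d}. ?h $$ (i, k) \<noteq> 0} < card {i \<in> {k<..<d}. g $$ (i, k) \<noteq> 0}"
            by (rule psubset_card_mono[rotated]) simp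
          moreover have "{i \<in> {k<..<d}. ?h $$ (k, i) \<noteq> 0} = {i \<in> {k<..<d}. g $$ (k, i) \<noteq> 0}"
            by (rule Collect_cong) (use hk in auto)
          ultimately have "bad k ?h < bad k g" unfolding bad_def by simp
          moreover have "?h $$ (k, k) \<noteq> 0" using hk[OF kd] less.prems(1) by simp
          ultimately have "\<phi> ?h = \<psi> ?h" using less.hyps cl hG by blast
          then show ?thesis using lower[OF j(1,2) less.prems(3), of c] by simp
        next
          case zero: True
          then have nz: "g $$ (k, j) \<noteq> 0" using j(3) by blast
          define c where "c = - g $$ (k, j) / g $$ (k, k)"
          let ?h = "g * addrow_mat d c k j"
          have e: "?h $$ (a, b) = (if b = j then c * g $$ (a, k) + g $$ (a, b) else g $$ (a, b))" if "a < d" "b < d" for a b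
            using addcol_entry[OF g kd that, of c j] by simp
          have hG: "?h \<in> carrier (GL d)" using GL_mult_closed[OF less.prems(3) addrow_GL] j by simp
          have h0: "?h $$ (k, j) = 0" using e[OF kd j(2)] less.prems(1) by (simp add: c_def)
          have hk: "?h $$ (b, k) = g $$ (b, k)" if "b < d" for b using e[OF that kd] j by simp
          have cl: "cleared k ?h" unfolding cleared_def
          proof (intro allI impI)
            fix a b assume ab: "a < d" "b < d" "a \<noteq> b \<and> (a < k \<or> b < k)"
            have "g $$ (a, b) = 0" using clearedD[OF less.prems(2) ab(1,2)] ab(3) by blast
            moreover have "b = j \<Longrightarrow> g $$ (a, k) = 0" using clearedD[OF less.prems(2) ab(1) kd] ab(3) j(1) by force
            ultimately show "?h $$ (a, b) = 0" using e[OF ab(1,2)] by (cases "b = j") simp_all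
          qed
          have "{i \<in> {k<..<d}. ?h $$ (k, i) \<noteq> 0} \<subset> {i \<in> {k<..<d}. g $$ (k, i) \<noteq> 0}"
          proof (rule psubsetI)
            show "{i \<in> {k<..<d}. ?h $$ (k, i) \<noteq> 0} \<subseteq> {i \<in> {k<..<d}. g $$ (k, i) \<noteq> 0}"
            proof (rule subsetI)
              fix i assume i: "i \<in> {i \<in> {k<..<d}. ?h $$ (k, i) \<noteq> 0}"
              then have "i \<noteq> j" using h0 by auto
              then show "i \<in> {i \<in> {k<..<d}. g $$ (k, i) \<noteq> 0}" using i e[of k i] kd by simp
            qed
            have "j \<in> {i \<in> {k<..<d}. g $$ (k, i) \<noteq> 0}" "j \<notin> {i \<in> {k<..<d}. ?h $$ (k, i) \<noteq> 0}" using j nz h0 by simp_all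
            then show "{i \<in> {k<..<d}. ?h $$ (k, i) \<noteq> 0} \<noteq> {i \<in> {k<..<d}. g $$ (k, i) \<noteq> 0}" by metis
          qed
          then have "card {i \<in> {k<..<d}. ?h $$ (k, i) \<noteq> 0} < card {i \<in> {k<..<d}. g $$ (k, i) \<noteq> 0}"
            by (rule psubset_card_mono[rotated]) simp
          moreover have "{i \<in> {k<..<d}. ?h $$ (i, k) \<noteq> 0} = {i \<in> {k<..<d}. g $$ (i, k) \<noteq> 0}"
            by (rule Collect_cong) (use hk in auto)
          ultimately have "bad k ?h < bad k g" unfolding bad_def by simp
          moreover have "?h $$ (k, k) \<noteq> 0" using hk[OF kd] less.prems(1) by simp
          ultimately have "\<phi> ?h = \<psi> ?h" using less.hyps cl hG by blast
          then show ?thesis using upper[OF j(1,2) less.prems(3), of c] by simp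
        qed
      qed
    qed
    show ?case
    proof (cases "g $$ (k, k) = 0")
      case False then show ?thesis using pivot step.prems by blast
    next
      case True
      note g = cm[OF step.prems(2)]
      \<comment> \<open>A column of an invertible matrix is nonzero. As the entries of column
        \<open>k\<close> above row \<open>k\<close> are already cleared, the nonzero entry lies
        below the pivot.\<close>
      have "\<exists>j<d. g $$ (j, k) \<noteq> 0"
      proof (rule ccontr)
        assume "\<not> (\<exists>j<d. g $$ (j, k) \<noteq> 0)"
        then have z: "g $$ (j, k) = 0" if "j < d" for j using that by blast
        obtain h where h: "h \<in> carrier (GL d)" "h * g = 1\<^sub>m d"
          using group.l_inv_ex[OF GL_group step.prems(2)] by (auto simp: GL_simps(2,3))
        have "(h * g) $$ (k, k) = (\<Sum>l<d. h $$ (k, l) * g $$ (l, k))"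
          using cm[OF h(1)] g kd by (simp add: scalar_prod_def lessThan_atLeast0)
        also have "\<dots> = 0" using z by simp
        finally show False unfolding h(2) using kd by simp
      qed
      then obtain j where j0: "j < d" "g $$ (j, k) \<noteq> 0" by blast
      have "j \<noteq> k" using True j0 by auto
      moreover have "\<not> j < k" using clearedD[OF step.prems(1) j0(1) kd] calculation j0(2) by blast
      ultimately have j: "k < j" by simp
      have gs: "\<phi> (addrow_mat d s k j * g) = \<psi> (addrow_mat d s k j * g)" if s: "s \<noteq> 0" for s
      proof -
        let ?h = "addrow_mat d s k j * g"
        have e: "?h $$ (a, b) = (if a = k then s * g $$ (j, b) + g $$ (a, b) else g $$ (a, b))" if "a < d" "b < d" for a b
          using addrow_entry[OF g j0(1) that, of s k] by simp
        have hG: "?h \<in> carrier (GL d)" using GL_mult_closed[OF addrow_GL step.prems(2)] j by simp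
        have cl: "cleared k ?h" unfolding cleared_def
        proof (intro allI impI)
          fix a b assume ab: "a < d" "b < d" "a \<noteq> b \<and> (a < k \<or> b < k)"
          have "g $$ (a, b) = 0" using clearedD[OF step.prems(1) ab(1,2)] ab(3) by blast
          moreover have "a = k \<Longrightarrow> g $$ (j, b) = 0" using clearedD[OF step.prems(1) j0(1) ab(2)] ab(3) j by force
          ultimately show "?h $$ (a, b) = 0" using e[OF ab(1,2)] by (cases "a = k") simp_all
        qed
        have "?h $$ (k, k) \<noteq> 0" using e[OF kd kd] True s j0(2) by simp
        then show ?thesis using pivot cl hG by blast
      qed
      have kj: "k \<noteq> j" using j by simp
      have "\<phi> (addrow_mat d 0 k j * g) = \<psi> (addrow_mat d 0 k j * g)"
        using polyf_eq_off_zero[OF inf, of "\<lambda>s. \<phi> (addrow_mat d s k j * g)" "\<lambda>s. \<psi> (addrow_mat d s k j * g)" 0]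
          gs poly[OF kj kd j0(1) step.prems(2)] by blast
      then show ?thesis using g by (simp add: addrow_zero)
    qed
  qed
  from this[of 0] show "g \<in> carrier (GL d) \<Longrightarrow> \<phi> g = \<psi> g" by (simp add: cleared_def)
qed

subsection \<open>The highest weight coefficient\<close>

context partition_shape
begin

text \<open>The functional sending \<open>a\<close> to the pairing of \<open>a e0\<close> with
  \<open>et\<close>, which governs \<open>equivariant_et\<close>, restricted to group elements;
  \<open>lext_Fc\<close> extends it back to lists.\<close>

definition Fc :: "'k::field mat \<Rightarrow> 'k" where "Fc g = ip d (tensor_act d g e0) et"

lemma lext_Fc: "glist (GL d) l \<Longrightarrow> lext Fc l = ip d (lact (tensor_space d) (tensor_act d) l e0) et"
  by (induction l) (simp_all add: ip_simps Fc_def)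

lemma tensor_one: "T \<in> carrier (tensor_space d) \<Longrightarrow> tensor_act d (1\<^sub>m d) T = T"
  using linear_rep.act_one[OF tensor_rep] by (simp add: GL_simps)

lemma tensor_mult: "g \<in> carrier (GL d) \<Longrightarrow> h \<in> carrier (GL d) \<Longrightarrow> T \<in> carrier (tensor_space d) \<Longrightarrow>
  tensor_act d (g * h) T = tensor_act d g (tensor_act d h T)"
  using linear_rep.act_mult[OF tensor_rep] by (simp add: GL_simps)

lemma Fc_one: "Fc (1\<^sub>m d) = (1 :: 'k::field)"
  unfolding Fc_def tensor_one[OF e0_E] unfolding e0_def ip_delta[OF i0_M] et_i0 ..

text \<open>The signed column sum moves across the form and commutes with GL, so \<open>e0\<close>
  and \<open>et\<close> exchange their roles. This symmetry is the source of
  \<open>Fc_transpose\<close>.\<close>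

lemma Fc_alt: "Fc g = ip d (tensor_act d g et) e0"
proof -
  have "Fc g = ip d (kap (tensor_act d g e0)) e0" unfolding Fc_def by (simp only: kap_adjoint et_def)
  then show ?thesis unfolding et_def kap_tensor[OF e0_E] .
qed

lemma Fc_transpose: "g \<in> carrier_mat d d \<Longrightarrow> Fc (transpose_mat g) = Fc g"
proof -
  assume g: "g \<in> carrier_mat d d"
  have "Fc g = ip d et (tensor_act d (transpose_mat g) e0)" unfolding Fc_alt ip_tensor[OF g] ..
  then show ?thesis unfolding Fc_def ip_commute[of d et] ..
qed

text \<open>A basis vector of \<open>x e\<^sub>0\<close> other than \<open>e\<^sub>0\<close> repeats the entry \<open>i\<close> in some column.\<close>

lemma kap_upper:
  fixes s :: "'k::field"
  assumes ij: "i < j" "j < d"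
  shows "kap (tensor_act d (addrow_mat d s i j) e0) = et"
proof -
  let ?x = "addrow_mat d s i j"
  have x: "?x $$ (a, b) = (if a = b then 1 else if a = i \<and> b = j then s else 0)" if "a < d" "b < d" for a b
    using that ij by auto
  have te: "tensor_act d ?x e0 I = (if I \<in> M then kern d ?x I i0 else 0)" for I
  proof -
    have "(\<Sum>J\<in>M. kern d ?x I J * e0 J) = (\<Sum>J\<in>M. if J = i0 then kern d ?x I i0 else 0)"
      by (rule sum.cong) (auto simp: e0_def delta_def)
    then show ?thesis using i0_M finite_multi_indices by (simp add: tensor_act_def)
  qed
  have "kap (tensor_act d ?x e0) = kap (\<lambda>I. \<Sum>J\<in>M. tensor_act d ?x e0 J * delta J I)"
    using tensor_expand[OF lhomD(1)[OF tensor_act_hom e0_E], of ?x] by simp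
  also have "\<dots> = (\<lambda>I. \<Sum>J\<in>M. tensor_act d ?x e0 J * kap (delta J) I)" by (rule kap_sum)
  also have "\<dots> = (\<lambda>I. \<Sum>J\<in>M. if J = i0 then et I else 0)"
  proof (intro ext sum.cong refl)
    fix I J assume J: "J \<in> M"
    show "tensor_act d ?x e0 J * kap (delta J) I = (if J = i0 then et I else 0)"
    proof (cases "J = i0")
      case True
      have "kern d ?x i0 i0 = 1"
      proof (rule prod.neutral, rule ballI)
        fix s' assume s': "s' \<in> {1..d}"
        note l = multi_indices_less[OF i0_M s']
        show "?x $$ (i0 s', i0 s') = 1" unfolding x[OF l l] by simp
      qed
      then show ?thesis using True te i0_M by (simp add: et_def e0_def)
    next
      case False
      have "tensor_act d ?x e0 J = 0 \<or> kap (delta J) = (\<lambda>_. 0 :: 'k)"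
      proof (rule disjCI)
        assume k: "kap (delta J) \<noteq> (\<lambda>_. 0 :: 'k)"
        show "tensor_act d ?x e0 J = 0"
        proof (rule ccontr)
          assume "tensor_act d ?x e0 J \<noteq> 0"
          then have "kern d ?x J i0 \<noteq> 0" using te J by simp
          then have nz: "?x $$ (J s, i0 s) \<noteq> 0" if "s \<in> {1..d}" for s using that by (simp add: prod_zero_iff)
          obtain s where s: "s \<in> {1..d}" "J s \<noteq> i0 s" using False multi_indices_eqI[OF J i0_M] by blast
          have si: "J s = i" "i0 s = j"
            using nz[OF s(1)] x[OF multi_indices_less[OF J s(1)] multi_indices_less[OF i0_M s(1)]] s(2) by (auto split: if_splits)
          then have "i \<le> rw s" using ij i0_apply[OF s(1)] by simp
          obtain y where y: "y \<in> {1..d}" "rw y = i" "cl y = cl s" by (rule cell_above[OF s(1) \<open>i \<le> rw s\<close>])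
          have y0: "i0 y = i" using i0_apply[OF y(1)] y(2) by simp
          have "J y = i" using nz[OF y(1)] x[OF multi_indices_less[OF J y(1)] multi_indices_less[OF i0_M y(1)]] y0 ij
            by (auto split: if_splits)
          moreover have "y \<noteq> s" using y0 si(2) ij by auto
          ultimately have "kap (delta J) = (\<lambda>_. 0 :: 'k)" by (intro kap_repeated[OF y(1) s(1)]) (use y si in simp_all)
          then show False using k by contradiction
        qed
      qed
      then show ?thesis using False by auto
    qed
  qed
  also have "\<dots> = et" using i0_M finite_multi_indices by simp
  finally show ?thesis .
qed

text \<open>Moving \<open>kap\<close> across the form and past \<open>g\<close> applies it to the
  translate of \<open>e0\<close> by the unipotent element, where \<open>kap_upper\<close> makes that
  element disappear.\<close>

lemma Fc_upper:
  assumes "i < j" "j < d" and g: "g \<in> carrier (GL d)"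
  shows "Fc (g * addrow_mat d s i j) = (Fc g :: 'k::field)"
proof -
  let ?x = "addrow_mat d s i j"
  have x: "?x \<in> carrier (GL d)" by (rule addrow_GL) (use assms in simp)
  note xe = lhomD(1)[OF tensor_act_hom e0_E]
  have "Fc (g * ?x) = ip d (kap (tensor_act d g (tensor_act d ?x e0))) e0"
    unfolding Fc_def tensor_mult[OF g x e0_E] by (simp only: kap_adjoint et_def)
  also have "\<dots> = ip d (tensor_act d g (kap (tensor_act d ?x e0))) e0" unfolding kap_tensor[OF xe] ..
  also have "\<dots> = Fc g" unfolding kap_upper[OF assms(1,2)] Fc_alt ..
  finally show ?thesis .
qed

lemma GL_transpose: "g \<in> carrier (GL d) \<Longrightarrow> transpose_mat g \<in> carrier (GL d :: 'k::field mat monoid)"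
  by (auto simp: GL_simps det_transpose)

text \<open>Transposition, under which \<open>Fc\<close> is invariant, turns lower elements on the
  left into upper elements on the right.\<close>

lemma Fc_lower:
  assumes ij: "i < j" "j < d" and g: "g \<in> carrier (GL d)"
  shows "Fc (addrow_mat d s j i * g) = (Fc g :: 'k::field)"
proof -
  have gc: "g \<in> carrier_mat d d" using g by (simp add: GL_simps)
  have "Fc (addrow_mat d s j i * g) = Fc (transpose_mat (addrow_mat d s j i * g))"
    by (rule Fc_transpose[symmetric]) (use gc in auto)
  also have "transpose_mat (addrow_mat d s j i * g) = transpose_mat g * addrow_mat d s i j"
    by (subst transpose_mult[of _ d d _ d]) (use gc in \<open>auto simp: transpose_addrow\<close>)
  also have "Fc \<dots> = Fc (transpose_mat g)" by (rule Fc_upper[OF ij GL_transpose[OF g]])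
  also have "\<dots> = Fc g" by (rule Fc_transpose[OF gc])
  finally show ?thesis .
qed

text \<open>Only \<open>J = I\<close> contributes for a diagonal matrix, and grouping the places by
  their index gives the weight as exponents.\<close>

lemma tensor_act_diag:
  fixes t :: "'k::field mat"
  assumes t: "t \<in> carrier (GL d)" "diagonal_mat t"
  shows "tensor_act d t T = (\<lambda>I. if I \<in> M then (\<Prod>a<d. t $$ (a, a) ^ wt I a) * T I else 0)"
proof
  fix I
  show "tensor_act d t T I = (if I \<in> M then (\<Prod>a<d. t $$ (a, a) ^ wt I a) * T I else 0)"
  proof (cases "I \<in> M")
    case I: True
    have off: "kern d t I J = 0" if J: "J \<in> M" "J \<noteq> I" for J
    proof -
      obtain s where s: "s \<in> {1..d}" "I s \<noteq> J s" using multi_indices_eqI[OF I J(1)] J(2) by blast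
      have "t $$ (I s, J s) = 0"
        using t s multi_indices_less[OF I s(1)] multi_indices_less[OF J(1) s(1)] by (auto simp: diagonal_mat_def GL_simps)
      then show ?thesis using s(1) by (intro prod_zero) auto
    qed
    have "tensor_act d t T I = (\<Sum>J\<in>M. if J = I then kern d t I I * T I else 0)"
      unfolding tensor_act_def if_P[OF I] by (intro sum.cong refl) (use off in auto)
    also have "\<dots> = kern d t I I * T I" using I finite_multi_indices by simp
    also have "kern d t I I = (\<Prod>a<d. \<Prod>s\<in>{s \<in> {1..d}. I s = a}. t $$ (I s, I s))"
      by (rule prod.group[symmetric]) (use multi_indices_less[OF I] in auto)
    also have "\<dots> = (\<Prod>a<d. t $$ (a, a) ^ wt I a)" unfolding wt_def by (intro prod.cong refl) simp
    finally show ?thesis using I by simp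
  qed (simp add: tensor_act_def)
qed

lemma wt_i0_powi: "(\<Prod>a<d. z a ^ wt i0 a) = (\<Prod>a<d. z a powi partition_weight lam a)"
  by (intro prod.cong refl) (simp add: wt_i0[symmetric] power_int_of_nat)

lemma Fc_torus:
  fixes t :: "'k::field mat"
  assumes t: "t \<in> carrier (GL d)" "diagonal_mat t"
  shows "Fc t = (\<Prod>a<d. t $$ (a, a) powi partition_weight lam a)"
proof -
  have "tensor_act d t e0 = (\<lambda>I. (\<Prod>a<d. t $$ (a, a) powi partition_weight lam a) * e0 I)"
    unfolding tensor_act_diag[OF t] wt_i0_powi[symmetric] by (rule ext) (auto simp: e0_def delta_def i0_M)
  then have "Fc t = (\<Prod>a<d. t $$ (a, a) powi partition_weight lam a) * ip d e0 et"
    unfolding Fc_def by (simp only: ip_simps)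
  then show ?thesis using ip_delta[OF i0_M, of "et :: _ \<Rightarrow> 'k"] et_i0[where 'k='k] by (simp add: e0_def)
qed

lemma Fc_poly:
  assumes "j < d" "g \<in> carrier (GL d)"
  shows "polyf (\<lambda>s :: 'k::field. Fc (addrow_mat d s k j * g))"
  unfolding Fc_def ip_def tensor_act_def
proof (intro polyf_sum)
  fix I assume I: "I \<in> M"
  have gc: "g \<in> carrier_mat d d" using assms by (simp add: GL_simps)
  have "polyf (\<lambda>s. (addrow_mat d s k j * g) $$ (a, b))" if "a < d" "b < d" for a b
    unfolding addrow_entry[OF gc assms(1) that] by (cases "a = k") (simp_all add: polyf_const polyf_add polyf_mult polyf_id)
  then have "polyf (\<lambda>s. (\<Sum>J\<in>M. kern d (addrow_mat d s k j * g) I J * e0 J))"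
    by (intro polyf_sum polyf_mult polyf_prod polyf_const) (use multi_indices_less I in auto)
  then show "polyf (\<lambda>s. (if I \<in> M then \<Sum>J\<in>M. kern d (addrow_mat d s k j * g) I J * e0 J else 0) * et I)"
    unfolding if_P[OF I] by (rule polyf_mult[OF _ polyf_const])
qed

end

subsection \<open>Functionals\<close>

lemma (in vsp) functional_finsum:
  assumes "functional V \<xi>" "g \<in> A \<rightarrow> carrier V"
  shows "\<xi> (finsum V g A) = (\<Sum>a\<in>A. \<xi> (g a))"
  using assms(2)
proof (induction A rule: infinite_finite_induct)
  case (insert x F)
  then have g: "g x \<in> carrier V" "g \<in> F \<rightarrow> carrier V" by auto
  then have "\<xi> (g x \<oplus> finsum V g F) = \<xi> (g x) + \<xi> (finsum V g F)"
    using assms(1) finsum_closed[OF g(2)] unfolding functional_def by blast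
  then show ?case using insert g by (simp add: finsum_insert)
qed (simp_all add: functional_zero[OF assms(1)])

lemma functional_comp: "functional W \<xi> \<Longrightarrow> f \<in> lhom V W \<Longrightarrow> functional V (\<lambda>x. \<xi> (f x))"
  unfolding functional_def by (simp add: lhomD)

lemma (in vsp) functional_minus: "functional V \<xi> \<Longrightarrow> x \<in> carrier V \<Longrightarrow> y \<in> carrier V \<Longrightarrow> \<xi> (x \<ominus> y) = \<xi> x - \<xi> y"
proof -
  assume \<xi>: "functional V \<xi>" and x: "x \<in> carrier V" and y: "y \<in> carrier V"
  have "x \<ominus> y = x \<oplus> (-1) \<odot> y" unfolding a_minus_def smult_neg1[OF y] ..
  moreover have "\<xi> (x \<oplus> (-1) \<odot> y) = \<xi> x + (-1) * \<xi> y" using \<xi> x y smult_cl[OF y, of "-1"] unfolding functional_def by (simp only:)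
  ultimately show ?thesis by simp
qed

lemma (in vsp) neg_zero: "\<ominus> \<zero> = \<zero>" using smult_neg1[of \<zero>] by simp

text \<open>A subspace \<open>X\<close> of largest dimension that contains \<open>W\<close> and
  misses \<open>v\<close> is a hyperplane complementary to the line of \<open>v\<close>; the
  functional is the coordinate along \<open>v\<close>.\<close>

theorem (in fvsp) functional_exists:
  assumes W: "VectorSpace.subspace class_ring W V" and v: "v \<in> carrier V" "v \<notin> W"
  shows "\<exists>\<xi>. functional V \<xi> \<and> \<xi> v = 1 \<and> (\<forall>w\<in>W. \<xi> w = 0)"
proof -
  define P where "P X \<longleftrightarrow> VectorSpace.subspace class_ring X V \<and> W \<subseteq> X \<and> v \<notin> X" for X
  have "\<exists>X. P X \<and> (\<forall>Y. P Y \<longrightarrow> vdim (V\<lparr>carrier := Y\<rparr>) \<le> vdim (V\<lparr>carrier := X\<rparr>))"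
    by (rule ex_has_greatest_nat[of P W _ "Suc dim"]) (use W v subsp_dim_le in \<open>auto simp: P_def less_Suc_eq_le\<close>)
  then obtain X where X: "P X" and max: "\<And>Y. P Y \<Longrightarrow> vdim (V\<lparr>carrier := Y\<rparr>) \<le> vdim (V\<lparr>carrier := X\<rparr>)" by blast
  have Xs: "VectorSpace.subspace class_ring X V" and WX: "W \<subseteq> X" and vX: "v \<notin> X" using X unfolding P_def by blast+
  note D = subspD[OF Xs]
  have ex: "\<exists>c. x \<ominus> c \<odot> v \<in> X" if x: "x \<in> carrier V" for x
  proof (cases "x \<in> X")
    case True
    have "x \<ominus> 0 \<odot> v = x" using x v by (simp add: a_minus_def)
    then show ?thesis using True by (intro exI[of _ 0]) simp
  next
    case False
    \<comment> \<open>\<open>X\<close> enlarged by \<open>x\<close>; by maximality of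
      \<open>X\<close> it contains \<open>v\<close>.\<close>
    define U where "U = {y \<in> carrier V. \<exists>a. y \<ominus> a \<odot> x \<in> X}"
    have Us: "VectorSpace.subspace class_ring U V"
      unfolding subsp_iff
    proof (intro conjI ballI allI)
      show "U \<subseteq> carrier V" unfolding U_def by blast
      have "\<zero> \<ominus> 0 \<odot> x \<in> X" using x D(2) by (simp add: a_minus_def neg_zero)
      then show "\<zero> \<in> U" unfolding U_def by blast
      fix y assume "y \<in> U"
      then obtain a where y: "y \<in> carrier V" "y \<ominus> a \<odot> x \<in> X" unfolding U_def by blast
      { fix z assume "z \<in> U"
        then obtain b where z: "z \<in> carrier V" "z \<ominus> b \<odot> x \<in> X" unfolding U_def by blast
        have "(y \<oplus> z) \<ominus> (a + b) \<odot> x = (y \<ominus> a \<odot> x) \<oplus> (z \<ominus> b \<odot> x)"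
          using x y(1) z(1) by (simp add: a_minus_def smult_left_distr minus_add a_ac)
        then have "(y \<oplus> z) \<ominus> (a + b) \<odot> x \<in> X" using D(3)[OF y(2) z(2)] by simp
        then show "y \<oplus> z \<in> U" unfolding U_def using y(1) z(1) by blast }
      { fix c
        have "c \<odot> y \<ominus> (c * a) \<odot> x = c \<odot> (y \<ominus> a \<odot> x)"
          using x y(1) by (simp add: a_minus_def smult_right_distr smult_ass smult_minus_left[symmetric])
        then have "c \<odot> y \<ominus> (c * a) \<odot> x \<in> X" using D(4)[OF y(2)] by simp
        then show "c \<odot> y \<in> U" unfolding U_def using y(1) by blast }
    qed
    have XU: "X \<subseteq> U"
    proof
      fix y assume y: "y \<in> X"
      have "y \<ominus> 0 \<odot> x = y" using x D(5)[OF y] by (simp add: a_minus_def)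
      then have "y \<ominus> 0 \<odot> x \<in> X" using y by simp
      then show "y \<in> U" unfolding U_def using D(5)[OF y] by blast
    qed
    have xU: "x \<in> U"
    proof -
      have "x \<ominus> 1 \<odot> x = \<zero>" using x by (simp add: a_minus_def r_neg)
      then have "x \<ominus> 1 \<odot> x \<in> X" using D(2) by simp
      then show ?thesis unfolding U_def using x by blast
    qed
    have "v \<in> U"
    proof (rule ccontr)
      assume "v \<notin> U"
      then have "vdim (V\<lparr>carrier := U\<rparr>) \<le> vdim (V\<lparr>carrier := X\<rparr>)" using max Us WX XU unfolding P_def by blast
      moreover have "VectorSpace.subspace class_ring X (V\<lparr>carrier := U\<rparr>)" unfolding subsp_nested[OF Us] using Xs XU by blast
      ultimately have "X = U" using fvsp.subsp_dim_eq[OF subsp_fin[OF Us], of X] by simp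
      then show False using xU False by simp
    qed
    then obtain a where a: "v \<ominus> a \<odot> x \<in> X" unfolding U_def by blast
    have "a \<noteq> 0"
    proof
      assume "a = 0"
      then have "v \<ominus> a \<odot> x = v" using x v by (simp add: a_minus_def)
      then show False using a vX by simp
    qed
    have "x \<ominus> inverse a \<odot> v = (- inverse a) \<odot> (v \<ominus> a \<odot> x)"
    proof -
      have "(- inverse a) \<odot> (v \<ominus> a \<odot> x) = (- inverse a) \<odot> v \<oplus> (- inverse a) \<odot> ((- a) \<odot> x)"
        using x v by (simp add: a_minus_def smult_right_distr smult_minus_left)
      also have "\<dots> = (- inverse a) \<odot> v \<oplus> x" using x \<open>a \<noteq> 0\<close> by (subst smult_ass) simp_all
      finally show ?thesis using x v by (simp add: a_minus_def smult_minus_left a_comm)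
    qed
    then have "x \<ominus> inverse a \<odot> v \<in> X" using D(4)[OF a] by simp
    then show ?thesis by blast
  qed
  have unique: "c = e" if "x \<in> carrier V" "x \<ominus> c \<odot> v \<in> X" "x \<ominus> e \<odot> v \<in> X" for x c e
  proof (rule ccontr)
    assume "c \<noteq> e"
    have "(x \<ominus> c \<odot> v) \<ominus> (x \<ominus> e \<odot> v) = (e - c) \<odot> v"
    proof -
      have "(e - c) \<odot> v = e \<odot> v \<oplus> (- c) \<odot> v" using smult_left_distr[OF v(1), of e "- c"] by simp
      then show ?thesis using that(1) v(1) by (simp add: a_minus_def minus_add smult_minus_left a_ac r_neg1 r_neg2)
    qed
    then have "(e - c) \<odot> v \<in> X" using D(7)[OF that(2,3)] by simp
    then have "inverse (e - c) \<odot> ((e - c) \<odot> v) \<in> X" by (rule D(4))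
    moreover have "inverse (e - c) \<odot> ((e - c) \<odot> v) = v" using v(1) \<open>c \<noteq> e\<close> by (subst smult_ass) simp_all
    ultimately show False using vX by simp
  qed
  define \<xi> where "\<xi> x = (THE c. x \<ominus> c \<odot> v \<in> X)" for x
  have \<xi>I: "\<xi> x = c" if "x \<in> carrier V" "x \<ominus> c \<odot> v \<in> X" for x c
    unfolding \<xi>_def using that unique by blast
  have \<xi>: "x \<ominus> \<xi> x \<odot> v \<in> X" if x: "x \<in> carrier V" for x using ex[OF x] \<xi>I[OF x] by metis
  have "functional V \<xi>" unfolding functional_def
  proof (intro conjI ballI allI)
    fix x y assume x: "x \<in> carrier V" and y: "y \<in> carrier V"
    have "(x \<oplus> y) \<ominus> (\<xi> x + \<xi> y) \<odot> v = (x \<ominus> \<xi> x \<odot> v) \<oplus> (y \<ominus> \<xi> y \<odot> v)"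
      using x y v by (simp add: a_minus_def smult_left_distr minus_add a_ac)
    then show "\<xi> (x \<oplus> y) = \<xi> x + \<xi> y" using x y D(3)[OF \<xi>[OF x] \<xi>[OF y]] by (intro \<xi>I) simp_all
  next
    fix c x assume x: "x \<in> carrier V"
    have "c \<odot> x \<ominus> (c * \<xi> x) \<odot> v = c \<odot> (x \<ominus> \<xi> x \<odot> v)"
      using x v by (simp add: a_minus_def smult_right_distr smult_ass smult_minus_left[symmetric])
    then show "\<xi> (c \<odot> x) = c * \<xi> x" using x D(4)[OF \<xi>[OF x]] by (intro \<xi>I) simp_all
  qed
  moreover have "\<xi> v = 1" by (rule \<xi>I) (use v D(2) in \<open>simp_all add: a_minus_def r_neg\<close>)
  moreover have "\<xi> w = 0" if "w \<in> W" for w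
  proof (rule \<xi>I)
    show "w \<in> carrier V" using that WX D(5) by blast
    then show "w \<ominus> 0 \<odot> v \<in> X" using that WX v by (auto simp: a_minus_def neg_zero)
  qed
  ultimately show ?thesis by blast
qed

lemma (in fvsp) functional_separates:
  assumes x: "x \<in> carrier V" "y \<in> carrier V" and eq: "\<And>\<xi>. functional V \<xi> \<Longrightarrow> \<xi> x = \<xi> y"
  shows "x = y"
proof (rule ccontr)
  assume "x \<noteq> y"
  then have "x \<ominus> y \<notin> {\<zero>}" using x by simp
  then obtain \<xi> where \<xi>: "functional V \<xi>" "\<xi> (x \<ominus> y) = 1"
    using functional_exists[OF subsp_zero, of "x \<ominus> y"] x minus_closed by blast
  then show False using functional_minus[OF \<xi>(1) x] eq[OF \<xi>(1)] by simp
qed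

subsection \<open>Characters of the torus\<close>

definition dg :: "nat \<Rightarrow> (nat \<Rightarrow> 'k::field) \<Rightarrow> 'k mat" where
  "dg d z = mat d d (\<lambda>(i, j). if i = j then z i else 0)"

definition ch :: "nat \<Rightarrow> (nat \<Rightarrow> int) \<Rightarrow> (nat \<Rightarrow> 'k::field) \<Rightarrow> 'k" where
  "ch d \<mu> z = (\<Prod>i<d. z i powi \<mu> i)"

definition nz :: "nat \<Rightarrow> (nat \<Rightarrow> 'k::field) \<Rightarrow> bool" where "nz d z \<longleftrightarrow> (\<forall>i<d. z i \<noteq> 0)"

text \<open>Vanishing from \<open>d\<close> on makes a weight determined by the values that matter,
  so that distinct elements are distinct as characters over an infinite field.\<close>

definition weights :: "nat \<Rightarrow> (nat \<Rightarrow> int) set" where "weights d = {\<mu>. \<forall>i\<ge>d. \<mu> i = 0}"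

lemma dg_entry: "i < d \<Longrightarrow> j < d \<Longrightarrow> dg d z $$ (i, j) = (if i = j then z i else 0)" by (simp add: dg_def)

lemma dg_carrier: "dg d z \<in> carrier_mat d d" by (simp add: dg_def)

lemma det_diagonal:
  assumes "t \<in> carrier_mat d d" "diagonal_mat t"
  shows "det t = (\<Prod>i<d. t $$ (i, i))"
proof -
  have "upper_triangular t" using assms by (auto simp: diagonal_mat_def upper_triangular_def)
  then have "det t = prod_list (diag_mat t)" using det_upper_triangular assms(1) by blast
  also have "\<dots> = (\<Prod>i<d. t $$ (i, i))"
    using assms(1) by (simp add: diag_mat_def prod.distinct_set_conv_list[symmetric] lessThan_atLeast0)
  finally show ?thesis .
qed

lemma dg_diagonal: "diagonal_mat (dg d z)" by (auto simp: diagonal_mat_def dg_def)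

lemma det_dg: "det (dg d z) = (\<Prod>i<d. z i)"
  using det_diagonal[OF dg_carrier dg_diagonal] by (simp add: dg_entry)

lemma dg_GL: "nz d z \<Longrightarrow> dg d z \<in> carrier (GL d)"
  by (simp add: GL_simps dg_carrier det_dg nz_def)

lemma dg_mult: "dg d (\<lambda>i. w i * z i) = dg d w * (dg d z :: 'k::field mat)"
proof (rule eq_matI)
  fix i j assume "i < dim_row (dg d w * dg d z)" "j < dim_col (dg d w * dg d z)"
  then have ij: "i < d" "j < d" by (auto simp: dg_def)
  have "(dg d w * dg d z) $$ (i, j) = (\<Sum>l<d. dg d w $$ (i, l) * dg d z $$ (l, j))"
    using ij dg_carrier[of d w] dg_carrier[of d z] by (simp add: scalar_prod_def lessThan_atLeast0)
  also have "\<dots> = (\<Sum>l<d. if l = i then w i * dg d z $$ (i, j) else 0)"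
    by (intro sum.cong refl) (use ij in \<open>auto simp: dg_entry\<close>)
  also have "\<dots> = w i * dg d z $$ (i, j)" using ij by simp
  finally show "dg d (\<lambda>i. w i * z i) $$ (i, j) = (dg d w * dg d z) $$ (i, j)" using ij by (simp add: dg_entry)
qed (auto simp: dg_def)

lemma dg_one: "dg d (\<lambda>_. 1) = 1\<^sub>m d" by (rule eq_matI) (auto simp: dg_def)

lemma diagonal_dg:
  assumes "t \<in> carrier (GL d)" "diagonal_mat t"
  shows "t = dg d (\<lambda>i. t $$ (i, i))" "nz d (\<lambda>i. t $$ (i, i))"
proof -
  have t: "t \<in> carrier_mat d d" "det t \<noteq> 0" using assms by (auto simp: GL_simps)
  show "t = dg d (\<lambda>i. t $$ (i, i))" by (rule eq_matI) (use t assms in \<open>auto simp: dg_def diagonal_mat_def\<close>)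
  show "nz d (\<lambda>i. t $$ (i, i))" using t(2) det_diagonal[OF t(1) assms(2)] by (auto simp: nz_def)
qed

lemma ch_mult: "ch d \<mu> (\<lambda>i. w i * z i) = ch d \<mu> w * ch d \<mu> z"
  by (simp add: ch_def power_int_mult_distrib prod.distrib)

lemma ch_add: "nz d z \<Longrightarrow> ch d (\<lambda>i. \<mu> i + \<nu> i) z = ch d \<mu> z * ch d \<nu> z"
  unfolding ch_def prod.distrib[symmetric] by (intro prod.cong refl) (simp add: nz_def power_int_add)

lemma ch_one: "ch d \<mu> (\<lambda>_. 1) = 1" by (simp add: ch_def)

text \<open>The exponents at \<open>i\<close> differ by a nonzero integer of absolute value
  \<open>m\<close>, and only finitely many \<open>x\<close> satisfy \<open>x^m = 1\<close>. The
  tuple with another nonzero \<open>x\<close> at \<open>i\<close> and 1 elsewhere separates.\<close>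

lemma ch_separates:
  assumes inf: "infinite (UNIV :: 'k::field set)" and "i < d" "\<mu> i \<noteq> \<nu> i"
  shows "\<exists>z :: nat \<Rightarrow> 'k. nz d z \<and> ch d \<mu> z \<noteq> ch d \<nu> z"
proof -
  define m where "m = nat \<bar>\<mu> i - \<nu> i\<bar>"
  have m: "m > 0" using assms by (simp add: m_def)
  have "monom 1 m - 1 \<noteq> (0 :: 'k poly)"
  proof
    assume "monom 1 m - 1 = (0 :: 'k poly)"
    then have "coeff (monom 1 m - 1 :: 'k poly) m = 0" by simp
    then show False using m by simp
  qed
  then have "finite {x :: 'k. poly (monom 1 m - 1) x = 0}" by (rule poly_roots_finite)
  then have "finite (insert 0 {x :: 'k. x ^ m = 1})" by (simp add: poly_monom)
  then obtain x :: 'k where x: "x \<noteq> 0" "x ^ m \<noteq> 1" using inf ex_new_if_finite by blast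
  define z where "z = (\<lambda>a. if a = i then x else 1)"
  have c: "ch d \<kappa> z = x powi \<kappa> i" for \<kappa>
  proof -
    have "ch d \<kappa> z = (\<Prod>a<d. if a = i then x powi \<kappa> i else 1)"
      unfolding ch_def z_def by (intro prod.cong refl) simp
    then show ?thesis using assms(2) by simp
  qed
  have "x powi \<mu> i \<noteq> x powi \<nu> i"
  proof
    assume e: "x powi \<mu> i = x powi \<nu> i"
    have 1: "x powi (\<mu> i - \<nu> i) = 1" "x powi (\<nu> i - \<mu> i) = 1" using e x(1) by (simp_all add: power_int_diff)
    have "x powi (int m) = 1" using 1 unfolding m_def by (cases "\<mu> i \<ge> \<nu> i") (simp_all add: abs_if)
    then show False using x(2) by (simp add: power_int_of_nat)
  qed
  then show ?thesis using c x(1) by (intro exI[of _ z]) (auto simp: nz_def z_def)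
qed

text \<open>Artin's argument for the independence of characters, by induction on their
  number.\<close>

lemma dedekind_independence:
  fixes c :: "(nat \<Rightarrow> int) \<Rightarrow> 'k::field"
  assumes inf: "infinite (UNIV :: 'k set)" and fin: "finite A" and A: "A \<subseteq> weights d"
    and "\<And>z. nz d z \<Longrightarrow> (\<Sum>\<mu>\<in>A. ch d \<mu> z * c \<mu>) = 0"
  shows "\<mu> \<in> A \<Longrightarrow> c \<mu> = 0"
  using fin A assms(4)
proof (induction A arbitrary: c \<mu> rule: finite_induct)
  case (insert \<nu> A)
  have cA: "c \<mu> = 0" if \<mu>: "\<mu> \<in> A" for \<mu>
  proof -
    have "\<mu> \<noteq> \<nu>" using \<mu> insert.hyps by auto
    then obtain i where "\<mu> i \<noteq> \<nu> i" by blast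
    moreover have "i < d"
      using insert.prems(2) \<mu> calculation unfolding weights_def
        by (metis (mono_tags) insert_subset linorder_not_le mem_Collect_eq subsetD)
    ultimately obtain w :: "nat \<Rightarrow> 'k" where w: "nz d w" "ch d \<mu> w \<noteq> ch d \<nu> w" using ch_separates[OF inf] by blast
    \<comment> \<open>Comparing the relation at \<open>w z\<close> with the relation at
      \<open>z\<close> multiplied by \<open>ch d \<nu> w\<close> eliminates \<nu> and leaves a
      shorter relation with these coefficients.\<close>
    have "(ch d \<mu> w - ch d \<nu> w) * c \<mu> = 0"
    proof (rule insert.IH[OF \<mu>])
      show "A \<subseteq> weights d" using insert.prems by simp
      fix z :: "nat \<Rightarrow> 'k" assume z: "nz d z"
      have wz: "nz d (\<lambda>i. w i * z i)" using w(1) z by (simp add: nz_def)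
      have 1: "ch d \<nu> z * c \<nu> + (\<Sum>\<mu>\<in>A. ch d \<mu> z * c \<mu>) = 0" using insert.prems(3)[OF z] insert.hyps by simp
      have 2: "ch d \<nu> w * ch d \<nu> z * c \<nu> + (\<Sum>\<mu>\<in>A. ch d \<mu> w * ch d \<mu> z * c \<mu>) = 0"
        using insert.prems(3)[OF wz] insert.hyps by (simp add: ch_mult)
      have "(\<Sum>\<mu>\<in>A. ch d \<mu> z * ((ch d \<mu> w - ch d \<nu> w) * c \<mu>)) =
        (\<Sum>\<mu>\<in>A. ch d \<mu> w * ch d \<mu> z * c \<mu>) - ch d \<nu> w * (\<Sum>\<mu>\<in>A. ch d \<mu> z * c \<mu>)"
        by (simp add: sum_distrib_left sum_subtractf[symmetric] algebra_simps)
      also have "\<dots> = - (ch d \<nu> w * ch d \<nu> z * c \<nu>) + ch d \<nu> w * (ch d \<nu> z * c \<nu>)"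
        using 1 2 by (simp add: eq_neg_iff_add_eq_0[symmetric] add_eq_0_iff)
      finally show "(\<Sum>\<mu>\<in>A. ch d \<mu> z * ((ch d \<mu> w - ch d \<nu> w) * c \<mu>)) = 0" by (simp add: mult.assoc)
    qed
    then show ?thesis using w(2) by simp
  qed
  have "nz d (\<lambda>_. 1 :: 'k)" by (simp add: nz_def)
  then have "c \<nu> = 0" using insert.prems(3)[of "\<lambda>_. 1"] insert.hyps cA by (simp add: ch_one)
  then show ?case using cA insert.prems(1) by blast
qed simp

text \<open>Laurent polynomials on the torus with exponents in \<open>B\<close>. The rule
  \<open>lau_cong\<close> disregards tuples with a zero entry, where the exponents of a product of
  characters need not add. The set \<open>B\<close> is a parameter so that one weight can be
  excluded.\<close>

inductive lau :: "nat \<Rightarrow> (nat \<Rightarrow> int) set \<Rightarrow> ((nat \<Rightarrow> 'k::field) \<Rightarrow> 'k) \<Rightarrow> bool" for d B where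
  lau_zero: "lau d B (\<lambda>z. 0)"
| lau_ch: "\<mu> \<in> B \<Longrightarrow> lau d B (\<lambda>z. ch d \<mu> z * c)"
| lau_add: "lau d B F \<Longrightarrow> lau d B H \<Longrightarrow> lau d B (\<lambda>z. F z + H z)"
| lau_cong: "lau d B F \<Longrightarrow> (\<And>z. nz d z \<Longrightarrow> H z = F z) \<Longrightarrow> lau d B H"

text \<open>Coefficients are required to vanish off \<open>A\<close> so that expansions over
  different sets can be added over their union.\<close>

lemma lau_expand: "lau d B F \<Longrightarrow> \<exists>A c. finite A \<and> A \<subseteq> B \<and> (\<forall>\<mu>. \<mu> \<notin> A \<longrightarrow> c \<mu> = 0) \<and>
  (\<forall>z. nz d z \<longrightarrow> F z = (\<Sum>\<mu>\<in>A. ch d \<mu> z * c \<mu>))"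
proof (induction rule: lau.induct)
  case lau_zero
  show ?case by (intro exI[of _ "{}"] exI[of _ "\<lambda>_. 0"]) simp
next
  case (lau_ch \<mu> c)
  then show ?case by (intro exI[of _ "{\<mu>}"] exI[of _ "\<lambda>\<nu>. if \<nu> = \<mu> then c else 0"]) simp
next
  case (lau_add F H)
  obtain A c where A: "finite A" "A \<subseteq> B" "\<forall>\<mu>. \<mu> \<notin> A \<longrightarrow> c \<mu> = 0" "\<forall>z. nz d z \<longrightarrow> F z = (\<Sum>\<mu>\<in>A. ch d \<mu> z * c \<mu>)"
    using lau_add.IH(1) by (elim exE conjE)
  obtain A' c' where A': "finite A'" "A' \<subseteq> B" "\<forall>\<mu>. \<mu> \<notin> A' \<longrightarrow> c' \<mu> = 0" "\<forall>z. nz d z \<longrightarrow> H z = (\<Sum>\<mu>\<in>A'. ch d \<mu> z * c' \<mu>)"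
    using lau_add.IH(2) by (elim exE conjE)
  have "F z + H z = (\<Sum>\<mu>\<in>A \<union> A'. ch d \<mu> z * (c \<mu> + c' \<mu>))" if z: "nz d z" for z
  proof -
    have "(\<Sum>\<mu>\<in>A. ch d \<mu> z * c \<mu>) = (\<Sum>\<mu>\<in>A \<union> A'. ch d \<mu> z * c \<mu>)"
      by (rule sum.mono_neutral_left) (use A A' in auto)
    moreover have "(\<Sum>\<mu>\<in>A'. ch d \<mu> z * c' \<mu>) = (\<Sum>\<mu>\<in>A \<union> A'. ch d \<mu> z * c' \<mu>)"
      by (rule sum.mono_neutral_left) (use A A' in auto)
    ultimately show ?thesis using A(4) A'(4) z by (simp add: sum.distrib distrib_left)
  qed
  then show ?case using A A' by (intro exI[of _ "A \<union> A'"] exI[of _ "\<lambda>\<mu>. c \<mu> + c' \<mu>"]) simp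
next
  case (lau_cong F H)
  then show ?case by simp
qed

lemma lau_scale: "lau d B F \<Longrightarrow> lau d B (\<lambda>z. c * F z)"
proof (induction rule: lau.induct)
  case (lau_ch \<mu> e)
  show ?case using lau.lau_ch[OF lau_ch, of d "c * e"] by (simp add: mult.left_commute)
next
  case (lau_add F H)
  show ?case using lau.lau_add[OF lau_add.IH] by (simp add: distrib_left)
next
  case (lau_cong F H)
  show ?case by (rule lau.lau_cong[OF lau_cong.IH]) (simp add: lau_cong.hyps)
qed (simp add: lau_zero)

lemma lau_mult:
  assumes B: "\<And>\<mu> \<nu>. \<mu> \<in> B \<Longrightarrow> \<nu> \<in> B \<Longrightarrow> (\<lambda>i. \<mu> i + \<nu> i) \<in> B"
  shows "lau d B F \<Longrightarrow> lau d B H \<Longrightarrow> lau d B (\<lambda>z. F z * H z)"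
proof (induction rule: lau.induct)
  case (lau_ch \<mu> c)
  from lau_ch(2) show ?case
  proof (induction rule: lau.induct)
    case (lau_ch \<nu> e)
    show ?case
      by (rule lau_cong[OF lau.lau_ch[OF B[OF \<open>\<mu> \<in> B\<close> lau_ch], of d "c * e"]]) (simp add: ch_add mult_ac)
  next
    case (lau_add F H)
    show ?case using lau.lau_add[OF lau_add.IH] by (simp add: distrib_left)
  next
    case (lau_cong F H)
    show ?case by (rule lau.lau_cong[OF lau_cong.IH]) (simp add: lau_cong.hyps)
  qed (simp add: lau_zero)
next
  case (lau_add F F')
  show ?case using lau.lau_add[OF lau_add.IH(1)[OF lau_add.prems] lau_add.IH(2)[OF lau_add.prems]] by (simp add: distrib_right)
next
  case (lau_cong F F')
  show ?case by (rule lau.lau_cong[OF lau_cong.IH[OF lau_cong.prems]]) (simp add: lau_cong.hyps)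
qed (simp add: lau_zero)

text \<open>The inverse determinant restricts to the character with all exponents -1, so the
  generators of the coordinate ring give Laurent polynomials, and these form a ring by
  \<open>lau_mult\<close>.\<close>

lemma regular_torus: "f \<in> regular_fun d \<Longrightarrow> lau d (weights d) (\<lambda>z. f (dg d z) :: 'k::field)"
proof (induction rule: regular_fun.induct)
  case (const c)
  have "lau d (weights d) (\<lambda>z. ch d (\<lambda>_. 0) z * c)" by (rule lau_ch) (simp add: weights_def)
  then show ?case by (simp add: ch_def)
next
  case (coord i j)
  show ?case
  proof (cases "i = j")
    case True
    have "(\<Prod>a<d. z a powi (if a = i then 1 else 0)) = (\<Prod>a<d. if a = i then z i else 1)" for z :: "nat \<Rightarrow> 'k"
      by (intro prod.cong refl) simp
    then have c: "ch d (\<lambda>a. if a = i then 1 else 0) z = z i" for z :: "nat \<Rightarrow> 'k" using coord unfolding ch_def by simp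
    have "lau d (weights d) (\<lambda>z. ch d (\<lambda>a. if a = i then 1 else 0) z * (1 :: 'k))"
      by (rule lau_ch) (use coord in \<open>auto simp: weights_def\<close>)
    then show ?thesis unfolding c mult_1_right using True by (simp only: dg_entry[OF coord(2,2)] if_True refl simp_thms)
  next
    case False then show ?thesis using coord by (simp add: dg_entry lau_zero)
  qed
next
  case inverse_det
  have c: "ch d (\<lambda>a. if a < d then - 1 else 0) z = inverse (det (dg d z))" for z :: "nat \<Rightarrow> 'k"
    unfolding det_dg ch_def prod_inversef[symmetric] by (intro prod.cong refl) (simp add: power_int_minus)
  have "lau d (weights d) (\<lambda>z. ch d (\<lambda>a. if a < d then - 1 else 0) z * (1 :: 'k))"
    by (rule lau_ch) (simp add: weights_def)
  then show ?case by (simp add: c)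
next
  case (add f h)
  show ?case by (rule lau_add[OF add.IH])
next
  case (mult f h)
  show ?case by (rule lau_mult[OF _ mult.IH]) (simp add: weights_def)
qed

text \<open>Elementary matrices have determinant 1, so the inverse determinant is constant along the
  curve; all entries are linear in \<open>s\<close>.\<close>

lemma regular_root:
  assumes "i \<noteq> j" "i < d" "j < d" and g: "g \<in> carrier_mat d d"
  shows "f \<in> regular_fun d \<Longrightarrow> polyf (\<lambda>s. f (addrow_mat d s i j * g) :: 'k::field)"
proof (induction rule: regular_fun.induct)
  case (coord a b)
  show ?case unfolding addrow_entry[OF g assms(3) coord]
    by (cases "a = i") (simp_all add: polyf_const polyf_add polyf_mult polyf_id)
next
  case inverse_det
  have "det (addrow_mat d s i j * g) = det g" for s :: 'k
    using det_mult[OF addrow_mat_carrier g, of s i j] det_addrow_mat[OF assms(1), of d s] by simp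
  then show ?case by (simp add: polyf_const)
qed (simp_all add: polyf_const polyf_add polyf_mult)

text \<open>Conjugation by the torus acts on a root subgroup through its root
  \<open>z i / z j\<close>; written as a commutation rule, this needs no inverse matrices.\<close>

lemma dg_addrow:
  assumes z: "nz d z" and "i < d" "j < d"
  shows "dg d z * addrow_mat d s i j = addrow_mat d (s * (z i / z j)) i j * dg d (z :: nat \<Rightarrow> 'k::field)"
proof (rule eq_matI)
  fix a b assume "a < dim_row (addrow_mat d (s * (z i / z j)) i j * dg d z)" "b < dim_col (addrow_mat d (s * (z i / z
    j)) i j * dg d z)"
  then have ab: "a < d" "b < d" by (auto simp: dg_def)
  have "z j \<noteq> 0" using z assms by (simp add: nz_def)
  then show "(dg d z * addrow_mat d s i j) $$ (a, b) = (addrow_mat d (s * (z i / z j)) i j * dg d z) $$ (a, b)"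
    unfolding addcol_entry[OF dg_carrier assms(2) ab] addrow_entry[OF dg_carrier assms(3) ab]
    using ab assms by (auto simp: dg_entry)
qed (auto simp: dg_def)

subsection \<open>The matrix coefficient of a highest weight vector\<close>

locale highest_weight_module = partition_shape +
  fixes L :: "('k::field, 'l) module" and \<tau> :: "'k mat \<Rightarrow> 'l \<Rightarrow> 'l"
  assumes inf: "infinite (UNIV :: 'k set)" and hw: "simple_highest_weight_module d L \<tau> (partition_weight lam)"
begin

abbreviation "\<Lambda> \<equiv> partition_weight lam"

lemma \<Lambda>_weights: "\<Lambda> \<in> weights d"
  using length_le by (simp add: weights_def partition_weight_def)

lemma rat: "rational_rep d L \<tau>" and simple: "simple_rep (GL d) L \<tau>" and hwt: "highest_weight d L \<tau> \<Lambda>"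
  using hw by (auto simp: simple_highest_weight_module_def)

lemma L_rep: "linear_rep (GL d) L \<tau>" using simple by (simp add: simple_rep_def)

sublocale L: lrep "GL d" L \<tau> using L_rep by (simp add: lrep_def)

lemma L_vsp: "vsp L" by (rule L.vsp)

definition expands :: "'l \<Rightarrow> 'l set \<Rightarrow> ('l \<Rightarrow> 'k mat \<Rightarrow> 'k) \<Rightarrow> bool" where
  "expands y Sf f \<longleftrightarrow> finite Sf \<and> Sf \<subseteq> carrier L \<and> (\<forall>w\<in>Sf. f w \<in> regular_fun d) \<and>
     (\<forall>g\<in>carrier (GL d). \<tau> g y = (\<Oplus>\<^bsub>L\<^esub>w\<in>Sf. f w g \<odot>\<^bsub>L\<^esub> w))"

lemma rational_expansion: "y \<in> carrier L \<Longrightarrow> \<exists>Sf f. expands y Sf f"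
  using rat unfolding rational_rep_def expands_def by blast

lemma expandsD:
  assumes "expands y Sf f"
  shows "finite Sf" "Sf \<subseteq> carrier L" "w \<in> Sf \<Longrightarrow> f w \<in> regular_fun d"
    "functional L \<xi> \<Longrightarrow> g \<in> carrier (GL d) \<Longrightarrow> \<xi> (\<tau> g y) = (\<Sum>w\<in>Sf. f w g * \<xi> w)"
    "g \<in> carrier (GL d) \<Longrightarrow> \<tau> g y = (\<Oplus>\<^bsub>L\<^esub>w\<in>Sf. f w g \<odot>\<^bsub>L\<^esub> w)"
proof -
  have SS: "finite Sf" "Sf \<subseteq> carrier L" "\<forall>w\<in>Sf. f w \<in> regular_fun d"
    and e: "\<forall>g\<in>carrier (GL d). \<tau> g y = (\<Oplus>\<^bsub>L\<^esub>w\<in>Sf. f w g \<odot>\<^bsub>L\<^esub> w)"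
    using assms unfolding expands_def by blast+
  show "\<xi> (\<tau> g y) = (\<Sum>w\<in>Sf. f w g * \<xi> w)" if \<xi>: "functional L \<xi>" and g: "g \<in> carrier (GL d)"
  proof -
    have "\<xi> (\<tau> g y) = (\<Sum>w\<in>Sf. \<xi> (f w g \<odot>\<^bsub>L\<^esub> w))"
      unfolding bspec[OF e g] by (rule vsp.functional_finsum[OF L_vsp \<xi>]) (use SS(2) vsp.smult_cl[OF L_vsp] in auto)
    also have "\<dots> = (\<Sum>w\<in>Sf. f w g * \<xi> w)"
      by (intro sum.cong refl) (use \<xi> SS(2) in \<open>auto simp: functional_def\<close>)
    finally show ?thesis .
  qed
  show "finite Sf" "Sf \<subseteq> carrier L" "w \<in> Sf \<Longrightarrow> f w \<in> regular_fun d"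
    "g \<in> carrier (GL d) \<Longrightarrow> \<tau> g y = (\<Oplus>\<^bsub>L\<^esub>w\<in>Sf. f w g \<odot>\<^bsub>L\<^esub> w)" using SS e by blast+
qed

lemma L_nonzero: "\<exists>v \<in> weight_space d L \<tau> \<Lambda>. v \<noteq> \<zero>\<^bsub>L\<^esub>"
proof -
  interpret V: vsp L by (rule L_vsp)
  have "\<zero>\<^bsub>L\<^esub> \<in> weight_space d L \<tau> \<Lambda>"
    unfolding weight_space_def using lhom_zero[OF L_vsp L_vsp L.act_hom] by auto
  then show ?thesis using hwt unfolding highest_weight_def by blast
qed

text \<open>Rationality puts the orbit of a nonzero vector into the span of a finite set, and by
  simplicity the orbit spans \<open>L\<close>.\<close>

lemma L_fvsp: "fvsp L"
proof -
  interpret V: vsp L by (rule L_vsp)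
  obtain v where v: "v \<in> weight_space d L \<tau> \<Lambda>" "v \<noteq> \<zero>\<^bsub>L\<^esub>" using L_nonzero by blast
  have vL: "v \<in> carrier L" using v(1) by (simp add: weight_space_def)
  obtain Sf f where SF: "expands v Sf f" using rational_expansion[OF vL] by blast
  note SS = expandsD(1,2)[OF SF] and reg = expandsD(3)[OF SF] and e = expandsD(4)[OF SF] and e5 = expandsD(5)[OF SF]
  have sp: "VectorSpace.subspace class_ring (L.span Sf) L" using L.span_is_subspace[OF SS(2)] .
  have orb: "\<tau> g v \<in> L.span Sf" if g: "g \<in> carrier (GL d)" for g
  proof -
    have "(\<Oplus>\<^bsub>L\<^esub>w\<in>Sf. f w g \<odot>\<^bsub>L\<^esub> w) = L.lincomb (\<lambda>w. f w g) Sf" by (simp add: L.lincomb_def)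
    then show ?thesis unfolding e5[OF g] L.span_def using SS(1) by (auto simp: class_ring_simps)
  qed
  have "lact L \<tau> b v \<in> L.span Sf" if "glist (GL d) b" for b
    using that
  proof (induction b)
    case Nil then show ?case using V.subspD(2)[OF sp] by simp
  next
    case (Cons cg b) then show ?case using V.subspD(3,4)[OF sp] orb by simp
  qed
  then have "carrier L \<subseteq> L.span Sf"
    using L.simple_orbit[OF simple vL v(2)] by (metis subsetI)
  then have "L.span Sf = carrier L" using V.subspD(1)[OF sp] by blast
  then have "L.fin_dim" unfolding L.fin_dim_def using SS by blast
  then show ?thesis using L_vsp by (simp add: fvsp_def fvsp_axioms_def)
qed

lemma weight_space_iff: "y \<in> weight_space d L \<tau> \<mu> \<longleftrightarrow>
  y \<in> carrier L \<and> (\<forall>z. nz d z \<longrightarrow> \<tau> (dg d z) y = ch d \<mu> z \<odot>\<^bsub>L\<^esub> y)"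
proof
  assume y: "y \<in> weight_space d L \<tau> \<mu>"
  have "\<tau> (dg d z) y = ch d \<mu> z \<odot>\<^bsub>L\<^esub> y" if "nz d z" for z
  proof -
    have "(\<Prod>i<d. dg d z $$ (i, i) powi \<mu> i) = ch d \<mu> z" unfolding ch_def by (intro prod.cong refl) (simp add: dg_entry)
    then show ?thesis using y dg_GL[OF that] dg_diagonal[of d z] unfolding weight_space_def by auto
  qed
  then show "y \<in> carrier L \<and> (\<forall>z. nz d z \<longrightarrow> \<tau> (dg d z) y = ch d \<mu> z \<odot>\<^bsub>L\<^esub> y)" using y by (simp add: weight_space_def)
next
  assume y: "y \<in> carrier L \<and> (\<forall>z. nz d z \<longrightarrow> \<tau> (dg d z) y = ch d \<mu> z \<odot>\<^bsub>L\<^esub> y)"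
  show "y \<in> weight_space d L \<tau> \<mu>" unfolding weight_space_def
  proof (intro CollectI conjI ballI impI)
    fix t :: "'k mat" assume t: "t \<in> carrier (GL d)" "diagonal_mat t"
    have "\<tau> (dg d (\<lambda>i. t $$ (i, i))) y = ch d \<mu> (\<lambda>i. t $$ (i, i)) \<odot>\<^bsub>L\<^esub> y" using y diagonal_dg(2)[OF t] by blast
    then show "\<tau> t y = (\<Prod>i<d. t $$ (i, i) powi \<mu> i) \<odot>\<^bsub>L\<^esub> y" unfolding diagonal_dg(1)[OF t, symmetric] ch_def .
  qed (use y in simp)
qed

lemma weight_bound: "y \<in> weight_space d L \<tau> \<mu> \<Longrightarrow> y \<noteq> \<zero>\<^bsub>L\<^esub> \<Longrightarrow> weight_le d \<mu> \<Lambda>"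
  using hwt unfolding highest_weight_def by blast

lemma tau_functional: "functional L \<xi> \<Longrightarrow> g \<in> carrier (GL d) \<Longrightarrow> functional L (\<lambda>y. \<xi> (\<tau> g y))"
  using functional_comp[OF _ L.act_hom] by blast

lemma tau_mult: "g \<in> carrier (GL d) \<Longrightarrow> h \<in> carrier (GL d) \<Longrightarrow> y \<in> carrier L \<Longrightarrow> \<tau> (g * h) y = \<tau> g (\<tau> h y)"
  using L.act_mult by (simp add: GL_simps)

lemma tau_one: "y \<in> carrier L \<Longrightarrow> \<tau> (1\<^sub>m d) y = y"
  using L.act_one by (simp add: GL_simps)

lemma functional_smult: "functional L \<xi> \<Longrightarrow> y \<in> carrier L \<Longrightarrow> \<xi> (c \<odot>\<^bsub>L\<^esub> y) = c * \<xi> y"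
  by (simp add: functional_def)

text \<open>Stated through functionals, so that the identities in the torus variable are scalar and
  \<open>dedekind_independence\<close> applies. Nothing is lost, since functionals separate the
  points of \<open>L\<close>.\<close>

definition decomposes :: "'l \<Rightarrow> (nat \<Rightarrow> int) set \<Rightarrow> ((nat \<Rightarrow> int) \<Rightarrow> 'l) \<Rightarrow> bool" where
  "decomposes y A ys \<longleftrightarrow> finite A \<and> A \<subseteq> weights d \<and> (\<forall>\<mu>\<in>A. ys \<mu> \<in> weight_space d L \<tau> \<mu>) \<and>
     (\<forall>\<xi>. functional L \<xi> \<longrightarrow> \<xi> y = (\<Sum>\<mu>\<in>A. \<xi> (ys \<mu>)))"

text \<open>Restricting the rational expansion of \<open>y\<close> to the torus and sorting by
  characters gives candidates for the components. Independence of characters shows that they are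
  weight vectors.\<close>

lemma weight_decomposition:
  assumes y: "y \<in> carrier L"
  shows "\<exists>A ys. decomposes y A ys"
proof -
  interpret V: vsp L by (rule L_vsp)
  obtain Sf f where SF: "expands y Sf f" using rational_expansion[OF y] by blast
  note SS = expandsD(1,2)[OF SF] and reg = expandsD(3)[OF SF] and e = expandsD(4)[OF SF] and e5 = expandsD(5)[OF SF]
  have "\<exists>A c. finite A \<and> A \<subseteq> weights d \<and> (\<forall>\<mu>. \<mu> \<notin> A \<longrightarrow> c \<mu> = 0) \<and>
    (\<forall>z. nz d z \<longrightarrow> f w (dg d z) = (\<Sum>\<mu>\<in>A. ch d \<mu> z * c \<mu>))" if "w \<in> Sf" for w
    by (rule lau_expand[OF regular_torus[OF reg[OF that]]])
  then obtain A c where A: "\<And>w. w \<in> Sf \<Longrightarrow> finite (A w) \<and> A w \<subseteq> weights d \<and> (\<forall>\<mu>. \<mu> \<notin> A w \<longrightarrow> c w \<mu> = 0) \<and>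
    (\<forall>z. nz d z \<longrightarrow> f w (dg d z) = (\<Sum>\<mu>\<in>A w. ch d \<mu> z * c w \<mu>))" by metis
  define B where "B = (\<Union>w\<in>Sf. A w)"
  have B: "finite B" "B \<subseteq> weights d" unfolding B_def using SS(1) A by blast+
  define ys where "ys \<mu> = (\<Oplus>\<^bsub>L\<^esub>w\<in>Sf. c w \<mu> \<odot>\<^bsub>L\<^esub> w)" for \<mu>
  have cl: "(\<lambda>w. c w \<mu> \<odot>\<^bsub>L\<^esub> w) \<in> Sf \<rightarrow> carrier L" for \<mu> using SS(2) by auto
  have ysL: "ys \<mu> \<in> carrier L" for \<mu> unfolding ys_def by (rule L.finsum_closed[OF cl])
  have \<xi>ys: "\<xi> (ys \<mu>) = (\<Sum>w\<in>Sf. c w \<mu> * \<xi> w)" if \<xi>: "functional L \<xi>" for \<xi> \<mu>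
    unfolding ys_def V.functional_finsum[OF \<xi> cl]
    by (intro sum.cong refl) (use functional_smult[OF \<xi>] SS(2) in auto)
  have exp: "\<xi> (\<tau> (dg d z) y) = (\<Sum>\<mu>\<in>B. ch d \<mu> z * \<xi> (ys \<mu>))" if \<xi>: "functional L \<xi>" and z: "nz d z" for \<xi> z
  proof -
    have "\<xi> (\<tau> (dg d z) y) = (\<Sum>w\<in>Sf. \<Sum>\<mu>\<in>B. ch d \<mu> z * (c w \<mu> * \<xi> w))"
      unfolding e[OF \<xi> dg_GL[OF z]]
    proof (intro sum.cong refl)
      fix w assume w: "w \<in> Sf"
      have "f w (dg d z) = (\<Sum>\<mu>\<in>A w. ch d \<mu> z * c w \<mu>)" using A[OF w] z by blast
      also have "\<dots> = (\<Sum>\<mu>\<in>B. ch d \<mu> z * c w \<mu>)"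
        by (rule sum.mono_neutral_left) (use B(1) A[OF w] w in \<open>auto simp: B_def\<close>)
      finally show "f w (dg d z) * \<xi> w = (\<Sum>\<mu>\<in>B. ch d \<mu> z * (c w \<mu> * \<xi> w))" by (simp add: sum_distrib_right mult.assoc)
    qed
    also have "\<dots> = (\<Sum>\<mu>\<in>B. \<Sum>w\<in>Sf. ch d \<mu> z * (c w \<mu> * \<xi> w))" by (rule sum.swap)
    finally show ?thesis by (simp add: \<xi>ys[OF \<xi>] sum_distrib_left)
  qed
  have wt: "ys \<mu> \<in> weight_space d L \<tau> \<mu>" if \<mu>: "\<mu> \<in> B" for \<mu>
    unfolding weight_space_iff
  proof (intro conjI allI impI)
    show "ys \<mu> \<in> carrier L" by (rule ysL)
    fix z :: "nat \<Rightarrow> 'k" assume z: "nz d z"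
    show "\<tau> (dg d z) (ys \<mu>) = ch d \<mu> z \<odot>\<^bsub>L\<^esub> ys \<mu>"
    proof (rule fvsp.functional_separates[OF L_fvsp])
      show "\<tau> (dg d z) (ys \<mu>) \<in> carrier L" by (rule L.act_cl[OF dg_GL[OF z] ysL])
      show "ch d \<mu> z \<odot>\<^bsub>L\<^esub> ys \<mu> \<in> carrier L" using ysL by simp
      fix \<xi> assume \<xi>: "functional L \<xi>"
      \<comment> \<open>The action of the product of \<open>z\<close> and \<open>w\<close> on
        \<open>y\<close> is expanded in two ways as a combination of characters of
        \<open>w\<close>.\<close>
      have "\<xi> (\<tau> (dg d z) (ys \<mu>)) - ch d \<mu> z * \<xi> (ys \<mu>) = 0"
      proof (rule dedekind_independence[OF inf B _ \<mu>])
        fix w :: "nat \<Rightarrow> 'k" assume w: "nz d w"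
        have zw: "nz d (\<lambda>i. z i * w i)" using z w by (simp add: nz_def)
        have "(\<Sum>\<mu>\<in>B. ch d \<mu> w * \<xi> (\<tau> (dg d z) (ys \<mu>))) = \<xi> (\<tau> (dg d z) (\<tau> (dg d w) y))"
          using exp[OF tau_functional[OF \<xi> dg_GL[OF z]] w] by simp
        also have "\<dots> = \<xi> (\<tau> (dg d (\<lambda>i. z i * w i)) y)"
          unfolding dg_mult tau_mult[OF dg_GL[OF z] dg_GL[OF w] y] ..
        also have "\<dots> = (\<Sum>\<mu>\<in>B. ch d \<mu> w * (ch d \<mu> z * \<xi> (ys \<mu>)))"
          unfolding exp[OF \<xi> zw] ch_mult by (intro sum.cong refl) (simp add: mult_ac)
        finally show "(\<Sum>\<mu>\<in>B. ch d \<mu> w * (\<xi> (\<tau> (dg d z) (ys \<mu>)) - ch d \<mu> z * \<xi> (ys \<mu>))) = 0"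
          by (simp add: right_diff_distrib sum_subtractf)
      qed
      then show "\<xi> (\<tau> (dg d z) (ys \<mu>)) = \<xi> (ch d \<mu> z \<odot>\<^bsub>L\<^esub> ys \<mu>)" using functional_smult[OF \<xi> ysL] by simp
    qed
  qed
  have "\<xi> y = (\<Sum>\<mu>\<in>B. \<xi> (ys \<mu>))" if \<xi>: "functional L \<xi>" for \<xi>
  proof -
    have "nz d (\<lambda>_. 1 :: 'k)" by (simp add: nz_def)
    from exp[OF \<xi> this] show ?thesis by (simp add: dg_one tau_one[OF y] ch_one)
  qed
  then have "decomposes y B ys" unfolding decomposes_def using B wt by blast
  then show ?thesis by blast
qed

text \<open>The weight \<mu> plus \<open>k\<close> times the root of the subgroup at position (i,
  j).\<close>

definition shift :: "(nat \<Rightarrow> int) \<Rightarrow> nat \<Rightarrow> nat \<Rightarrow> nat \<Rightarrow> nat \<Rightarrow> int" where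
  "shift \<mu> i j k a = \<mu> a + (if a = i then int k else 0) - (if a = j then int k else 0)"

lemma ch_shift:
  assumes z: "nz d z" and ij: "i < d" "j < d" "i \<noteq> j"
  shows "ch d (shift \<mu> i j k) z = ch d \<mu> z * (z i / z j) ^ k"
proof -
  have "ch d (shift \<mu> i j k) z = ch d (\<lambda>a. \<mu> a + ((if a = i then int k else 0) + (if a = j then - int k else 0))) z"
    unfolding shift_def by (intro arg_cong[where f="\<lambda>\<mu>. ch d \<mu> z"] ext) simp
  also have "\<dots> = ch d \<mu> z * (ch d (\<lambda>a. if a = i then int k else 0) z * ch d (\<lambda>a. if a = j then - int k else 0) z)"
    unfolding ch_add[OF z] ..
  also have "ch d (\<lambda>a. if a = i then int k else 0) z = z i ^ k"
  proof -
    have "ch d (\<lambda>a. if a = i then int k else 0) z = (\<Prod>a<d. if a = i then z i ^ k else 1)"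
      unfolding ch_def by (intro prod.cong refl) (simp add: power_int_of_nat)
    then show ?thesis using ij by simp
  qed
  also have "ch d (\<lambda>a. if a = j then - int k else 0) z = inverse (z j ^ k)"
  proof -
    have "ch d (\<lambda>a. if a = j then - int k else 0) z = (\<Prod>a<d. if a = j then inverse (z j ^ k) else 1)"
      unfolding ch_def by (intro prod.cong refl) (simp add: power_int_minus power_int_of_nat)
    then show ?thesis using ij by simp
  qed
  finally show ?thesis by (simp add: divide_inverse power_mult_distrib power_inverse)
qed

text \<open>The partial sum up to and including \<open>i\<close> exceeds that of \<Lambda> by
  \<open>k\<close>, which \<open>weight_le\<close> forbids for weights of \<open>L\<close>.\<close>

lemma shift_not_weight:
  assumes "i < j" "j < d" "k > 0" "y \<in> weight_space d L \<tau> (shift \<Lambda> i j k)"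
  shows "y = \<zero>\<^bsub>L\<^esub>"
proof (rule ccontr)
  assume "y \<noteq> \<zero>\<^bsub>L\<^esub>"
  then have "weight_le d (shift \<Lambda> i j k) \<Lambda>" using weight_bound assms(4) by blast
  then have "(\<Sum>a<Suc i. shift \<Lambda> i j k a) \<le> (\<Sum>a<Suc i. \<Lambda> a)" unfolding weight_le_def using assms(1,2)
    by (simp del: sum.lessThan_Suc add: Suc_le_eq)
  moreover have "(\<Sum>a<i. shift \<Lambda> i j k a) = (\<Sum>a<i. \<Lambda> a)"
    by (intro sum.cong refl) (use assms(1) in \<open>simp add: shift_def\<close>)
  moreover have "shift \<Lambda> i j k i = \<Lambda> i + int k" using assms(1) by (simp add: shift_def)
  ultimately show False using assms(3) by simp
qed

text \<open>The coefficients of the powers of \<open>s\<close> in the action of a root subgroup are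
  the divided-power components of \<open>y\<close>. Torus conjugation rescales \<open>s\<close> by
  the root, so the component of degree \<open>k\<close> has its weight shifted by \<open>k\<close>
  roots.\<close>

lemma root_expansion:
  assumes y: "y \<in> weight_space d L \<tau> \<mu>" and ij: "i < d" "j < d" "i \<noteq> j"
  shows "\<exists>yk. (\<forall>k. yk k \<in> weight_space d L \<tau> (shift \<mu> i j k)) \<and>
    (\<forall>\<xi>. functional L \<xi> \<longrightarrow> (\<exists>P. (\<forall>s. \<xi> (\<tau> (addrow_mat d s i j) y) = poly P s) \<and> (\<forall>k. coeff P k = \<xi> (yk k))))"
proof -
  interpret V: vsp L by (rule L_vsp)
  have yL: "y \<in> carrier L" using y by (simp add: weight_space_iff)
  obtain Sf f where SF: "expands y Sf f" using rational_expansion[OF yL] by blast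
  note SS = expandsD(1,2)[OF SF] and reg = expandsD(3)[OF SF] and e = expandsD(4)[OF SF] and e5 = expandsD(5)[OF SF]
  have xG: "addrow_mat d s i j \<in> carrier (GL d)" for s :: 'k by (rule addrow_GL[OF ij(3)])
  have "polyf (\<lambda>s. f w (addrow_mat d s i j))" if "w \<in> Sf" for w
    using regular_root[OF ij(3,1,2) one_carrier_mat reg[OF that]] by simp
  then obtain p where p: "\<And>w s. w \<in> Sf \<Longrightarrow> f w (addrow_mat d s i j) = poly (p w) s" unfolding polyf_def by metis
  define yk where "yk k = (\<Oplus>\<^bsub>L\<^esub>w\<in>Sf. coeff (p w) k \<odot>\<^bsub>L\<^esub> w)" for k
  have cl: "(\<lambda>w. coeff (p w) k \<odot>\<^bsub>L\<^esub> w) \<in> Sf \<rightarrow> carrier L" for k using SS(2) by auto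
  have ykL: "yk k \<in> carrier L" for k unfolding yk_def by (rule L.finsum_closed[OF cl])
  define Q where "Q \<xi> = (\<Sum>w\<in>Sf. smult (\<xi> w) (p w))" for \<xi>
  have Qp: "\<xi> (\<tau> (addrow_mat d s i j) y) = poly (Q \<xi>) s" if "functional L \<xi>" for \<xi> s
    unfolding e[OF that xG] Q_def poly_sum by (intro sum.cong refl) (simp add: p)
  have Qc: "coeff (Q \<xi>) k = \<xi> (yk k)" if \<xi>: "functional L \<xi>" for \<xi> k
    unfolding Q_def coeff_sum yk_def V.functional_finsum[OF \<xi> cl]
    by (intro sum.cong refl) (use functional_smult[OF \<xi>] SS(2) in auto)
  have "yk k \<in> weight_space d L \<tau> (shift \<mu> i j k)" for k
    unfolding weight_space_iff
  proof (intro conjI allI impI)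
    show "yk k \<in> carrier L" by (rule ykL)
    fix z :: "nat \<Rightarrow> 'k" assume z: "nz d z"
    show "\<tau> (dg d z) (yk k) = ch d (shift \<mu> i j k) z \<odot>\<^bsub>L\<^esub> yk k"
    proof (rule fvsp.functional_separates[OF L_fvsp])
      show "\<tau> (dg d z) (yk k) \<in> carrier L" by (rule L.act_cl[OF dg_GL[OF z] ykL])
      show "ch d (shift \<mu> i j k) z \<odot>\<^bsub>L\<^esub> yk k \<in> carrier L" using ykL by simp
      fix \<xi> assume \<xi>: "functional L \<xi>"
      note \<xi>z = tau_functional[OF \<xi> dg_GL[OF z]]
      let ?r = "z i / z j"
      \<comment> \<open>Both sides are, as polynomials in \<open>s\<close>, the value of \<xi> after
        first the root element and then the torus element act on \<open>y\<close>; on the right the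
        torus element has been moved past the root element.\<close>
      have "Q (\<lambda>y. \<xi> (\<tau> (dg d z) y)) = smult (ch d \<mu> z) (pcompose (Q \<xi>) [:0, ?r:])"
      proof (rule poly_eq_off_zero[OF inf])
        fix s :: 'k
        have "poly (Q (\<lambda>y. \<xi> (\<tau> (dg d z) y))) s = \<xi> (\<tau> (dg d z * addrow_mat d s i j) y)"
          using Qp[OF \<xi>z, of s] tau_mult[OF dg_GL[OF z] xG yL] by simp
        also have "\<dots> = \<xi> (\<tau> (addrow_mat d (s * ?r) i j) (\<tau> (dg d z) y))"
          unfolding dg_addrow[OF z ij(1,2)] tau_mult[OF xG dg_GL[OF z] yL] ..
        also have "\<tau> (dg d z) y = ch d \<mu> z \<odot>\<^bsub>L\<^esub> y" using y z by (simp add: weight_space_iff)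
        also have "\<xi> (\<tau> (addrow_mat d (s * ?r) i j) (ch d \<mu> z \<odot>\<^bsub>L\<^esub> y)) = ch d \<mu> z * poly (Q \<xi>) (s * ?r)"
          using functional_smult[OF tau_functional[OF \<xi> xG] yL] Qp[OF \<xi>] by simp
        finally show "poly (Q (\<lambda>y. \<xi> (\<tau> (dg d z) y))) s = poly (smult (ch d \<mu> z) (pcompose (Q \<xi>) [:0, ?r:])) s"
          by (simp add: poly_pcompose)
      qed
      then have "coeff (Q (\<lambda>y. \<xi> (\<tau> (dg d z) y))) k = ch d \<mu> z * (?r ^ k * coeff (Q \<xi>) k)"
        by (simp add: coeff_pcompose_linear)
      then show "\<xi> (\<tau> (dg d z) (yk k)) = \<xi> (ch d (shift \<mu> i j k) z \<odot>\<^bsub>L\<^esub> yk k)"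
        unfolding functional_smult[OF \<xi> ykL] ch_shift[OF z ij] Qc[OF \<xi>z] Qc[OF \<xi>] by simp
    qed
  qed
  then show ?thesis using Qp Qc by (intro exI[of _ yk]) blast
qed

text \<open>The \<Lambda>-weight space is not known to be a line, so \<xi> is chosen to be 1 on a
  highest weight vector \<open>v\<close> and 0 on vectors without \<Lambda>-component. Upper root
  subgroups fix \<open>v\<close> because raising \<Lambda> leads to no weight; lower ones fix \<xi>
  because the terms they create never have weight \<Lambda>.\<close>

theorem highest_weight_coefficient: "coefficient (GL d) L \<tau> Fc"
proof -
  interpret V: vsp L by (rule L_vsp)
  obtain v where v: "v \<in> weight_space d L \<tau> \<Lambda>" "v \<noteq> \<zero>\<^bsub>L\<^esub>" using L_nonzero by blast
  have vL: "v \<in> carrier L" using v(1) by (simp add: weight_space_iff)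
  have constP: "P = [:coeff P 0:]" if "\<And>k. k > 0 \<Longrightarrow> coeff P k = 0" for P :: "'k poly"
    by (rule poly_eqI) (use that in \<open>auto simp: coeff_pCons split: nat.splits\<close>)
  have upper_v: "\<tau> (addrow_mat d s i j) v = v" if ij: "i < j" "j < d" for i j s
  proof (rule fvsp.functional_separates[OF L_fvsp])
    have ij': "i < d" "j < d" "i \<noteq> j" using ij by simp_all
    show "\<tau> (addrow_mat d s i j) v \<in> carrier L" by (rule L.act_cl[OF addrow_GL[OF ij'(3)] vL])
    show "v \<in> carrier L" by (rule vL)
    fix \<xi> assume \<xi>: "functional L \<xi>"
    obtain yk where yk0: "(\<forall>k. yk k \<in> weight_space d L \<tau> (shift \<Lambda> i j k)) \<and>
    (\<forall>\<xi>. functional L \<xi> \<longrightarrow> (\<exists>P. (\<forall>s. \<xi> (\<tau> (addrow_mat d s i j) v) = poly P s) \<and> (\<forall>k. coeff P k = \<xi> (yk k))))"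
      using root_expansion[OF v(1) ij'] by (elim exE)
    have yk: "\<And>k. yk k \<in> weight_space d L \<tau> (shift \<Lambda> i j k)" and P: "\<And>\<xi>. functional L \<xi> \<Longrightarrow>
      \<exists>P. (\<forall>s. \<xi> (\<tau> (addrow_mat d s i j) v) = poly P s) \<and> (\<forall>k. coeff P k = \<xi> (yk k))" using yk0 by blast+
    obtain P where P: "\<And>s. \<xi> (\<tau> (addrow_mat d s i j) v) = poly P s" "\<And>k. coeff P k = \<xi> (yk k)" using P[OF \<xi>] by blast
    have "coeff P k = 0" if "k > 0" for k
      unfolding P(2) shift_not_weight[OF ij that yk] by (rule V.functional_zero[OF \<xi>])
    then have "P = [:coeff P 0:]" by (rule constP)
    then have "poly P s = poly P 0" by (metis poly_pCons poly_0 mult_zero_right)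
    then show "\<xi> (\<tau> (addrow_mat d s i j) v) = \<xi> v" using P(1)[of s] P(1)[of 0] by (simp add: addrow_zero tau_one[OF vL])
  qed
  let ?B = "weights d - {\<Lambda>}"
  \<comment> \<open>Plays the part of the sum of the other weight spaces. Described by torus
    expansions without the character \<Lambda>, it is a subspace at once.\<close>
  define W0 where "W0 = {y \<in> carrier L. \<forall>\<xi>. functional L \<xi> \<longrightarrow> lau d ?B (\<lambda>z. \<xi> (\<tau> (dg d z) y))}"
  have W0: "VectorSpace.subspace class_ring W0 L"
    unfolding V.subsp_iff
  proof (intro conjI ballI allI)
    show "W0 \<subseteq> carrier L" unfolding W0_def by blast
    have "lau d ?B (\<lambda>z. \<xi> (\<tau> (dg d z) \<zero>\<^bsub>L\<^esub>))" if \<xi>: "functional L \<xi>" for \<xi>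
      by (rule lau_cong[OF lau_zero]) (simp add: lhom_zero[OF L_vsp L_vsp L.act_hom[OF dg_GL]] V.functional_zero[OF \<xi>])
    then show "\<zero>\<^bsub>L\<^esub> \<in> W0" unfolding W0_def by simp
    fix x assume x: "x \<in> W0"
    have xL: "x \<in> carrier L" using x unfolding W0_def by blast
    { fix y assume y: "y \<in> W0"
      have yL: "y \<in> carrier L" using y unfolding W0_def by blast
      have "lau d ?B (\<lambda>z. \<xi> (\<tau> (dg d z) (x \<oplus>\<^bsub>L\<^esub> y)))" if \<xi>: "functional L \<xi>" for \<xi>
      proof (rule lau_cong)
        show "lau d ?B (\<lambda>z. \<xi> (\<tau> (dg d z) x) + \<xi> (\<tau> (dg d z) y))"
          by (rule lau_add) (use x y \<xi> in \<open>simp_all add: W0_def\<close>)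
        fix z :: "nat \<Rightarrow> 'k" assume "nz d z"
        then show "\<xi> (\<tau> (dg d z) (x \<oplus>\<^bsub>L\<^esub> y)) = \<xi> (\<tau> (dg d z) x) + \<xi> (\<tau> (dg d z) y)"
          using tau_functional[OF \<xi> dg_GL] xL yL by (simp add: functional_def)
      qed
      then show "x \<oplus>\<^bsub>L\<^esub> y \<in> W0" unfolding W0_def using xL yL by simp }
    { fix c
      have "lau d ?B (\<lambda>z. \<xi> (\<tau> (dg d z) (c \<odot>\<^bsub>L\<^esub> x)))" if \<xi>: "functional L \<xi>" for \<xi>
      proof (rule lau_cong)
        show "lau d ?B (\<lambda>z. c * \<xi> (\<tau> (dg d z) x))"
          by (rule lau_scale) (use x \<xi> in \<open>simp add: W0_def\<close>)
        fix z :: "nat \<Rightarrow> 'k" assume "nz d z"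
        then show "\<xi> (\<tau> (dg d z) (c \<odot>\<^bsub>L\<^esub> x)) = c * \<xi> (\<tau> (dg d z) x)"
          using functional_smult[OF tau_functional[OF \<xi> dg_GL] xL] by simp
      qed
      then show "c \<odot>\<^bsub>L\<^esub> x \<in> W0" unfolding W0_def using xL by simp }
  qed
  have ws: "\<xi> (\<tau> (dg d z) y) = ch d \<mu> z * \<xi> y" if "y \<in> weight_space d L \<tau> \<mu>" "functional L \<xi>" "nz d z" for y \<mu> \<xi> z
    using that functional_smult[OF that(2)] by (simp add: weight_space_iff)
  have other: "y \<in> W0" if y: "y \<in> weight_space d L \<tau> \<mu>" and \<mu>: "\<mu> \<in> ?B" for y \<mu>
  proof -
    have "lau d ?B (\<lambda>z. \<xi> (\<tau> (dg d z) y))" if \<xi>: "functional L \<xi>" for \<xi>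
      by (rule lau_cong[OF lau_ch[OF \<mu>, of d "\<xi> y"]]) (rule ws[OF y \<xi>])
    then show ?thesis using y unfolding W0_def by (simp add: weight_space_iff)
  qed
  \<comment> \<open>Otherwise the character \<Lambda> would be a combination of other characters;
    giving \<Lambda> the coefficient -1 turns this into a relation that contradicts
    independence.\<close>
  have "v \<notin> W0"
  proof
    assume vW: "v \<in> W0"
    obtain \<xi> where \<xi>: "functional L \<xi>" "\<xi> v = 1"
      using fvsp.functional_exists[OF L_fvsp V.subsp_zero vL] v(2) by blast
    have "lau d ?B (\<lambda>z. \<xi> (\<tau> (dg d z) v))" using vW \<xi>(1) unfolding W0_def by blast
    from lau_expand[OF this] obtain A c where A: "finite A" "A \<subseteq> ?B"
      and e: "\<forall>z. nz d z \<longrightarrow> \<xi> (\<tau> (dg d z) v) = (\<Sum>\<mu>\<in>A. ch d \<mu> z * c \<mu>)" by (elim exE conjE)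
    have "\<Lambda> \<notin> A" using A(2) by blast
    have "(if \<Lambda> = \<Lambda> then - 1 else c \<Lambda>) = (0 :: 'k)"
    proof (rule dedekind_independence[OF inf, of "insert \<Lambda> A" d "\<lambda>\<mu>. if \<mu> = \<Lambda> then - 1 else c \<mu>"])
      show "finite (insert \<Lambda> A)" using A(1) by simp
      show "insert \<Lambda> A \<subseteq> weights d" using A(2) \<Lambda>_weights by blast
      fix z :: "nat \<Rightarrow> 'k" assume z: "nz d z"
      have "(\<Sum>\<mu>\<in>A. ch d \<mu> z * (if \<mu> = \<Lambda> then - 1 else c \<mu>)) = (\<Sum>\<mu>\<in>A. ch d \<mu> z * c \<mu>)"
        by (intro sum.cong refl) (use \<open>\<Lambda> \<notin> A\<close> in auto)
      also have "\<dots> = ch d \<Lambda> z" using e z ws[OF v(1) \<xi>(1) z] \<xi>(2) by simp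
      finally show "(\<Sum>\<mu>\<in>insert \<Lambda> A. ch d \<mu> z * (if \<mu> = \<Lambda> then - 1 else c \<mu>)) = 0"
        using A(1) \<open>\<Lambda> \<notin> A\<close> by simp
    qed simp
    then show False by simp
  qed
  then obtain \<xi> where \<xi>: "functional L \<xi>" "\<xi> v = 1" "\<And>w. w \<in> W0 \<Longrightarrow> \<xi> w = 0"
    using fvsp.functional_exists[OF L_fvsp W0 vL] by blast
  have lower_weight: "\<xi> (\<tau> (addrow_mat d s j i) y) = \<xi> y"
    if ij: "i < j" "j < d" and y: "y \<in> weight_space d L \<tau> \<mu>" and \<mu>: "\<mu> \<in> weights d" for i j s y \<mu>
  proof (cases "y = \<zero>\<^bsub>L\<^esub>")
    case True
    have "j \<noteq> i" using ij by simp
    then show ?thesis unfolding True using lhom_zero[OF L_vsp L_vsp L.act_hom[OF addrow_GL]] by simp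
  next
    case False
    have ji: "j < d" "i < d" "j \<noteq> i" using ij by simp_all
    have yL: "y \<in> carrier L" using y by (simp add: weight_space_iff)
    obtain yk where yk0: "(\<forall>k. yk k \<in> weight_space d L \<tau> (shift \<mu> j i k)) \<and>
    (\<forall>\<xi>. functional L \<xi> \<longrightarrow> (\<exists>P. (\<forall>s. \<xi> (\<tau> (addrow_mat d s j i) y) = poly P s) \<and> (\<forall>k. coeff P k = \<xi> (yk k))))"
      using root_expansion[OF y ji] by (elim exE)
    have yk: "\<And>k. yk k \<in> weight_space d L \<tau> (shift \<mu> j i k)" and P: "\<And>\<xi>. functional L \<xi> \<Longrightarrow>
      \<exists>P. (\<forall>s. \<xi> (\<tau> (addrow_mat d s j i) y) = poly P s) \<and> (\<forall>k. coeff P k = \<xi> (yk k))" using yk0 by blast+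
    obtain P where P: "\<And>s. \<xi> (\<tau> (addrow_mat d s j i) y) = poly P s" "\<And>k. coeff P k = \<xi> (yk k)" using P[OF \<xi>(1)] by blast
    \<comment> \<open>A term of weight \<Lambda> would mean that the nonzero \<open>y\<close> has a
      weight above \<Lambda>; terms of any other weight lie in \<open>W0\<close> and are killed by
      \<xi>.\<close>
    have "coeff P k = 0" if k: "k > 0" for k
    proof -
      have "shift \<mu> j i k \<noteq> \<Lambda>"
      proof
        assume e: "shift \<mu> j i k = \<Lambda>"
        have "\<mu> = shift \<Lambda> i j k" unfolding e[symmetric] by (rule ext) (simp add: shift_def)
        then show False using shift_not_weight[OF ij k] y False by blast
      qed
      moreover have "shift \<mu> j i k \<in> weights d" using \<mu> ji by (auto simp: weights_def shift_def)
      ultimately have "yk k \<in> W0" using other[OF yk] by blast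
      then show ?thesis unfolding P(2) by (rule \<xi>(3))
    qed
    then have "P = [:coeff P 0:]" by (rule constP)
    then have "poly P s = poly P 0" by (metis poly_pCons poly_0 mult_zero_right)
    then show ?thesis using P(1)[of s] P(1)[of 0] by (simp add: addrow_zero tau_one[OF yL])
  qed
  have lower: "\<xi> (\<tau> (addrow_mat d s j i) y) = \<xi> y" if ij: "i < j" "j < d" and y: "y \<in> carrier L" for i j s y
  proof -
    obtain A ys where "decomposes y A ys" using weight_decomposition[OF y] by blast
    then have A: "A \<subseteq> weights d" and ys: "\<And>\<mu>. \<mu> \<in> A \<Longrightarrow> ys \<mu> \<in> weight_space d L \<tau> \<mu>"
      and sum: "\<And>\<xi>. functional L \<xi> \<Longrightarrow> \<xi> y = (\<Sum>\<mu>\<in>A. \<xi> (ys \<mu>))" unfolding decomposes_def by blast+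
    have xG: "addrow_mat d s j i \<in> carrier (GL d)" by (rule addrow_GL) (use ij in simp)
    have "\<xi> (\<tau> (addrow_mat d s j i) y) = (\<Sum>\<mu>\<in>A. \<xi> (\<tau> (addrow_mat d s j i) (ys \<mu>)))"
      using sum[OF tau_functional[OF \<xi>(1) xG]] .
    also have "\<dots> = (\<Sum>\<mu>\<in>A. \<xi> (ys \<mu>))"
      by (intro sum.cong refl lower_weight[OF ij ys]) (use A in auto)
    also have "\<dots> = \<xi> y" using sum[OF \<xi>(1)] ..
    finally show ?thesis .
  qed
  have "\<xi> (\<tau> g v) = Fc g" if "g \<in> carrier (GL d)" for g
  proof (rule big_cell_unique[OF inf _ _ _ _ that, of "\<lambda>g. \<xi> (\<tau> g v)" Fc])
    fix i j and s :: 'k and g :: "'k mat" assume ij: "i < j" "j < d" and g: "g \<in> carrier (GL d)"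
    have x: "addrow_mat d s j i \<in> carrier (GL d)" by (rule addrow_GL) (use ij in simp)
    have x': "addrow_mat d s i j \<in> carrier (GL d)" by (rule addrow_GL) (use ij in simp)
    show "\<xi> (\<tau> (addrow_mat d s j i * g) v) = \<xi> (\<tau> g v) \<and> Fc (addrow_mat d s j i * g) = Fc g"
      unfolding tau_mult[OF x g vL] lower[OF ij L.act_cl[OF g vL]] Fc_lower[OF ij g] by simp
    show "\<xi> (\<tau> (g * addrow_mat d s i j) v) = \<xi> (\<tau> g v) \<and> Fc (g * addrow_mat d s i j) = Fc g"
      unfolding tau_mult[OF g x' vL] upper_v[OF ij] Fc_upper[OF ij g] by simp
  next
    fix t :: "'k mat" assume t: "t \<in> carrier (GL d)" "diagonal_mat t"
    have "\<tau> t v = (\<Prod>i<d. t $$ (i, i) powi \<Lambda> i) \<odot>\<^bsub>L\<^esub> v" using v(1) t unfolding weight_space_def by blast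
    then show "\<xi> (\<tau> t v) = Fc t" unfolding Fc_torus[OF t] using functional_smult[OF \<xi>(1) vL] \<xi>(2) by simp
  next
    fix i j and g :: "'k mat" assume ij: "i \<noteq> j" "i < d" "j < d" and g: "g \<in> carrier (GL d)"
    obtain Sf f where SF: "expands v Sf f" using rational_expansion[OF vL] by blast
  note SS = expandsD(1,2)[OF SF] and reg = expandsD(3)[OF SF] and e = expandsD(4)[OF SF] and e5 = expandsD(5)[OF SF]
    have gc: "g \<in> carrier_mat d d" using g by (simp add: GL_simps)
    have "polyf (\<lambda>s. \<Sum>w\<in>Sf. f w (addrow_mat d s i j * g) * \<xi> w)"
      by (intro polyf_sum polyf_mult polyf_const regular_root[OF ij gc] reg)
    then have "polyf (\<lambda>s. \<xi> (\<tau> (addrow_mat d s i j * g) v))"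
      by (simp only: e[OF \<xi>(1) GL_mult_closed[OF addrow_GL[OF ij(1)] g]])
    then show "polyf (\<lambda>s. \<xi> (\<tau> (addrow_mat d s i j * g) v)) \<and> polyf (\<lambda>s. Fc (addrow_mat d s i j * g))"
      using Fc_poly[OF ij(3) g] by blast
  qed
  then show ?thesis unfolding coefficient_def using vL \<xi>(1) by blast
qed

end

subsection \<open>The permutation module as a weight space of tensor space\<close>

context partition_shape
begin

abbreviation "G \<equiv> sym_group d"
abbreviation "H \<equiv> young_subgroup d lam"
abbreviation "cosets \<equiv> lcosets\<^bsub>G\<^esub> H"
abbreviation "PM \<equiv> perm_module d lam"

definition Ml :: "(nat \<Rightarrow> nat) set" where "Ml = {J \<in> M. wt J = wt i0}"

text \<open>The coset \<open>\<pi>\<Sigma>\<^sub>\<lambda>\<close> corresponds to the multi-index \<open>i\<^sub>0 \<circ> \<pi>\<^sup>-\<^sup>1\<close>, where \<open>i\<^sub>0\<close> lists the rows of the standard tableau.\<close>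

definition cst :: "(nat \<Rightarrow> nat) \<Rightarrow> (nat \<Rightarrow> nat) set" where
  "cst J = {\<pi>. \<pi> permutes {1..d} \<and> J \<circ> \<pi> = i0}"

lemma H_iff: "\<pi> \<in> H \<longleftrightarrow> \<pi> permutes {1..d} \<and> i0 \<circ> \<pi> = i0"
proof -
  have "(\<forall>x\<in>{1..d}. rw (\<pi> x) = rw x) \<longleftrightarrow> i0 \<circ> \<pi> = i0" if p: "\<pi> permutes {1..d}"
  proof
    assume a: "\<forall>x\<in>{1..d}. rw (\<pi> x) = rw x"
    show "i0 \<circ> \<pi> = i0"
    proof (rule multi_indices_eqI[OF multi_indices_comp[OF i0_M p] i0_M])
      fix s assume s: "s \<in> {1..d}"
      have "\<pi> s \<in> {1..d}" using permutes_in_image[OF p] s by blast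
      then show "(i0 \<circ> \<pi>) s = i0 s" using a s i0_apply by simp
    qed
  next
    assume a: "i0 \<circ> \<pi> = i0"
    show "\<forall>x\<in>{1..d}. rw (\<pi> x) = rw x"
    proof
      fix x assume x: "x \<in> {1..d}"
      then have "\<pi> x \<in> {1..d}" using permutes_in_image[OF p] by blast
      then show "rw (\<pi> x) = rw x" using fun_cong[OF a, of x] i0_apply x by simp
    qed
  qed
  then show ?thesis unfolding young_subgroup_def by (auto simp: sym_simps simp del: One_nat_def)
qed

lemma l_coset_comp: "\<sigma> <#\<^bsub>G\<^esub> X = (\<lambda>\<pi>. \<sigma> \<circ> \<pi>) ` X"
  by (auto simp: l_coset_def sym_simps)

lemma l_coset_cst:
  assumes \<sigma>: "\<sigma> permutes {1..d}"
  shows "\<sigma> <#\<^bsub>G\<^esub> cst J = cst (J \<circ> inv' \<sigma>)"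
proof (intro equalityI subsetI)
  fix \<pi> assume "\<pi> \<in> \<sigma> <#\<^bsub>G\<^esub> cst J"
  then obtain \<rho> where \<rho>: "\<rho> permutes {1..d}" "J \<circ> \<rho> = i0" "\<pi> = \<sigma> \<circ> \<rho>" unfolding l_coset_comp cst_def by blast
  have "J \<circ> inv' \<sigma> \<circ> (\<sigma> \<circ> \<rho>) = J \<circ> (inv' \<sigma> \<circ> \<sigma>) \<circ> \<rho>" by (simp only: o_assoc)
  then have "J \<circ> inv' \<sigma> \<circ> (\<sigma> \<circ> \<rho>) = i0" unfolding permutes_inv_o(2)[OF \<sigma>] o_id \<rho>(2) .
  then show "\<pi> \<in> cst (J \<circ> inv' \<sigma>)" unfolding cst_def \<rho>(3) using permutes_compose[OF \<rho>(1) \<sigma>] by simp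
next
  fix \<pi> assume p: "\<pi> \<in> cst (J \<circ> inv' \<sigma>)"
  have "inv' \<sigma> \<circ> \<pi> permutes {1..d}" using p permutes_compose[OF _ permutes_inv[OF \<sigma>]] unfolding cst_def by blast
  moreover have "J \<circ> (inv' \<sigma> \<circ> \<pi>) = i0" using p unfolding cst_def by (simp add: o_assoc)
  moreover have "\<pi> = \<sigma> \<circ> (inv' \<sigma> \<circ> \<pi>)" unfolding o_assoc permutes_inv_o(1)[OF \<sigma>] by simp
  ultimately show "\<pi> \<in> \<sigma> <#\<^bsub>G\<^esub> cst J" unfolding l_coset_comp cst_def by blast
qed

lemma H_cst: "H = cst i0" unfolding cst_def using H_iff by blast

lemma i0_Ml: "i0 \<in> Ml" by (simp add: Ml_def i0_M)

lemma Ml_comp: "\<sigma> permutes {1..d} \<Longrightarrow> J \<circ> \<sigma> \<in> Ml \<longleftrightarrow> J \<in> Ml"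
  by (simp add: Ml_def multi_indices_comp_iff wt_comp)

lemma finite_Ml: "finite Ml" unfolding Ml_def using finite_multi_indices by simp

lemma Ml_orbit: "J \<in> Ml \<Longrightarrow> \<exists>\<pi>. \<pi> permutes {1..d} \<and> J = i0 \<circ> inv' \<pi>"
proof -
  assume "J \<in> Ml"
  then obtain \<sigma> where s: "\<sigma> permutes {1..d}" "J = i0 \<circ> \<sigma>" using same_weight_permute[of J i0] i0_M unfolding Ml_def by blast
  have "inv' (inv' \<sigma>) = \<sigma>" by (rule inv_inv_eq[OF permutes_bij[OF s(1)]])
  then show ?thesis using s permutes_inv[OF s(1)] by (intro exI[of _ "inv' \<sigma>"]) simp
qed

text \<open>The multi-indices of weight \<lambda> form one orbit, that of \<open>i0\<close>, whose
  stabiliser is the Young subgroup.\<close>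

lemma cosets_eq: "cosets = cst ` Ml"
proof -
  have "cosets = {\<pi> <#\<^bsub>G\<^esub> H |\<pi>. \<pi> permutes {1..d}}"
    unfolding LCOSETS_def by (auto simp: sym_simps)
  also have "\<dots> = {cst (i0 \<circ> inv' \<pi>) |\<pi>. \<pi> permutes {1..d}}"
    unfolding H_cst by (intro Collect_cong ex_cong1) (auto simp: l_coset_cst)
  also have "\<dots> = cst ` Ml"
  proof (intro equalityI subsetI)
    fix X assume "X \<in> {cst (i0 \<circ> inv' \<pi>) |\<pi>. \<pi> permutes {1..d}}"
    then obtain \<pi> where p: "\<pi> permutes {1..d}" "X = cst (i0 \<circ> inv' \<pi>)" by blast
    have "i0 \<circ> inv' \<pi> \<in> Ml" using Ml_comp[OF permutes_inv[OF p(1)]] i0_Ml by simp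
    then show "X \<in> cst ` Ml" unfolding p(2) by (rule imageI)
  next
    fix X assume "X \<in> cst ` Ml"
    then obtain J where J: "J \<in> Ml" "X = cst J" by (rule imageE)
    obtain \<pi> where "\<pi> permutes {1..d}" "J = i0 \<circ> inv' \<pi>" using Ml_orbit[OF J(1)] by (elim exE conjE)
    then show "X \<in> {cst (i0 \<circ> inv' \<pi>) |\<pi>. \<pi> permutes {1..d}}" using J(2) by blast
  qed
  finally show ?thesis .
qed

text \<open>The inverse of \<open>cst\<close> on \<open>Ml\<close>; any element of the coset gives
  the same multi-index.\<close>

definition pos :: "(nat \<Rightarrow> nat) set \<Rightarrow> nat \<Rightarrow> nat" where
  "pos X = i0 \<circ> inv' (SOME \<pi>. \<pi> \<in> X)"

lemma pos_cst: "J \<in> Ml \<Longrightarrow> pos (cst J) = J"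
proof -
  assume J: "J \<in> Ml"
  obtain \<pi> where p: "\<pi> permutes {1..d}" "J = i0 \<circ> inv' \<pi>" using Ml_orbit[OF J] by (elim exE conjE)
  have "\<pi> \<in> cst J" unfolding cst_def p(2) using p(1) by (simp add: o_assoc[symmetric] permutes_inv_o(2)[OF p(1)])
  then have "(SOME \<pi>. \<pi> \<in> cst J) \<in> cst J" by (rule someI[of "\<lambda>\<pi>. \<pi> \<in> cst J"])
  then have s: "(SOME \<pi>. \<pi> \<in> cst J) permutes {1..d}" "J \<circ> (SOME \<pi>. \<pi> \<in> cst J) = i0" unfolding cst_def by blast+
  show "pos (cst J) = J" unfolding pos_def s(2)[symmetric] o_assoc[symmetric] permutes_inv_o(1)[OF s(1)] o_id ..
qed

lemma cst_inj: "inj_on cst Ml" by (rule inj_on_inverseI[where g=pos]) (rule pos_cst)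

lemma sum_cosets: "(\<Sum>X\<in>cosets. F X) = (\<Sum>J\<in>Ml. F (cst J))" for F :: "_ \<Rightarrow> 'k::field"
  unfolding cosets_eq sum.reindex[OF cst_inj] by simp

lemma finite_cosets: "finite cosets" unfolding cosets_eq using finite_Ml by simp

lemma cst_cosets: "J \<in> Ml \<Longrightarrow> cst J \<in> cosets" unfolding cosets_eq by simp

lemma inv_sym: "\<sigma> permutes {1..d} \<Longrightarrow> inv\<^bsub>G\<^esub> \<sigma> = inv' \<sigma>"
  by (rule group.inv_equality[OF sym_group_is_group])
    (simp_all add: sym_simps permutes_inv_o permutes_inv)

lemma act_coset: "\<sigma> permutes {1..d} \<Longrightarrow> inv\<^bsub>G\<^esub> \<sigma> <#\<^bsub>G\<^esub> cst J = cst (J \<circ> \<sigma>)"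
  by (simp add: inv_sym l_coset_cst[OF permutes_inv] inv_inv_eq[OF permutes_bij])

lemma perm_act_cst: "\<sigma> permutes {1..d} \<Longrightarrow> perm_act d \<sigma> f (cst J) = f (cst (J \<circ> \<sigma>))"
  by (simp add: perm_act_def act_coset)

lemma perm_act_off:
  assumes \<sigma>: "\<sigma> permutes {1..d}" and X: "X \<notin> cosets" and f: "f \<in> carrier PM"
  shows "perm_act d \<sigma> f X = 0"
proof -
  have "inv\<^bsub>G\<^esub> \<sigma> <#\<^bsub>G\<^esub> X \<notin> cosets"
  proof
    assume "inv\<^bsub>G\<^esub> \<sigma> <#\<^bsub>G\<^esub> X \<in> cosets"
    then obtain J where J: "J \<in> Ml" "inv\<^bsub>G\<^esub> \<sigma> <#\<^bsub>G\<^esub> X = cst J" unfolding cosets_eq by (rule imageE)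
    have "\<sigma> <#\<^bsub>G\<^esub> (inv\<^bsub>G\<^esub> \<sigma> <#\<^bsub>G\<^esub> X) = X"
      unfolding l_coset_comp inv_sym[OF \<sigma>] image_image o_assoc permutes_inv_o(1)[OF \<sigma>] by simp
    then have "X = cst (J \<circ> inv' \<sigma>)" unfolding J(2) l_coset_cst[OF \<sigma>] ..
    then have "X \<in> cosets" using cst_cosets[of "J \<circ> inv' \<sigma>"] Ml_comp[OF permutes_inv[OF \<sigma>]] J(1) by simp
    then show False using X by contradiction
  qed
  then show ?thesis using f by (simp add: perm_act_def perm_module_def)
qed

lemma PM_iff: "f \<in> carrier PM \<longleftrightarrow> (\<forall>X. X \<notin> cosets \<longrightarrow> f X = 0)"
  by (simp add: perm_module_def)

lemma PM_eqI:
  assumes "f \<in> carrier PM" "h \<in> carrier PM" "\<And>J. J \<in> Ml \<Longrightarrow> f (cst J) = h (cst J)"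
  shows "f = h"
proof
  fix X
  show "f X = h X"
  proof (cases "X \<in> cosets")
    case True
    then obtain J where "J \<in> Ml" "X = cst J" unfolding cosets_eq by blast
    then show ?thesis using assms(3) by simp
  next
    case False then show ?thesis using assms(1,2) PM_iff by metis
  qed
qed

lemma PM_vsp: "vsp (PM :: ('k::field, _) module)" unfolding perm_module_def by (rule coeff_space_vsp)

lemma PM_simps: "\<zero>\<^bsub>PM\<^esub> = (\<lambda>_. 0)" "f \<oplus>\<^bsub>PM\<^esub> h = (\<lambda>x. f x + h x)" "c \<odot>\<^bsub>PM\<^esub> f = (\<lambda>x. c * f x)"
  by (simp_all add: perm_module_def)

lemma perm_act_in: "\<sigma> permutes {1..d} \<Longrightarrow> f \<in> carrier PM \<Longrightarrow> perm_act d \<sigma> f \<in> carrier PM"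
  unfolding PM_iff[of "perm_act d \<sigma> f"] using perm_act_off by blast

lemma perm_rep: "linear_rep G (PM :: ('k::field, _) module) (perm_act d)"
proof (rule lrepI)
  show "group G" by (rule sym_group_is_group)
  show "vsp (PM :: ('k, _) module)" by (rule PM_vsp)
  fix \<sigma> assume "\<sigma> \<in> carrier G"
  then have \<sigma>: "\<sigma> permutes {1..d}" by (simp add: sym_simps)
  show "perm_act d \<sigma> \<in> lhom PM (PM :: ('k, _) module)"
    by (rule lhomI) (simp_all add: perm_act_in[OF \<sigma>] PM_simps perm_act_def fun_eq_iff)
  fix v :: "(nat \<Rightarrow> nat) set \<Rightarrow> 'k" assume v: "v \<in> carrier PM"
  { fix \<tau> assume "\<tau> \<in> carrier G"
    then have \<tau>: "\<tau> permutes {1..d}" by (simp add: sym_simps)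
    show "perm_act d (\<sigma> \<otimes>\<^bsub>G\<^esub> \<tau>) v = perm_act d \<sigma> (perm_act d \<tau> v)"
      unfolding sym_simps(2)
    proof (rule PM_eqI)
      show "perm_act d (\<sigma> \<circ> \<tau>) v \<in> carrier PM" by (rule perm_act_in[OF permutes_compose[OF \<tau> \<sigma>] v])
      show "perm_act d \<sigma> (perm_act d \<tau> v) \<in> carrier PM" by (rule perm_act_in[OF \<sigma> perm_act_in[OF \<tau> v]])
      show "perm_act d (\<sigma> \<circ> \<tau>) v (cst J) = perm_act d \<sigma> (perm_act d \<tau> v) (cst J)" for J
        unfolding perm_act_cst[OF permutes_compose[OF \<tau> \<sigma>]] perm_act_cst[OF \<sigma>] perm_act_cst[OF \<tau>] o_assoc ..
    qed }
next
  fix v :: "(nat \<Rightarrow> nat) set \<Rightarrow> 'k" assume v: "v \<in> carrier PM"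
  show "perm_act d \<one>\<^bsub>G\<^esub> v = v"
    unfolding sym_simps(3) by (rule PM_eqI) (simp_all add: perm_act_in perm_act_cst v permutes_id)
qed

text \<open>Extension by zero, which identifies \<open>M^\<lambda>\<close> with the \<lambda>-weight
  space of tensor space. The map \<open>rm\<close> restricts back, and \<open>jm\<close> after
  \<open>rm\<close> is \<open>wproj\<close>.\<close>

definition jm :: "((nat \<Rightarrow> nat) set \<Rightarrow> 'k::field) \<Rightarrow> (nat \<Rightarrow> nat) \<Rightarrow> 'k" where
  "jm f J = (if J \<in> Ml then f (cst J) else 0)"

definition rm :: "((nat \<Rightarrow> nat) \<Rightarrow> 'k::field) \<Rightarrow> (nat \<Rightarrow> nat) set \<Rightarrow> 'k" where
  "rm T X = (if X \<in> cosets then T (pos X) else 0)"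

lemma jm_E: "jm f \<in> carrier (tensor_space d)" by (auto simp: tensor_space_iff jm_def Ml_def)

lemma rm_PM: "rm T \<in> carrier PM" by (simp add: PM_iff rm_def)

lemma rm_cst: "J \<in> Ml \<Longrightarrow> rm T (cst J) = T J" by (simp add: rm_def pos_cst cst_cosets)

lemma jm_hom: "jm \<in> lhom PM (tensor_space d)"
  by (rule lhomI) (auto simp: jm_E PM_simps jm_def fun_eq_iff)

lemma rm_hom: "rm \<in> lhom (tensor_space d) PM"
  by (rule lhomI) (auto simp: rm_PM PM_simps rm_def fun_eq_iff)

lemma rm_jm: "f \<in> carrier PM \<Longrightarrow> rm (jm f) = f"
  by (rule PM_eqI) (simp_all add: rm_PM rm_cst jm_def)

lemma jm_rm: "jm (rm T) = wproj T"
  by (rule ext) (simp add: jm_def wproj_def rm_cst Ml_def)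

lemma rm_wproj: "rm (wproj T) = rm T"
  by (rule PM_eqI) (simp_all add: rm_PM rm_cst wproj_def Ml_def)

lemma wproj_jm: "wproj (jm f) = jm f"
  by (rule ext) (simp add: wproj_def jm_def Ml_def)

lemma jm_act: "\<sigma> permutes {1..d} \<Longrightarrow> jm (perm_act d \<sigma> f) = place_act \<sigma> (jm f)"
  by (rule ext) (simp add: jm_def place_act_def perm_act_cst Ml_comp)

lemma rm_act: "\<sigma> permutes {1..d} \<Longrightarrow> rm (place_act \<sigma> T) = perm_act d \<sigma> (rm T)"
  by (rule PM_eqI) (simp_all add: rm_PM perm_act_in rm_cst perm_act_cst Ml_comp place_act_def)

lemma form_jm: "(\<Sum>X\<in>cosets. u X * v X) = ip d (jm u) (jm v :: _ \<Rightarrow> 'k::field)"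
proof -
  have "ip d (jm u) (jm v) = (\<Sum>J\<in>Ml. jm u J * jm v J)"
    unfolding ip_def by (rule sum.mono_neutral_right) (auto simp: Ml_def finite_multi_indices jm_def)
  then show ?thesis unfolding sum_cosets by (simp add: jm_def)
qed

lemma perm_form_invariant:
  assumes \<sigma>: "\<sigma> permutes {1..d}"
  shows "(\<Sum>X\<in>cosets. perm_act d \<sigma> u X * perm_act d \<sigma> v X) = (\<Sum>X\<in>cosets. u X * v X :: 'k::field)"
proof -
  have b: "bij_betw (\<lambda>J. J \<circ> \<sigma>) Ml Ml"
    by (rule bij_betw_byWitness[where f'="\<lambda>J. J \<circ> inv' \<sigma>"])
      (auto simp: o_assoc[symmetric] permutes_inv_o[OF \<sigma>] Ml_comp[OF \<sigma>] Ml_comp[OF permutes_inv[OF \<sigma>]])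
  show ?thesis unfolding sum_cosets perm_act_cst[OF \<sigma>]
    by (rule sum.reindex_bij_betw[OF b])
qed

lemma perm_form_rep: "form_rep G (PM :: ('k::field, _) module) (perm_act d) cosets (carrier PM)"
  unfolding form_rep_def form_rep_axioms_def lrep_def
proof (intro conjI allI impI)
  show "PM = coeff_space cosets\<lparr>carrier := carrier PM\<rparr>" by (simp add: perm_module_def coeff_space_def)
  show "VectorSpace.subspace class_ring (carrier PM) (coeff_space cosets)"
    unfolding perm_module_def by (rule vsp.subsp_carrier[OF coeff_space_vsp])
  fix \<sigma> and u v :: "(nat \<Rightarrow> nat) set \<Rightarrow> 'k" assume "\<sigma> \<in> carrier G"
  then show "(\<Sum>X\<in>cosets. perm_act d \<sigma> u X * perm_act d \<sigma> v X) = (\<Sum>X\<in>cosets. u X * v X)"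
    by (intro perm_form_invariant) (simp add: sym_simps)
next
  fix u :: "(nat \<Rightarrow> nat) set \<Rightarrow> 'k" assume u: "u \<in> carrier PM"
    and z: "\<forall>v. v \<in> carrier PM \<longrightarrow> (\<Sum>X\<in>cosets. u X * v X) = 0"
  show "u = (\<lambda>_. 0)"
  proof
    fix X
    show "u X = 0"
    proof (cases "X \<in> cosets")
      case True
      have "delta X \<in> carrier (PM :: ('k, _) module)" unfolding perm_module_def by (rule delta_in[OF True])
      then have "(\<Sum>X'\<in>cosets. u X' * delta X X') = 0" using z by blast
      also have "(\<Sum>X'\<in>cosets. u X' * delta X X') = (\<Sum>X'\<in>cosets. if X' = X then u X' else 0)"
        by (intro sum.cong refl) (simp add: delta_def)
      finally show ?thesis using True finite_cosets by simp
    next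
      case False then show ?thesis using u PM_iff by blast
    qed
  qed
qed (simp_all add: sym_finite finite_cosets perm_rep)

text \<open>The coset of a column permutation \<pi> is the one of \<open>J\<close> exactly if
  \<open>J\<close> composed with \<pi> is \<open>i0\<close>, and this is also the condition for
  \<pi> to contribute to \<open>et\<close> at \<open>J\<close>.\<close>

lemma jm_polytabloid: "jm (polytabloid d lam) = (et :: _ \<Rightarrow> 'k::field)"
proof
  fix J
  show "jm (polytabloid d lam) J = (et J :: 'k)"
  proof (cases "J \<in> Ml")
    case J: True
    have "jm (polytabloid d lam) J = (\<Sum>\<pi>\<in>colgrp. if cst J = \<pi> <#\<^bsub>G\<^esub> H then sg \<pi> else 0 :: 'k)"
      using J by (simp add: jm_def polytabloid_def colgrp_eq)
    also have "\<dots> = (\<Sum>\<pi>\<in>colgrp. sg \<pi> * place_act \<pi> e0 J)"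
    proof (intro sum.cong refl)
      fix \<pi> assume "\<pi> \<in> colgrp"
      note p = colgrp_perm[OF this]
      have m: "i0 \<circ> inv' \<pi> \<in> Ml" using Ml_comp[OF permutes_inv[OF p]] i0_Ml by simp
      have "cst J = \<pi> <#\<^bsub>G\<^esub> H \<longleftrightarrow> J = i0 \<circ> inv' \<pi>"
        unfolding H_cst l_coset_cst[OF p] using inj_on_eq_iff[OF cst_inj J m] .
      also have "\<dots> \<longleftrightarrow> J \<circ> \<pi> = i0"
      proof
        assume "J = i0 \<circ> inv' \<pi>"
        then show "J \<circ> \<pi> = i0" by (simp add: o_assoc[symmetric] permutes_inv_o[OF p])
      next
        assume "J \<circ> \<pi> = i0"
        then have "J \<circ> \<pi> \<circ> inv' \<pi> = i0 \<circ> inv' \<pi>" by simp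
        then show "J = i0 \<circ> inv' \<pi>" unfolding o_assoc[symmetric] permutes_inv_o[OF p] by simp
      qed
      finally show "(if cst J = \<pi> <#\<^bsub>G\<^esub> H then sg \<pi> else 0) = (sg \<pi> * place_act \<pi> e0 J :: 'k)"
        by (simp add: place_act_def e0_def delta_def)
    qed
    finally show ?thesis by (simp add: et_def kap_def)
  next
    case False
    have "et J = (0 :: 'k)" using fun_cong[OF wproj_et, of J] False by (auto simp: wproj_def Ml_def split: if_splits)
    then show ?thesis using False by (simp add: jm_def)
  qed
qed

lemma equivariant_jm: "equivariant_map G (PM :: ('k::field, _) module) (perm_act d) cosets (carrier PM)
    (tensor_space d) place_act M (carrier (tensor_space d)) jm"
  unfolding equivariant_map_def equivariant_map_axioms_def
  using perm_form_rep tensor_form_rep jm_hom jm_act by (auto simp: sym_simps simp del: One_nat_def)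

lemma equivariant_rm: "equivariant_map G (tensor_space d :: ('k::field, _) module) place_act M (carrier (tensor_space d))
    PM (perm_act d) cosets (carrier PM) rm"
  unfolding equivariant_map_def equivariant_map_axioms_def
  using perm_form_rep tensor_form_rep rm_hom rm_act by (auto simp: sym_simps simp del: One_nat_def)

end

subsection \<open>Weight spaces of the homology of tensor space\<close>

context partition_shape
begin

abbreviation "Hn n \<equiv> tensor_homology d n"
abbreviation "Ha n \<equiv> tensor_homology_act d n"

lemma tensor_homology_lrep: "lrep (GL d) (Hn n :: ('k::field, _) module) (Ha n)"
  unfolding lrep_def tensor_homology_def tensor_homology_act_def by (rule commuting_action.hact_lrep[OF tensor_commuting])

lemma equivariant_wproj: "equivariant_map G (tensor_space d :: ('k::field, _) module) place_act M (carrier (tensor_space d))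
    (tensor_space d) place_act M (carrier (tensor_space d)) wproj"
  unfolding equivariant_map_def equivariant_map_axioms_def
  using tensor_form_rep wproj_hom wproj_place by (auto simp: sym_simps simp del: One_nat_def)

abbreviation "wproj_hom_map n \<equiv> quot_map (bar_space G (tensor_space d) n)
   (boundaries G (tensor_space d) place_act n) (\<lambda>c. wproj \<circ> c)"

lemma lact_weight:
  fixes x :: "((nat \<Rightarrow> nat) list \<Rightarrow> (nat \<Rightarrow> nat) \<Rightarrow> 'k::field) set"
  assumes x: "x \<in> weight_space d (Hn n) (Ha n) (partition_weight lam)"
    and t: "t \<in> carrier (GL d)" "diagonal_mat t"
  shows "lact (Hn n) (Ha n) [(a, t), (b, 1\<^sub>m d)] x = (a * (\<Prod>i<d. t $$ (i, i) ^ wt i0 i) + b) \<odot>\<^bsub>Hn n\<^esub> x"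
proof -
  interpret H: lrep "GL d" "Hn n :: ('k, _) module" "Ha n" by (rule tensor_homology_lrep)
  interpret Hv: vsp "Hn n :: ('k, _) module" by (rule H.vsp)
  have xH: "x \<in> carrier (Hn n)" using x by (simp add: weight_space_def)
  have "Ha n t x = (\<Prod>i<d. t $$ (i, i) ^ wt i0 i) \<odot>\<^bsub>Hn n\<^esub> x" using x t by (simp add: weight_space_def wt_i0_powi)
  moreover have "Ha n (1\<^sub>m d) x = x" using H.act_one[OF xH] by (simp add: GL_simps)
  ultimately show ?thesis using xH by (simp add: Hv.smult_ass Hv.smult_left_distr)
qed

text \<open>The projection onto a weight is a combination of torus elements: for each other weight take a torus element
  separating the two
  weights and multiply the corresponding Lagrange factors.\<close>

lemma weight_projection_list:
  assumes inf: "infinite (UNIV :: 'k::field set)"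
  shows "\<exists>l :: ('k \<times> 'k mat) list. glist (GL d) l \<and> (\<forall>T\<in>carrier (tensor_space d). lact (tensor_space d) (tensor_act d) l
    T = wproj T) \<and>
    (\<forall>x\<in>weight_space d (Hn n) (Ha n) (partition_weight lam). lact (Hn n) (Ha n) l x = x)"
proof -
  interpret H: lrep "GL d" "Hn n :: ('k, _) module" "Ha n" by (rule tensor_homology_lrep)
  interpret Hv: vsp "Hn n :: ('k, _) module" by (rule H.vsp)
  interpret E: lrep "GL d" "tensor_space d :: ('k, _) module" "tensor_act d" using tensor_rep by (simp add: lrep_def)
  let ?W = "weight_space d (Hn n :: ('k, _) module) (Ha n) (partition_weight lam)"
  have WH: "x \<in> carrier (Hn n)" if "x \<in> ?W" for x using that by (simp add: weight_space_def)
  \<comment> \<open>The lists act diagonally on tensor space with factors \<open>f\<close>, which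
    are 1 on the wanted weight and 0 on the multi-indices \<open>B\<close> treated so far, while
    weight vectors in homology stay fixed.\<close>
  have step: "finite B \<Longrightarrow> B \<subseteq> M - Ml \<Longrightarrow> \<exists>(l :: ('k \<times> 'k mat) list) f. glist (GL d) l \<and>
      (\<forall>T\<in>carrier (tensor_space d). lact (tensor_space d) (tensor_act d) l T = (\<lambda>I. f I * T I)) \<and>
      (\<forall>I\<in>Ml. f I = 1) \<and> (\<forall>I\<in>B. f I = 0) \<and> (\<forall>x\<in>?W. lact (Hn n) (Ha n) l x = x)" for B
  proof (induction B rule: finite_induct)
    case empty
    define l1 where "l1 = [(1 :: 'k, \<one>\<^bsub>GL d\<^esub> :: 'k mat)]"
    show ?case
    proof (intro exI[of _ l1] exI[of _ "\<lambda>_. 1"] conjI ballI)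
      show "glist (GL d) l1" unfolding l1_def using E.one_G by simp
      show "lact (tensor_space d) (tensor_act d) l1 T = (\<lambda>I. 1 * T I)"
        if "T \<in> carrier (tensor_space d)" for T :: "(nat \<Rightarrow> nat) \<Rightarrow> 'k"
        unfolding l1_def E.lact_one[OF that] by simp
      show "lact (Hn n) (Ha n) l1 x = x" if "x \<in> ?W" for x
        unfolding l1_def H.lact_one[OF WH[OF that]] using WH[OF that] by simp
    qed simp_all
  next
    case (insert J B)
    have "B \<subseteq> M - Ml" using insert.prems by blast
    from insert.IH[OF this] obtain l :: "('k \<times> 'k mat) list" and f where l: "glist (GL d) l"
      and f: "\<forall>T\<in>carrier (tensor_space d). lact (tensor_space d) (tensor_act d) l T = (\<lambda>I. f I * T I)"
      and f1: "\<forall>I\<in>Ml. f I = 1" and f0: "\<forall>I\<in>B. f I = 0" and fx: "\<forall>x\<in>?W. lact (Hn n) (Ha n) l x = x"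
      by (elim exE conjE)
    have J: "J \<in> M" "wt J \<noteq> wt i0" using insert.prems by (auto simp: Ml_def)
    obtain a where a: "wt J a \<noteq> wt i0 a" using J(2) by blast
    have "a < d"
    proof (rule ccontr)
      assume "\<not> a < d"
      then have "{s \<in> {1..d}. K s = a} = {}" if "K \<in> M" for K using multi_indices_less[OF that] by force
      then have "wt J a = 0" "wt i0 a = 0" unfolding wt_def using J(1) i0_M by simp_all
      then show False using a by simp
    qed
    then obtain z :: "nat \<Rightarrow> 'k" where z: "nz d z" "ch d (\<lambda>a. int (wt i0 a)) z \<noteq> ch d (\<lambda>a. int (wt J a)) z"
      using ch_separates[OF inf, of a d "\<lambda>a. int (wt i0 a)" "\<lambda>a. int (wt J a)"] a by force
    define q where "q I = (\<Prod>a<d. z a ^ wt I a)" for I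
    have q: "q i0 \<noteq> q J" using z(2) by (simp add: ch_def q_def power_int_of_nat)
    let ?t = "dg d z"
    have t: "?t \<in> carrier (GL d)" "diagonal_mat ?t" using dg_GL[OF z(1)] dg_diagonal by auto
    have tq: "(\<Prod>a<d. ?t $$ (a, a) ^ wt I a) = q I" for I unfolding q_def by (intro prod.cong refl) (simp add: dg_entry)
    define b where "b = inverse (q i0 - q J)"
    \<comment> \<open>The Lagrange factor \<open>(q I - q J) / (q i0 - q J)\<close>, which is 1 on
      the weight of \<open>i0\<close> and 0 at \<open>J\<close>.\<close>
    let ?m = "[(b, ?t), (- b * q J, 1\<^sub>m d)]"
    have m: "glist (GL d) ?m" using t(1) E.one_G by (simp add: GL_simps(3))
    have mE: "lact (tensor_space d) (tensor_act d) ?m T = (\<lambda>I. (b * (q I - q J)) * T I)"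
      if T: "T \<in> carrier (tensor_space d)" for T :: "(nat \<Rightarrow> nat) \<Rightarrow> 'k"
    proof
      fix I
      show "lact (tensor_space d) (tensor_act d) ?m T I = (b * (q I - q J)) * T I"
        using T by (cases "I \<in> M") (simp_all add: tensor_one[OF T] tensor_act_diag[OF t] tq tensor_space_iff algebra_simps)
    qed
    have b: "b * (q i0 - q J) = 1" using q by (simp add: b_def)
    have mH: "lact (Hn n) (Ha n) ?m x = x" if x: "x \<in> ?W" for x
    proof -
      have "b * q i0 + - b * q J = 1" using b by (simp add: algebra_simps)
      then show ?thesis unfolding lact_weight[OF x t] tq using WH[OF x] by simp
    qed
    have qMl: "q I = q i0" if "I \<in> Ml" for I using that by (simp add: q_def Ml_def)
    let ?l = "lmul (GL d) ?m l"
    have 1: "glist (GL d) ?l" by (rule glist_lmul[OF GL_group m l])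
    have 2: "lact (tensor_space d) (tensor_act d) ?l T = (\<lambda>I. (b * (q I - q J) * f I) * T I)"
      if T: "T \<in> carrier (tensor_space d)" for T :: "(nat \<Rightarrow> nat) \<Rightarrow> 'k"
    proof -
      have "lact (tensor_space d) (tensor_act d) ?l T = lact (tensor_space d) (tensor_act d) ?m (\<lambda>I. f I * T I)"
        unfolding E.lact_lmul[OF m l T] using f T by simp
      also have "\<dots> = (\<lambda>I. (b * (q I - q J)) * (f I * T I))" by (rule mE) (use T in \<open>simp add: tensor_space_iff\<close>)
      finally show ?thesis by (simp add: mult.assoc)
    qed
    have 3: "lact (Hn n) (Ha n) ?l x = x" if x: "x \<in> ?W" for x
      unfolding H.lact_lmul[OF m l WH[OF x]] using fx x mH[OF x] by simp
    show ?case
    proof (intro exI[of _ ?l] exI[of _ "\<lambda>I. b * (q I - q J) * f I"] conjI ballI)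
      show "b * (q I - q J) * f I = 1" if "I \<in> Ml" for I using that f1 b qMl by simp
      show "b * (q I - q J) * f I = 0" if "I \<in> insert J B" for I using that f0 by auto
    qed (use 1 2 3 in blast)+
  qed
  obtain l :: "('k \<times> 'k mat) list" and f where l: "glist (GL d) l"
    and f: "\<forall>T\<in>carrier (tensor_space d). lact (tensor_space d) (tensor_act d) l T = (\<lambda>I. f I * T I)"
    and f1: "\<forall>I\<in>Ml. f I = 1" and f0: "\<forall>I\<in>M - Ml. f I = 0" and fx: "\<forall>x\<in>?W. lact (Hn n) (Ha n) l x = x"
    using step[OF finite_Diff[OF finite_multi_indices] subset_refl] by (elim exE conjE)
  have "lact (tensor_space d) (tensor_act d) l T = wproj T" if T: "T \<in> carrier (tensor_space d)" for T
  proof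
    fix I
    show "lact (tensor_space d) (tensor_act d) l T I = wproj T I"
      using f T f1 f0 by (auto simp: wproj_def Ml_def tensor_space_iff)
  qed
  then show ?thesis using l fx by blast
qed

text \<open>The image consists of weight vectors because the torus acts through the values of
  cycles. Conversely the list from \<open>weight_projection_list\<close> fixes weight vectors and
  acts on homology as the map induced by \<open>wproj\<close>.\<close>

lemma weight_space_image:
  assumes inf: "infinite (UNIV :: 'k::field set)"
  shows "wproj_hom_map n ` carrier (Hn n) = weight_space d (Hn n :: ('k, _) module) (Ha n) (partition_weight lam)"
proof -
  interpret c: commuting_action G "tensor_space d :: ('k, _) module" place_act M "carrier (tensor_space d)" "GL d" "tensor_act d"
    by (rule tensor_commuting)
  interpret w: equivariant_map G "tensor_space d :: ('k, _) module" place_act M "carrier (tensor_space d)"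
    "tensor_space d" place_act M "carrier (tensor_space d)" wproj by (rule equivariant_wproj)
  let ?W = "weight_space d (Hn n :: ('k, _) module) (Ha n) (partition_weight lam)"
  have carr: "carrier (Hn n :: ('k, _) module) = c.hclass n ` cycles G (tensor_space d) place_act n"
    unfolding tensor_homology_def by (rule c.homology_carrier)
  show ?thesis
  proof (intro equalityI subsetI)
    fix y :: "((nat \<Rightarrow> nat) list \<Rightarrow> (nat \<Rightarrow> nat) \<Rightarrow> 'k) set" assume "y \<in> wproj_hom_map n ` carrier (Hn n)"
    then obtain x where x: "x \<in> carrier (Hn n)" "y = wproj_hom_map n x" by blast
    obtain b where b: "b \<in> cycles G (tensor_space d) place_act n" "x = c.hclass n b" using x(1) unfolding carr by blast
    have wb: "(\<lambda>gs. wproj (b gs)) \<in> cycles G (tensor_space d) place_act n" by (rule w.comp_cycles[OF b(1)])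
    have y: "y = c.hclass n (\<lambda>gs. wproj (b gs))" unfolding x(2) b(2) by (rule w.hmap_class[OF b(1)])
    have "Ha n t y = (\<Prod>i<d. t $$ (i, i) powi partition_weight lam i) \<odot>\<^bsub>Hn n\<^esub> y"
      if t: "t \<in> carrier (GL d)" "diagonal_mat t" for t :: "'k mat"
    proof -
      let ?q = "\<Prod>i<d. t $$ (i, i) powi partition_weight lam i"
      have e: "tensor_act d t (wproj T) = (\<lambda>I. ?q * wproj T I)" for T
        unfolding tensor_act_diag[OF t] wt_i0_powi[symmetric] by (rule ext) (simp add: wproj_def)
      have "Ha n t y = c.hclass n (\<lambda>gs. tensor_act d t (wproj (b gs)))"
        unfolding y tensor_homology_act_def by (rule c.hact_class[OF t(1) wb])
      also have "\<dots> = c.hclass n (?q \<odot>\<^bsub>c.C n\<^esub> (\<lambda>gs. wproj (b gs)))" unfolding e by simp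
      also have "\<dots> = ?q \<odot>\<^bsub>Hn n\<^esub> y"
        unfolding y tensor_homology_def group_homology_def
        by (rule subquot.Q_smult[OF c.homology_subquot c.cycles_C[OF wb], symmetric])
      finally show ?thesis .
    qed
    moreover have "y \<in> carrier (Hn n)" unfolding carr y using wb by (rule imageI)
    ultimately show "y \<in> ?W" unfolding weight_space_def by blast
  next
    fix x :: "((nat \<Rightarrow> nat) list \<Rightarrow> (nat \<Rightarrow> nat) \<Rightarrow> 'k) set" assume x: "x \<in> ?W"
    have xH: "x \<in> carrier (Hn n)" using x by (simp add: weight_space_def)
    obtain l :: "('k \<times> 'k mat) list" where l: "glist (GL d) l"
      and lE: "\<forall>T\<in>carrier (tensor_space d). lact (tensor_space d) (tensor_act d) l T = wproj T"
      and lx: "\<forall>x\<in>?W. lact (Hn n) (Ha n) l x = x"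
      using weight_projection_list[OF inf, of n] by (elim exE conjE)
    have lE': "lact (tensor_space d) (tensor_act d) l T = wproj T" if "T \<in> carrier (tensor_space d)" for T using lE that by blast
    have "lact (Hn n) (Ha n) l x = wproj_hom_map n x"
      unfolding tensor_homology_def tensor_homology_act_def
    proof (rule c.lact_homology_image[OF l _ w.equivariant_map_axioms])
      show "x \<in> carrier (group_homology G (tensor_space d) place_act n)" using xH unfolding tensor_homology_def .
    qed (rule lE')
    then have "x = wproj_hom_map n x" using lx x by simp
    then show "x \<in> wproj_hom_map n ` carrier (Hn n)" using xH by (rule image_eqI)
  qed
qed

text \<open>The maps \<open>jm\<close> and \<open>rm\<close> make \<open>M^\<lambda>\<close> a
  retract of tensor space with idempotent \<open>wproj\<close>, so its homology is the image of that
  idempotent, and duality passes to cohomology.\<close>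

theorem permutation_module_weight:
  assumes inf: "infinite (UNIV :: 'k::field set)"
  shows "vdim (group_cohomology G (PM :: ('k, _) module) (perm_act d) n) =
    vdim ((Hn n :: ('k, _) module)\<lparr>carrier := weight_space d (Hn n) (Ha n) (partition_weight lam)\<rparr>)"
proof -
  have "vdim (group_cohomology G (PM :: ('k, _) module) (perm_act d) n) = vdim (group_homology G (PM :: ('k, _) module)
    (perm_act d) n)"
    by (rule form_rep.cohomology_dim_eq[OF perm_form_rep])
  also have "\<dots> = vdim ((Hn n :: ('k, _) module)\<lparr>carrier := wproj_hom_map n ` carrier (Hn n)\<rparr>)"
    unfolding tensor_homology_def jm_rm[abs_def, symmetric]
    by (rule homology_retract_dim[OF equivariant_jm equivariant_rm]) (rule rm_jm)
  finally show ?thesis unfolding weight_space_image[OF inf] .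
qed

end

subsection \<open>Endomorphisms of indecomposable modules\<close>

lemma funpow_hom: "f \<in> lhom V V \<Longrightarrow> (f ^^ n) \<in> lhom V V"
  by (induction n) (auto intro!: lhomI simp: lhomD)

text \<open>For suitable \<open>N\<close> the space is the direct sum of the kernel and the image of
  \<open>f^N\<close>, both subrepresentations. Indecomposability makes one of them zero, and the
  kernel contains the nonzero vector \<open>w\<close>.\<close>

theorem (in lrep) fitting_nilpotent:
  assumes fin: "fvsp V" and indec: "indecomposable_rep G V \<rho>"
    and f: "f \<in> lhom V V" and eq: "\<And>g v. g \<in> carrier G \<Longrightarrow> v \<in> carrier V \<Longrightarrow> f (\<rho> g v) = \<rho> g (f v)"
    and w: "w \<in> carrier V" "w \<noteq> \<zero>\<^bsub>V\<^esub>" "f w = \<zero>\<^bsub>V\<^esub>"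
  shows "\<exists>N. \<forall>v\<in>carrier V. (f ^^ N) v = \<zero>\<^bsub>V\<^esub>"
proof -
  interpret V: fvsp V by (rule fin)
  note vs = V.vsp_axioms
  let ?im = "\<lambda>n. (f ^^ n) ` carrier V"
  have h: "(f ^^ n) \<in> lhom V V" for n by (rule funpow_hom[OF f])
  have heq: "(f ^^ n) (\<rho> g v) = \<rho> g ((f ^^ n) v)" if "g \<in> carrier G" "v \<in> carrier V" for n g v
    using that(2)
  proof (induction n)
    case (Suc n) then show ?case using eq[OF that(1) lhomD(1)[OF h Suc.prems, of n]] by simp
  qed simp
  have ims: "VectorSpace.subspace class_ring (?im n) V" for n
    by (rule lhom_image_subsp[OF vs vs h V.subsp_carrier])
  have mono: "?im (m + n) \<subseteq> ?im n" for m n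
  proof
    fix x assume "x \<in> ?im (m + n)"
    then obtain y where y: "y \<in> carrier V" "x = (f ^^ (m + n)) y" by blast
    have "x = (f ^^ n) ((f ^^ m) y)" unfolding y(2) by (simp add: funpow_add add.commute[of m n])
    then show "x \<in> ?im n" using lhomD(1)[OF h y(1)] by blast
  qed
  have sub: "VectorSpace.subspace class_ring (?im (m + n)) (V\<lparr>carrier := ?im n\<rparr>)" for m n
    unfolding V.subsp_nested[OF ims] using ims mono by blast
  \<comment> \<open>\<open>N = Suc n\<close> minimises the dimension of the image among the positive
    powers; positivity ensures that \<open>f^N\<close> kills \<open>w\<close>.\<close>
  define n where "n = (ARG_MIN (\<lambda>n. vdim (V\<lparr>carrier := ?im (Suc n)\<rparr>)) n. True)"
  have least: "vdim (V\<lparr>carrier := ?im (Suc n)\<rparr>) \<le> vdim (V\<lparr>carrier := ?im (Suc m)\<rparr>)" for m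
    unfolding n_def by (rule arg_min_nat_le) simp
  define N where "N = Suc n"
  have stable: "?im (N + N) = ?im N"
  proof -
    have "vdim (V\<lparr>carrier := ?im N\<rparr>) \<le> vdim (V\<lparr>carrier := ?im (N + N)\<rparr>)"
      using least[of "n + N"] unfolding N_def by simp
    then show ?thesis using fvsp.subsp_dim_eq[OF V.subsp_fin[OF ims] sub[of N N]] by simp
  qed
  let ?K = "{v \<in> carrier V. (f ^^ N) v = \<zero>\<^bsub>V\<^esub>}"
  have Ks: "VectorSpace.subspace class_ring ?K V"
    using lhom_vimage_subsp[OF vs vs h[of N] V.subsp_zero] by simp
  have Kz: "?K \<inter> ?im N = {\<zero>\<^bsub>V\<^esub>}"
  proof -
    interpret I: fvsp "V\<lparr>carrier := ?im N\<rparr>" by (rule V.subsp_fin[OF ims])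
    have hI: "(f ^^ N) \<in> lhom (V\<lparr>carrier := ?im N\<rparr>) V"
      by (rule lhom_restrict_dom[OF h V.subspD(1)[OF ims]])
    have "(f ^^ N) ` carrier (V\<lparr>carrier := ?im N\<rparr>) = ?im N"
      using stable by (simp add: image_image funpow_add)
    then have "vdim (V\<lparr>carrier := {x \<in> ?im N. (f ^^ N) x = \<zero>\<^bsub>V\<^esub>}\<rparr>) = 0"
      using rank_nullity'[OF I.fvsp_axioms vs hI] by simp
    moreover have K': "VectorSpace.subspace class_ring {x \<in> ?im N. (f ^^ N) x = \<zero>\<^bsub>V\<^esub>} (V\<lparr>carrier := ?im N\<rparr>)"
      using lhom_vimage_subsp[OF I.vsp_axioms vs hI V.subsp_zero] by simp
    ultimately have "{x \<in> ?im N. (f ^^ N) x = \<zero>\<^bsub>V\<^esub>} = {\<zero>\<^bsub>V\<^esub>}"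
      using fvsp.dim_zeroD[OF I.subsp_fin[OF K']] by simp
    then show ?thesis using V.subspD(1)[OF ims[of N]] by blast
  qed
  have "subrep G V \<rho> ?K" unfolding subrep_def
    using Ks heq act_cl lhom_zero[OF vs vs act_hom] by simp
  moreover have "subrep G V \<rho> (?im N)" unfolding subrep_def
  proof (intro conjI ballI)
    show "VectorSpace.subspace class_ring (?im N) V" by (rule ims)
    fix g w assume g: "g \<in> carrier G" and "w \<in> ?im N"
    then obtain v where v: "v \<in> carrier V" "w = (f ^^ N) v" by blast
    show "\<rho> g w \<in> ?im N" unfolding v(2) heq[OF g v(1), symmetric] using act_cl[OF g v(1)] by (rule imageI)
  qed
  moreover have "?K <+>\<^bsub>V\<^esub> ?im N = carrier V"
  proof (intro equalityI subsetI)
    fix x assume "x \<in> ?K <+>\<^bsub>V\<^esub> ?im N"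
    then obtain a b where "a \<in> ?K" "b \<in> ?im N" "x = a \<oplus>\<^bsub>V\<^esub> b" unfolding set_add_def' by blast
    then show "x \<in> carrier V" using V.subspD(1)[OF ims[of N]] by blast
  next
    fix x assume x: "x \<in> carrier V"
    \<comment> \<open>Stability of the image writes \<open>f^N x\<close> as
      \<open>f^N (f^N y)\<close>, so \<open>x\<close> minus \<open>f^N y\<close> lies in the
      kernel.\<close>
    then have "(f ^^ N) x \<in> ?im (N + N)" using stable by blast
    then obtain y where y: "y \<in> carrier V" "(f ^^ N) x = (f ^^ N) ((f ^^ N) y)" by (auto simp: funpow_add)
    let ?b = "(f ^^ N) y"
    have b: "?b \<in> carrier V" by (rule lhomD(1)[OF h y(1)])
    have "(f ^^ N) (x \<ominus>\<^bsub>V\<^esub> ?b) = (f ^^ N) x \<ominus>\<^bsub>V\<^esub> (f ^^ N) ?b" by (rule lhom_diff[OF vs vs h x b])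
    also have "\<dots> = \<zero>\<^bsub>V\<^esub>" unfolding y(2) using lhomD(1)[OF h b] by simp
    finally have "x \<ominus>\<^bsub>V\<^esub> ?b \<in> ?K" using x b by simp
    moreover have "?b \<in> ?im N" using y(1) by (rule imageI)
    moreover have "x = (x \<ominus>\<^bsub>V\<^esub> ?b) \<oplus>\<^bsub>V\<^esub> ?b" using x b by (simp add: a_minus_def a_assoc l_neg)
    ultimately show "x \<in> ?K <+>\<^bsub>V\<^esub> ?im N" unfolding set_add_def' by blast
  qed
  ultimately have "complementary_subreps G V \<rho> ?K (?im N)" unfolding complementary_subreps_def using Kz by blast
  then have d: "?K = {\<zero>\<^bsub>V\<^esub>} \<or> ?im N = {\<zero>\<^bsub>V\<^esub>}" using indec unfolding indecomposable_rep_def by blast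
  have "(f ^^ N) w = (f ^^ n) (f w)" unfolding N_def by (simp only: funpow_Suc_right o_def)
  then have "w \<in> ?K" using w lhom_zero[OF vs vs h] by simp
  then have "?im N = {\<zero>\<^bsub>V\<^esub>}" using d w(2) by blast
  then show ?thesis by blast
qed

subsection \<open>Young modules\<close>

locale young = partition_shape +
  fixes Y Z :: "((nat \<Rightarrow> nat) set \<Rightarrow> 'k::field) set"
  assumes inf: "infinite (UNIV :: 'k set)"
    and compl: "complementary_subreps G (PM :: ('k, _) module) (perm_act d) Y Z"
    and indec: "indecomposable_rep G ((PM :: ('k, _) module)\<lparr>carrier := Y\<rparr>) (perm_act d)"
    and specht: "specht_module d lam \<subseteq> Y"
begin

abbreviation "E \<equiv> tensor_space d :: ('k, _) module"
abbreviation "P \<equiv> PM :: ('k, _) module"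
abbreviation "YM \<equiv> P\<lparr>carrier := Y\<rparr>"
abbreviation "pt \<equiv> polytabloid d lam :: _ \<Rightarrow> 'k"

sublocale P: vsp P by (rule PM_vsp)

lemma subrep_Y: "subrep G P (perm_act d) Y" and subrep_Z: "subrep G P (perm_act d) Z"
  and inter: "Y \<inter> Z = {\<zero>\<^bsub>P\<^esub>}" and sum: "Y <+>\<^bsub>P\<^esub> Z = carrier P"
  using compl by (auto simp: complementary_subreps_def)

lemma Y_sub: "VectorSpace.subspace class_ring Y P" and Z_sub: "VectorSpace.subspace class_ring Z P"
  using subrep_Y subrep_Z by (auto simp: subrep_def)

lemmas YD = P.subspD[OF Y_sub] and ZD = P.subspD[OF Z_sub]

lemma Y_act: "g \<in> carrier G \<Longrightarrow> y \<in> Y \<Longrightarrow> perm_act d g y \<in> Y"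
  using subrep_Y by (auto simp: subrep_def)

lemma Z_act: "g \<in> carrier G \<Longrightarrow> y \<in> Z \<Longrightarrow> perm_act d g y \<in> Z"
  using subrep_Z by (auto simp: subrep_def)

text \<open>The projection onto \<open>Y\<close> along the given complement \<open>Z\<close>;
  \<open>prj_eq\<close> shows that the choice is unique on the carrier.\<close>

definition prj :: "((nat \<Rightarrow> nat) set \<Rightarrow> 'k) \<Rightarrow> (nat \<Rightarrow> nat) set \<Rightarrow> 'k" where
  "prj x = (SOME y. y \<in> Y \<and> (\<exists>z\<in>Z. x = y \<oplus>\<^bsub>P\<^esub> z))"

lemma prj_ex: "x \<in> carrier P \<Longrightarrow> \<exists>y. y \<in> Y \<and> (\<exists>z\<in>Z. x = y \<oplus>\<^bsub>P\<^esub> z)"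
  unfolding sum[symmetric] set_add_def' by blast

lemma prj: "x \<in> carrier P \<Longrightarrow> prj x \<in> Y \<and> (\<exists>z\<in>Z. x = prj x \<oplus>\<^bsub>P\<^esub> z)"
  unfolding prj_def by (rule someI_ex[OF prj_ex])

lemma prj_eq:
  assumes y: "y \<in> Y" and z: "z \<in> Z"
  shows "prj (y \<oplus>\<^bsub>P\<^esub> z) = y"
proof -
  have c: "y \<in> carrier P" "z \<in> carrier P" using YD(5)[OF y] ZD(5)[OF z] by simp_all
  then have p: "prj (y \<oplus>\<^bsub>P\<^esub> z) \<in> Y" "\<exists>z'\<in>Z. y \<oplus>\<^bsub>P\<^esub> z = prj (y \<oplus>\<^bsub>P\<^esub> z) \<oplus>\<^bsub>P\<^esub> z'" using prj[of "y \<oplus>\<^bsub>P\<^esub> z"] by simp_all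
  obtain z' where z': "z' \<in> Z" "y \<oplus>\<^bsub>P\<^esub> z = prj (y \<oplus>\<^bsub>P\<^esub> z) \<oplus>\<^bsub>P\<^esub> z'" using p(2) by blast
  let ?u = "\<lambda>X. y X - prj (y \<oplus>\<^bsub>P\<^esub> z) X"
  have u1: "?u = y \<oplus>\<^bsub>P\<^esub> ((- 1) \<odot>\<^bsub>P\<^esub> prj (y \<oplus>\<^bsub>P\<^esub> z))" by (simp add: PM_simps)
  have "?u \<in> Y" unfolding u1 by (rule YD(3)[OF y YD(4)[OF p(1)]])
  moreover have "?u = z' \<oplus>\<^bsub>P\<^esub> ((- 1) \<odot>\<^bsub>P\<^esub> z)"
  proof
    fix X
    show "?u X = (z' \<oplus>\<^bsub>P\<^esub> ((- 1) \<odot>\<^bsub>P\<^esub> z)) X" using fun_cong[OF z'(2), of X] by (simp add: PM_simps algebra_simps)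
  qed
  then have "?u \<in> Z" using ZD(3)[OF z'(1) ZD(4)[OF z, of "- 1"]] by simp
  ultimately have "?u = (\<lambda>_. 0)" using inter by (auto simp: PM_simps)
  then show ?thesis by (auto simp: fun_eq_iff)
qed

lemma prj_Y: "y \<in> Y \<Longrightarrow> prj y = y"
  using prj_eq[of y "\<zero>\<^bsub>P\<^esub>"] ZD(2) YD(5)[of y] by simp

lemma prj_hom: "prj \<in> lhom P YM"
proof (rule lhomI)
  fix x assume x: "x \<in> carrier P"
  then show "prj x \<in> carrier YM" using prj by simp
  obtain z where z: "z \<in> Z" "x = prj x \<oplus>\<^bsub>P\<^esub> z" and px: "prj x \<in> Y" using prj[OF x] by blast
  { fix x' assume x': "x' \<in> carrier P"
    obtain z' where z': "z' \<in> Z" "x' = prj x' \<oplus>\<^bsub>P\<^esub> z'" and px': "prj x' \<in> Y" using prj[OF x'] by blast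
    have "x \<oplus>\<^bsub>P\<^esub> x' = (prj x \<oplus>\<^bsub>P\<^esub> z) \<oplus>\<^bsub>P\<^esub> (prj x' \<oplus>\<^bsub>P\<^esub> z')" using z(2) z'(2) by simp
    also have "\<dots> = (prj x \<oplus>\<^bsub>P\<^esub> prj x') \<oplus>\<^bsub>P\<^esub> (z \<oplus>\<^bsub>P\<^esub> z')" by (simp add: PM_simps fun_eq_iff)
    finally have "prj (x \<oplus>\<^bsub>P\<^esub> x') = prj x \<oplus>\<^bsub>P\<^esub> prj x'" using prj_eq[OF YD(3)[OF px px'] ZD(3)[OF z(1) z'(1)]] by simp
    then show "prj (x \<oplus>\<^bsub>P\<^esub> x') = prj x \<oplus>\<^bsub>YM\<^esub> prj x'" by simp }
  { fix c
    have "c \<odot>\<^bsub>P\<^esub> x = c \<odot>\<^bsub>P\<^esub> (prj x \<oplus>\<^bsub>P\<^esub> z)" using z(2) by simp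
    also have "\<dots> = c \<odot>\<^bsub>P\<^esub> prj x \<oplus>\<^bsub>P\<^esub> c \<odot>\<^bsub>P\<^esub> z" by (simp add: PM_simps algebra_simps)
    finally have "prj (c \<odot>\<^bsub>P\<^esub> x) = c \<odot>\<^bsub>P\<^esub> prj x" using prj_eq[OF YD(4)[OF px] ZD(4)[OF z(1)]] by simp
    then show "prj (c \<odot>\<^bsub>P\<^esub> x) = c \<odot>\<^bsub>YM\<^esub> prj x" by simp }
qed

lemma prj_act: "g \<in> carrier G \<Longrightarrow> x \<in> carrier P \<Longrightarrow> prj (perm_act d g x) = perm_act d g (prj x)"
proof -
  assume g: "g \<in> carrier G" and x: "x \<in> carrier P"
  obtain z where z: "z \<in> Z" "x = prj x \<oplus>\<^bsub>P\<^esub> z" and px: "prj x \<in> Y" using prj[OF x] by blast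
  have "perm_act d g x = perm_act d g (prj x \<oplus>\<^bsub>P\<^esub> z)" using z(2) by simp
  also have "\<dots> = perm_act d g (prj x) \<oplus>\<^bsub>P\<^esub> perm_act d g z" by (simp add: PM_simps perm_act_def fun_eq_iff)
  finally show ?thesis using prj_eq[OF Y_act[OF g px] Z_act[OF g z(1)]] by simp
qed

lemma prj_in: "x \<in> carrier P \<Longrightarrow> prj x \<in> Y" using prj by blast

lemma pt_in: "pt \<in> Y"
proof -
  let ?S = "{perm_act d \<sigma> pt | \<sigma>. \<sigma> \<in> carrier G}"
  have ptP: "pt \<in> carrier P" unfolding PM_iff
  proof (intro allI impI)
    fix X assume X: "X \<notin> cosets"
    have "X \<noteq> \<pi> <#\<^bsub>G\<^esub> H" if "\<pi> \<in> colgrp" for \<pi>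
    proof
      assume "X = \<pi> <#\<^bsub>G\<^esub> H"
      moreover have "\<pi> \<in> carrier G" using colgrp_perm[OF that] by (simp add: sym_simps)
      ultimately show False using X unfolding LCOSETS_def by blast
    qed
    then show "pt X = 0" unfolding polytabloid_def colgrp_eq by (intro sum.neutral) simp
  qed
  have S: "?S \<subseteq> carrier P" using perm_act_in ptP by (auto simp: sym_simps simp del: One_nat_def)
  have "perm_act d \<one>\<^bsub>G\<^esub> pt = pt" by (rule linear_rep.act_one[OF perm_rep ptP])
  moreover have "\<one>\<^bsub>G\<^esub> \<in> carrier G" by (simp add: sym_simps permutes_id)
  ultimately have "pt \<in> ?S" by (intro CollectI exI[of _ "\<one>\<^bsub>G\<^esub>"] conjI) simp_all
  then have "pt \<in> P.span ?S" using P.in_own_span[OF S] by blast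
  then show ?thesis using specht unfolding specht_module_def by blast
qed

lemma jm_pt: "jm pt = et" by (rule jm_polytabloid)

lemma rm_et: "rm et = pt" unfolding jm_pt[symmetric] by (rule rm_jm[OF YD(5)[OF pt_in]])

lemma pt_nonzero: "pt \<noteq> (\<lambda>_. 0)"
proof
  assume "pt = (\<lambda>_. 0)"
  then have "et = (\<lambda>_. 0 :: 'k)" unfolding jm_pt[symmetric] by (simp add: jm_def fun_eq_iff)
  then show False using et_i0[where 'k='k] by simp
qed

lemma Y_lrep: "lrep G YM (perm_act d)" using indec by (simp add: lrep_def indecomposable_rep_def)

lemma Y_fvsp: "fvsp YM"
proof -
  have "fvsp P" unfolding perm_module_def by (rule coeff_space_fin(1)[OF finite_cosets])
  then show ?thesis by (rule fvsp.subsp_fin[OF _ Y_sub])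
qed

text \<open>The idempotent of tensor space whose image is the copy of \<open>Y\<close> inside the
  \<lambda>-weight space.\<close>

definition eps :: "((nat \<Rightarrow> nat) \<Rightarrow> 'k) \<Rightarrow> (nat \<Rightarrow> nat) \<Rightarrow> 'k" where
  "eps T = jm (prj (rm T))"

lemma prj_P: "x \<in> carrier P \<Longrightarrow> prj x \<in> carrier P" using prj_in YD(5) by blast

lemma eps_hom: "eps \<in> lhom E E"
proof -
  have 1: "prj \<in> lhom P P"
    by (rule lhomI) (use prj_P lhomD(2,3)[OF prj_hom] in simp_all)
  show ?thesis unfolding eps_def[abs_def] by (rule lhom_comp[OF lhom_comp[OF rm_hom 1] jm_hom])
qed

lemma eps_place: "\<sigma> permutes {1..d} \<Longrightarrow> eps (place_act \<sigma> T) = place_act \<sigma> (eps T)"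
  unfolding eps_def by (simp only: rm_act prj_act[OF _ rm_PM] sym_simps(1) jm_act)

lemma rm_eps: "rm (eps T) = prj (rm T)"
  unfolding eps_def by (rule rm_jm[OF prj_P[OF rm_PM]])

lemma eps_idem: "eps (eps T) = eps T"
  unfolding eps_def[of "eps T"] rm_eps prj_Y[OF prj_in[OF rm_PM]] unfolding eps_def ..

lemma eps_et: "eps et = et" unfolding eps_def rm_et prj_Y[OF pt_in] jm_pt ..

lemma eps_wproj: "eps (wproj T) = eps T" unfolding eps_def rm_wproj ..

text \<open>\<open>eps\<close> factors through the \<lambda>-part, where
  \<open>equivariant_et\<close> makes \<open>a et\<close> a multiple of \<open>et\<close>, and
  \<open>eps\<close> fixes \<open>et\<close>.\<close>

lemma equivariant_pairing:
  assumes a: "a \<in> lhom E E" and eq: "\<And>\<sigma> T. \<sigma> permutes {1..d} \<Longrightarrow> T \<in> carrier E \<Longrightarrow> a (place_act \<sigma> T) = place_act \<sigma> (a T)"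
  shows "eps (a et) = (\<lambda>I. ip d (a e0) et * et I)"
proof -
  have "eps (a et) = eps (\<lambda>I. ip d (a e0) et * et I)"
    unfolding eps_wproj[of "a et", symmetric] by (subst equivariant_et[OF a]) (simp_all add: eq)
  also have "\<dots> = (\<lambda>I. ip d (a e0) et * eps et I)" using lhomD(3)[OF eps_hom et_E, of "ip d (a e0) et"] by simp
  finally show ?thesis unfolding eps_et .
qed

text \<open>Compressing \<open>a\<close> to \<open>Y\<close> gives an endomorphism of an
  indecomposable module with a nonzero kernel vector, so Fitting's lemma applies.\<close>

lemma compression_nilpotent:
  assumes a: "a \<in> lhom E E" and eq: "\<And>\<sigma> T. \<sigma> permutes {1..d} \<Longrightarrow> T \<in> carrier E \<Longrightarrow> a (place_act \<sigma> T) = place_act \<sigma> (a T)"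
    and w: "w \<in> Y" "w \<noteq> (\<lambda>_. 0)" "prj (rm (a (jm w))) = (\<lambda>_. 0)"
  shows "\<exists>N. \<forall>y\<in>Y. ((\<lambda>y. prj (rm (a (jm y)))) ^^ N) y = (\<lambda>_. 0)"
proof -
  interpret Y: lrep G YM "perm_act d" by (rule Y_lrep)
  let ?f = "\<lambda>y. prj (rm (a (jm y)))"
  have "?f \<in> lhom YM YM"
    by (rule lhom_comp[OF lhom_comp[OF lhom_comp[OF lhom_restrict_dom[OF jm_hom YD(1)] a] rm_hom] prj_hom])
  moreover have "?f (perm_act d g v) = perm_act d g (?f v)" if g: "g \<in> carrier G" for g v
  proof -
    have s: "g permutes {1..d}" using g by (simp add: sym_simps)
    show ?thesis unfolding jm_act[OF s] eq[OF s jm_E] rm_act[OF s] prj_act[OF g rm_PM] ..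
  qed
  ultimately have "\<exists>N. \<forall>v\<in>carrier YM. (?f ^^ N) v = \<zero>\<^bsub>YM\<^esub>"
    by (rule Y.fitting_nilpotent[OF Y_fvsp indec]) (use w in \<open>simp_all add: PM_simps\<close>)
  then show ?thesis by (simp add: PM_simps)
qed

text \<open>The transpose of \<open>eps\<close> for the standard form, its entries being read off by
  pairing with the images of basis tensors.\<close>

definition epsT :: "((nat \<Rightarrow> nat) \<Rightarrow> 'k) \<Rightarrow> (nat \<Rightarrow> nat) \<Rightarrow> 'k" where
  "epsT T I = (if I \<in> M then ip d (eps (delta I)) T else 0)"

lemma epsT_E: "epsT T \<in> carrier E" by (simp add: tensor_space_iff epsT_def)

lemma eps_adjoint:
  assumes T: "T \<in> carrier E"
  shows "ip d (eps T) v = ip d T (epsT v)"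
proof -
  have "eps T = (\<lambda>I. \<Sum>J\<in>M. T J * eps (delta J) I)"
    by (subst tensor_expand[OF T], rule lhom_tensor_sum[OF eps_hom]) (rule delta_tensor)
  then have "ip d (eps T) v = (\<Sum>J\<in>M. T J * ip d (eps (delta J)) v)" by (simp only: ip_sum ip_simps)
  also have "\<dots> = ip d T (epsT v)" unfolding ip_def[of d T] by (intro sum.cong refl) (simp add: epsT_def)
  finally show ?thesis .
qed

lemma ip_eqI:
  assumes "u \<in> carrier E" "v \<in> carrier E" "\<And>T. T \<in> carrier E \<Longrightarrow> ip d T u = ip d T v"
  shows "u = v"
proof
  fix I
  show "u I = v I"
  proof (cases "I \<in> M")
    case True
    then show ?thesis using assms(3)[OF delta_tensor[OF True]] ip_delta[OF True, of u] ip_delta[OF True, of v] by simp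
  next
    case False then show ?thesis using assms(1,2) by (simp add: tensor_space_iff)
  qed
qed

lemma epsT_hom: "epsT \<in> lhom E E"
  by (rule lhomI) (simp_all add: epsT_E epsT_def ip_commute[of d "eps _"] ip_simps fun_eq_iff)

lemma epsT_place:
  assumes s: "\<sigma> permutes {1..d}" and T: "T \<in> carrier E"
  shows "epsT (place_act \<sigma> T) = place_act \<sigma> (epsT T)"
proof (rule ip_eqI)
  show "epsT (place_act \<sigma> T) \<in> carrier E" by (rule epsT_E)
  show "place_act \<sigma> (epsT T) \<in> carrier E" by (rule place_act_in[OF s epsT_E])
  fix u assume u: "u \<in> carrier E"
  note s' = permutes_inv[OF s]
  have inv: "ip d x (place_act \<sigma> y) = ip d (place_act (inv' \<sigma>) x) y" for x y :: "(nat \<Rightarrow> nat) \<Rightarrow> 'k"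
    using ip_place[OF s', of x y] inv_inv_eq[OF permutes_bij[OF s]] by simp
  show "ip d u (epsT (place_act \<sigma> T)) = ip d u (place_act \<sigma> (epsT T))"
    unfolding inv eps_adjoint[OF u, symmetric] eps_adjoint[OF place_act_in[OF s' u], symmetric] eps_place[OF s'] ..
qed

text \<open>\<open>equivariant_pairing\<close> for \<open>eps\<close> itself, compared at the
  coefficient of \<open>i0\<close>, where \<open>et\<close> is 1.\<close>

lemma eps_pairing: "ip d (eps e0) et = 1"
proof -
  have "eps et = (\<lambda>I. ip d (eps e0) et * et I)"
    using equivariant_pairing[OF eps_hom eps_place] unfolding eps_et by simp
  then have "et i0 = ip d (eps e0) et * et i0" unfolding eps_et by (rule fun_cong)
  then show ?thesis using et_i0[where 'k='k] by simp
qed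

text \<open>Moving the transpose across the form leaves the coefficient of \<open>et\<close> at
  \<open>i0\<close>.\<close>

lemma epsT_pairing: "ip d (epsT e0) et = 1"
proof -
  have "ip d (epsT e0) et = ip d (eps et) e0" unfolding eps_adjoint[OF et_E] by (rule ip_commute)
  then show ?thesis unfolding eps_et ip_commute[of d et] unfolding e0_def ip_delta[OF i0_M] et_i0 .
qed

text \<open>\<open>prj \<circ> prj\<^sup>T\<close> fixes the polytabloid, so by Fitting's lemma it is injective on \<open>Y\<close>; but it kills the radical of the form.\<close>

lemma form_nondegenerate:
  assumes u: "u \<in> Y" and z: "\<And>v. v \<in> Y \<Longrightarrow> (\<Sum>X\<in>cosets. u X * v X) = 0"
  shows "u = (\<lambda>_. 0)"
proof (rule ccontr)
  assume un: "u \<noteq> (\<lambda>_. 0)"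
  \<comment> \<open>Every \<open>eps (delta I)\<close> lies in the copy of \<open>Y\<close>, and
    \<open>u\<close> pairs to zero with all of \<open>Y\<close>.\<close>
  have "epsT (jm u) = (\<lambda>_. 0)"
  proof
    fix I
    have "ip d (eps (delta I)) (jm u) = (\<Sum>X\<in>cosets. prj (rm (delta I)) X * u X)" unfolding eps_def form_jm ..
    also have "\<dots> = 0" using z[OF prj_in[OF rm_PM]] by (simp add: mult.commute)
    finally show "epsT (jm u) I = 0" by (simp add: epsT_def)
  qed
  then have "eps (epsT (jm u)) = (\<lambda>_. 0)" using lhom_zero[OF tensor_vsp tensor_vsp eps_hom] by simp
  then have "rm (eps (epsT (jm u))) = (\<lambda>_. 0)" by (simp add: rm_def fun_eq_iff)
  then have k: "prj (rm (epsT (jm u))) = (\<lambda>_. 0)" unfolding rm_eps .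
  obtain N where N: "\<forall>y\<in>Y. ((\<lambda>y. prj (rm (epsT (jm y)))) ^^ N) y = (\<lambda>_. 0)"
    using compression_nilpotent[OF epsT_hom epsT_place u un k] by blast
  have "eps (epsT et) = et"
    using equivariant_pairing[OF epsT_hom epsT_place] unfolding epsT_pairing by simp
  then have "prj (rm (epsT (jm pt))) = pt" using rm_eps[of "epsT et"] rm_et unfolding jm_pt by simp
  then have "((\<lambda>y. prj (rm (epsT (jm y)))) ^^ N) pt = pt" by (induction N) simp_all
  then show False using N pt_in pt_nonzero by metis
qed

lemma Y_form_rep: "form_rep G YM (perm_act d) cosets Y"
  unfolding form_rep_def form_rep_axioms_def
proof (intro conjI allI impI)
  show "lrep G YM (perm_act d)" by (rule Y_lrep)
  show "YM = coeff_space cosets\<lparr>carrier := Y\<rparr>" by (simp add: perm_module_def)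
  show "VectorSpace.subspace class_ring Y (coeff_space cosets)" using Y_sub unfolding perm_module_def .
  fix \<sigma> and u v :: "(nat \<Rightarrow> nat) set \<Rightarrow> 'k" assume "\<sigma> \<in> carrier G"
  then show "(\<Sum>X\<in>cosets. perm_act d \<sigma> u X * perm_act d \<sigma> v X) = (\<Sum>X\<in>cosets. u X * v X)"
    by (intro perm_form_invariant) (simp add: sym_simps)
next
  fix u :: "(nat \<Rightarrow> nat) set \<Rightarrow> 'k" assume u: "u \<in> Y"
    and z: "\<forall>v. v \<in> Y \<longrightarrow> (\<Sum>X\<in>cosets. u X * v X) = 0"
  show "u = (\<lambda>_. 0)" by (rule form_nondegenerate[OF u]) (use z in blast)
qed (simp_all add: sym_finite finite_cosets)

lemma lact_place:
  "glist (GL d) l \<Longrightarrow> \<sigma> permutes {1..d} \<Longrightarrow> lact E (tensor_act d) l (place_act \<sigma> T) = place_act \<sigma> (lact E (tensor_act d) l T)"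
  by (induction l) (simp_all add: tensor_place_commute, simp_all add: place_act_def fun_eq_iff)

text \<open>The condition \<open>char\<close> is \<open>equivariant_pairing\<close> for the operator
  of \<open>a\<close>, and \<open>nilp\<close> is \<open>compression_nilpotent\<close> for the
  operator of \<open>b\<close>, carried over from \<open>Y\<close> to tensor space.\<close>

theorem young_idempotent:
  assumes e: "glist (GL d) e" and eE: "\<And>T. T \<in> carrier E \<Longrightarrow> lact E (tensor_act d) e T = eps T"
  shows "primitive_idempotent (GL d) E (tensor_act d) e et Fc"
proof -
  interpret E: lrep "GL d" E "tensor_act d" using tensor_rep by (simp add: lrep_def)
  have epsE: "eps T \<in> carrier E" if "T \<in> carrier E" for T by (rule lhomD(1)[OF eps_hom that])
  show ?thesis
  proof
    show "glist (GL d) e" by (rule e)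
    show "lact E (tensor_act d) e (lact E (tensor_act d) e T) = lact E (tensor_act d) e T" if "T \<in> carrier E" for T
      unfolding eE[OF that] eE[OF epsE[OF that]] by (rule eps_idem)
    show "et \<in> carrier E" by (rule et_E)
    show "lact E (tensor_act d) e et = et" unfolding eE[OF et_E] by (rule eps_et)
    show "lact E (tensor_act d) e (lact E (tensor_act d) a et) = lext Fc a \<odot>\<^bsub>E\<^esub> et" if a: "glist (GL d) a" for a
    proof -
      have "eps (lact E (tensor_act d) a et) = (\<lambda>I. ip d (lact E (tensor_act d) a e0) et * et I)"
        by (rule equivariant_pairing[OF E.lact_hom[OF a]]) (rule lact_place[OF a])
      then show ?thesis unfolding eE[OF E.lact_cl[OF a et_E]] lext_Fc[OF a] by simp
    qed
    show "lext Fc e = 1" unfolding lext_Fc[OF e] eE[OF e0_E] by (rule eps_pairing)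
    show "Fc \<one>\<^bsub>GL d\<^esub> = 1" unfolding GL_simps(3) by (rule Fc_one)
    fix b assume b: "glist (GL d) b" and z: "lact E (tensor_act d) e (lact E (tensor_act d) b et) = \<zero>\<^bsub>E\<^esub>"
    let ?B = "lact E (tensor_act d) b"
    let ?f = "\<lambda>y. prj (rm (?B (jm y)))"
    have "eps (?B et) = (\<lambda>_. 0)" using z unfolding eE[OF E.lact_cl[OF b et_E]] by simp
    then have "rm (eps (?B et)) = (\<lambda>_. 0)" by (simp add: rm_def fun_eq_iff)
    then have "prj (rm (?B (jm pt))) = (\<lambda>_. 0)" unfolding rm_eps jm_pt .
    then obtain N where N: "\<forall>y\<in>Y. (?f ^^ N) y = (\<lambda>_. 0)"
      using compression_nilpotent[OF E.lact_hom[OF b] lact_place[OF b] pt_in pt_nonzero] by blast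
    let ?g = "\<lambda>T. lact E (tensor_act d) e (?B (lact E (tensor_act d) e T))"
    have BE: "?B T \<in> carrier E" if "T \<in> carrier E" for T by (rule E.lact_cl[OF b that])
    have g: "?g T = jm (?f (prj (rm T)))" if T: "T \<in> carrier E" for T
      unfolding eE[OF T] eE[OF BE[OF epsE[OF T]]] unfolding eps_def ..
    \<comment> \<open>The exponent starts at 1, because the zeroth power of \<open>?g\<close> is the
      identity on all of tensor space and not only on the image of \<open>eps\<close>.\<close>
    have "(?g ^^ Suc n) T = jm ((?f ^^ Suc n) (prj (rm T)))" if T: "T \<in> carrier E" for n T
    proof (induction n)
      case 0 show ?case using g[OF T] by simp
    next
      case (Suc n)
      let ?y = "(?f ^^ Suc n) (prj (rm T))"
      have y: "?y \<in> Y" using prj_in[OF rm_PM] by simp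
      have "(?g ^^ Suc (Suc n)) T = ?g (jm ?y)" using Suc by simp
      also have "\<dots> = jm (?f (prj (rm (jm ?y))))" by (rule g[OF jm_E])
      also have "prj (rm (jm ?y)) = ?y" unfolding rm_jm[OF YD(5)[OF y]] by (rule prj_Y[OF y])
      finally show ?case by simp
    qed
    \<comment> \<open>One application more than needed on \<open>Y\<close>, to match the shifted
      exponent; it is harmless because \<open>?f\<close> maps 0 to 0.\<close>
    moreover have "(?f ^^ Suc N) y = ?f (\<lambda>_. 0)" if "y \<in> Y" for y using N that by simp
    moreover have "?f (\<lambda>_. 0) = (\<lambda>_. 0)"
    proof -
      have "?f \<in> lhom P YM" by (rule lhom_comp[OF lhom_comp[OF lhom_comp[OF jm_hom E.lact_hom[OF b]] rm_hom] prj_hom])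
      from lhom_zero[OF PM_vsp P.subsp_vsp[OF Y_sub] this] show ?thesis by (simp add: PM_simps)
    qed
    moreover have "jm (\<lambda>_. 0) = (\<lambda>_. 0 :: 'k)" by (simp add: jm_def fun_eq_iff)
    ultimately have "(?g ^^ Suc N) T = (\<lambda>_. 0)" if "T \<in> carrier E" for T using that prj_in[OF rm_PM] by simp
    then show "\<exists>N. \<forall>T\<in>carrier E. (?g ^^ N) T = \<zero>\<^bsub>E\<^esub>" unfolding tensor_space_simps by blast
  qed
qed

text \<open>The image of \<open>eps\<close> on homology is computed twice: as the homology of the
  retract \<open>Y\<close>, and, since \<open>eps\<close> is realised by a list \<open>e\<close>, as
  the image of a primitive idempotent, whose dimension is the multiplicity.\<close>

theorem young_module_multiplicity:
  assumes hw: "simple_highest_weight_module d L \<tau> (partition_weight lam)"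
  shows "vdim (group_cohomology G YM (perm_act d) n) = composition_mult (GL d) (Hn n :: ('k, _) module) (Ha n) L \<tau>"
proof -
  interpret c: commuting_action G E place_act M "carrier E" "GL d" "tensor_act d" by (rule tensor_commuting)
  obtain e :: "('k \<times> 'k mat) list" where e: "glist (GL d) e" "\<forall>T\<in>carrier E. lact E (tensor_act d) e T = eps T"
    using equivariant_from_GL[OF inf eps_hom eps_place] by blast
  have eE: "lact E (tensor_act d) e T = eps T" if "T \<in> carrier E" for T using e(2) that by blast
  interpret p: primitive_idempotent "GL d" E "tensor_act d" e et Fc by (rule young_idempotent[OF e(1) eE])
  have hwm: "highest_weight_module d lam L \<tau>"
    using part inf hw by (simp add: highest_weight_module_def partition_shape_def highest_weight_module_axioms_def)
  have eqj: "equivariant_map G YM (perm_act d) cosets Y E place_act M (carrier E) jm"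
    unfolding equivariant_map_def equivariant_map_axioms_def
    by (intro conjI allI impI Y_form_rep tensor_form_rep lhom_restrict_dom[OF jm_hom YD(1)] jm_act) (simp only: sym_simps)
  have eqr: "equivariant_map G E place_act M (carrier E) YM (perm_act d) cosets Y (\<lambda>T. prj (rm T))"
    unfolding equivariant_map_def equivariant_map_axioms_def
    by (intro conjI allI impI Y_form_rep tensor_form_rep lhom_comp[OF rm_hom prj_hom]) (simp only: rm_act prj_act[OF _
      rm_PM] sym_simps(1))
  have eqe: "equivariant_map G E place_act M (carrier E) E place_act M (carrier E) eps"
    unfolding equivariant_map_def equivariant_map_axioms_def
    by (intro conjI allI impI tensor_form_rep eps_hom eps_place) (simp only: sym_simps)
  let ?q = "quot_map (bar_space G E n) (boundaries G E place_act n) (\<lambda>c. eps \<circ> c)"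
  have Hn: "Hn n = group_homology G E place_act n" and Ha: "Ha n = c.hact n"
    by (simp_all add: tensor_homology_def tensor_homology_act_def[abs_def])
  have ret: "prj (rm (jm y)) = y" if "y \<in> carrier YM" for y
    using that rm_jm[OF YD(5), of y] prj_Y by simp
  have im: "lact (Hn n) (Ha n) e x = ?q x" if x: "x \<in> carrier (Hn n)" for x
    unfolding Hn Ha
  proof (rule c.lact_homology_image[OF e(1) _ eqe])
    show "x \<in> carrier (group_homology G E place_act n)" using x unfolding Hn .
  qed (rule eE)
  have "vdim (group_cohomology G YM (perm_act d) n) = vdim (group_homology G YM (perm_act d) n)"
    by (rule form_rep.cohomology_dim_eq[OF Y_form_rep])
  also have "\<dots> = vdim ((Hn n)\<lparr>carrier := ?q ` carrier (Hn n)\<rparr>)"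
    unfolding Hn eps_def[abs_def] by (rule homology_retract_dim[OF eqj eqr]) (rule ret)
  also have "?q ` carrier (Hn n) = lact (Hn n) (Ha n) e ` carrier (Hn n)"
    by (rule image_cong[OF refl, symmetric]) (rule im)
  also have "vdim ((Hn n)\<lparr>carrier := lact (Hn n) (Ha n) e ` carrier (Hn n)\<rparr>) = composition_mult (GL d) (Hn n) (Ha n) L \<tau>"
  proof (rule p.composition_mult_idempotent[symmetric])
    show "linear_rep (GL d) (Hn n :: ('k, _) module) (Ha n)" unfolding Hn Ha by (rule c.hact_lrep)
    show "fvsp (Hn n :: ('k, _) module)" unfolding Hn by (rule c.homology_fin)
    show "satisfies_relations (GL d) E (tensor_act d) (Hn n) (Ha n)" unfolding Hn Ha by (rule c.homology_relations)
    show "simple_rep (GL d) L \<tau>" using hw by (simp add: simple_highest_weight_module_def)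
    show "coefficient (GL d) L \<tau> Fc" by (rule highest_weight_module.highest_weight_coefficient[OF hwm])
  qed
  finally show ?thesis .
qed

end

theorem theorem14p1p2:
  fixes d p i :: nat and lam :: "nat list"
  assumes "CHAR('k::alg_closed_field) = p" and "p > 0"
    and "partition_of d lam"
  shows "vectorspace.dim class_ring
           (group_cohomology (sym_group d) (perm_module d lam :: ('k, _) module) (perm_act d) i) =
         vectorspace.dim class_ring
           ((tensor_homology d i :: ('k, _) module)
              \<lparr>carrier := weight_space d (tensor_homology d i) (tensor_homology_act d i)
                            (partition_weight lam)\<rparr>)
       \<and> (\<forall>Y (L :: ('k, 'l) module) \<tau>.
           young_module d lam Y \<longrightarrow>
           simple_highest_weight_module d L \<tau> (partition_weight lam) \<longrightarrow>
           vectorspace.dim class_ring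
             (group_cohomology (sym_group d) ((perm_module d lam :: ('k, _) module)\<lparr>carrier := Y\<rparr>)
               (perm_act d) i) =
           composition_mult (GL d) (tensor_homology d i) (tensor_homology_act d i) L \<tau>)"
proof (intro conjI allI impI)
  interpret partition_shape d lam by (simp add: partition_shape_def assms(3))
  show "vectorspace.dim class_ring
      (group_cohomology (sym_group d) (perm_module d lam :: ('k, _) module) (perm_act d) i) =
    vectorspace.dim class_ring
      ((tensor_homology d i :: ('k, _) module)
         \<lparr>carrier := weight_space d (tensor_homology d i) (tensor_homology_act d i) (partition_weight lam)\<rparr>)"
    by (rule permutation_module_weight[OF alg_closed_infinite])
  fix Y :: "((nat \<Rightarrow> nat) set \<Rightarrow> 'k) set" and L :: "('k, 'l) module" and \<tau>
  assume "young_module d lam Y" and L: "simple_highest_weight_module d L \<tau> (partition_weight lam)"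
  then obtain Z where "young d lam Y Z"
    unfolding young_module_def young_def young_axioms_def
    using partition_shape_axioms alg_closed_infinite[where 'k='k] by blast
  then show "vectorspace.dim class_ring
      (group_cohomology (sym_group d) ((perm_module d lam :: ('k, _) module)\<lparr>carrier := Y\<rparr>) (perm_act d) i) =
    composition_mult (GL d) (tensor_homology d i) (tensor_homology_act d i) L \<tau>"
    using L by (rule young.young_module_multiplicity)
qed

end
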